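(* Let $\Sigma$ be a rational simplicial fan in $N_{\mathbb R}$. A class $\alpha\in A^1(\Sigma,\mathbb Q)$ is ample if and only if $\alpha$, viewed in $H^{1,1}(\overline\Sigma,\mathbb Q)$, has positive pairing with the class in $H_{1,1}(\overline\Sigma,\mathbb Q)$ of every effective tropical curve in $\overline\Sigma$.
   Context: **Fans.** $N$ is a free $\mathbb Z$-module of finite rank, $M=\mathrm{Hom}(N,\mathbb Z)$, $N_{\mathbb R}=N\otimes\mathbb R$. Cones are strictly convex polyhedral cones, rational with respect to $N$; fans are finite. $\Sigma_k$ is the set of $k$-dimensional cones, $\underline 0=\{0\}$, $|\sigma|=\dim\sigma$, and $\tau\prec\sigma$ means that $\tau$ is a face of $\sigma$ (equality allowed). $N_{\sigma,\mathbb R}$ is the span of $\sigma$, $N_\sigma=N\cap N_{\sigma,\mathbb R}$, $N^\sigma=N/N_\sigma$, $N^\sigma_{\mathbb R}=N_{\mathbb R}/N_{\sigma,\mathbb R}$. If $\tau\prec\sigma$ has codimension one, $e^\tau_\sigma$ is the generator of $N_\sigma/N_\tau\simeq\mathbb Z$ lying in the image of $\sigma$. $e_\rho$ is the primitive vector of a ray $\rho$. $\Sigma$ is simplicial if each cone is generated by as many rays as its dimension. The star fan $\Sigma^\sigma$ is the fan in $N^\sigma_{\mathbb R}$ formed by the projections of the cones $\eta\in\Sigma$ with $\sigma\prec\eta$. **Chow group and ampleness.** $A^1(\Sigma,\mathbb Q)$ is the quotient of $\bigoplus_{\rho\in\Sigma_1}\mathbb Q x_\rho$ by the span of the elements $\sum_{\rho}m(e_\rho)x_\rho$,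 $m\in M$ (the degree-one part of the Chow ring of $\Sigma$). A conewise linear function $f$ on $\Sigma$ is a continuous function $|\Sigma|\to\mathbb R$ on the support whose restriction to each cone is linear; if its values $f(e_\rho)$ are rational, the associated class is $\sum_\rho f(e_\rho)x_\rho\in A^1(\Sigma,\mathbb Q)$. $f$ is strictly convex if for each $\sigma\in\Sigma$ there is a linear function $\lambda$ on $N_{\mathbb R}$ such that $f-\lambda$ vanishes on $\sigma$ and is strictly positive on $\eta\setminus\sigma$ for every $\eta\in\Sigma$ containing $\sigma$. $\alpha\in A^1(\Sigma,\mathbb Q)$ is ample if it is the class associated to a strictly convex conewise linear function on $\Sigma$. **Canonical compactification.** Let $\mathbb T_+=\mathbb R_{\ge0}\cup\{\infty\}$. For a cone $\sigma$ with dual cone $\sigma^\vee$, $\overline\sigma=\mathrm{Hom}_{\mathbb R_+}(\sigma^\vee,\mathbb T_+)$ (morphisms of $\mathbb R_{+}$-modules); $\overline\Sigma$ is the union of the $\overline\sigma$, glued along $\overline\tau\subseteq\overline\sigma$ for $\tau\prec\sigma$. Its closed faces are hypercubes $\square^\tau_\sigma\simeq\mathbb T_+^{|\sigma|-|\tau|}$ indexed by pairs $\tau\prec\sigma$: $\square^\tau_\sigma$ is the closure of the copy, in the stratum at infinity $N^\tau_{\mathbb R}$, of the projection of $\sigma$ to $N^\tau_{\mathbb R}$. One has $\square^{\tau'}_{\sigma'}\subseteq\square^\tau_\sigma$ iff $\tau\prec\tau'\prec\sigma'\prec\sigma$; $\square^{\underline0}_\sigma=\overline\sigma$. $\overline\Sigma$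 is the disjoint union of the strata $\Sigma^\sigma_\infty$, $\sigma\in\Sigma$, copies of (the supports of) the star fans $\Sigma^\sigma$ in $N^\sigma_{\mathbb R}$. **Tropical (co)homology.** For $\delta=\square^\tau_\sigma$ put $N_\delta=N_\sigma/N_\tau$, $\mathbf F_p(\delta)=\sum_{\eta\succ\sigma}\bigwedge^p(N_\eta/N_\tau)\otimes\mathbb Q$, $\mathbf F^p(\delta)$ its dual. For $\gamma=\square^{\tau'}_{\sigma'}\subseteq\delta=\square^\tau_\sigma$, the projection $N^\tau\to N^{\tau'}$ induces $\mathbf F_p(\delta)\to\mathbf F_p(\gamma)$. Fix a generator $\nu_\delta$ of $\bigwedge^{\dim\delta}N_\delta$ for every face (equal to $1$ for points and to the primitive generator $e^\tau_\sigma$ in dimension one). For a codimension-one face $\gamma$ of $\delta=\square^\tau_\sigma$, $\mathrm{sign}(\gamma,\delta)\in\{\pm1\}$ is defined by $n\wedge\nu_\gamma=\mathrm{sign}(\gamma,\delta)\nu_\delta$ if $\gamma=\square^\tau_{\sigma'}$, $n$ any lift of $e^{\sigma'}_\sigma$; and by $e^\tau_{\tau'}\wedge\nu'=-\mathrm{sign}(\gamma,\delta)\nu_\delta$ if $\gamma=\square^{\tau'}_\sigma$, $\nu'$ any lift of $\nu_\gamma$. $C_{p,q}(\overline\Sigma)=\bigoplus_{\dim\delta=q}\mathbf F_p(\delta)$ with $\partial$ the sum of the maps $\mathbf F_p(\delta)\to\mathbf F_p(\gamma)$ multiplied by $\mathrm{sign}(\gamma,\delta)$; $C^{p,\bullet}(\overline\Sigma)$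 is the dual complex; $H_{p,q}(\overline\Sigma,\mathbb Q)$ and $H^{p,q}(\overline\Sigma,\mathbb Q)$ are the resulting (co)homology groups; the pairing $H^{1,1}\times H_{1,1}\to\mathbb Q$ is induced by the duality of complexes. **Identification.** $A^1(\Sigma,\mathbb Q)$ is identified with $H^{1,1}(\overline\Sigma,\mathbb Q)$ via the isomorphism $H^{1,1}(\overline\Sigma,\mathbb Q)\to A^1(\Sigma,\mathbb Q)$ sending the class of a cocycle $a=(a_\delta)_\delta\in C^{1,1}(\overline\Sigma)$ to $\sum_{\rho\in\Sigma_1}a_{\overline\rho}(e_\rho)x_\rho$. **Tropical curves.** A tropical curve in $\overline\Sigma$ is the closure in $\overline\Sigma$ of a nonempty one-dimensional rational polyhedral complex (finitely many segments and rays of rational slope) contained in a stratum $\Sigma^\sigma_\infty$, with nonzero integer weights on its edges satisfying the balancing condition at each vertex (the weighted sum of the outgoing primitive vectors is zero in $N^\sigma$), or a sum of such. It is effective if all weights are positive. Its class in $H_{1,1}(\overline\Sigma,\mathbb Q)$ is represented, on a suitable subdivision of $\overline\Sigma$, by the chain with component $w(P)\,v_P$ on each oriented closed edge $P$, where $w(P)$ is the weight and $v_P$ the primitive vector along $P$. For instance, weights $w(\eta)>0$ or $=0$ (not all zero) on the cones $\eta\succ\sigma$ with $|\eta|=|\sigma|+1$ such that $\sum_\eta w(\eta)e^\sigma_\eta=0$ in $N^\sigma$ define an effective tropical curve, of class represented by $(w(\eta)e^\sigma_\eta)$ on the faces $\square^\sigma_\eta$. *)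

theory Defs
  imports "HOL-Analysis.Analysis" "HOL-Homology.Homology"
begin

section \<open>Lattices and quotients\<close>

text \<open>The lattice \<open>N\<close> is a subgroup of a Euclidean space \<open>'v\<close> generated by linearly independent
vectors; it need not have full rank, so that every rank (including \<open>0\<close>) occurs, and
\<open>N\<^sub>\<real> = span N\<close>.\<close>

definition int_span :: "'v::real_vector list \<Rightarrow> 'v set" where
  "int_span bs = {(\<Sum>i<length bs. of_int (k i) *\<^sub>R bs ! i) | k :: nat \<Rightarrow> int. True}"

definition zlattice :: "'v::euclidean_space set \<Rightarrow> bool" where
  "zlattice N \<longleftrightarrow> (\<exists>bs. distinct bs \<and> independent (set bs) \<and> N = int_span bs)"

definition rat_span :: "'v::real_vector set \<Rightarrow> 'v set" where
  "rat_span S = module.span (\<lambda>q x. real_of_rat q *\<^sub>R x) S"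

text \<open>The quotient of \<open>N\<^sub>\<real>\<close> by \<open>span \<tau>\<close> is modelled by the orthogonal complement of
\<open>span \<tau>\<close>, the quotient map being the orthogonal projection \<open>qproj \<tau>\<close>. Thus
\<open>N\<^sup>\<tau> = N / N\<^sub>\<tau>\<close> is \<open>qproj \<tau> ` N\<close>, the group \<open>N\<^sub>\<sigma> / N\<^sub>\<tau>\<close> is \<open>qproj \<tau> ` sublattice N \<sigma>\<close>, and for
\<open>\<tau> \<subseteq> \<tau>'\<close> the map \<open>N\<^sup>\<tau> \<rightarrow> N\<^sup>\<tau>'\<close> is the restriction of \<open>qproj \<tau>'\<close>.\<close>

definition qproj :: "'v::euclidean_space set \<Rightarrow> 'v \<Rightarrow> 'v" where
  "qproj \<tau> x = (THE y. y \<in> (span \<tau>)\<^sup>\<bottom> \<and> x - y \<in> span \<tau>)"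

definition sublattice :: "'v::euclidean_space set \<Rightarrow> 'v set \<Rightarrow> 'v set" where
  "sublattice N \<sigma> = N \<inter> span \<sigma>"

definition primitive :: "'v::real_vector set \<Rightarrow> 'v \<Rightarrow> bool" where
  "primitive L v \<longleftrightarrow> v \<in> L \<and> v \<noteq> 0 \<and>
     (\<forall>u\<in>L. \<forall>k::int. v = of_int k *\<^sub>R u \<longrightarrow> k = 1 \<or> k = -1)"

definition quot_class :: "'a::minus set \<Rightarrow> 'a set \<Rightarrow> 'a \<Rightarrow> 'a set" where
  "quot_class V W x = {y \<in> V. x - y \<in> W}"

definition quot_space :: "'a::minus set \<Rightarrow> 'a set \<Rightarrow> 'a set set" where
  "quot_space V W = quot_class V W ` V"


section \<open>Fans\<close>

definition rational_cone :: "'v::euclidean_space set \<Rightarrow> 'v set \<Rightarrow> bool" where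
  "rational_cone N \<sigma> \<longleftrightarrow>
     (\<exists>S. finite S \<and> S \<subseteq> N \<and> \<sigma> = convex_cone hull S) \<and> \<sigma> \<inter> uminus ` \<sigma> = {0}"

text \<open>Unlike \<open>face_of\<close>, this excludes the empty face.\<close>

definition cface :: "'v::euclidean_space set \<Rightarrow> 'v set \<Rightarrow> bool" where
  "cface \<tau> \<sigma> \<longleftrightarrow> \<tau> face_of \<sigma> \<and> \<tau> \<noteq> {}"

definition fan :: "'v::euclidean_space set \<Rightarrow> 'v set set \<Rightarrow> bool" where
  "fan N \<Sigma> \<longleftrightarrow> finite \<Sigma> \<and> \<Sigma> \<noteq> {} \<and> (\<forall>\<sigma>\<in>\<Sigma>. rational_cone N \<sigma>) \<and>
     (\<forall>\<sigma>\<in>\<Sigma>. \<forall>\<tau>. cface \<tau> \<sigma> \<longrightarrow> \<tau> \<in> \<Sigma>) \<and>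
     (\<forall>\<sigma>\<in>\<Sigma>. \<forall>\<eta>\<in>\<Sigma>. cface (\<sigma> \<inter> \<eta>) \<sigma> \<and> cface (\<sigma> \<inter> \<eta>) \<eta>)"

definition rays :: "'v::euclidean_space set set \<Rightarrow> 'v set set" where
  "rays \<Sigma> = {\<rho> \<in> \<Sigma>. dim \<rho> = 1}"

definition simplicial :: "'v::euclidean_space set set \<Rightarrow> bool" where
  "simplicial \<Sigma> \<longleftrightarrow> (\<forall>\<sigma>\<in>\<Sigma>. \<exists>R \<subseteq> rays \<Sigma>. finite R \<and> card R = dim \<sigma> \<and> \<sigma> = convex_cone hull (\<Union>R))"

definition star_fan :: "'v::euclidean_space set set \<Rightarrow> 'v set \<Rightarrow> 'v set set" where
  "star_fan \<Sigma> \<sigma> = {qproj \<sigma> ` \<eta> | \<eta>. \<eta> \<in> \<Sigma> \<and> cface \<sigma> \<eta>}"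

text \<open>\<open>e\<^sup>\<tau>\<^sub>\<sigma>\<close> for a facet \<open>\<tau>\<close> of \<open>\<sigma>\<close>, and the primitive vector of a ray.\<close>

definition edge_gen :: "'v::euclidean_space set \<Rightarrow> 'v set \<Rightarrow> 'v set \<Rightarrow> 'v" where
  "edge_gen N \<tau> \<sigma> = (THE u. u \<in> qproj \<tau> ` \<sigma> \<and>
     qproj \<tau> ` sublattice N \<sigma> = range (\<lambda>k::int. of_int k *\<^sub>R u))"

definition ray_gen :: "'v::euclidean_space set \<Rightarrow> 'v set \<Rightarrow> 'v" where
  "ray_gen N \<rho> = edge_gen N {0} \<rho>"


section \<open>Degree one Chow group and ampleness\<close>

text \<open>\<open>\<Sum>\<^sub>\<rho> c\<^sub>\<rho> x\<^sub>\<rho>\<close> is encoded as the function \<open>\<rho> \<mapsto> c\<^sub>\<rho>\<close>, zero outside \<open>rays \<Sigma>\<close>; an element of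
\<open>M = Hom(N, \<int>)\<close> as a function additive on \<open>N\<close>, whose values off \<open>N\<close> are irrelevant.\<close>

definition chow_free :: "'v::euclidean_space set set \<Rightarrow> ('v set \<Rightarrow> rat) set" where
  "chow_free \<Sigma> = {x. \<forall>\<rho>. \<rho> \<notin> rays \<Sigma> \<longrightarrow> x \<rho> = 0}"

definition dual_lattice :: "'v::euclidean_space set \<Rightarrow> ('v \<Rightarrow> int) set" where
  "dual_lattice N = {m. \<forall>x\<in>N. \<forall>y\<in>N. m (x + y) = m x + m y}"

definition chow_rel :: "'v::euclidean_space set \<Rightarrow> 'v set set \<Rightarrow> ('v set \<Rightarrow> rat) set" where
  "chow_rel N \<Sigma> =
     {(\<lambda>\<rho>. if \<rho> \<in> rays \<Sigma> then \<Sum>m\<in>T. q m * of_int (m (ray_gen N \<rho>)) else 0) | T q.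
        finite T \<and> T \<subseteq> dual_lattice N}"

definition chow_class :: "'v::euclidean_space set \<Rightarrow> 'v set set \<Rightarrow> ('v set \<Rightarrow> rat) \<Rightarrow> ('v set \<Rightarrow> rat) set" where
  "chow_class N \<Sigma> x = quot_class (chow_free \<Sigma>) (chow_rel N \<Sigma>) x"

definition chow1 :: "'v::euclidean_space set \<Rightarrow> 'v set set \<Rightarrow> ('v set \<Rightarrow> rat) set set" where
  "chow1 N \<Sigma> = quot_space (chow_free \<Sigma>) (chow_rel N \<Sigma>)"

definition conewise_linear :: "'v::euclidean_space set set \<Rightarrow> ('v \<Rightarrow> real) \<Rightarrow> bool" where
  "conewise_linear \<Sigma> f \<longleftrightarrow> continuous_on (\<Union>\<Sigma>) f \<and> (\<forall>\<sigma>\<in>\<Sigma>. \<exists>l. linear l \<and> (\<forall>x\<in>\<sigma>. f x = l x))"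

definition strictly_convex :: "'v::euclidean_space set set \<Rightarrow> ('v \<Rightarrow> real) \<Rightarrow> bool" where
  "strictly_convex \<Sigma> f \<longleftrightarrow> (\<forall>\<sigma>\<in>\<Sigma>. \<exists>l. linear l \<and> (\<forall>x\<in>\<sigma>. f x - l x = 0) \<and>
     (\<forall>\<eta>\<in>\<Sigma>. \<sigma> \<subseteq> \<eta> \<longrightarrow> (\<forall>x\<in>\<eta> - \<sigma>. f x - l x > 0)))"

definition ample :: "'v::euclidean_space set \<Rightarrow> 'v set set \<Rightarrow> ('v set \<Rightarrow> rat) set \<Rightarrow> bool" where
  "ample N \<Sigma> \<alpha> \<longleftrightarrow> (\<exists>f x. conewise_linear \<Sigma> f \<and> strictly_convex \<Sigma> f \<and> x \<in> chow_free \<Sigma> \<and>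
     (\<forall>\<rho>\<in>rays \<Sigma>. f (ray_gen N \<rho>) = real_of_rat (x \<rho>)) \<and> \<alpha> = chow_class N \<Sigma> x)"


section \<open>Tropical homology and cohomology of the canonical compactification\<close>

text \<open>The pair \<open>(\<tau>, \<sigma>)\<close> stands for the closed face \<open>\<box>\<^sup>\<tau>\<^sub>\<sigma>\<close>.\<close>

type_synonym 'v cube = "'v set \<times> 'v set"

definition cubes :: "'v::euclidean_space set set \<Rightarrow> 'v cube set" where
  "cubes \<Sigma> = {(\<tau>, \<sigma>). \<tau> \<in> \<Sigma> \<and> \<sigma> \<in> \<Sigma> \<and> cface \<tau> \<sigma>}"

definition cubes_dim :: "'v::euclidean_space set set \<Rightarrow> nat \<Rightarrow> 'v cube set" where
  "cubes_dim \<Sigma> q = {(\<tau>, \<sigma>) \<in> cubes \<Sigma>. dim \<sigma> = dim \<tau> + q}"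

fun subcube :: "'v::euclidean_space cube \<Rightarrow> 'v cube \<Rightarrow> bool" where
  "subcube (\<tau>', \<sigma>') (\<tau>, \<sigma>) \<longleftrightarrow> cface \<tau> \<tau>' \<and> cface \<tau>' \<sigma>' \<and> cface \<sigma>' \<sigma>"

fun F1 :: "'v::euclidean_space set \<Rightarrow> 'v set set \<Rightarrow> 'v cube \<Rightarrow> 'v set" where
  "F1 N \<Sigma> (\<tau>, \<sigma>) = rat_span (\<Union>\<eta>\<in>{\<eta>\<in>\<Sigma>. cface \<sigma> \<eta>}. qproj \<tau> ` sublattice N \<eta>)"

text \<open>The wedge product of a list of \<open>q\<close> vectors, as an alternating \<open>q\<close>-linear form. By
nondegeneracy of the inner product, equality of such forms is equality in the exterior power.\<close>

definition wedge :: "'v::euclidean_space list \<Rightarrow> 'v list \<Rightarrow> real" where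
  "wedge vs xs = (if length xs = length vs
     then \<Sum>p | p permutes {..<length vs}. of_int (sign p) * (\<Prod>i<length vs. (vs ! i) \<bullet> (xs ! p i))
     else 0)"

text \<open>A generator of \<open>\<Lambda>\<^sup>q N\<^sub>\<delta>\<close> is given by an ordered basis of \<open>N\<^sub>\<delta> = N\<^sub>\<sigma> / N\<^sub>\<tau>\<close>, through the wedge
product of its members.\<close>

definition orientation :: "'v::euclidean_space set \<Rightarrow> 'v set set \<Rightarrow> ('v cube \<Rightarrow> 'v list) \<Rightarrow> bool" where
  "orientation N \<Sigma> \<nu> \<longleftrightarrow>
     (\<forall>q. \<forall>(\<tau>, \<sigma>)\<in>cubes_dim \<Sigma> q.
        length (\<nu> (\<tau>, \<sigma>)) = q \<and> int_span (\<nu> (\<tau>, \<sigma>)) = qproj \<tau> ` sublattice N \<sigma>) \<and>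
     (\<forall>(\<tau>, \<sigma>)\<in>cubes_dim \<Sigma> 1. \<nu> (\<tau>, \<sigma>) = [edge_gen N \<tau> \<sigma>])"

fun cube_sign :: "'v::euclidean_space set \<Rightarrow> ('v cube \<Rightarrow> 'v list) \<Rightarrow> 'v cube \<Rightarrow> 'v cube \<Rightarrow> int" where
  "cube_sign N \<nu> (\<tau>', \<sigma>') (\<tau>, \<sigma>) =
     (if \<tau>' = \<tau>
      then (THE \<epsilon>. \<epsilon> \<in> {1, -1} \<and> (\<exists>n \<in> qproj \<tau> ` sublattice N \<sigma>.
             qproj \<sigma>' n = edge_gen N \<sigma>' \<sigma> \<and>
             wedge (n # \<nu> (\<tau>', \<sigma>')) = (\<lambda>xs. of_int \<epsilon> * wedge (\<nu> (\<tau>, \<sigma>)) xs)))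
      else (THE \<epsilon>. \<epsilon> \<in> {1, -1} \<and> (\<exists>us. set us \<subseteq> qproj \<tau> ` sublattice N \<sigma> \<and>
             map (qproj \<tau>') us = \<nu> (\<tau>', \<sigma>') \<and>
             wedge (edge_gen N \<tau> \<tau>' # us) = (\<lambda>xs. - of_int \<epsilon> * wedge (\<nu> (\<tau>, \<sigma>)) xs))))"

text \<open>\<open>C\<^sub>1\<^sub>,\<^sub>q\<close>, its boundary operator \<open>C\<^sub>1\<^sub>,\<^sub>q\<^sub>+\<^sub>1 \<rightarrow> C\<^sub>1\<^sub>,\<^sub>q\<close>, and the dual complex. A functional on
\<open>F1 N \<Sigma> \<delta>\<close> is extended by zero.\<close>

definition trop_chains :: "'v::euclidean_space set \<Rightarrow> 'v set set \<Rightarrow> nat \<Rightarrow> ('v cube \<Rightarrow> 'v) set" where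
  "trop_chains N \<Sigma> q =
     {z. (\<forall>\<delta>\<in>cubes_dim \<Sigma> q. z \<delta> \<in> F1 N \<Sigma> \<delta>) \<and> (\<forall>\<delta>. \<delta> \<notin> cubes_dim \<Sigma> q \<longrightarrow> z \<delta> = 0)}"

definition trop_boundary ::
  "'v::euclidean_space set \<Rightarrow> 'v set set \<Rightarrow> ('v cube \<Rightarrow> 'v list) \<Rightarrow> nat \<Rightarrow> ('v cube \<Rightarrow> 'v) \<Rightarrow> 'v cube \<Rightarrow> 'v"
where
  "trop_boundary N \<Sigma> \<nu> q z \<gamma> =
     (if \<gamma> \<in> cubes_dim \<Sigma> q
      then \<Sum>\<delta> | \<delta> \<in> cubes_dim \<Sigma> (Suc q) \<and> subcube \<gamma> \<delta>.
             of_int (cube_sign N \<nu> \<gamma> \<delta>) *\<^sub>R qproj (fst \<gamma>) (z \<delta>)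
      else 0)"

definition trop_cochains ::
  "'v::euclidean_space set \<Rightarrow> 'v set set \<Rightarrow> nat \<Rightarrow> ('v cube \<Rightarrow> 'v \<Rightarrow> rat) set" where
  "trop_cochains N \<Sigma> q =
     {a. (\<forall>\<delta>\<in>cubes_dim \<Sigma> q.
            (\<forall>v\<in>F1 N \<Sigma> \<delta>. \<forall>w\<in>F1 N \<Sigma> \<delta>. a \<delta> (v + w) = a \<delta> v + a \<delta> w) \<and>
            (\<forall>v\<in>F1 N \<Sigma> \<delta>. \<forall>r. a \<delta> (real_of_rat r *\<^sub>R v) = r * a \<delta> v)) \<and>
         (\<forall>\<delta> v. \<delta> \<notin> cubes_dim \<Sigma> q \<or> v \<notin> F1 N \<Sigma> \<delta> \<longrightarrow> a \<delta> v = 0)}"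

definition trop_coboundary ::
  "'v::euclidean_space set \<Rightarrow> 'v set set \<Rightarrow> ('v cube \<Rightarrow> 'v list) \<Rightarrow> nat \<Rightarrow>
     ('v cube \<Rightarrow> 'v \<Rightarrow> rat) \<Rightarrow> 'v cube \<Rightarrow> 'v \<Rightarrow> rat" where
  "trop_coboundary N \<Sigma> \<nu> q a \<delta> v =
     (if \<delta> \<in> cubes_dim \<Sigma> (Suc q) \<and> v \<in> F1 N \<Sigma> \<delta>
      then \<Sum>\<gamma> | \<gamma> \<in> cubes_dim \<Sigma> q \<and> subcube \<gamma> \<delta>.
             of_int (cube_sign N \<nu> \<gamma> \<delta>) * a \<gamma> (qproj (fst \<gamma>) v)
      else 0)"

definition trop_homology11 ::
  "'v::euclidean_space set \<Rightarrow> 'v set set \<Rightarrow> ('v cube \<Rightarrow> 'v list) \<Rightarrow> ('v cube \<Rightarrow> 'v) set set" where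
  "trop_homology11 N \<Sigma> \<nu> =
     quot_space {z \<in> trop_chains N \<Sigma> 1. trop_boundary N \<Sigma> \<nu> 0 z = (\<lambda>_. 0)}
                (trop_boundary N \<Sigma> \<nu> 1 ` trop_chains N \<Sigma> 2)"

definition trop_cohomology11 ::
  "'v::euclidean_space set \<Rightarrow> 'v set set \<Rightarrow> ('v cube \<Rightarrow> 'v list) \<Rightarrow> ('v cube \<Rightarrow> 'v \<Rightarrow> rat) set set" where
  "trop_cohomology11 N \<Sigma> \<nu> =
     quot_space {a \<in> trop_cochains N \<Sigma> 1. trop_coboundary N \<Sigma> \<nu> 1 a = (\<lambda>_ _. 0)}
                (trop_coboundary N \<Sigma> \<nu> 0 ` trop_cochains N \<Sigma> 0)"

definition trop_pairing ::
  "'v::euclidean_space set set \<Rightarrow> ('v cube \<Rightarrow> 'v \<Rightarrow> rat) set \<Rightarrow> ('v cube \<Rightarrow> 'v) set \<Rightarrow> rat" where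
  "trop_pairing \<Sigma> \<beta> c = (THE r. \<forall>a\<in>\<beta>. \<forall>z\<in>c. r = (\<Sum>\<delta>\<in>cubes_dim \<Sigma> 1. a \<delta> (z \<delta>)))"

text \<open>The isomorphism \<open>H\<^sup>1\<^sup>,\<^sup>1 \<rightarrow> A\<^sup>1\<close> (the union is over representatives, all of which give the
same class), and its inverse.\<close>

definition chow_of_cohomology ::
  "'v::euclidean_space set \<Rightarrow> 'v set set \<Rightarrow> ('v cube \<Rightarrow> 'v \<Rightarrow> rat) set \<Rightarrow> ('v set \<Rightarrow> rat) set" where
  "chow_of_cohomology N \<Sigma> \<beta> =
     (\<Union>a\<in>\<beta>. chow_class N \<Sigma> (\<lambda>\<rho>. if \<rho> \<in> rays \<Sigma> then a ({0}, \<rho>) (ray_gen N \<rho>) else 0))"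

definition cohomology_of_chow ::
  "'v::euclidean_space set \<Rightarrow> 'v set set \<Rightarrow> ('v cube \<Rightarrow> 'v list) \<Rightarrow> ('v set \<Rightarrow> rat) set \<Rightarrow>
     ('v cube \<Rightarrow> 'v \<Rightarrow> rat) set" where
  "cohomology_of_chow N \<Sigma> \<nu> = the_inv_into (trop_cohomology11 N \<Sigma> \<nu>) (chow_of_cohomology N \<Sigma>)"


section \<open>The canonical compactification as a topological space\<close>

text \<open>A point of the compactification is written \<open>(\<tau>, x)\<close>, where \<open>x \<in> N\<^sup>\<tau>\<^sub>\<real>\<close> is a point of the
support of the star fan of \<open>\<tau>\<close>. If \<open>x \<in> qproj \<tau> ` \<sigma>\<close> with \<open>\<tau>\<close> a face of \<open>\<sigma>\<close>, it is the morphism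
\<open>\<sigma>\<^sup>\<or> \<rightarrow> [0, \<infinity>]\<close> sending \<open>m\<close> to \<open>m(x)\<close> if \<open>m\<close> vanishes on \<open>\<tau>\<close> and to \<open>\<infinity>\<close> otherwise. Linear forms
are represented through the inner product. The closure of \<open>\<sigma>\<close> carries the topology of pointwise
convergence of morphisms, and the compactification the glued topology.\<close>

definition dual_cone :: "'v::euclidean_space set \<Rightarrow> 'v set" where
  "dual_cone \<sigma> = {m. \<forall>x\<in>\<sigma>. 0 \<le> m \<bullet> x}"

fun point_eval :: "'v::euclidean_space set \<times> 'v \<Rightarrow> 'v \<Rightarrow> ennreal" where
  "point_eval (\<tau>, x) m = (if \<forall>t\<in>\<tau>. m \<bullet> t = 0 then ennreal (m \<bullet> x) else \<infinity>)"

definition cone_closure :: "'v::euclidean_space set \<Rightarrow> ('v set \<times> 'v) set" where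
  "cone_closure \<sigma> = {(\<tau>, x). cface \<tau> \<sigma> \<and> x \<in> qproj \<tau> ` \<sigma>}"

definition cone_closure_topology :: "'v::euclidean_space set \<Rightarrow> ('v set \<times> 'v) topology" where
  "cone_closure_topology \<sigma> =
     pullback_topology (cone_closure \<sigma>) (\<lambda>p. \<lambda>m\<in>dual_cone \<sigma>. point_eval p m)
       (product_topology (\<lambda>_. euclidean) (dual_cone \<sigma>))"

definition compactification :: "'v::euclidean_space set set \<Rightarrow> ('v set \<times> 'v) topology" where
  "compactification \<Sigma> = topology (\<lambda>U. U \<subseteq> (\<Union>\<sigma>\<in>\<Sigma>. cone_closure \<sigma>) \<and>
     (\<forall>\<sigma>\<in>\<Sigma>. openin (cone_closure_topology \<sigma>) (U \<inter> cone_closure \<sigma>)))"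

lemma openin_compactification:
  "openin (compactification \<Sigma>) U \<longleftrightarrow> U \<subseteq> (\<Union>\<sigma>\<in>\<Sigma>. cone_closure \<sigma>) \<and>
     (\<forall>\<sigma>\<in>\<Sigma>. openin (cone_closure_topology \<sigma>) (U \<inter> cone_closure \<sigma>))"
proof -
  have "istopology (\<lambda>U. U \<subseteq> (\<Union>\<sigma>\<in>\<Sigma>. cone_closure \<sigma>) \<and>
     (\<forall>\<sigma>\<in>\<Sigma>. openin (cone_closure_topology \<sigma>) (U \<inter> cone_closure \<sigma>)))"
    unfolding istopology_def
  proof (intro conjI allI impI ballI)
    fix U V \<sigma>
    assume *: "U \<subseteq> (\<Union>\<sigma>\<in>\<Sigma>. cone_closure \<sigma>) \<and>
        (\<forall>\<sigma>\<in>\<Sigma>. openin (cone_closure_topology \<sigma>) (U \<inter> cone_closure \<sigma>))"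
      "V \<subseteq> (\<Union>\<sigma>\<in>\<Sigma>. cone_closure \<sigma>) \<and>
        (\<forall>\<sigma>\<in>\<Sigma>. openin (cone_closure_topology \<sigma>) (V \<inter> cone_closure \<sigma>))" "\<sigma> \<in> \<Sigma>"
    have "U \<inter> V \<inter> cone_closure \<sigma> = (U \<inter> cone_closure \<sigma>) \<inter> (V \<inter> cone_closure \<sigma>)" by auto
    then show "openin (cone_closure_topology \<sigma>) (U \<inter> V \<inter> cone_closure \<sigma>)"
      using * by (metis openin_Int)
  next
    fix K \<sigma>
    assume *: "\<forall>U\<in>K. U \<subseteq> (\<Union>\<sigma>\<in>\<Sigma>. cone_closure \<sigma>) \<and>
        (\<forall>\<sigma>\<in>\<Sigma>. openin (cone_closure_topology \<sigma>) (U \<inter> cone_closure \<sigma>))" "\<sigma> \<in> \<Sigma>"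
    have "\<Union>K \<inter> cone_closure \<sigma> = (\<Union>U\<in>K. U \<inter> cone_closure \<sigma>)" by auto
    then show "openin (cone_closure_topology \<sigma>) (\<Union>K \<inter> cone_closure \<sigma>)"
      using * by (simp only:) (blast intro: openin_Union)
  qed auto
  then show ?thesis
    unfolding compactification_def by (simp add: topology_inverse')
qed


section \<open>Singular tropical chains\<close>

text \<open>Classes of chains living on different subdivisions of the compactification are compared in
its singular tropical chain complex: the simplices are the continuous ones which map each open face
of the standard simplex into the relative interior of a single cube, and a simplex whose interior
lies in that of the cube \<open>\<delta>\<close> has coefficients in \<open>F1 N \<Sigma> \<delta>\<close>. The complex of every subdivision maps
to this one by an isomorphism in homology.\<close>

fun open_cube :: "'v::euclidean_space cube \<Rightarrow> ('v set \<times> 'v) set" where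
  "open_cube (\<tau>, \<sigma>) = {\<tau>} \<times> rel_interior (qproj \<tau> ` \<sigma>)"

definition open_face :: "nat \<Rightarrow> nat set \<Rightarrow> (nat \<Rightarrow> real) set" where
  "open_face q J = {x \<in> standard_simplex q. {i. x i \<noteq> 0} = J}"

type_synonym 'v sing = "(nat \<Rightarrow> real) \<Rightarrow> 'v set \<times> 'v"

definition strat_simplex :: "'v::euclidean_space set set \<Rightarrow> nat \<Rightarrow> 'v sing \<Rightarrow> bool" where
  "strat_simplex \<Sigma> q s \<longleftrightarrow> singular_simplex q (compactification \<Sigma>) s \<and>
     (\<forall>J. J \<noteq> {} \<and> J \<subseteq> {..q} \<longrightarrow> (\<exists>\<delta>\<in>cubes \<Sigma>. s ` open_face q J \<subseteq> open_cube \<delta>))"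

definition simplex_cube :: "'v::euclidean_space set set \<Rightarrow> nat \<Rightarrow> 'v sing \<Rightarrow> 'v cube" where
  "simplex_cube \<Sigma> q s = (THE \<delta>. \<delta> \<in> cubes \<Sigma> \<and> s ` open_face q {..q} \<subseteq> open_cube \<delta>)"

definition sing_chains :: "'v::euclidean_space set \<Rightarrow> 'v set set \<Rightarrow> nat \<Rightarrow> ('v sing \<Rightarrow> 'v) set" where
  "sing_chains N \<Sigma> q = {c. finite {s. c s \<noteq> 0} \<and>
     (\<forall>s. c s \<noteq> 0 \<longrightarrow> strat_simplex \<Sigma> q s \<and> c s \<in> F1 N \<Sigma> (simplex_cube \<Sigma> q s))}"

definition sing_boundary :: "'v::euclidean_space set set \<Rightarrow> nat \<Rightarrow> ('v sing \<Rightarrow> 'v) \<Rightarrow> 'v sing \<Rightarrow> 'v" where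
  "sing_boundary \<Sigma> q c t =
     (\<Sum>s | c s \<noteq> 0. \<Sum>k | k \<le> q \<and> singular_face q k s = t.
        (-1) ^ k *\<^sub>R qproj (fst (simplex_cube \<Sigma> (q - 1) t)) (c s))"


section \<open>Tropical curves\<close>

text \<open>\<open>Edge p v l\<close> is the segment (\<open>l < \<infinity>\<close>) or ray (\<open>l = \<infinity>\<close>) of points \<open>p + t v\<close>, \<open>0 \<le> t \<le> l\<close>,
oriented by \<open>v\<close>. Orientations are auxiliary.\<close>

datatype 'v edge = Edge (base: 'v) (dir: 'v) (len: ereal)

definition edge_points :: "'v::euclidean_space edge \<Rightarrow> 'v set" where
  "edge_points e = {base e + t *\<^sub>R dir e | t. 0 \<le> t \<and> ereal t \<le> len e}"

definition edge_end :: "'v::euclidean_space edge \<Rightarrow> 'v" where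
  "edge_end e = base e + real_of_ereal (len e) *\<^sub>R dir e"

definition edge_vertices :: "'v::euclidean_space edge \<Rightarrow> 'v set" where
  "edge_vertices e = {base e} \<union> (if len e = \<infinity> then {} else {edge_end e})"

record 'v stratum_curve =
  stratum :: "'v set"
  edges :: "'v edge set"
  weight :: "'v edge \<Rightarrow> int"

definition balanced :: "'v::euclidean_space stratum_curve \<Rightarrow> bool" where
  "balanced D \<longleftrightarrow> (\<forall>p.
     (\<Sum>e | e \<in> edges D \<and> base e = p. of_int (weight D e) *\<^sub>R dir e) +
     (\<Sum>e | e \<in> edges D \<and> len e \<noteq> \<infinity> \<and> edge_end e = p. of_int (weight D e) *\<^sub>R (- dir e)) = 0)"

definition is_stratum_curve ::
  "'v::euclidean_space set \<Rightarrow> 'v set set \<Rightarrow> 'v stratum_curve \<Rightarrow> bool" where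
  "is_stratum_curve N \<Sigma> D \<longleftrightarrow> stratum D \<in> \<Sigma> \<and> finite (edges D) \<and> edges D \<noteq> {} \<and>
     (\<forall>e\<in>edges D. primitive (qproj (stratum D) ` N) (dir e) \<and> 0 < len e \<and>
        edge_points e \<subseteq> \<Union>(star_fan \<Sigma> (stratum D)) \<and> weight D e \<noteq> 0) \<and>
     (\<forall>e\<in>edges D. \<forall>e'\<in>edges D. e \<noteq> e' \<longrightarrow>
        edge_points e \<inter> edge_points e' \<subseteq> edge_vertices e \<inter> edge_vertices e') \<and>
     balanced D"

text \<open>A tropical curve is a formal sum of curves in the strata; its closure enters through the
closed edges of \<open>edge_path\<close> below. The formal sums with positive weights give all effective curves,
since the summands in a common stratum may be merged into one weighted complex.\<close>

definition tropical_curve ::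
  "'v::euclidean_space set \<Rightarrow> 'v set set \<Rightarrow> 'v stratum_curve list \<Rightarrow> bool" where
  "tropical_curve N \<Sigma> C \<longleftrightarrow> C \<noteq> [] \<and> (\<forall>D\<in>set C. is_stratum_curve N \<Sigma> D)"

definition effective_curve ::
  "'v::euclidean_space set \<Rightarrow> 'v set set \<Rightarrow> 'v stratum_curve list \<Rightarrow> bool" where
  "effective_curve N \<Sigma> C \<longleftrightarrow> tropical_curve N \<Sigma> C \<and> (\<forall>D\<in>set C. \<forall>e\<in>edges D. 0 < weight D e)"

definition subdivides ::
  "'v::euclidean_space stratum_curve \<Rightarrow> 'v stratum_curve \<Rightarrow> bool" where
  "subdivides D' D \<longleftrightarrow> stratum D' = stratum D \<and>
     (\<Union>e'\<in>edges D'. edge_points e') = (\<Union>e\<in>edges D. edge_points e) \<and>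
     (\<forall>e'\<in>edges D'. \<exists>e\<in>edges D. edge_points e' \<subseteq> edge_points e \<and> weight D' e' = weight D e)"

text \<open>The closure in the compactification of an edge in the stratum \<open>\<tau>\<close>, parametrised as a singular
1-simplex. The point at infinity of a ray with base \<open>p\<close> and direction \<open>v\<close> is the image of \<open>p\<close> in the
stratum of the cone \<open>\<eta>\<close> whose image in \<open>N\<^sup>\<tau>\<^sub>\<real>\<close> has \<open>v\<close> in its relative interior.\<close>

definition edge_path :: "'v::euclidean_space set set \<Rightarrow> 'v set \<Rightarrow> 'v edge \<Rightarrow> 'v sing" where
  "edge_path \<Sigma> \<tau> e = restrict (\<lambda>x.
     if len e \<noteq> \<infinity> then (\<tau>, base e + (x 1 * real_of_ereal (len e)) *\<^sub>R dir e)
     else if x 0 \<noteq> 0 then (\<tau>, base e + (x 1 / x 0) *\<^sub>R dir e)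
     else let \<eta> = (THE \<eta>. \<eta> \<in> \<Sigma> \<and> cface \<tau> \<eta> \<and> dir e \<in> rel_interior (qproj \<tau> ` \<eta>))
          in (\<eta>, qproj \<eta> (base e))) (standard_simplex 1)"

definition curve_chain :: "'v::euclidean_space set set \<Rightarrow> 'v stratum_curve list \<Rightarrow> 'v sing \<Rightarrow> 'v" where
  "curve_chain \<Sigma> C s = (\<Sum>D\<leftarrow>C. \<Sum>e | e \<in> edges D \<and> edge_path \<Sigma> (stratum D) e = s.
     of_int (weight D e) *\<^sub>R dir e)"

text \<open>The one-dimensional cube \<open>\<box>\<^sup>\<tau>\<^sub>\<sigma>\<close> is the closed ray from \<open>0\<close> in direction \<open>e\<^sup>\<tau>\<^sub>\<sigma>\<close> in the stratum \<open>\<tau>\<close>,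
with the orientation given by \<open>e\<^sup>\<tau>\<^sub>\<sigma>\<close>.\<close>

definition cube_path :: "'v::euclidean_space set \<Rightarrow> 'v set set \<Rightarrow> 'v cube \<Rightarrow> 'v sing" where
  "cube_path N \<Sigma> = (\<lambda>(\<tau>, \<sigma>). edge_path \<Sigma> \<tau> (Edge 0 (edge_gen N \<tau> \<sigma>) \<infinity>))"

definition sing_of_trop :: "'v::euclidean_space set \<Rightarrow> 'v set set \<Rightarrow> ('v cube \<Rightarrow> 'v) \<Rightarrow> 'v sing \<Rightarrow> 'v" where
  "sing_of_trop N \<Sigma> z s = (\<Sum>\<delta> | \<delta> \<in> cubes_dim \<Sigma> 1 \<and> cube_path N \<Sigma> \<delta> = s. z \<delta>)"

text \<open>\<open>c\<close> is the class of \<open>C\<close>: after subdividing the edges of \<open>C\<close> so that each of them has its interior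
in a single open cube, the chain of \<open>C\<close> is homologous to the cycles in \<open>c\<close>.\<close>

definition is_class_of_curve ::
  "'v::euclidean_space set \<Rightarrow> 'v set set \<Rightarrow> ('v cube \<Rightarrow> 'v list) \<Rightarrow> 'v stratum_curve list \<Rightarrow>
     ('v cube \<Rightarrow> 'v) set \<Rightarrow> bool" where
  "is_class_of_curve N \<Sigma> \<nu> C c \<longleftrightarrow> c \<in> trop_homology11 N \<Sigma> \<nu> \<and>
     (\<exists>C'. list_all2 subdivides C' C \<and> tropical_curve N \<Sigma> C' \<and>
        (\<forall>D\<in>set C'. \<forall>e\<in>edges D. strat_simplex \<Sigma> 1 (edge_path \<Sigma> (stratum D) e)) \<and>
        (\<exists>z\<in>c. (\<lambda>s. sing_of_trop N \<Sigma> z s - curve_chain \<Sigma> C' s)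
                 \<in> sing_boundary \<Sigma> 2 ` sing_chains N \<Sigma> 2))"

end

theory Submission
  imports Defs
begin

text \<open>Represent \<open>\<alpha>\<close> by \<open>x\<close> and choose for each cone \<open>\<sigma>\<close> a linear form \<open>L \<sigma>\<close>, rational on \<open>N\<close>, with
\<open>L \<sigma> (e\<^sub>\<rho>) = x \<rho>\<close> on the rays of \<open>\<sigma>\<close>. The differences \<open>L \<sigma> - L \<tau>\<close> on the edges \<open>\<box>\<^sup>\<tau>\<^sub>\<sigma>\<close> form a cocycle
representing \<open>\<alpha>\<close>. It extends to singular chains: an edge running from a point in the stratum \<open>\<tau>\<^sub>0\<close> to
one in the stratum \<open>\<tau>\<^sub>1\<close> is evaluated by \<open>L \<tau>\<^sub>1 - L \<tau>\<^sub>0\<close>. Hence only the unbounded edges of a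
curve contribute to its pairing with \<open>\<alpha>\<close>, and by balancing \<open>L \<tau>\<close> may be replaced, for a curve in the
stratum \<open>\<tau>\<close>, by any linear form equal to it on \<open>\<tau>\<close>. If \<open>\<alpha>\<close> is ample, the form
provided by strict convexity at \<open>\<tau>\<close> makes every contribution positive, and an effective curve has an
unbounded edge. Conversely, by Gordan's theorem over the rationals, the failure of strict convexity
at \<open>\<sigma>\<close> yields nonnegative integral balanced weights on the rays of the star fan of \<open>\<sigma>\<close>, that is, an
effective curve whose pairing with \<open>\<alpha>\<close> is not positive.\<close>

section \<open>Linear algebra\<close>

text \<open>Two features of the encoding shape the argument. Quotients are orthogonal complements,
  so elements of \<open>F1\<close> need not lie in the rational span of \<open>N\<close>, while
  cochains take rational values. Rationality is therefore always checked on a lift to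
  \<open>Q.span N\<close>, and a form may be moved to a lift only if it vanishes on the cone divided
  out. The differences \<open>L \<sigma> - L \<tau>\<close> do so on \<open>\<tau>\<close>; the
  single forms do not. Secondly, the cohomology class of \<alpha> is defined by inverting a map, so
  injectivity has to be proved: a cocycle is integrated, and if its ray values come from a linear
  form it is a coboundary. Cubical and singular chains meet only through the values of the form. One
  direction rests on its vanishing on singular boundaries, for which unions of strata have to be
  closed; in the other, the curve and a cubical cycle have the same singular chain, and what remains
  is the continuity of closed rays at infinity. In Gordan's theorem one further coordinate makes the
  inequalities homogeneous; its weight accounts for pairings that are negative rather than
  zero.\<close>

lemma qproj_exists: "\<exists>!y. y \<in> (span \<tau>)\<^sup>\<bottom> \<and> x - y \<in> span (\<tau> :: 'v::euclidean_space set)"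
proof -
  obtain y z where *: "y \<in> span \<tau>" "\<And>w. w \<in> span \<tau> \<Longrightarrow> orthogonal z w" "x = y + z"
    using orthogonal_subspace_decomp_exists by metis
  have "z \<in> (span \<tau>)\<^sup>\<bottom> \<and> x - z \<in> span \<tau>"
    using * by (auto simp: orthogonal_comp_def orthogonal_commute)
  moreover have "u = v" if "u \<in> (span \<tau>)\<^sup>\<bottom> \<and> x - u \<in> span \<tau>" "v \<in> (span \<tau>)\<^sup>\<bottom> \<and> x - v \<in> span \<tau>" for u v
  proof -
    have "(x - v) - (x - u) \<in> span \<tau>" using that by (blast intro: span_diff)
    then have a: "u - v \<in> span \<tau>" by simp
    have "u - v \<in> (span \<tau>)\<^sup>\<bottom>"
      using that subspace_diff[OF subspace_orthogonal_comp] by blast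
    then have "orthogonal (u - v) (u - v)" using a by (auto simp: orthogonal_comp_def)
    then show ?thesis by (simp add: orthogonal_self)
  qed
  ultimately show ?thesis by blast
qed

lemma qproj_props: "qproj \<tau> x \<in> (span \<tau>)\<^sup>\<bottom>" "x - qproj \<tau> x \<in> span \<tau>"
  using theI'[OF qproj_exists[of \<tau> x]] unfolding qproj_def by auto

lemma qproj_eqI: "y \<in> (span \<tau>)\<^sup>\<bottom> \<Longrightarrow> x - y \<in> span \<tau> \<Longrightarrow> qproj \<tau> x = y"
  using qproj_exists[of \<tau> x] qproj_props(1)[of \<tau> x] qproj_props(2)[of x \<tau>] by blast

lemma linear_qproj: "linear (qproj \<tau>)"
proof (rule linearI)
  show "qproj \<tau> (x + y) = qproj \<tau> x + qproj \<tau> y" for x y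
  proof (rule qproj_eqI)
    show "qproj \<tau> x + qproj \<tau> y \<in> (span \<tau>)\<^sup>\<bottom>"
      by (intro subspace_add[OF subspace_orthogonal_comp] qproj_props)
    show "x + y - (qproj \<tau> x + qproj \<tau> y) \<in> span \<tau>"
      using span_add[OF qproj_props(2)[of x \<tau>] qproj_props(2)[of y \<tau>]] by (simp add: algebra_simps)
  qed
  show "qproj \<tau> (r *\<^sub>R x) = r *\<^sub>R qproj \<tau> x" for r x
  proof (rule qproj_eqI)
    show "r *\<^sub>R qproj \<tau> x \<in> (span \<tau>)\<^sup>\<bottom>"
      by (intro subspace_scale[OF subspace_orthogonal_comp] qproj_props)
    show "r *\<^sub>R x - (r *\<^sub>R qproj \<tau> x) \<in> span \<tau>"
      using span_scale[OF qproj_props(2)[of x \<tau>]] by (simp add: algebra_simps)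
  qed
qed

lemma qproj_0[simp]: "qproj \<tau> 0 = 0"
  by (rule linear_0[OF linear_qproj])

lemma qproj_eq_0_iff: "qproj \<tau> x = 0 \<longleftrightarrow> x \<in> span \<tau>"
proof
  assume "qproj \<tau> x = 0"
  then show "x \<in> span \<tau>" using qproj_props(2)[of x \<tau>] by simp
next
  assume "x \<in> span \<tau>"
  then show "qproj \<tau> x = 0"
    by (intro qproj_eqI) (auto simp: subspace_0[OF subspace_orthogonal_comp])
qed

lemma qproj_eq_iff: "qproj \<tau> x = qproj \<tau> y \<longleftrightarrow> x - y \<in> span \<tau>"
  using qproj_eq_0_iff[of \<tau> "x - y"] by (simp add: linear_diff[OF linear_qproj])

lemma qproj_qproj:
  fixes \<tau> \<tau>' :: "'v::euclidean_space set"
  assumes "\<tau> \<subseteq> \<tau>'"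
  shows "qproj \<tau>' (qproj \<tau> x) = qproj \<tau>' x"
proof -
  have "x - qproj \<tau> x \<in> span \<tau>'" using qproj_props(2) span_mono[OF assms] by blast
  then show ?thesis using qproj_eq_iff by metis
qed

lemma qproj_zero_cone[simp]: "qproj {0} x = x"
  by (rule qproj_eqI) auto

lemma linear_eq_0_on_span': "linear l \<Longrightarrow> (\<And>x. x \<in> S \<Longrightarrow> l x = 0) \<Longrightarrow> x \<in> span S \<Longrightarrow> l x = (0::real)"
  using linear_eq_on_span[of l "\<lambda>_. 0" S x] by (auto intro: linear_zero)

text \<open>Descent of a form to the quotient: as the quotient is a complement inside the same
  space, a form vanishing on \<open>\<tau>\<close> descends unchanged, and descent means invariance
  under \<open>qproj \<tau>\<close>.\<close>

lemma linear_qproj_invariant: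
  assumes "linear l" "\<And>t. t \<in> \<tau> \<Longrightarrow> l t = (0::real)"
  shows "l (qproj \<tau> x) = l x"
proof -
  have "l (x - qproj \<tau> x) = 0"
    using assms linear_eq_0_on_span' qproj_props(2) by metis
  then show ?thesis using linear_diff[OF assms(1)] by simp
qed

lemma linear_extension:
  fixes B :: "'v::euclidean_space set"
  assumes "independent B"
  shows "\<exists>l :: 'v \<Rightarrow> real. linear l \<and> (\<forall>b\<in>B. l b = y b)"
  using linear_independent_extend[OF assms, of y] by auto

text \<open>The kernel of \<open>qproj \<tau>\<close> is \<open>span A\<close>, which meets
  \<open>span B\<close> only in 0, so the projection is injective on all of
  \<open>span B\<close>.\<close>

lemma independent_qproj_image:
  assumes "independent (A \<union> B)" "A \<inter> B = {}" "span \<tau> = span A"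
  shows "independent (qproj \<tau> ` B)" "inj_on (qproj \<tau>) B"
proof -
  have 1: "span A \<inter> span B = {0}"
  proof -
    \<comment> \<open>\<open>P\<close> is the projection onto \<open>span A\<close> along
      \<open>span B\<close>; on the intersection it is both the identity and zero.\<close>
    obtain P where P: "linear P" "\<And>x. x \<in> A \<union> B \<Longrightarrow> P x = (if x \<in> A then x else 0)"
      using linear_independent_extend[OF assms(1), of "\<lambda>x. if x \<in> A then x else 0"] by blast
    have "P x = x" if "x \<in> span A" for x
      using linear_eq_on_span[OF P(1) linear_id, of A x] P(2) that by simp
    moreover have "P x = 0" if "x \<in> span B" for x
    proof (rule linear_eq_on_span[OF P(1) linear_zero _ that])
      show "P y = 0" if "y \<in> B" for y using P(2)[of y] assms(2) that by auto
    qed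
    ultimately have "x = 0" if "x \<in> span A" "x \<in> span B" for x using that by metis
    then show ?thesis by (auto simp: span_zero)
  qed
  have B: "independent B" using assms(1) independent_mono by blast
  have inj: "inj_on (qproj \<tau>) (span B)"
  proof (rule inj_onI)
    fix x y assume *: "x \<in> span B" "y \<in> span B" "qproj \<tau> x = qproj \<tau> y"
    then have "x - y \<in> span A" using qproj_eq_iff assms(3) by blast
    moreover have "x - y \<in> span B" using * span_diff by blast
    ultimately have "x - y \<in> {0}" using 1 by blast
    then show "x = y" by simp
  qed
  show "independent (qproj \<tau> ` B)" by (rule linear_independent_injective_image[OF linear_qproj B inj])
  show "inj_on (qproj \<tau>) B" using inj inj_on_subset span_superset by metis
qed

section \<open>Simplicial cones\<close>

lemma convex_cone_hull_finite:
  assumes "finite S"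
  shows "convex_cone hull S = {\<Sum>v\<in>S. c v *\<^sub>R v | c. \<forall>v\<in>S. 0 \<le> c v}" (is "_ = ?C")
proof (rule hull_unique)
  show "S \<subseteq> ?C"
  proof
    fix v assume "v \<in> S"
    then have "v = (\<Sum>w\<in>S. (if w = v then 1 else 0) *\<^sub>R w)"
      using assms by (simp add: if_distrib[of "\<lambda>c. c *\<^sub>R _"] sum.delta cong: if_cong)
    moreover have "\<forall>w\<in>S. 0 \<le> (if w = v then 1 else (0::real))" by simp
    ultimately show "v \<in> ?C" by (intro CollectI exI[of _ "\<lambda>w. if w = v then 1 else 0"] conjI)
  qed
  show "convex_cone ?C"
    unfolding convex_cone_iff
  proof (intro conjI ballI allI impI)
    show "0 \<in> ?C" by (auto intro!: exI[of _ "\<lambda>_. 0"])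
    fix x assume "x \<in> ?C"
    then obtain c where c: "x = (\<Sum>v\<in>S. c v *\<^sub>R v)" "\<forall>v\<in>S. 0 \<le> c v" by blast
    show "x + y \<in> ?C" if y: "y \<in> ?C" for y
    proof -
      obtain d where d: "y = (\<Sum>v\<in>S. d v *\<^sub>R v)" "\<forall>v\<in>S. 0 \<le> d v" using y by blast
      have "x + y = (\<Sum>v\<in>S. (c v + d v) *\<^sub>R v)"
        unfolding c d by (simp add: scaleR_left_distrib sum.distrib)
      moreover have "\<forall>v\<in>S. 0 \<le> c v + d v" using c d by simp
      ultimately show ?thesis by (intro CollectI exI[of _ "\<lambda>v. c v + d v"] conjI)
    qed
    show "r *\<^sub>R x \<in> ?C" if "0 \<le> r" for r
    proof -
      have "r *\<^sub>R x = (\<Sum>v\<in>S. (r * c v) *\<^sub>R v)" unfolding c by (simp add: scaleR_sum_right)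
      moreover have "\<forall>v\<in>S. 0 \<le> r * c v" using c that by simp
      ultimately show ?thesis by (intro CollectI exI[of _ "\<lambda>v. r * c v"] conjI)
    qed
  qed
  show "?C \<subseteq> D" if "S \<subseteq> D" "convex_cone D" for D
  proof
    fix x assume "x \<in> ?C"
    then obtain c where c: "x = (\<Sum>v\<in>S. c v *\<^sub>R v)" "\<forall>v\<in>S. 0 \<le> c v" by blast
    have "(\<Sum>v\<in>T. c v *\<^sub>R v) \<in> D" if "finite T" "T \<subseteq> S" for T
      using that
    proof (induction T rule: finite_induct)
      case empty then show ?case using \<open>convex_cone D\<close> convex_cone_contains_0 by simp
    next
      case (insert v T)
      then show ?case using \<open>S \<subseteq> D\<close> c \<open>convex_cone D\<close>
        by (auto intro!: convex_cone_add convex_cone_scaleR)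
    qed
    then show "x \<in> D" using c assms by blast
  qed
qed

lemma simplicial_coneI:
  "finite S \<Longrightarrow> \<forall>v\<in>S. 0 \<le> c v \<Longrightarrow> (\<Sum>v\<in>S. c v *\<^sub>R v) \<in> convex_cone hull S"
  unfolding convex_cone_hull_finite by blast

lemma simplicial_coneD:
  "x \<in> convex_cone hull S \<Longrightarrow> finite S \<Longrightarrow> \<exists>c. x = (\<Sum>v\<in>S. c v *\<^sub>R v) \<and> (\<forall>v\<in>S. 0 \<le> c v)"
  unfolding convex_cone_hull_finite by blast

lemma independent_coeffs_eq:
  fixes S :: "'v::real_vector set"
  assumes "independent S" "finite S" "(\<Sum>v\<in>S. c v *\<^sub>R v) = (\<Sum>v\<in>S. d v *\<^sub>R v)" "v \<in> S"
  shows "c v = d v"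
proof -
  have "(\<Sum>v\<in>S. (c v - d v) *\<^sub>R v) = 0"
    using assms(3) by (simp add: scaleR_left_diff_distrib sum_subtractf)
  then have "c v - d v = 0" using independentD[OF assms(1,2) subset_refl, of "\<lambda>v. c v - d v"] assms(4) by blast
  then show ?thesis by simp
qed

text \<open>Criterion used: \<open>z\<close> is relatively interior iff every segment from a point
  of the cone to \<open>z\<close> can be prolonged beyond \<open>z\<close> inside the cone.
  Independence turns this into a condition on coefficients.\<close>

lemma rel_interior_simplicial_cone:
  fixes S :: "'v::euclidean_space set"
  assumes "independent S"
  shows "rel_interior (convex_cone hull S) = {\<Sum>v\<in>S. c v *\<^sub>R v | c. \<forall>v\<in>S. 0 < c v}"
proof -
  have fin: "finite S" using assms independent_bound by blast
  note C = convex_cone_hull_finite[OF fin]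
  note iff = convex_rel_interior_iff[OF convex_convex_cone_hull convex_cone_hull_nonempty, of _ S]
  show ?thesis
  proof (intro Set.set_eqI iffI)
    fix z assume z: "z \<in> rel_interior (convex_cone hull S)"
    then have "z \<in> convex_cone hull S" using rel_interior_subset by blast
    then obtain c where c: "z = (\<Sum>v\<in>S. c v *\<^sub>R v)" "\<forall>v\<in>S. 0 \<le> c v" unfolding C by blast
    \<comment> \<open>The test point has all coefficients 1: prolonging beyond \<open>z\<close>
      gives \<open>1 - e + e * c v \<ge> 0\<close> with \<open>e > 1\<close>, hence
      \<open>c v > 0\<close>.\<close>
    have "(\<Sum>v\<in>S. 1 *\<^sub>R v) \<in> convex_cone hull S" unfolding C
      by (intro CollectI exI[of _ "\<lambda>_. 1"]) auto
    then obtain e where e: "e > 1" "(1 - e) *\<^sub>R (\<Sum>v\<in>S. 1 *\<^sub>R v) + e *\<^sub>R z \<in> convex_cone hull S"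
      using z iff by blast
    then obtain d where d: "(1 - e) *\<^sub>R (\<Sum>v\<in>S. 1 *\<^sub>R v) + e *\<^sub>R z = (\<Sum>v\<in>S. d v *\<^sub>R v)" "\<forall>v\<in>S. 0 \<le> d v"
      unfolding C by blast
    have "(\<Sum>v\<in>S. ((1 - e) + e * c v) *\<^sub>R v) = (\<Sum>v\<in>S. d v *\<^sub>R v)"
      unfolding d(1)[symmetric] c(1) by (simp add: scaleR_sum_right scaleR_left_distrib sum.distrib)
    then have "(1 - e) + e * c v = d v" if "v \<in> S" for v
      by (rule independent_coeffs_eq[OF assms fin _ that])
    then have "0 < e * c v" if "v \<in> S" for v using d(2) e(1) that by (smt (verit))
    then have "0 < c v" if "v \<in> S" for v using e(1) that by (simp add: zero_less_mult_iff)
    then show "z \<in> {\<Sum>v\<in>S. c v *\<^sub>R v | c. \<forall>v\<in>S. 0 < c v}" using c by blast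
  next
    fix z assume "z \<in> {\<Sum>v\<in>S. c v *\<^sub>R v | c. \<forall>v\<in>S. 0 < c v}"
    then obtain c where c: "z = (\<Sum>v\<in>S. c v *\<^sub>R v)" "\<forall>v\<in>S. 0 < c v" by blast
    show "z \<in> rel_interior (convex_cone hull S)"
      unfolding iff
    proof
      fix x assume "x \<in> convex_cone hull S"
      then obtain d where d: "x = (\<Sum>v\<in>S. d v *\<^sub>R v)" "\<forall>v\<in>S. 0 \<le> d v" unfolding C by blast
      \<comment> \<open>Chosen so that \<open>\<delta> * d v \<le> c v\<close> for all
        \<open>v\<close>. The summand 1 keeps the denominators positive, the inserted 1 covers empty
        \<open>S\<close>.\<close>
      define \<delta> where "\<delta> = Min (insert 1 ((\<lambda>v. c v / (1 + d v)) ` S))"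
      have \<delta>0: "\<delta> > 0" unfolding \<delta>_def using fin c(2) d(2) by (auto simp: add_pos_nonneg)
      have \<delta>: "\<delta> * d v \<le> c v" if "v \<in> S" for v
      proof -
        have "\<delta> \<le> c v / (1 + d v)" unfolding \<delta>_def using fin that by auto
        then have "\<delta> * (1 + d v) \<le> c v" using d(2) that by (simp add: pos_le_divide_eq add_pos_nonneg)
        then show ?thesis using \<delta>0 by (simp add: algebra_simps)
      qed
      have "(1 - (1 + \<delta>)) *\<^sub>R x + (1 + \<delta>) *\<^sub>R z = (\<Sum>v\<in>S. ((1 + \<delta>) * c v - \<delta> * d v) *\<^sub>R v)"
        unfolding c(1) d(1) by (simp add: scaleR_sum_right scaleR_left_diff_distrib sum_subtractf sum_negf)
      moreover have "\<forall>v\<in>S. 0 \<le> (1 + \<delta>) * c v - \<delta> * d v"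
      proof
        fix v assume v: "v \<in> S"
        have "0 \<le> \<delta> * c v" using \<delta>0 c(2) v by (simp add: less_imp_le)
        then show "0 \<le> (1 + \<delta>) * c v - \<delta> * d v" using \<delta>[OF v] by (simp add: algebra_simps)
      qed
      ultimately have "(1 - (1 + \<delta>)) *\<^sub>R x + (1 + \<delta>) *\<^sub>R z \<in> convex_cone hull S"
        by (simp only: simplicial_coneI[OF fin])
      then show "\<exists>e>1. (1 - e) *\<^sub>R x + e *\<^sub>R z \<in> convex_cone hull S"
        using \<delta>0 by (intro exI[of _ "1 + \<delta>"]) auto
    qed
  qed
qed

text \<open>The supporting hyperplane is the kernel of the form that is 0 on \<open>T\<close> and 1
  on \<open>S - T\<close>; on the cone its value is the sum of the coefficients outside
  \<open>T\<close>.\<close>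

lemma simplicial_cone_face:
  fixes S :: "'v::euclidean_space set"
  assumes "independent S" "T \<subseteq> S"
  shows "(convex_cone hull T) face_of (convex_cone hull S)"
proof -
  have fin: "finite S" "finite T" using assms independent_bound finite_subset by blast+
  obtain l :: "'v \<Rightarrow> real" where l: "linear l" "\<And>b. b \<in> S \<Longrightarrow> l b = (if b \<in> T then 0 else 1)"
    using linear_extension[OF assms(1), of "\<lambda>b. if b \<in> T then 0 else 1"] by blast
  obtain a where a: "\<And>x. l x = a \<bullet> x"
    using l(1) by (metis adjoint_works inner_commute inner_real_def mult.right_neutral)
  have lx: "l (\<Sum>v\<in>S. c v *\<^sub>R v) = (\<Sum>v\<in>S-T. c v)" for c
  proof -
    have "l (\<Sum>v\<in>S. c v *\<^sub>R v) = (\<Sum>v\<in>S. c v * l v)"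
      using l(1) by (simp add: linear_sum linear_cmul)
    also have "\<dots> = (\<Sum>v\<in>S-T. c v)"
      using l(2) fin by (intro sum.mono_neutral_cong_right) auto
    finally show ?thesis .
  qed
  have "convex_cone hull T = convex_cone hull S \<inter> {x. a \<bullet> x = 0}"
  proof (intro Set.set_eqI iffI)
    fix x assume "x \<in> convex_cone hull T"
    moreover then have "x \<in> convex_cone hull S" using hull_mono[OF assms(2)] by blast
    moreover have "l x = 0"
    proof -
      have "convex_cone hull T \<subseteq> span T" by (simp add: hull_minimal span_superset convex_cone_span)
      then have "x \<in> span T" using calculation by blast
      then show ?thesis using l assms(2) by (intro linear_eq_0_on_span'[of l T x]) auto
    qed
    ultimately show "x \<in> convex_cone hull S \<inter> {x. a \<bullet> x = 0}" using a by auto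
  next
    fix x assume x: "x \<in> convex_cone hull S \<inter> {x. a \<bullet> x = 0}"
    then obtain c where c: "x = (\<Sum>v\<in>S. c v *\<^sub>R v)" "\<forall>v\<in>S. 0 \<le> c v"
      unfolding convex_cone_hull_finite[OF fin(1)] by blast
    have "(\<Sum>v\<in>S-T. c v) = 0" using x lx[of c] c a by auto
    then have "\<forall>v\<in>S-T. c v = 0" using fin c(2) by (subst (asm) sum_nonneg_eq_0_iff) auto
    then have "x = (\<Sum>v\<in>T. c v *\<^sub>R v)" unfolding c(1)
      using fin assms(2) by (intro sum.mono_neutral_right) auto
    then show "x \<in> convex_cone hull T" unfolding convex_cone_hull_finite[OF fin(2)] using c(2) assms(2) by blast
  qed
  moreover have "a \<bullet> x \<ge> 0" if x: "x \<in> convex_cone hull S" for x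
  proof -
    obtain c where c: "x = (\<Sum>v\<in>S. c v *\<^sub>R v)" "\<forall>v\<in>S. 0 \<le> c v"
      using x unfolding convex_cone_hull_finite[OF fin(1)] by blast
    then show ?thesis using lx[of c] a by (auto intro!: sum_nonneg)
  qed
  ultimately show ?thesis
    using face_of_Int_supporting_hyperplane_ge[OF convex_convex_cone_hull[of S], of 0 a] by simp
qed

section \<open>Rational functionals\<close>

text \<open>Provides spans, bases and dimension over the rationals inside the real space;
  \<open>Q.span N\<close> plays the role of N tensored with the rationals.\<close>

interpretation Q: vector_space "\<lambda>(q::rat) (x::'v::real_vector). real_of_rat q *\<^sub>R x"
  by unfold_locales (auto simp: scaleR_add_right scaleR_add_left of_rat_add of_rat_mult)

lemma rat_span_eq: "rat_span S = Q.span S"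
  by (simp add: rat_span_def)

lemma Q_span_subset_span: "Q.span S \<subseteq> span S"
proof -
  have "Q.subspace (span S)" unfolding Q.subspace_def
    by (auto simp: span_add span_scale span_zero)
  then show ?thesis using Q.span_minimal span_superset by blast
qed

text \<open>Rational independence alone is weaker, as 1 and the square root of 2 show. Here
  \<open>S\<close> lies in the rational span of a real basis \<open>B\<close>: a rational basis
  extending \<open>S\<close> has \<open>card B\<close> elements and spans \<open>span B\<close> over
  the reals, so it is independent over the reals.\<close>

lemma Q_independent_imp_independent:
  fixes B S :: "'v::euclidean_space set"
  assumes B: "independent B" and S: "S \<subseteq> Q.span B" "Q.independent S"
  shows "independent S"
proof -
  have finB: "finite B" using B independent_bound by blast
  have "Q.independent B"
  proof
    assume "Q.dependent B"
    then obtain b where "b \<in> B" "b \<in> Q.span (B - {b})" unfolding Q.dependent_def by blast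
    then show False using B Q_span_subset_span unfolding dependent_def by blast
  qed
  then have dimB: "Q.dim (Q.span B) = card B" by (simp add: Q.dim_span Q.dim_eq_card_independent)
  obtain S' where S': "S \<subseteq> S'" "S' \<subseteq> Q.span B" "Q.independent S'" "Q.span B \<subseteq> Q.span S'"
    using Q.maximal_independent_subset_extend[OF S] by blast
  have finS': "finite S'" using Q.independent_span_bound[OF finB S'(3,2)] by blast
  have "Q.dim (Q.span B) = card S'" using S' by (intro Q.dim_unique[of S']) auto
  then have card: "card S' = card B" using dimB by simp
  have "B \<subseteq> span S'" using S'(4) Q.span_superset Q_span_subset_span by blast
  moreover have "S' \<subseteq> span B" using S'(2) Q_span_subset_span by blast
  ultimately have eq: "span S' = span B" by (metis span_minimal subset_antisym subspace_span)
  then have "dim (span S') = card B" using B by (simp add: dim_eq_card_independent)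
  then have "independent S'"
    using card_le_dim_spanning[of S' "span S'"] finS' card span_superset by auto
  then show ?thesis using S'(1) independent_mono by blast
qed

text \<open>Elements of M tensored with the rationals, each with a real-linear extension to the
  ambient space; the extension is arbitrary outside \<open>span N\<close>.\<close>

definition rat_functionals :: "'v::euclidean_space set \<Rightarrow> ('v \<Rightarrow> real) set" where
  "rat_functionals N = {l. linear l \<and> l ` N \<subseteq> \<rat>}"

lemma rat_functionals_span:
  assumes "l \<in> rat_functionals N" "x \<in> Q.span N"
  shows "l x \<in> \<rat>"
proof -
  have l: "linear l" using assms by (auto simp: rat_functionals_def)
  have "Q.subspace {x. l x \<in> \<rat>}" unfolding Q.subspace_def
    using l by (auto simp: linear_0 linear_add linear_cmul)
  moreover have "N \<subseteq> {x. l x \<in> \<rat>}" using assms by (auto simp: rat_functionals_def)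
  ultimately show ?thesis using Q.span_minimal assms(2) by blast
qed

lemma rat_functionals_add: "l \<in> rat_functionals N \<Longrightarrow> k \<in> rat_functionals N \<Longrightarrow> (\<lambda>x. l x + k x) \<in> rat_functionals N"
  by (auto simp: rat_functionals_def image_subset_iff linear_compose_add)

lemma rat_functionals_diff: "l \<in> rat_functionals N \<Longrightarrow> k \<in> rat_functionals N \<Longrightarrow> (\<lambda>x. l x - k x) \<in> rat_functionals N"
  by (auto simp: rat_functionals_def image_subset_iff linear_compose_sub)

lemma rat_functionals_cmul: "l \<in> rat_functionals N \<Longrightarrow> q \<in> \<rat> \<Longrightarrow> (\<lambda>x. q * l x) \<in> rat_functionals N"
  using linear_compose_scale_right[of l q] by (simp add: rat_functionals_def image_subset_iff)

lemma int_spanE: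
  assumes "x \<in> int_span bs"
  obtains k :: "nat \<Rightarrow> int" where "x = (\<Sum>i<length bs. of_int (k i) *\<^sub>R bs ! i)"
  using assms by (auto simp: int_span_def)

lemma int_spanI: "x = (\<Sum>i<length bs. of_int (k i) *\<^sub>R bs ! i) \<Longrightarrow> x \<in> int_span bs"
  by (auto simp: int_span_def)

lemma zlattice_basis:
  assumes "zlattice N"
  obtains bs where "distinct bs" "independent (set bs)" "N = int_span bs"
    "N \<subseteq> Q.span (set bs)" "Q.span N = Q.span (set bs)"
proof -
  obtain bs where bs: "distinct bs" "independent (set bs)" "N = int_span bs"
    using assms zlattice_def by blast
  have "N \<subseteq> Q.span (set bs)"
  proof
    fix x assume "x \<in> N"
    then obtain k :: "nat \<Rightarrow> int" where k: "x = (\<Sum>i<length bs. of_int (k i) *\<^sub>R bs ! i)"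
      using bs(3) int_spanE by metis
    have "of_int (k i) *\<^sub>R bs ! i \<in> Q.span (set bs)" if "i < length bs" for i
      using Q.span_scale[OF Q.span_base[of "bs ! i" "set bs"], of "of_int (k i)"] that by simp
    then show "x \<in> Q.span (set bs)" unfolding k by (intro Q.span_sum) auto
  qed
  moreover have "set bs \<subseteq> N"
  proof
    fix b assume "b \<in> set bs"
    then obtain i where i: "i < length bs" "b = bs ! i" by (metis in_set_conv_nth)
    have "b = (\<Sum>j<length bs. of_int (if j = i then 1 else 0) *\<^sub>R bs ! j)"
      using i by (simp add: if_distrib[of "\<lambda>c. of_int c *\<^sub>R _"] sum.delta cong: if_cong)
    then show "b \<in> N" unfolding bs(3) by (rule int_spanI)
  qed
  then have "set bs \<subseteq> Q.span N" using Q.span_superset[of N] by blast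
  ultimately have "Q.span N = Q.span (set bs)" by (simp add: Q.span_eq)
  then show ?thesis
    using that[OF bs] \<open>N \<subseteq> Q.span (set bs)\<close> by blast
qed

lemma zlattice_add:
  assumes "zlattice N" "x \<in> N" "y \<in> N"
  shows "x + y \<in> N"
proof -
  obtain bs where bs: "N = int_span bs" using assms zlattice_def by blast
  obtain k :: "nat \<Rightarrow> int" where k: "x = (\<Sum>i<length bs. of_int (k i) *\<^sub>R bs ! i)"
    using assms(2) bs int_spanE by metis
  obtain l :: "nat \<Rightarrow> int" where l: "y = (\<Sum>i<length bs. of_int (l i) *\<^sub>R bs ! i)"
    using assms(3) bs int_spanE by metis
  show ?thesis unfolding bs int_span_def k l
    by (intro CollectI exI[of _ "\<lambda>i. k i + l i"]) (simp add: scaleR_left_distrib sum.distrib)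
qed

lemma zlattice_mult:
  assumes "zlattice N" "x \<in> N"
  shows "of_int m *\<^sub>R x \<in> N"
proof -
  obtain bs where bs: "N = int_span bs" using assms zlattice_def by blast
  obtain k :: "nat \<Rightarrow> int" where k: "x = (\<Sum>i<length bs. of_int (k i) *\<^sub>R bs ! i)"
    using assms(2) bs int_spanE by metis
  show ?thesis unfolding bs int_span_def k
    by (intro CollectI exI[of _ "\<lambda>i. m * k i"]) (simp add: scaleR_sum_right)
qed

text \<open>A rational basis of \<open>W\<close> is extended to one of \<open>Q.span N\<close>,
  which is independent over the reals; so \<open>b\<close>, continued by 0 on the added basis
  vectors, extends real-linearly. This turns a degree 0 cochain into a linear form.\<close>

lemma rat_functional_extension:
  fixes N :: "'v::euclidean_space set" and b :: "'v \<Rightarrow> rat"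
  assumes N: "zlattice N" and W: "Q.subspace W" "W \<subseteq> Q.span N"
    and b: "\<And>v w. v \<in> W \<Longrightarrow> w \<in> W \<Longrightarrow> b (v + w) = b v + b w"
      "\<And>v r. v \<in> W \<Longrightarrow> b (real_of_rat r *\<^sub>R v) = r * b v"
  shows "\<exists>l\<in>rat_functionals N. \<forall>w\<in>W. l w = real_of_rat (b w)"
proof -
  obtain bs where bs: "independent (set bs)" "Q.span N = Q.span (set bs)"
    using zlattice_basis[OF N] by metis
  obtain A where A: "A \<subseteq> W" "Q.independent A" "W \<subseteq> Q.span A"
    using Q.maximal_independent_subset[of W] by blast
  have "A \<subseteq> Q.span N" using A W by blast
  obtain B where B: "A \<subseteq> B" "B \<subseteq> Q.span N" "Q.independent B" "Q.span N \<subseteq> Q.span B"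
    using Q.maximal_independent_subset_extend[OF \<open>A \<subseteq> Q.span N\<close> A(2)] by blast
  have "independent B" using Q_independent_imp_independent[OF bs(1)] B bs(2) by blast
  then obtain l where l: "linear l" "\<And>v. v \<in> B \<Longrightarrow> l v = (if v \<in> A then real_of_rat (b v) else 0)"
    using linear_extension[of B "\<lambda>v. if v \<in> A then real_of_rat (b v) else 0"] by blast
  have "l \<in> rat_functionals B" using l by (auto simp: rat_functionals_def)
  then have "l \<in> rat_functionals N"
    using rat_functionals_span B(4) Q.span_superset l(1) by (auto simp: rat_functionals_def) blast
  moreover have "l w = real_of_rat (b w)" if "w \<in> W" for w
  proof -
    have b0: "b 0 = 0" using b(2)[of 0 0] Q.subspace_0[OF W(1)] by simp
    have "Q.subspace {w\<in>W. l w = real_of_rat (b w)}" unfolding Q.subspace_def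
      using W(1) l(1) b b0
      by (auto simp: Q.subspace_0 Q.subspace_add Q.subspace_scale linear_0 linear_add linear_cmul of_rat_add of_rat_mult)
    moreover have "A \<subseteq> {w\<in>W. l w = real_of_rat (b w)}" using A(1) B(1) l(2) by auto
    ultimately have "Q.span A \<subseteq> {w\<in>W. l w = real_of_rat (b w)}" by (rule Q.span_minimal[rotated])
    then show ?thesis using A(3) that by blast
  qed
  ultimately show ?thesis by blast
qed

lemma rat_functional_prescribed:
  fixes N :: "'v::euclidean_space set" and y :: "'v \<Rightarrow> rat"
  assumes N: "zlattice N" and A: "A \<subseteq> Q.span N" "independent A"
  shows "\<exists>l\<in>rat_functionals N. \<forall>w\<in>A. l w = real_of_rat (y w)"
proof -
  obtain bs where bs: "independent (set bs)" "Q.span N = Q.span (set bs)"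
    using zlattice_basis[OF N] by metis
  have "Q.independent A"
    using A(2) Q_span_subset_span unfolding Q.dependent_def dependent_def by blast
  obtain B where B: "A \<subseteq> B" "B \<subseteq> Q.span N" "Q.independent B" "Q.span N \<subseteq> Q.span B"
    using Q.maximal_independent_subset_extend[OF A(1) \<open>Q.independent A\<close>] by blast
  have "independent B" using Q_independent_imp_independent[OF bs(1)] B bs(2) by blast
  then obtain l where l: "linear l" "\<And>v. v \<in> B \<Longrightarrow> l v = real_of_rat (y v)"
    using linear_extension[of B "\<lambda>v. real_of_rat (y v)"] by blast
  have "l \<in> rat_functionals B" using l by (auto simp: rat_functionals_def)
  then have "l \<in> rat_functionals N"
    using rat_functionals_span B(4) Q.span_superset l(1) by (auto simp: rat_functionals_def) blast
  then show ?thesis using l(2) B(1) by blast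
qed

section \<open>Simplicial fans\<close>

text \<open>The generator \<open>w\<close> will be supplied by the orientation; only its sign remains to be determined.\<close>

lemma edge_gen_unique:
  fixes u :: "'v::euclidean_space"
  assumes H: "qproj \<tau> ` \<sigma> = {t *\<^sub>R u | t. 0 \<le> t}" and u: "u \<noteq> 0"
    and L: "qproj \<tau> ` sublattice N \<sigma> = range (\<lambda>k::int. of_int k *\<^sub>R w)"
    and y: "y \<in> qproj \<tau> ` sublattice N \<sigma>" "y \<in> qproj \<tau> ` \<sigma>" "y \<noteq> 0"
  shows "\<exists>c>0. edge_gen N \<tau> \<sigma> = c *\<^sub>R u"
    "qproj \<tau> ` sublattice N \<sigma> = range (\<lambda>k::int. of_int k *\<^sub>R edge_gen N \<tau> \<sigma>)"
proof -
  obtain k :: int where k: "y = of_int k *\<^sub>R w" using y L by auto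
  obtain t where t: "y = t *\<^sub>R u" "0 \<le> t" using y H by auto
  have "k \<noteq> 0" "t \<noteq> 0" using k y(3) t(1) by (metis of_int_0 scaleR_zero_left)+
  then have kt: "k \<noteq> 0" "t > 0" using t(2) by auto
  \<comment> \<open>\<open>w\<close> generates the group but may point away from the cone. Since
    \<open>y\<close> is \<open>k\<close> times \<open>w\<close> and a positive multiple of
    \<open>u\<close>, the sign of \<open>k\<close> decides.\<close>
  define e where "e = (if k > 0 then w else - w)"
  have w: "w = (t / of_int k) *\<^sub>R u"
  proof -
    have "of_int k *\<^sub>R w = t *\<^sub>R u" using k t by simp
    then have "(1 / of_int k) *\<^sub>R (of_int k *\<^sub>R w) = (1 / of_int k) *\<^sub>R (t *\<^sub>R u)" by simp
    then show ?thesis using kt by simp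
  qed
  define c where "c = t / \<bar>of_int k\<bar>"
  have c: "c > 0" "e = c *\<^sub>R u" using kt w unfolding e_def c_def by (auto simp: abs_if)
  have eH: "e \<in> qproj \<tau> ` \<sigma>" unfolding H using c by (auto intro!: exI[of _ c])
  have eL: "qproj \<tau> ` sublattice N \<sigma> = range (\<lambda>k::int. of_int k *\<^sub>R e)"
  proof (cases "k > 0")
    case True then show ?thesis using L e_def by simp
  next
    case False
    have "range (\<lambda>k::int. of_int k *\<^sub>R w) = range (\<lambda>k::int. of_int k *\<^sub>R (- w))"
    proof (intro equalityI subsetI)
      fix x assume "x \<in> range (\<lambda>k::int. of_int k *\<^sub>R w)"
      then obtain j :: int where "x = of_int j *\<^sub>R w" by auto
      then have "x = of_int (- j) *\<^sub>R (- w)" by simp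
      then show "x \<in> range (\<lambda>k::int. of_int k *\<^sub>R (- w))" by blast
    next
      fix x assume "x \<in> range (\<lambda>k::int. of_int k *\<^sub>R (- w))"
      then obtain j :: int where "x = of_int j *\<^sub>R (- w)" by auto
      then have "x = of_int (- j) *\<^sub>R w" by simp
      then show "x \<in> range (\<lambda>k::int. of_int k *\<^sub>R w)" by blast
    qed
    then show ?thesis using L e_def False by simp
  qed
  have eq: "edge_gen N \<tau> \<sigma> = e" unfolding edge_gen_def
  proof (rule the_equality)
    show "e \<in> qproj \<tau> ` \<sigma> \<and> qproj \<tau> ` sublattice N \<sigma> = range (\<lambda>k::int. of_int k *\<^sub>R e)"
      using eH eL by blast
    fix v assume v: "v \<in> qproj \<tau> ` \<sigma> \<and> qproj \<tau> ` sublattice N \<sigma> = range (\<lambda>k::int. of_int k *\<^sub>R v)"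
    have "v \<in> range (\<lambda>k::int. of_int k *\<^sub>R v)" by (rule range_eqI[of _ _ 1]) simp
    then have "v \<in> range (\<lambda>k::int. of_int k *\<^sub>R e)" using v eL by simp
    then obtain m :: int where m: "v = of_int m *\<^sub>R e" by blast
    have "e \<in> range (\<lambda>k::int. of_int k *\<^sub>R e)" by (rule range_eqI[of _ _ 1]) simp
    then have "e \<in> range (\<lambda>k::int. of_int k *\<^sub>R v)" using v eL by simp
    then obtain n :: int where n: "e = of_int n *\<^sub>R v" by blast
    have e0: "e \<noteq> 0" using c u by simp
    have "e = of_int (n * m) *\<^sub>R e" using m n by (metis of_int_mult scaleR_scaleR)
    then have "(of_int (n * m) - 1 :: real) *\<^sub>R e = 0" by (simp add: scaleR_left_diff_distrib)
    then have "of_int (n * m) = (1::real)" using e0 by simp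
    then have "n * m = 1" by linarith
    then have "m = 1 \<or> m = -1" using zmult_eq_1_iff by auto
    moreover have "m \<noteq> -1"
    proof
      assume "m = -1"
      then have "v = (- c) *\<^sub>R u" using m c by simp
      moreover obtain s where "v = s *\<^sub>R u" "0 \<le> s" using v H by auto
      ultimately have "(s + c) *\<^sub>R u = 0" by (simp add: scaleR_left_distrib)
      then show False using u c \<open>0 \<le> s\<close> by simp
    qed
    ultimately show "v = e" using m by auto
  qed
  show "\<exists>c>0. edge_gen N \<tau> \<sigma> = c *\<^sub>R u" unfolding eq using c by blast
  show "qproj \<tau> ` sublattice N \<sigma> = range (\<lambda>k::int. of_int k *\<^sub>R edge_gen N \<tau> \<sigma>)"
    unfolding eq by (rule eL)
qed

locale oriented_fan =
  fixes N :: "'v::euclidean_space set" and \<Sigma> :: "'v set set" and \<nu> :: "'v cube \<Rightarrow> 'v list"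
  assumes lattice: "zlattice N" and fan: "fan N \<Sigma>" and simplicial: "simplicial \<Sigma>"
    and orient: "orientation N \<Sigma> \<nu>"
begin

lemma finite_fan: "finite \<Sigma>" using fan by (simp add: fan_def)

lemma cone_generators:
  assumes "\<sigma> \<in> \<Sigma>"
  obtains S where "finite S" "S \<subseteq> N" "\<sigma> = convex_cone hull S"
proof -
  have "\<forall>\<sigma>\<in>\<Sigma>. rational_cone N \<sigma>" using fan unfolding fan_def by (elim conjE)
  then have "rational_cone N \<sigma>" using assms by (rule bspec)
  then have "\<exists>S. finite S \<and> S \<subseteq> N \<and> \<sigma> = convex_cone hull S" by (simp add: rational_cone_def)
  then show ?thesis by (elim exE conjE) (rule that)
qed

lemma convex_cone_cone: "\<sigma> \<in> \<Sigma> \<Longrightarrow> convex_cone \<sigma>"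
  by (metis cone_generators convex_cone_convex_cone_hull)

lemma zero_in_cone: "\<sigma> \<in> \<Sigma> \<Longrightarrow> 0 \<in> \<sigma>"
  using convex_cone_cone convex_cone_contains_0 by blast

lemma cone_pointed: "\<sigma> \<in> \<Sigma> \<Longrightarrow> x \<in> \<sigma> \<Longrightarrow> - x \<in> \<sigma> \<Longrightarrow> x = 0"
proof -
  assume "\<sigma> \<in> \<Sigma>" and *: "x \<in> \<sigma>" "- x \<in> \<sigma>"
  then have "\<sigma> \<inter> uminus ` \<sigma> = {0}" using fan by (simp add: fan_def rational_cone_def)
  moreover have "x \<in> \<sigma> \<inter> uminus ` \<sigma>" using * by (auto intro!: image_eqI[of _ _ "-x"])
  ultimately show "x = 0" by blast
qed

lemma cface_in_fan: "\<sigma> \<in> \<Sigma> \<Longrightarrow> cface \<tau> \<sigma> \<Longrightarrow> \<tau> \<in> \<Sigma>"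
  using fan by (simp add: fan_def)

lemma cface_Int: "\<sigma> \<in> \<Sigma> \<Longrightarrow> \<eta> \<in> \<Sigma> \<Longrightarrow> cface (\<sigma> \<inter> \<eta>) \<sigma>"
  using fan by (simp add: fan_def)

lemma Int_in_fan: "\<sigma> \<in> \<Sigma> \<Longrightarrow> \<eta> \<in> \<Sigma> \<Longrightarrow> \<sigma> \<inter> \<eta> \<in> \<Sigma>"
  using cface_in_fan cface_Int by blast

text \<open>A cone contained in another equals their intersection, which the fan axioms make a face.
  From here on faces are handled as inclusions.\<close>

lemma cface_iff: "\<tau> \<in> \<Sigma> \<Longrightarrow> \<sigma> \<in> \<Sigma> \<Longrightarrow> cface \<tau> \<sigma> \<longleftrightarrow> \<tau> \<subseteq> \<sigma>"
  using cface_Int[of \<sigma> \<tau>] face_of_imp_subset by (metis Int_absorb1 cface_def)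

lemma zero_cone: "{0} \<in> \<Sigma>"
proof -
  have "\<Sigma> \<noteq> {}" using fan by (simp add: fan_def)
  then obtain \<sigma> where \<sigma>: "\<sigma> \<in> \<Sigma>" by blast
  have "{0} face_of \<sigma>" unfolding face_of_def
  proof (intro conjI ballI impI)
    show "{0} \<subseteq> \<sigma>" using zero_in_cone \<sigma> by simp
    show "convex {0::'v}" by simp
    fix a b x assume *: "a \<in> \<sigma>" "b \<in> \<sigma>" "x \<in> {0}" "x \<in> open_segment a b"
    then obtain u where u: "0 < u" "u < 1" "(1 - u) *\<^sub>R a + u *\<^sub>R b = 0" "a \<noteq> b"
      by (auto simp: in_segment)
    have "u *\<^sub>R b \<in> \<sigma>" "(1 - u) *\<^sub>R a \<in> \<sigma>"
      using convex_cone_scaleR[OF convex_cone_cone[OF \<sigma>]] * u by auto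
    moreover have "(1 - u) *\<^sub>R a = - (u *\<^sub>R b)" using u(3) by (simp add: eq_neg_iff_add_eq_0)
    ultimately have "u *\<^sub>R b = 0" using cone_pointed[OF \<sigma>] by metis
    then show "a \<in> {0}" "b \<in> {0}" using u by auto
  qed
  then show ?thesis using cface_in_fan[OF \<sigma>] by (simp add: cface_def)
qed

lemma cubes_iff: "(\<tau>, \<sigma>) \<in> cubes \<Sigma> \<longleftrightarrow> \<tau> \<in> \<Sigma> \<and> \<sigma> \<in> \<Sigma> \<and> \<tau> \<subseteq> \<sigma>"
  using cface_iff by (auto simp: cubes_def)

lemma cubes_dim_iff: "(\<tau>, \<sigma>) \<in> cubes_dim \<Sigma> q \<longleftrightarrow> \<tau> \<in> \<Sigma> \<and> \<sigma> \<in> \<Sigma> \<and> \<tau> \<subseteq> \<sigma> \<and> dim \<sigma> = dim \<tau> + q"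
  using cubes_iff by (auto simp: cubes_dim_def)

text \<open>The orientation supplies a one-element basis of
  \<open>N\<^sub>\<sigma> / N\<^sub>\<tau>\<close>; this is where the cyclicity of that group comes
  from.\<close>

lemma edge_lattice:
  assumes "(\<tau>, \<sigma>) \<in> cubes_dim \<Sigma> 1"
  shows "qproj \<tau> ` sublattice N \<sigma> = range (\<lambda>k::int. of_int k *\<^sub>R edge_gen N \<tau> \<sigma>)"
proof -
  have "\<nu> (\<tau>, \<sigma>) = [edge_gen N \<tau> \<sigma>]" "int_span (\<nu> (\<tau>, \<sigma>)) = qproj \<tau> ` sublattice N \<sigma>"
    using orient assms unfolding orientation_def by blast+
  moreover have "int_span [w] = range (\<lambda>k::int. of_int k *\<^sub>R w)" for w :: 'v
    unfolding int_span_def by (auto simp: image_iff intro: exI[of _ "\<lambda>_. _"])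
  ultimately show ?thesis by simp
qed

text \<open>For dimension reasons some lattice generator of \<open>\<sigma>\<close> lies outside
  \<open>span \<tau>\<close>. Its image is a nonzero lattice vector on the half-line, which fixes
  the sign of the generator.\<close>

lemma edge_gen_props:
  assumes c: "(\<tau>, \<sigma>) \<in> cubes_dim \<Sigma> 1" and H: "qproj \<tau> ` \<sigma> = {t *\<^sub>R u | t. 0 \<le> t}" "u \<noteq> 0"
  shows "\<exists>c>0. edge_gen N \<tau> \<sigma> = c *\<^sub>R u"
proof -
  have s: "\<sigma> \<in> \<Sigma>" "dim \<sigma> = dim \<tau> + 1" using c cubes_dim_iff by auto
  obtain S where S: "finite S" "S \<subseteq> N" "\<sigma> = convex_cone hull S" using cone_generators[OF s(1)] .
  have "\<exists>x\<in>S. x \<notin> span \<tau>"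
  proof (rule ccontr)
    assume "\<not> ?thesis"
    then have "\<sigma> \<subseteq> span \<tau>" unfolding S(3) by (intro hull_minimal convex_cone_span) auto
    then have "dim \<sigma> \<le> dim \<tau>" using dim_subset dim_span by metis
    then show False using s by simp
  qed
  then obtain x where x: "x \<in> S" "x \<notin> span \<tau>" by blast
  have "x \<in> \<sigma>" using x(1) S(3) hull_inc by metis
  moreover have "x \<in> sublattice N \<sigma>"
    using x(1) S(2) calculation span_base by (auto simp: sublattice_def)
  moreover have "qproj \<tau> x \<noteq> 0" using x(2) qproj_eq_0_iff by blast
  ultimately show ?thesis
    using edge_gen_unique(1)[OF H edge_lattice[OF c], of "qproj \<tau> x"] by blast
qed

lemma ray_cube: "\<rho> \<in> rays \<Sigma> \<Longrightarrow> ({0}, \<rho>) \<in> cubes_dim \<Sigma> 1"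
  using zero_cone zero_in_cone by (auto simp: cubes_dim_iff rays_def)

lemma ray_gen_props:
  assumes \<rho>: "\<rho> \<in> rays \<Sigma>"
  shows "ray_gen N \<rho> \<noteq> 0" "\<rho> = {t *\<^sub>R ray_gen N \<rho> | t. 0 \<le> t}" "ray_gen N \<rho> \<in> N"
proof -
  have r: "\<rho> \<in> \<Sigma>" "dim \<rho> = 1" using \<rho> rays_def by auto
  have "\<not> \<rho> \<subseteq> {0}" using r(2) dim_eq_0[of \<rho>] by simp
  then obtain g where g: "g \<in> \<rho>" "g \<noteq> 0" by blast
  have sp: "span \<rho> = span {g}"
  proof -
    have "independent {g}" using g by simp
    moreover have "{g} \<subseteq> \<rho>" using g by simp
    ultimately have "\<rho> \<subseteq> span {g}" using card_ge_dim_independent[of "{g}" \<rho>] r(2) by simp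
    then show ?thesis using g by (metis empty_subsetI insert_subset span_eq span_base subset_trans)
  qed
  have eq: "\<rho> = {t *\<^sub>R g | t. 0 \<le> t}"
  proof (intro equalityI subsetI)
    fix x assume x: "x \<in> \<rho>"
    then have "x \<in> span {g}" using sp span_base by blast
    then obtain t where t: "x = t *\<^sub>R g" by (auto simp: span_singleton)
    have "0 \<le> t"
    proof (rule ccontr)
      assume "\<not> 0 \<le> t"
      then have "(-t) *\<^sub>R g \<in> \<rho>" using convex_cone_scaleR[OF convex_cone_cone[OF r(1)], of "-t" g] g by simp
      then have "x = 0" using cone_pointed[OF r(1) x] t by simp
      then show False using t g \<open>\<not> 0 \<le> t\<close> by auto
    qed
    then show "x \<in> {t *\<^sub>R g | t. 0 \<le> t}" using t by blast
  next
    fix x assume "x \<in> {t *\<^sub>R g | t. 0 \<le> t}"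
    then show "x \<in> \<rho>" using convex_cone_scaleR[OF convex_cone_cone[OF r(1)]] g by blast
  qed
  have "qproj {0} ` \<rho> = {t *\<^sub>R g | t. 0 \<le> t}" using eq by simp
  then obtain c where c: "c > 0" "ray_gen N \<rho> = c *\<^sub>R g"
    using edge_gen_props[OF ray_cube[OF \<rho>] _ g(2)] unfolding ray_gen_def by blast
  show "ray_gen N \<rho> \<noteq> 0" using c g by simp
  show "\<rho> = {t *\<^sub>R ray_gen N \<rho> | t. 0 \<le> t}"
  proof (intro equalityI subsetI)
    fix x assume "x \<in> \<rho>"
    then obtain t where t: "x = t *\<^sub>R g" "0 \<le> t" using eq by blast
    then have "x = (t / c) *\<^sub>R ray_gen N \<rho>" "0 \<le> t / c" using c by auto
    then show "x \<in> {t *\<^sub>R ray_gen N \<rho> | t. 0 \<le> t}" by blast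
  next
    fix x assume "x \<in> {t *\<^sub>R ray_gen N \<rho> | t. 0 \<le> t}"
    then obtain t where t: "x = t *\<^sub>R ray_gen N \<rho>" "0 \<le> t" by blast
    then have "x = (t * c) *\<^sub>R g" "0 \<le> t * c" using c by auto
    then show "x \<in> \<rho>" using eq by blast
  qed
  have "ray_gen N \<rho> \<in> range (\<lambda>k::int. of_int k *\<^sub>R ray_gen N \<rho>)"
    by (rule range_eqI[of _ _ 1]) simp
  then have "ray_gen N \<rho> \<in> qproj {0} ` sublattice N \<rho>"
    using edge_lattice[OF ray_cube[OF \<rho>]] unfolding ray_gen_def by simp
  then show "ray_gen N \<rho> \<in> N" by (auto simp: sublattice_def)
qed

lemma ray_gen_in_ray: "\<rho> \<in> rays \<Sigma> \<Longrightarrow> ray_gen N \<rho> \<in> \<rho>"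
  using ray_gen_props(2)[of \<rho>] by (metis (mono_tags, lifting) mem_Collect_eq scaleR_one zero_le_one)

lemma ray_subset_iff: "\<rho> \<in> rays \<Sigma> \<Longrightarrow> \<sigma> \<in> \<Sigma> \<Longrightarrow> \<rho> \<subseteq> \<sigma> \<longleftrightarrow> ray_gen N \<rho> \<in> \<sigma>"
proof
  assume \<rho>: "\<rho> \<in> rays \<Sigma>" and \<sigma>: "\<sigma> \<in> \<Sigma>"
  show "\<rho> \<subseteq> \<sigma> \<Longrightarrow> ray_gen N \<rho> \<in> \<sigma>" using ray_gen_in_ray[OF \<rho>] by blast
  assume "ray_gen N \<rho> \<in> \<sigma>"
  then show "\<rho> \<subseteq> \<sigma>"
    using convex_cone_scaleR[OF convex_cone_cone[OF \<sigma>]] by (subst ray_gen_props(2)[OF \<rho>]) blast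
qed

section \<open>Generators of the cones of a simplicial fan\<close>

definition verts :: "'v set" where "verts = ray_gen N ` rays \<Sigma>"

text \<open>The combinatorial handle on the fan: these finite sets turn inclusion of cones into
  inclusion of sets, intersection into intersection and dimension into cardinality.\<close>

definition gens :: "'v set \<Rightarrow> 'v set" where "gens \<sigma> = verts \<inter> \<sigma>"

lemma ray_eqI:
  assumes "\<rho> \<in> rays \<Sigma>" "\<rho>' \<in> rays \<Sigma>" "ray_gen N \<rho> \<in> \<rho>'"
  shows "\<rho> = \<rho>'"
proof -
  have sub: "\<rho> \<subseteq> \<rho>'" using ray_subset_iff assms rays_def by blast
  obtain t where t: "ray_gen N \<rho> = t *\<^sub>R ray_gen N \<rho>'" "0 \<le> t"
    using assms(3) ray_gen_props(2)[OF assms(2)] by blast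
  have "t \<noteq> 0" using t ray_gen_props(1)[OF assms(1)] by auto
  then have "ray_gen N \<rho>' = (1 / t) *\<^sub>R ray_gen N \<rho>" "0 \<le> 1 / t" using t by auto
  then have "ray_gen N \<rho>' \<in> \<rho>" using ray_gen_props(2)[OF assms(1)] by blast
  then have "\<rho>' \<subseteq> \<rho>" using ray_subset_iff[of \<rho>' \<rho>] assms rays_def by blast
  then show ?thesis using sub by blast
qed

lemma inj_ray_gen: "inj_on (ray_gen N) (rays \<Sigma>)"
  using ray_eqI ray_gen_in_ray by (metis inj_onI)

lemma finite_verts: "finite verts"
  using finite_fan by (simp add: verts_def rays_def)

lemma verts_lattice: "verts \<subseteq> N" using ray_gen_props(3) by (auto simp: verts_def)

lemma finite_gens: "finite (gens \<sigma>)" using finite_verts by (simp add: gens_def)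

lemma gens_subset: "gens \<sigma> \<subseteq> \<sigma>" by (simp add: gens_def)

lemma gens_mono: "\<tau> \<subseteq> \<sigma> \<Longrightarrow> gens \<tau> \<subseteq> gens \<sigma>" by (auto simp: gens_def)

lemma gens_lattice: "gens \<sigma> \<subseteq> N" using verts_lattice by (auto simp: gens_def)

text \<open>The rays granted by simpliciality generate \<open>\<sigma>\<close> and are independent
  by counting. Any other ray of the fan inside \<open>\<sigma>\<close> would be a face; it then
  contains a generator occurring with positive coefficient in its own primitive vector, and so is
  one of the given rays.\<close>

lemma gens_cone:
  assumes \<sigma>: "\<sigma> \<in> \<Sigma>"
  shows "independent (gens \<sigma>)" "\<sigma> = convex_cone hull (gens \<sigma>)" "card (gens \<sigma>) = dim \<sigma>"
proof -
  obtain R where R: "R \<subseteq> rays \<Sigma>" "finite R" "card R = dim \<sigma>" "\<sigma> = convex_cone hull (\<Union>R)"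
    using simplicial \<sigma> unfolding simplicial_def by blast
  define E where "E = ray_gen N ` R"
  have finE: "finite E" using R E_def by simp
  have hull: "\<sigma> = convex_cone hull E"
  proof (rule antisym)
    have "\<rho> \<subseteq> convex_cone hull E" if "\<rho> \<in> R" for \<rho>
    proof
      fix x assume "x \<in> \<rho>"
      moreover have "\<rho> \<in> rays \<Sigma>" using R(1) that by blast
      ultimately obtain t where "x = t *\<^sub>R ray_gen N \<rho>" "0 \<le> t" using ray_gen_props(2) by blast
      moreover have "ray_gen N \<rho> \<in> convex_cone hull E" using that by (simp add: E_def hull_inc)
      ultimately show "x \<in> convex_cone hull E"
        using convex_cone_scaleR[OF convex_cone_convex_cone_hull] by blast
    qed
    then show "\<sigma> \<subseteq> convex_cone hull E"
      unfolding R(4) by (intro hull_minimal convex_cone_convex_cone_hull) blast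
    have "E \<subseteq> \<Union>R" using ray_gen_in_ray R(1) E_def by blast
    then show "convex_cone hull E \<subseteq> \<sigma>" unfolding R(4) by (rule hull_mono)
  qed
  have E\<sigma>: "E \<subseteq> \<sigma>" unfolding hull by (rule hull_subset)
  have "\<sigma> \<subseteq> span E" unfolding hull by (intro hull_minimal convex_cone_span span_superset)
  have dimE: "dim E = dim \<sigma>"
  proof (rule antisym)
    show "dim E \<le> dim \<sigma>" using E\<sigma> by (rule dim_subset)
    show "dim \<sigma> \<le> dim E" using \<open>\<sigma> \<subseteq> span E\<close> dim_subset dim_span by metis
  qed
  have cardE: "card E = dim \<sigma>"
    using dimE dim_le_card[of E E] span_superset[of E] card_image_le[OF R(2), of "ray_gen N"] R(3) finE
    unfolding E_def by (simp add: le_antisym)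
  have indE: "independent E"
    using card_le_dim_spanning[of E "span E"] finE cardE dimE span_superset by auto
  have "gens \<sigma> = E"
  proof (intro equalityI subsetI)
    fix v assume "v \<in> E" then show "v \<in> gens \<sigma>" using E\<sigma> R(1) by (auto simp: gens_def verts_def E_def)
  next
    fix v assume "v \<in> gens \<sigma>"
    then obtain \<rho> where \<rho>: "\<rho> \<in> rays \<Sigma>" "v = ray_gen N \<rho>" "v \<in> \<sigma>" by (auto simp: gens_def verts_def)
    have "\<rho> \<subseteq> \<sigma>" using ray_subset_iff \<rho> \<sigma> by blast
    then have face: "\<rho> face_of \<sigma>" using cface_iff \<rho>(1) \<sigma> by (auto simp: rays_def cface_def)
    have "v \<in> convex_cone hull E" using \<rho>(3) hull by simp
    then obtain c where "v = (\<Sum>w\<in>E. c w *\<^sub>R w)" "\<forall>w\<in>E. 0 \<le> c w"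
      using simplicial_coneD[OF _ finE] by blast
    note c = this(1) this(2)[rule_format]
    have v0: "v \<noteq> 0" using ray_gen_props(1)[OF \<rho>(1)] \<rho>(2) by simp
    have "\<exists>w\<in>E. c w \<noteq> 0"
    proof (rule ccontr)
      assume "\<not> ?thesis" then have "v = 0" unfolding c(1) by (intro sum.neutral) auto
      then show False using v0 by simp
    qed
    then obtain w where w: "w \<in> E" "c w > 0" using c(2) by force
    define r where "r = (\<Sum>w\<in>E - {w}. c w *\<^sub>R w)"
    have v: "v = c w *\<^sub>R w + r" unfolding c(1) r_def using w(1) finE by (simp add: sum.remove)
    have r\<sigma>: "r \<in> \<sigma>" using simplicial_coneI[of "E - {w}" c] c(2) finE hull_mono[of "E - {w}" E] hull
      unfolding r_def by blast
    have w\<sigma>: "w \<in> \<sigma>" using w E\<sigma> by blast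
    \<comment> \<open>The factor 2 makes \<open>v\<close> the midpoint of these two points, so that
      the face property applies unless they coincide.\<close>
    have ab: "2 *\<^sub>R (c w *\<^sub>R w) \<in> \<sigma>" "2 *\<^sub>R r \<in> \<sigma>"
      using convex_cone_scaleR[OF convex_cone_cone[OF \<sigma>]] r\<sigma> w\<sigma> w(2) by auto
    have v\<rho>: "v \<in> \<rho>" using ray_gen_in_ray \<rho> by blast
    have "2 *\<^sub>R (c w *\<^sub>R w) \<in> \<rho>"
    proof (cases "c w *\<^sub>R w = r")
      case True
      then have "2 *\<^sub>R (c w *\<^sub>R w) = v" using v by (simp add: scaleR_2)
      then show ?thesis using v\<rho> by simp
    next
      case False
      have "v \<in> open_segment (2 *\<^sub>R (c w *\<^sub>R w)) (2 *\<^sub>R r)"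
      proof -
        have "2 *\<^sub>R (c w *\<^sub>R w) \<noteq> 2 *\<^sub>R r" using False by (simp only: scaleR_cancel_left) simp
        moreover have "v = (1 - 1/2) *\<^sub>R (2 *\<^sub>R (c w *\<^sub>R w)) + (1/2) *\<^sub>R (2 *\<^sub>R r)" using v by simp
        ultimately show ?thesis unfolding in_segment by (intro conjI exI[of _ "1/2"]) simp_all
      qed
      then show ?thesis using face ab v\<rho> unfolding face_of_def by blast
    qed
    moreover have "\<rho> \<in> \<Sigma>" using \<rho> rays_def by auto
    ultimately have "(1 / (2 * c w)) *\<^sub>R (2 *\<^sub>R (c w *\<^sub>R w)) \<in> \<rho>"
      using convex_cone_scaleR[OF convex_cone_cone] w(2) by (metis divide_nonneg_pos mult_pos_pos zero_le_one zero_less_numeral)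
    then have "w \<in> \<rho>" using w(2) by simp
    obtain \<rho>' where \<rho>': "\<rho>' \<in> R" "w = ray_gen N \<rho>'" using w E_def by blast
    then have "\<rho>' = \<rho>" using ray_eqI[of \<rho>' \<rho>] \<open>w \<in> \<rho>\<close> \<rho> R(1) by blast
    then show "v \<in> E" using \<rho> \<rho>' E_def by blast
  qed
  then show "independent (gens \<sigma>)" "\<sigma> = convex_cone hull (gens \<sigma>)" "card (gens \<sigma>) = dim \<sigma>"
    using indE hull cardE by auto
qed

lemma span_gens: "\<sigma> \<in> \<Sigma> \<Longrightarrow> span (gens \<sigma>) = span \<sigma>"
proof (rule antisym)
  assume \<sigma>: "\<sigma> \<in> \<Sigma>"
  show "span (gens \<sigma>) \<subseteq> span \<sigma>" by (rule span_mono[OF gens_subset])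
  have "convex_cone hull (gens \<sigma>) \<subseteq> span (gens \<sigma>)" by (intro hull_minimal convex_cone_span span_superset)
  then have "\<sigma> \<subseteq> span (gens \<sigma>)" using gens_cone(2)[OF \<sigma>] by simp
  then show "span \<sigma> \<subseteq> span (gens \<sigma>)" by (simp add: span_minimal)
qed

lemma cone_coneD:
  assumes "\<sigma> \<in> \<Sigma>" "x \<in> \<sigma>"
  shows "\<exists>c. x = (\<Sum>v\<in>gens \<sigma>. c v *\<^sub>R v) \<and> (\<forall>v\<in>gens \<sigma>. 0 \<le> c v)"
  using simplicial_coneD[OF _ finite_gens, of x \<sigma>] gens_cone(2)[OF assms(1)] assms(2) by simp

lemma cone_coneI:
  assumes "\<sigma> \<in> \<Sigma>" "\<And>v. v \<in> gens \<sigma> \<Longrightarrow> 0 \<le> c v"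
  shows "(\<Sum>v\<in>gens \<sigma>. c v *\<^sub>R v) \<in> \<sigma>"
  using simplicial_coneI[OF finite_gens, of \<sigma> c] gens_cone(2)[OF assms(1)] assms(2) by auto

lemma subset_iff_gens: "\<tau> \<in> \<Sigma> \<Longrightarrow> \<sigma> \<in> \<Sigma> \<Longrightarrow> \<tau> \<subseteq> \<sigma> \<longleftrightarrow> gens \<tau> \<subseteq> gens \<sigma>"
  using gens_mono hull_mono gens_cone(2) by metis

lemma gens_eqD: "\<tau> \<in> \<Sigma> \<Longrightarrow> \<sigma> \<in> \<Sigma> \<Longrightarrow> gens \<tau> = gens \<sigma> \<Longrightarrow> \<tau> = \<sigma>"
  using gens_cone(2) by metis

lemma gens_Int: "gens (\<sigma> \<inter> \<eta>) = gens \<sigma> \<inter> gens \<eta>" by (auto simp: gens_def)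

text \<open>Subsets of the generators of a simplicial cone span faces. A generator in the face but
  outside \<open>T\<close> would lie in \<open>span T\<close> and contradict independence.\<close>

lemma subcone:
  assumes "\<sigma> \<in> \<Sigma>" "T \<subseteq> gens \<sigma>"
  shows "convex_cone hull T \<in> \<Sigma>" "gens (convex_cone hull T) = T" "convex_cone hull T \<subseteq> \<sigma>"
proof -
  have f: "(convex_cone hull T) face_of \<sigma>"
    using simplicial_cone_face[OF gens_cone(1)[OF assms(1)] assms(2)] gens_cone(2)[OF assms(1)] by simp
  then show in\<Sigma>: "convex_cone hull T \<in> \<Sigma>"
    using cface_in_fan[OF assms(1)] convex_cone_hull_nonempty unfolding cface_def by blast
  show sub: "convex_cone hull T \<subseteq> \<sigma>" using f face_of_imp_subset by blast
  show "gens (convex_cone hull T) = T"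
  proof (intro equalityI subsetI)
    fix v assume "v \<in> T"
    then show "v \<in> gens (convex_cone hull T)" using assms(2) hull_inc[of v T] by (auto simp: gens_def)
  next
    fix v assume v: "v \<in> gens (convex_cone hull T)"
    show "v \<in> T"
    proof (rule ccontr)
      assume "v \<notin> T"
      have "convex_cone hull T \<subseteq> span T" by (intro hull_minimal convex_cone_span span_superset)
      then have "v \<in> span T" using v gens_subset by blast
      moreover have "T \<subseteq> gens \<sigma> - {v}" using \<open>v \<notin> T\<close> assms(2) by blast
      ultimately have "v \<in> span (gens \<sigma> - {v})" using span_mono by blast
      moreover have "v \<in> gens \<sigma>" using v sub gens_mono by blast
      ultimately show False using gens_cone(1)[OF assms(1)] unfolding dependent_def by blast
    qed
  qed
qed

lemma dim_gens: "\<sigma> \<in> \<Sigma> \<Longrightarrow> dim \<sigma> = card (gens \<sigma>)" using gens_cone(3) by simp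

lemma gens_zero: "gens {0} = {}"
  using ray_gen_props(1) by (auto simp: gens_def verts_def)

lemma edge_cubeD:
  assumes "(\<tau>, \<sigma>) \<in> cubes_dim \<Sigma> 1"
  shows "\<exists>v. v \<notin> gens \<tau> \<and> gens \<sigma> = insert v (gens \<tau>) \<and> v \<in> verts"
proof -
  have *: "\<tau> \<in> \<Sigma>" "\<sigma> \<in> \<Sigma>" "gens \<tau> \<subseteq> gens \<sigma>" "card (gens \<sigma>) = card (gens \<tau>) + 1"
    using assms gens_mono dim_gens by (auto simp: cubes_dim_iff)
  then have "card (gens \<sigma> - gens \<tau>) = 1" by (simp add: card_Diff_subset finite_gens)
  then obtain v where "gens \<sigma> - gens \<tau> = {v}" by (auto simp: card_1_singleton_iff)
  then have "v \<notin> gens \<tau>" "gens \<sigma> = insert v (gens \<tau>)" using *(3) by auto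
  moreover then have "v \<in> verts" by (auto simp: gens_def)
  ultimately show ?thesis by (intro exI[of _ v] conjI)
qed

text \<open>The projection kills the generators of \<open>\<tau>\<close> and keeps the others
  independent, so the cones of the star fan are again simplicial and their relative interiors are
  described by positive coefficients.\<close>

lemma star_gens:
  assumes "\<tau> \<in> \<Sigma>" "\<sigma> \<in> \<Sigma>" "\<tau> \<subseteq> \<sigma>"
  shows "independent (qproj \<tau> ` (gens \<sigma> - gens \<tau>))" "inj_on (qproj \<tau>) (gens \<sigma> - gens \<tau>)"
    "qproj \<tau> ` \<sigma> = convex_cone hull (qproj \<tau> ` (gens \<sigma> - gens \<tau>))"
proof -
  have eq: "gens \<tau> \<union> (gens \<sigma> - gens \<tau>) = gens \<sigma>" using gens_mono[OF assms(3)] by blast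
  note * = independent_qproj_image[of "gens \<tau>" "gens \<sigma> - gens \<tau>" \<tau>]
  show "independent (qproj \<tau> ` (gens \<sigma> - gens \<tau>))" "inj_on (qproj \<tau>) (gens \<sigma> - gens \<tau>)"
    using * gens_cone(1)[OF assms(2)] span_gens[OF assms(1)] by (simp_all only: eq) auto
  have "qproj \<tau> ` \<sigma> = convex_cone hull (qproj \<tau> ` gens \<sigma>)"
    by (subst gens_cone(2)[OF assms(2)]) (simp add: convex_cone_hull_linear_image[OF linear_qproj])
  also have "\<dots> = convex_cone hull (qproj \<tau> ` (gens \<sigma> - gens \<tau>))"
  proof (rule antisym)
    show "convex_cone hull (qproj \<tau> ` (gens \<sigma> - gens \<tau>)) \<subseteq> convex_cone hull (qproj \<tau> ` gens \<sigma>)"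
      by (intro hull_mono) blast
    have "qproj \<tau> v \<in> convex_cone hull (qproj \<tau> ` (gens \<sigma> - gens \<tau>))" if "v \<in> gens \<sigma>" for v
    proof (cases "v \<in> gens \<tau>")
      case True
      then have "qproj \<tau> v = 0" using span_base[of v "gens \<tau>"] span_gens[OF assms(1)] by (simp add: qproj_eq_0_iff)
      then show ?thesis by (simp add: convex_cone_hull_contains_0)
    next
      case False then show ?thesis using that by (intro hull_inc) blast
    qed
    then show "convex_cone hull (qproj \<tau> ` gens \<sigma>) \<subseteq> convex_cone hull (qproj \<tau> ` (gens \<sigma> - gens \<tau>))"
      by (intro hull_minimal convex_cone_convex_cone_hull) blast
  qed
  finally show "qproj \<tau> ` \<sigma> = convex_cone hull (qproj \<tau> ` (gens \<sigma> - gens \<tau>))" .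
qed

lemma star_relintD:
  assumes "\<tau> \<in> \<Sigma>" "\<sigma> \<in> \<Sigma>" "\<tau> \<subseteq> \<sigma>" "x \<in> rel_interior (qproj \<tau> ` \<sigma>)"
  shows "\<exists>c. x = qproj \<tau> (\<Sum>v\<in>gens \<sigma> - gens \<tau>. c v *\<^sub>R v) \<and> (\<forall>v\<in>gens \<sigma> - gens \<tau>. 0 < c v)"
proof -
  note s = star_gens[OF assms(1-3)]
  obtain d where d: "x = (\<Sum>v\<in>qproj \<tau> ` (gens \<sigma> - gens \<tau>). d v *\<^sub>R v)" "\<forall>v\<in>qproj \<tau> ` (gens \<sigma> - gens \<tau>). 0 < d v"
    using assms(4) unfolding s(3) rel_interior_simplicial_cone[OF s(1)] by blast
  have "x = qproj \<tau> (\<Sum>v\<in>gens \<sigma> - gens \<tau>. d (qproj \<tau> v) *\<^sub>R v)"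
    unfolding d(1) by (simp add: sum.reindex[OF s(2)] linear_sum[OF linear_qproj] linear_cmul[OF linear_qproj])
  then show ?thesis using d(2) by (intro exI[of _ "\<lambda>v. d (qproj \<tau> v)"]) blast
qed

lemma star_relintI:
  assumes "\<tau> \<in> \<Sigma>" "\<sigma> \<in> \<Sigma>" "\<tau> \<subseteq> \<sigma>" "\<And>v. v \<in> gens \<sigma> - gens \<tau> \<Longrightarrow> 0 < c v"
  shows "qproj \<tau> (\<Sum>v\<in>gens \<sigma> - gens \<tau>. c v *\<^sub>R v) \<in> rel_interior (qproj \<tau> ` \<sigma>)"
proof -
  note s = star_gens[OF assms(1-3)]
  define d where "d = (\<lambda>w. c (the_inv_into (gens \<sigma> - gens \<tau>) (qproj \<tau>) w))"
  have d: "d (qproj \<tau> v) = c v" if "v \<in> gens \<sigma> - gens \<tau>" for v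
    unfolding d_def using the_inv_into_f_f[OF s(2) that] by simp
  have "qproj \<tau> (\<Sum>v\<in>gens \<sigma> - gens \<tau>. c v *\<^sub>R v) = (\<Sum>v\<in>qproj \<tau> ` (gens \<sigma> - gens \<tau>). d v *\<^sub>R v)"
    by (simp add: sum.reindex[OF s(2)] linear_sum[OF linear_qproj] linear_cmul[OF linear_qproj] d)
  moreover have "\<forall>v\<in>qproj \<tau> ` (gens \<sigma> - gens \<tau>). 0 < d v" using d assms(4) by auto
  ultimately show ?thesis unfolding s(3) rel_interior_simplicial_cone[OF s(1)] by blast
qed

text \<open>Lifts of \<open>x\<close> to the two cones differ by an element of
  \<open>span \<tau>\<close>, a difference of elements of \<open>\<tau>\<close>. Moving these to
  opposite sides gives a point of \<open>\<sigma> \<inter> \<sigma>'\<close>, hence supported on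
  common generators; comparing coefficients in \<open>\<sigma>\<close> shows that every generator of
  \<open>\<sigma>\<close> belongs to \<open>\<sigma>'\<close>.\<close>

lemma star_relint_subset:
  assumes t: "\<tau> \<in> \<Sigma>" and s: "\<sigma> \<in> \<Sigma>" "\<tau> \<subseteq> \<sigma>" "x \<in> rel_interior (qproj \<tau> ` \<sigma>)"
    and s': "\<sigma>' \<in> \<Sigma>" "\<tau> \<subseteq> \<sigma>'" "x \<in> qproj \<tau> ` \<sigma>'"
  shows "\<sigma> \<subseteq> \<sigma>'"
proof -
  obtain c where "x = qproj \<tau> (\<Sum>v\<in>gens \<sigma> - gens \<tau>. c v *\<^sub>R v)" "\<forall>v\<in>gens \<sigma> - gens \<tau>. 0 < c v"
    using star_relintD[OF t s] by blast
  note c = this(1) this(2)[rule_format]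
  obtain y' where y': "y' \<in> \<sigma>'" "x = qproj \<tau> y'" using s'(3) by blast
  define y where "y = (\<Sum>v\<in>gens \<sigma> - gens \<tau>. c v *\<^sub>R v)"
  have "y' - y \<in> span (gens \<tau>)" using c(1) y'(2) qproj_eq_iff y_def span_gens[OF t] by metis
  then obtain d where d: "y' - y = (\<Sum>v\<in>gens \<tau>. d v *\<^sub>R v)"
    using span_finite[OF finite_gens] by auto
  \<comment> \<open>\<open>p\<close> and \<open>q\<close> collect the positive and the negative
    parts of the coefficients \<open>d\<close>.\<close>
  define p where "p = (\<Sum>v\<in>gens \<tau>. max (d v) 0 *\<^sub>R v)"
  define q where "q = (\<Sum>v\<in>gens \<tau>. max (- d v) 0 *\<^sub>R v)"
  have pq: "p \<in> \<tau>" "q \<in> \<tau>" unfolding p_def q_def by (auto intro!: cone_coneI[OF t])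
  have "y' - y = p - q" unfolding d p_def q_def
    by (simp add: sum_subtractf[symmetric] scaleR_left_diff_distrib[symmetric]) (intro sum.cong, auto simp: max_def)
  then have eq: "y + p = y' + q" by (simp add: algebra_simps)
  have sub: "gens \<tau> \<subseteq> gens \<sigma>" using gens_mono s(2) by blast
  define b where "b = (\<lambda>v. if v \<in> gens \<tau> then max (d v) 0 else c v)"
  have yp: "y + p = (\<Sum>v\<in>gens \<sigma>. b v *\<^sub>R v)"
  proof -
    have "(\<Sum>v\<in>gens \<sigma>. b v *\<^sub>R v) = (\<Sum>v\<in>gens \<sigma> - gens \<tau>. b v *\<^sub>R v) + (\<Sum>v\<in>gens \<tau>. b v *\<^sub>R v)"
      by (rule sum.subset_diff[OF sub finite_gens])
    also have "\<dots> = y + p" unfolding y_def p_def b_def by (intro arg_cong2[of _ _ _ _ "(+)"] sum.cong) auto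
    finally show ?thesis by simp
  qed
  have b0: "0 \<le> b v" if "v \<in> gens \<sigma>" for v using that c(2)[of v] by (auto simp: b_def)
  have "y + p \<in> \<sigma>" unfolding yp by (rule cone_coneI[OF s(1) b0])
  moreover have "y + p \<in> \<sigma>'" unfolding eq
    using convex_cone_add[OF convex_cone_cone[OF s'(1)]] y'(1) pq s'(2) by blast
  ultimately have "y + p \<in> \<sigma> \<inter> \<sigma>'" by blast
  then obtain a where a: "y + p = (\<Sum>v\<in>gens (\<sigma> \<inter> \<sigma>'). a v *\<^sub>R v)"
    using cone_coneD[OF Int_in_fan[OF s(1) s'(1)]] by blast
  also have "\<dots> = (\<Sum>v\<in>gens \<sigma>. (if v \<in> gens \<sigma>' then a v else 0) *\<^sub>R v)"
    by (intro sum.mono_neutral_cong_left finite_gens) (auto simp: gens_Int)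
  finally have "(\<Sum>v\<in>gens \<sigma>. b v *\<^sub>R v) = (\<Sum>v\<in>gens \<sigma>. (if v \<in> gens \<sigma>' then a v else 0) *\<^sub>R v)"
    using yp by simp
  then have ba: "b v = (if v \<in> gens \<sigma>' then a v else 0)" if "v \<in> gens \<sigma>" for v
    by (rule independent_coeffs_eq[OF gens_cone(1)[OF s(1)] finite_gens _ that])
  have "v \<in> gens \<sigma>'" if v: "v \<in> gens \<sigma>" for v
  proof (cases "v \<in> gens \<tau>")
    case True then show ?thesis using gens_mono[OF s'(2)] by blast
  next
    case False
    then have "b v > 0" using c(2) v by (simp add: b_def)
    then show ?thesis using ba[OF v] by (auto split: if_splits)
  qed
  then show ?thesis using subset_iff_gens[OF s(1) s'(1)] by blast
qed

text \<open>Makes the open cubes disjoint and the end of a ray at infinity well defined.\<close>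

lemma star_relint_unique:
  assumes "\<tau> \<in> \<Sigma>" "\<sigma> \<in> \<Sigma>" "\<tau> \<subseteq> \<sigma>" "x \<in> rel_interior (qproj \<tau> ` \<sigma>)"
    "\<sigma>' \<in> \<Sigma>" "\<tau> \<subseteq> \<sigma>'" "x \<in> rel_interior (qproj \<tau> ` \<sigma>')"
  shows "\<sigma> = \<sigma>'"
  using star_relint_subset[OF assms(1-6)] star_relint_subset[OF assms(1,5,6,7,2,3)] assms(4,7) rel_interior_subset
  by blast

lemma star_relint_exists:
  assumes t: "\<tau> \<in> \<Sigma>" and s: "\<sigma> \<in> \<Sigma>" "\<tau> \<subseteq> \<sigma>" "x \<in> qproj \<tau> ` \<sigma>"
  obtains \<eta> where "\<eta> \<in> \<Sigma>" "\<tau> \<subseteq> \<eta>" "\<eta> \<subseteq> \<sigma>" "x \<in> rel_interior (qproj \<tau> ` \<eta>)"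
proof -
  obtain y where y: "y \<in> \<sigma>" "x = qproj \<tau> y" using s by blast
  obtain c where "y = (\<Sum>v\<in>gens \<sigma>. c v *\<^sub>R v)" "\<forall>v\<in>gens \<sigma>. 0 \<le> c v"
    using cone_coneD[OF s(1) y(1)] by blast
  note c = this(1) this(2)[rule_format]
  have sub: "gens \<tau> \<subseteq> gens \<sigma>" using gens_mono s(2) by blast
  \<comment> \<open>Generators with coefficient 0 are dropped, except those of
    \<open>\<tau>\<close>, whose coefficients are invisible in the quotient.\<close>
  define T where "T = gens \<tau> \<union> {v \<in> gens \<sigma>. c v > 0}"
  have T: "T \<subseteq> gens \<sigma>" using sub T_def by blast
  define \<eta> where "\<eta> = convex_cone hull T"
  note \<eta> = subcone[OF s(1) T, folded \<eta>_def]
  have te: "\<tau> \<subseteq> \<eta>" using subset_iff_gens[OF t \<eta>(1)] \<eta>(2) T_def by blast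
  have "y - (\<Sum>v\<in>gens \<eta> - gens \<tau>. c v *\<^sub>R v) \<in> span \<tau>"
  proof -
    have "y = (\<Sum>v\<in>gens \<sigma> - (gens \<eta> - gens \<tau>). c v *\<^sub>R v) + (\<Sum>v\<in>gens \<eta> - gens \<tau>. c v *\<^sub>R v)"
      unfolding c(1) using T \<eta>(2) by (intro sum.subset_diff finite_gens) blast
    moreover have "(\<Sum>v\<in>gens \<sigma> - (gens \<eta> - gens \<tau>). c v *\<^sub>R v) \<in> span \<tau>"
    proof (rule span_sum)
      fix v assume v: "v \<in> gens \<sigma> - (gens \<eta> - gens \<tau>)"
      show "c v *\<^sub>R v \<in> span \<tau>"
      proof (cases "v \<in> gens \<tau>")
        case True then show ?thesis using gens_subset span_base span_scale by blast
      next
        case False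
        then have "\<not> c v > 0" using v \<eta>(2) T_def by blast
        then have "c v = 0" using c(2)[of v] v by simp
        then show ?thesis by (simp add: span_zero)
      qed
    qed
    ultimately show ?thesis by simp
  qed
  then have "x = qproj \<tau> (\<Sum>v\<in>gens \<eta> - gens \<tau>. c v *\<^sub>R v)" using y(2) qproj_eq_iff by blast
  moreover have "\<And>v. v \<in> gens \<eta> - gens \<tau> \<Longrightarrow> 0 < c v" using \<eta>(2) T_def by blast
  ultimately have "x \<in> rel_interior (qproj \<tau> ` \<eta>)" using star_relintI[OF t \<eta>(1) te] by metis
  then show ?thesis using that \<eta> te by blast
qed

text \<open>The fan is simplicial but possibly not unimodular: the image of the primitive vector
  \<open>v\<close> may be a proper multiple of the generator, hence a positive factor instead of
  1.\<close>

lemma edge_gen_vert: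
  assumes "(\<tau>, \<sigma>) \<in> cubes_dim \<Sigma> 1" "gens \<sigma> = insert v (gens \<tau>)" "v \<notin> gens \<tau>"
  shows "\<exists>c>0. edge_gen N \<tau> \<sigma> = c *\<^sub>R qproj \<tau> v" "qproj \<tau> v \<noteq> 0" "qproj \<tau> ` \<sigma> = {t *\<^sub>R qproj \<tau> v | t. 0 \<le> t}"
proof -
  have *: "\<tau> \<in> \<Sigma>" "\<sigma> \<in> \<Sigma>" "\<tau> \<subseteq> \<sigma>" using assms(1) by (auto simp: cubes_dim_iff)
  have diff: "gens \<sigma> - gens \<tau> = {v}" using assms(2,3) by blast
  note s = star_gens[OF *, unfolded diff]
  show 0: "qproj \<tau> v \<noteq> 0" using s(1) dependent_zero by fastforce
  show H: "qproj \<tau> ` \<sigma> = {t *\<^sub>R qproj \<tau> v | t. 0 \<le> t}"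
  proof (intro equalityI subsetI)
    fix x assume "x \<in> qproj \<tau> ` \<sigma>"
    then have "x \<in> convex_cone hull {qproj \<tau> v}" using s(3) by simp
    then obtain c where "x = (\<Sum>w\<in>{qproj \<tau> v}. c w *\<^sub>R w)" "\<forall>w\<in>{qproj \<tau> v}. 0 \<le> c w"
      using simplicial_coneD[of x "{qproj \<tau> v}"] by blast
    then show "x \<in> {t *\<^sub>R qproj \<tau> v | t. 0 \<le> t}" by auto
  next
    fix x assume "x \<in> {t *\<^sub>R qproj \<tau> v | t. 0 \<le> t}"
    then obtain t where "x = t *\<^sub>R qproj \<tau> v" "0 \<le> t" by blast
    then show "x \<in> qproj \<tau> ` \<sigma>"
      unfolding s(3) by (simp add: convex_cone_hull_mul hull_inc)
  qed
  show "\<exists>c>0. edge_gen N \<tau> \<sigma> = c *\<^sub>R qproj \<tau> v" by (rule edge_gen_props[OF assms(1) H 0])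
qed

end

section \<open>Orientation signs\<close>

lemma wedge_1: "wedge [a :: 'v::euclidean_space] = (\<lambda>xs. if length xs = 1 then a \<bullet> (xs ! 0) else 0)"
proof
  fix xs :: "'v list"
  have "{p. p permutes {..<Suc 0}} = {id}" by (simp add: lessThan_Suc permutes_doubleton_iff[of _ 0 0, simplified])
  then show "wedge [a] xs = (if length xs = 1 then a \<bullet> (xs ! 0) else 0)" by (simp add: wedge_def)
qed

lemma wedge_2: "wedge [a :: 'v::euclidean_space, b] = (\<lambda>xs. if length xs = 2
    then (a \<bullet> (xs ! 0)) * (b \<bullet> (xs ! 1)) - (a \<bullet> (xs ! 1)) * (b \<bullet> (xs ! 0)) else 0)"
proof
  fix xs :: "'v list"
  have 2: "{..<Suc (Suc 0)} = {0, Suc 0}" by auto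
  have "{p. p permutes {..<Suc (Suc 0)}} = {id, Transposition.transpose 0 1}"
    by (auto simp: 2 permutes_doubleton_iff)
  moreover have "id \<noteq> Transposition.transpose 0 (Suc 0)"
    by (metis Transposition.transpose_apply_first id_apply n_not_Suc_n)
  ultimately show "wedge [a, b] xs = (if length xs = 2
    then (a \<bullet> (xs ! 0)) * (b \<bullet> (xs ! 1)) - (a \<bullet> (xs ! 1)) * (b \<bullet> (xs ! 0)) else 0)"
    by (simp add: wedge_def sign_swap_id 2)
qed

lemma wedge_2_lincomb:
  "wedge [p *\<^sub>R a + q *\<^sub>R b, r *\<^sub>R a + s *\<^sub>R b] = (\<lambda>xs. (p * s - q * r) * wedge [a, b] xs)"
  by (auto simp: wedge_2 inner_add_left algebra_simps)

lemma wedge_2_swap: "wedge [b, a] = (\<lambda>xs. - wedge [a, b] xs)"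
  by (auto simp: wedge_2)

text \<open>Evaluation on \<open>x\<close> and \<open>e\<close>, where \<open>x\<close> is the
  component of \<open>n\<close> orthogonal to \<open>e\<close>, gives
  \<open>(x \<bullet> x) * (e \<bullet> e)\<close>.\<close>

lemma wedge_2_nonzero:
  assumes "e \<noteq> 0" "n \<notin> span {e}"
  shows "\<exists>xs. wedge [n, e] xs \<noteq> 0"
proof -
  define x where "x = n - ((n \<bullet> e) / (e \<bullet> e)) *\<^sub>R e"
  have ee: "e \<bullet> e > 0" using assms(1) by simp
  have "x \<noteq> 0"
  proof
    assume "x = 0"
    then have "n = ((n \<bullet> e) / (e \<bullet> e)) *\<^sub>R e" by (simp add: x_def)
    then show False using assms(2) by (metis span_base span_scale singletonI)
  qed
  have xe: "x \<bullet> e = 0" using ee by (simp add: x_def inner_diff_left)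
  have nx: "n \<bullet> x = x \<bullet> x"
  proof -
    have "n = x + ((n \<bullet> e) / (e \<bullet> e)) *\<^sub>R e" by (simp add: x_def)
    then have "n \<bullet> x = x \<bullet> x + ((n \<bullet> e) / (e \<bullet> e)) * (e \<bullet> x)" by (metis inner_add_left inner_scaleR_left)
    then show ?thesis using xe by (simp add: inner_commute)
  qed
  have "wedge [n, e] [x, e] = (x \<bullet> x) * (e \<bullet> e)"
    using xe nx by (simp add: wedge_2 inner_commute)
  then show ?thesis using ee \<open>x \<noteq> 0\<close> by (intro exI[of _ "[x, e]"]) simp
qed

lemma int_span_2: "int_span [a, b] = {of_int p *\<^sub>R a + of_int q *\<^sub>R b | p q :: int. True}"
proof (intro equalityI subsetI)
  fix x assume "x \<in> int_span [a, b]"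
  then obtain k :: "nat \<Rightarrow> int" where "x = (\<Sum>i<length [a,b]. of_int (k i) *\<^sub>R [a,b] ! i)"
    by (auto simp: int_span_def)
  then have "x = of_int (k 0) *\<^sub>R a + of_int (k 1) *\<^sub>R b" by (simp add: numeral_2_eq_2)
  then show "x \<in> {of_int p *\<^sub>R a + of_int q *\<^sub>R b | p q :: int. True}" by blast
next
  fix x assume "x \<in> {of_int p *\<^sub>R a + of_int q *\<^sub>R b | p q :: int. True}"
  then obtain p q :: int where "x = of_int p *\<^sub>R a + of_int q *\<^sub>R b" by blast
  then have "x = (\<Sum>i<length [a,b]. of_int ((\<lambda>i. if i = 0 then p else q) i) *\<^sub>R [a,b] ! i)"
    by (simp add: numeral_2_eq_2)
  then show "x \<in> int_span [a, b]" by (rule int_spanI)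
qed

text \<open>The transition determinants in both directions are integers, and their product is 1
  because the form is nonzero somewhere; so each is a unit.\<close>

lemma int_basis_change:
  assumes "int_span [n, e] = int_span [a, b]" "wedge [n, e] xs \<noteq> 0"
  shows "\<exists>\<epsilon>::int. \<epsilon> \<in> {1, -1} \<and> wedge [n, e] = (\<lambda>xs. of_int \<epsilon> * wedge [a, b] xs)"
proof -
  have "n \<in> int_span [n, e]" unfolding int_span_2 by (intro CollectI exI[of _ 1] exI[of _ 0]) simp
  then have "n \<in> int_span [a, b]" using assms(1) by simp
  then obtain p q :: int where n: "n = of_int p *\<^sub>R a + of_int q *\<^sub>R b" unfolding int_span_2 by blast
  have "e \<in> int_span [n, e]" unfolding int_span_2 by (intro CollectI exI[of _ 0] exI[of _ 1]) simp
  then have "e \<in> int_span [a, b]" using assms(1) by simp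
  then obtain r s :: int where e: "e = of_int r *\<^sub>R a + of_int s *\<^sub>R b" unfolding int_span_2 by blast
  have "a \<in> int_span [a, b]" unfolding int_span_2 by (intro CollectI exI[of _ 1] exI[of _ 0]) simp
  then have "a \<in> int_span [n, e]" using assms(1) by simp
  then obtain p' q' :: int where a: "a = of_int p' *\<^sub>R n + of_int q' *\<^sub>R e" unfolding int_span_2 by blast
  have "b \<in> int_span [a, b]" unfolding int_span_2 by (intro CollectI exI[of _ 0] exI[of _ 1]) simp
  then have "b \<in> int_span [n, e]" using assms(1) by simp
  then obtain r' s' :: int where b: "b = of_int r' *\<^sub>R n + of_int s' *\<^sub>R e" unfolding int_span_2 by blast
  have 1: "wedge [n, e] = (\<lambda>xs. of_int (p * s - q * r) * wedge [a, b] xs)"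
    using wedge_2_lincomb[of "of_int p" a "of_int q" b "of_int r" "of_int s"] n e by simp
  have 2: "wedge [a, b] = (\<lambda>xs. of_int (p' * s' - q' * r') * wedge [n, e] xs)"
    using wedge_2_lincomb[of "of_int p'" n "of_int q'" e "of_int r'" "of_int s'"] a b by simp
  have "wedge [n, e] xs = of_int (p * s - q * r) * (of_int (p' * s' - q' * r') * wedge [n, e] xs)"
    by (subst 1, subst 2) (rule refl)
  then have "of_int ((p * s - q * r) * (p' * s' - q' * r')) = (1::real)" using assms(2) by simp
  then have "(p * s - q * r) * (p' * s' - q' * r') = 1" by linarith
  then have "p * s - q * r \<in> {1, -1}" using zmult_eq_1_iff by auto
  then show ?thesis using 1 by blast
qed

context oriented_fan
begin

section \<open>Signs of the facets of edges and squares\<close>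

lemma qproj_cube: "(\<tau>, \<kappa>) \<in> cubes_dim \<Sigma> q \<Longrightarrow> qproj \<kappa> (qproj \<tau> x) = qproj \<kappa> x"
  by (rule qproj_qproj) (simp add: cubes_dim_iff)

lemma edge_gen_lattice:
  assumes "(\<tau>, \<sigma>) \<in> cubes_dim \<Sigma> 1"
  shows "edge_gen N \<tau> \<sigma> \<in> qproj \<tau> ` sublattice N \<sigma>"
  unfolding edge_lattice[OF assms] by (rule range_eqI[of _ _ 1]) simp

lemma edge_gen_nonzero:
  assumes "(\<tau>, \<sigma>) \<in> cubes_dim \<Sigma> 1"
  shows "edge_gen N \<tau> \<sigma> \<noteq> 0"
proof -
  obtain v where v: "v \<notin> gens \<tau>" "gens \<sigma> = insert v (gens \<tau>)" using edge_cubeD[OF assms] by blast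
  obtain c where "c > 0" "edge_gen N \<tau> \<sigma> = c *\<^sub>R qproj \<tau> v" using edge_gen_vert(1)[OF assms v(2,1)] by blast
  then show ?thesis using edge_gen_vert(2)[OF assms v(2,1)] by simp
qed

lemma qproj_idem[simp]: "qproj \<tau> (qproj \<tau> x) = qproj \<tau> x"
  by (rule qproj_qproj) simp

lemma edge_gen_qproj:
  assumes "(\<tau>, \<sigma>) \<in> cubes_dim \<Sigma> 1"
  shows "qproj \<tau> (edge_gen N \<tau> \<sigma>) = edge_gen N \<tau> \<sigma>" "qproj \<sigma> (edge_gen N \<tau> \<sigma>) = 0"
proof -
  obtain x where x: "edge_gen N \<tau> \<sigma> = qproj \<tau> x" "x \<in> sublattice N \<sigma>" using edge_gen_lattice[OF assms] by blast
  show "qproj \<tau> (edge_gen N \<tau> \<sigma>) = edge_gen N \<tau> \<sigma>" using x by simp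
  have "\<tau> \<subseteq> \<sigma>" using assms cubes_dim_iff by blast
  then have "qproj \<sigma> (edge_gen N \<tau> \<sigma>) = qproj \<sigma> x" using x qproj_qproj by simp
  also have "\<dots> = 0" using x(2) by (simp add: sublattice_def qproj_eq_0_iff)
  finally show "qproj \<sigma> (edge_gen N \<tau> \<sigma>) = 0" .
qed

lemma nu_0: "\<sigma> \<in> \<Sigma> \<Longrightarrow> \<nu> (\<sigma>, \<sigma>) = []"
proof -
  assume "\<sigma> \<in> \<Sigma>"
  then have "(\<sigma>, \<sigma>) \<in> cubes_dim \<Sigma> 0" by (simp add: cubes_dim_iff)
  then have "length (\<nu> (\<sigma>, \<sigma>)) = 0" using orient unfolding orientation_def by blast
  then show ?thesis by simp
qed

lemma nu_1: "(\<tau>, \<sigma>) \<in> cubes_dim \<Sigma> 1 \<Longrightarrow> \<nu> (\<tau>, \<sigma>) = [edge_gen N \<tau> \<sigma>]"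
  using orient unfolding orientation_def by blast

lemma nu_2:
  assumes "(\<tau>, \<sigma>) \<in> cubes_dim \<Sigma> 2"
  shows "\<exists>a b. \<nu> (\<tau>, \<sigma>) = [a, b] \<and> int_span [a, b] = qproj \<tau> ` sublattice N \<sigma>"
proof -
  have "length (\<nu> (\<tau>, \<sigma>)) = 2" and *: "int_span (\<nu> (\<tau>, \<sigma>)) = qproj \<tau> ` sublattice N \<sigma>"
    using orient assms unfolding orientation_def by blast+
  then obtain a b where "\<nu> (\<tau>, \<sigma>) = [a, b]" by (auto simp: length_Suc_conv numeral_2_eq_2)
  then show ?thesis using * by auto
qed

lemma wedge_edge_nonzero:
  assumes "(\<tau>, \<sigma>) \<in> cubes_dim \<Sigma> 1"
  shows "wedge [edge_gen N \<tau> \<sigma>] [edge_gen N \<tau> \<sigma>] \<noteq> 0"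
  using edge_gen_nonzero[OF assms] by (simp add: wedge_1)

text \<open>A point carries the empty list, so the defining condition compares the generator with
  itself. With the value -1 at the other end, the boundary of an edge is its near end minus its end
  at infinity.\<close>

lemma cube_sign_lower:
  assumes c: "(\<tau>, \<sigma>) \<in> cubes_dim \<Sigma> 1"
  shows "cube_sign N \<nu> (\<tau>, \<tau>) (\<tau>, \<sigma>) = 1"
proof -
  have t: "\<tau> \<in> \<Sigma>" using c cubes_dim_iff by blast
  let ?e = "edge_gen N \<tau> \<sigma>"
  have "(THE \<epsilon>::int. \<epsilon> \<in> {1, -1} \<and> (\<exists>n \<in> qproj \<tau> ` sublattice N \<sigma>. qproj \<tau> n = ?e \<and>
             wedge (n # \<nu> (\<tau>, \<tau>)) = (\<lambda>xs. of_int \<epsilon> * wedge (\<nu> (\<tau>, \<sigma>)) xs))) = 1"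
  proof (rule the_equality)
    show "1 \<in> {1, -1::int} \<and> (\<exists>n \<in> qproj \<tau> ` sublattice N \<sigma>. qproj \<tau> n = ?e \<and>
             wedge (n # \<nu> (\<tau>, \<tau>)) = (\<lambda>xs. of_int 1 * wedge (\<nu> (\<tau>, \<sigma>)) xs))"
      unfolding nu_0[OF t] nu_1[OF c]
      by (intro conjI bexI[of _ ?e] edge_gen_lattice[OF c] edge_gen_qproj[OF c]) simp_all
    fix \<epsilon> :: int
    assume "\<epsilon> \<in> {1, -1} \<and> (\<exists>n \<in> qproj \<tau> ` sublattice N \<sigma>. qproj \<tau> n = ?e \<and>
             wedge (n # \<nu> (\<tau>, \<tau>)) = (\<lambda>xs. of_int \<epsilon> * wedge (\<nu> (\<tau>, \<sigma>)) xs))"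
    then obtain x where x: "qproj \<tau> (qproj \<tau> x) = ?e"
      "wedge (qproj \<tau> x # \<nu> (\<tau>, \<tau>)) = (\<lambda>xs. of_int \<epsilon> * wedge (\<nu> (\<tau>, \<sigma>)) xs)" by blast
    then have "wedge [?e] = (\<lambda>xs. of_int \<epsilon> * wedge [?e] xs)" using nu_0[OF t] nu_1[OF c] by simp
    then have "wedge [?e] [?e] = of_int \<epsilon> * wedge [?e] [?e]" by metis
    then show "\<epsilon> = 1" using wedge_edge_nonzero[OF c] by simp
  qed
  then show ?thesis by simp
qed

lemma cube_sign_upper:
  assumes c: "(\<tau>, \<sigma>) \<in> cubes_dim \<Sigma> 1"
  shows "cube_sign N \<nu> (\<sigma>, \<sigma>) (\<tau>, \<sigma>) = -1"
proof -
  have t: "\<sigma> \<in> \<Sigma>" "\<tau> \<noteq> \<sigma>" using c cubes_dim_iff by auto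
  let ?e = "edge_gen N \<tau> \<sigma>"
  have "(THE \<epsilon>::int. \<epsilon> \<in> {1, -1} \<and> (\<exists>us. set us \<subseteq> qproj \<tau> ` sublattice N \<sigma> \<and>
             map (qproj \<sigma>) us = \<nu> (\<sigma>, \<sigma>) \<and>
             wedge (?e # us) = (\<lambda>xs. - of_int \<epsilon> * wedge (\<nu> (\<tau>, \<sigma>)) xs))) = - 1"
  proof (rule the_equality)
    show "- 1 \<in> {1, -1::int} \<and> (\<exists>us. set us \<subseteq> qproj \<tau> ` sublattice N \<sigma> \<and>
             map (qproj \<sigma>) us = \<nu> (\<sigma>, \<sigma>) \<and>
             wedge (?e # us) = (\<lambda>xs. - of_int (- 1) * wedge (\<nu> (\<tau>, \<sigma>)) xs))"
      using nu_0[OF t(1)] nu_1[OF c] by simp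
    fix \<epsilon> :: int
    assume "\<epsilon> \<in> {1, -1} \<and> (\<exists>us. set us \<subseteq> qproj \<tau> ` sublattice N \<sigma> \<and>
             map (qproj \<sigma>) us = \<nu> (\<sigma>, \<sigma>) \<and>
             wedge (?e # us) = (\<lambda>xs. - of_int \<epsilon> * wedge (\<nu> (\<tau>, \<sigma>)) xs))"
    then have "wedge [?e] = (\<lambda>xs. - of_int \<epsilon> * wedge [?e] xs)" using nu_0[OF t(1)] nu_1[OF c] by auto
    then have "wedge [?e] [?e] = - of_int \<epsilon> * wedge [?e] [?e]" by metis
    then have "(1 + of_int \<epsilon>) * wedge [?e] [?e] = 0" by (simp add: algebra_simps)
    then have "1 + of_int \<epsilon> = (0::real)" using wedge_edge_nonzero[OF c] by simp
    then show "\<epsilon> = -1" by linarith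
  qed
  then show ?thesis using t by simp
qed

lemma facet_lift_exists:
  assumes c: "(\<tau>, \<kappa>) \<in> cubes_dim \<Sigma> 1" "(\<kappa>, \<sigma>) \<in> cubes_dim \<Sigma> 1"
  shows "\<exists>n \<in> qproj \<tau> ` sublattice N \<sigma>. qproj \<kappa> n = edge_gen N \<kappa> \<sigma>"
proof -
  obtain x where x: "edge_gen N \<kappa> \<sigma> = qproj \<kappa> x" "x \<in> sublattice N \<sigma>" using edge_gen_lattice[OF c(2)] by blast
  have "qproj \<kappa> (qproj \<tau> x) = edge_gen N \<kappa> \<sigma>" using x qproj_cube[OF c(1)] by simp
  then show ?thesis using x(2) by blast
qed

text \<open>Exactness in the middle of \<open>N\<^sub>\<kappa> / N\<^sub>\<tau> \<rightarrow>
  N\<^sub>\<sigma> / N\<^sub>\<tau> \<rightarrow> N\<^sub>\<sigma> / N\<^sub>\<kappa>\<close>,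
  combined with the cyclicity of the first group.\<close>

lemma facet_kernel:
  assumes c: "(\<tau>, \<kappa>) \<in> cubes_dim \<Sigma> 1" "(\<kappa>, \<sigma>) \<in> cubes_dim \<Sigma> 1"
    and y: "y \<in> qproj \<tau> ` sublattice N \<sigma>" "qproj \<kappa> y = 0"
  shows "\<exists>k::int. y = of_int k *\<^sub>R edge_gen N \<tau> \<kappa>"
proof -
  obtain u where u: "y = qproj \<tau> u" "u \<in> N" using y(1) by (auto simp: sublattice_def)
  have "qproj \<kappa> u = 0" using y(2) u(1) qproj_cube[OF c(1)] by simp
  then have "u \<in> sublattice N \<kappa>" using u(2) by (simp add: sublattice_def qproj_eq_0_iff)
  then have "y \<in> qproj \<tau> ` sublattice N \<kappa>" using u(1) by blast
  then show ?thesis unfolding edge_lattice[OF c(1)] by blast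
qed

lemma sublattice_image_diff:
  assumes "x \<in> qproj \<tau> ` sublattice N \<sigma>" "y \<in> qproj \<tau> ` sublattice N \<sigma>"
  shows "x - of_int k *\<^sub>R y \<in> qproj \<tau> ` sublattice N \<sigma>"
proof -
  obtain u v where uv: "x = qproj \<tau> u" "u \<in> sublattice N \<sigma>" "y = qproj \<tau> v" "v \<in> sublattice N \<sigma>"
    using assms by blast
  have "u + of_int (- k) *\<^sub>R v \<in> N"
    using uv by (intro zlattice_add[OF lattice] zlattice_mult[OF lattice]) (auto simp: sublattice_def)
  moreover have "u - of_int k *\<^sub>R v \<in> span \<sigma>"
    using uv by (intro span_diff span_scale) (auto simp: sublattice_def)
  ultimately have "u - of_int k *\<^sub>R v \<in> sublattice N \<sigma>" by (simp add: sublattice_def)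
  moreover have "x - of_int k *\<^sub>R y = qproj \<tau> (u - of_int k *\<^sub>R v)"
    using uv by (simp add: linear_diff[OF linear_qproj] linear_cmul[OF linear_qproj])
  ultimately show ?thesis by blast
qed

text \<open>By the exact sequence, a lift of the generator of the quotient and the generator of the
  kernel form a basis of \<open>N\<^sub>\<sigma> / N\<^sub>\<tau>\<close>; two integral bases differ
  by a determinant 1 or -1.\<close>

lemma facet_lift_wedge:
  assumes d: "(\<tau>, \<sigma>) \<in> cubes_dim \<Sigma> 2"
    and c: "(\<tau>, \<kappa>) \<in> cubes_dim \<Sigma> 1" "(\<kappa>, \<sigma>) \<in> cubes_dim \<Sigma> 1"
    and n: "n \<in> qproj \<tau> ` sublattice N \<sigma>" "qproj \<kappa> n = edge_gen N \<kappa> \<sigma>"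
  shows "\<exists>\<epsilon>::int. \<epsilon> \<in> {1, -1} \<and> wedge [n, edge_gen N \<tau> \<kappa>] = (\<lambda>xs. of_int \<epsilon> * wedge (\<nu> (\<tau>, \<sigma>)) xs)"
    "\<exists>xs. wedge [n, edge_gen N \<tau> \<kappa>] xs \<noteq> 0"
proof -
  let ?e = "edge_gen N \<tau> \<kappa>" and ?\<Lambda> = "qproj \<tau> ` sublattice N \<sigma>"
  obtain a b where ab: "\<nu> (\<tau>, \<sigma>) = [a, b]" "int_span [a, b] = ?\<Lambda>" using nu_2[OF d] by blast
  have "n \<notin> span {?e}"
  proof
    assume "n \<in> span {?e}"
    then obtain t where "n = t *\<^sub>R ?e" by (auto simp: span_singleton)
    then have "qproj \<kappa> n = 0" using edge_gen_qproj(2)[OF c(1)] by (simp add: linear_cmul[OF linear_qproj])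
    then show False using n(2) edge_gen_nonzero[OF c(2)] by simp
  qed
  then show nz: "\<exists>xs. wedge [n, ?e] xs \<noteq> 0" using wedge_2_nonzero edge_gen_nonzero[OF c(1)] by blast
  have sub: "sublattice N \<kappa> \<subseteq> sublattice N \<sigma>"
    using c(2) span_mono by (auto simp: sublattice_def cubes_dim_iff)
  have e: "?e \<in> ?\<Lambda>" using edge_gen_lattice[OF c(1)] sub by blast
  have "int_span [n, ?e] = ?\<Lambda>"
  proof (intro equalityI subsetI)
    fix x assume "x \<in> int_span [n, ?e]"
    then obtain p q :: int where x: "x = of_int p *\<^sub>R n + of_int q *\<^sub>R ?e" unfolding int_span_2 by blast
    have "n - of_int (1 - p) *\<^sub>R n \<in> ?\<Lambda>" using sublattice_image_diff[OF n(1) n(1)] .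
    then have "(n - of_int (1 - p) *\<^sub>R n) - of_int (- q) *\<^sub>R ?e \<in> ?\<Lambda>" using sublattice_image_diff[OF _ e] by blast
    then show "x \<in> ?\<Lambda>" unfolding x by (simp add: scaleR_left_diff_distrib)
  next
    fix x assume x: "x \<in> ?\<Lambda>"
    then obtain y where y: "x = qproj \<tau> y" "y \<in> sublattice N \<sigma>" by blast
    have "qproj \<kappa> x = qproj \<kappa> y" using y(1) qproj_cube[OF c(1)] by simp
    then have "qproj \<kappa> x \<in> qproj \<kappa> ` sublattice N \<sigma>" using y(2) by simp
    then obtain k :: int where k: "qproj \<kappa> x = of_int k *\<^sub>R edge_gen N \<kappa> \<sigma>"
      unfolding edge_lattice[OF c(2)] by blast
    have "qproj \<kappa> (x - of_int k *\<^sub>R n) = 0"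
      using k n(2) by (simp add: linear_diff[OF linear_qproj] linear_cmul[OF linear_qproj])
    then obtain j :: int where "x - of_int k *\<^sub>R n = of_int j *\<^sub>R ?e"
      using facet_kernel[OF c sublattice_image_diff[OF x n(1)]] by blast
    then have "x = of_int k *\<^sub>R n + of_int j *\<^sub>R ?e" by (simp add: algebra_simps)
    then show "x \<in> int_span [n, ?e]" unfolding int_span_2 by blast
  qed
  then show "\<exists>\<epsilon>::int. \<epsilon> \<in> {1, -1} \<and> wedge [n, ?e] = (\<lambda>xs. of_int \<epsilon> * wedge (\<nu> (\<tau>, \<sigma>)) xs)"
    using int_basis_change[of n ?e a b] nz ab by auto
qed

text \<open>For \<open>(\<tau>, \<kappa>)\<close> a lift \<open>n\<close> stands in front of the
  generator \<open>e\<close>, for \<open>(\<kappa>, \<sigma>)\<close> it is the reverse. The swap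
  costs a sign which the minus in the convention for faces at infinity restores, so both edges on
  the route through \<open>\<kappa>\<close> have the same sign.\<close>

lemma facet_sign:
  assumes d: "(\<tau>, \<sigma>) \<in> cubes_dim \<Sigma> 2"
    and c: "(\<tau>, \<kappa>) \<in> cubes_dim \<Sigma> 1" "(\<kappa>, \<sigma>) \<in> cubes_dim \<Sigma> 1"
  shows "\<exists>\<epsilon> n. \<epsilon> \<in> {1, -1} \<and> cube_sign N \<nu> (\<tau>, \<kappa>) (\<tau>, \<sigma>) = \<epsilon> \<and> cube_sign N \<nu> (\<kappa>, \<sigma>) (\<tau>, \<sigma>) = \<epsilon> \<and>
    n \<in> qproj \<tau> ` sublattice N \<sigma> \<and> qproj \<kappa> n = edge_gen N \<kappa> \<sigma> \<and>
    wedge [n, edge_gen N \<tau> \<kappa>] = (\<lambda>xs. of_int \<epsilon> * wedge (\<nu> (\<tau>, \<sigma>)) xs)"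
proof -
  let ?e = "edge_gen N \<tau> \<kappa>" and ?\<Lambda> = "qproj \<tau> ` sublattice N \<sigma>" and ?w = "wedge (\<nu> (\<tau>, \<sigma>))"
  obtain n where n: "n \<in> ?\<Lambda>" "qproj \<kappa> n = edge_gen N \<kappa> \<sigma>" using facet_lift_exists[OF c] by blast
  obtain \<epsilon> :: int where \<epsilon>: "\<epsilon> \<in> {1, -1}" "wedge [n, ?e] = (\<lambda>xs. of_int \<epsilon> * ?w xs)"
    using facet_lift_wedge(1)[OF d c n] by blast
  obtain xs where xs: "wedge [n, ?e] xs \<noteq> 0" using facet_lift_wedge(2)[OF d c n] by blast
  \<comment> \<open>Two lifts differ by a multiple of \<open>e\<close>, which leaves the wedge with
    \<open>e\<close> unchanged: the sign does not depend on the lift.\<close>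
  have any: "wedge [m, ?e] = wedge [n, ?e]" if m: "m \<in> ?\<Lambda>" "qproj \<kappa> m = edge_gen N \<kappa> \<sigma>" for m
  proof -
    have "qproj \<kappa> (m - of_int 1 *\<^sub>R n) = 0" using m n by (simp add: linear_diff[OF linear_qproj])
    then obtain k :: int where "m - of_int 1 *\<^sub>R n = of_int k *\<^sub>R ?e"
      using facet_kernel[OF c sublattice_image_diff[OF m(1) n(1)]] by blast
    then have m: "m = 1 *\<^sub>R n + of_int k *\<^sub>R ?e" by (simp add: algebra_simps)
    have "wedge [1 *\<^sub>R n + of_int k *\<^sub>R ?e, 0 *\<^sub>R n + 1 *\<^sub>R ?e] = (\<lambda>xs. (1 * 1 - of_int k * 0) * wedge [n, ?e] xs)"
      by (rule wedge_2_lincomb)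
    then show ?thesis unfolding m by simp
  qed
  have uniq: "\<epsilon>' = \<epsilon>" if "wedge [n, ?e] = (\<lambda>xs. of_int \<epsilon>' * ?w xs)" for \<epsilon>' :: int
  proof -
    have 1: "wedge [n, ?e] xs = of_int \<epsilon>' * ?w xs" by (rule fun_cong[OF that])
    have 2: "wedge [n, ?e] xs = of_int \<epsilon> * ?w xs" by (rule fun_cong[OF \<epsilon>(2)])
    have "?w xs \<noteq> 0" using xs 1 by (metis mult_zero_right)
    moreover have "of_int \<epsilon>' * ?w xs = of_int \<epsilon> * ?w xs" using 1 2 by (rule trans[OF sym])
    ultimately show ?thesis by simp
  qed
  have ne: "\<kappa> \<noteq> \<tau>" "\<sigma> \<noteq> \<kappa>" using c cubes_dim_iff by auto
  have "(THE \<epsilon>::int. \<epsilon> \<in> {1, -1} \<and> (\<exists>n \<in> ?\<Lambda>. qproj \<kappa> n = edge_gen N \<kappa> \<sigma> \<and>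
             wedge (n # \<nu> (\<tau>, \<kappa>)) = (\<lambda>xs. of_int \<epsilon> * ?w xs))) = \<epsilon>"
  proof (rule the_equality)
    show "\<epsilon> \<in> {1, -1} \<and> (\<exists>n \<in> ?\<Lambda>. qproj \<kappa> n = edge_gen N \<kappa> \<sigma> \<and>
             wedge (n # \<nu> (\<tau>, \<kappa>)) = (\<lambda>xs. of_int \<epsilon> * ?w xs))"
      unfolding nu_1[OF c(1)] using n \<epsilon> by blast
    fix \<epsilon>' :: int
    assume "\<epsilon>' \<in> {1, -1} \<and> (\<exists>n \<in> ?\<Lambda>. qproj \<kappa> n = edge_gen N \<kappa> \<sigma> \<and>
             wedge (n # \<nu> (\<tau>, \<kappa>)) = (\<lambda>xs. of_int \<epsilon>' * ?w xs))"
    then obtain m where m: "m \<in> ?\<Lambda>" "qproj \<kappa> m = edge_gen N \<kappa> \<sigma>" "wedge [m, ?e] = (\<lambda>xs. of_int \<epsilon>' * ?w xs)"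
      unfolding nu_1[OF c(1)] by blast
    then show "\<epsilon>' = \<epsilon>" using any uniq by metis
  qed
  then have s1: "cube_sign N \<nu> (\<tau>, \<kappa>) (\<tau>, \<sigma>) = \<epsilon>" by simp
  have "(THE \<epsilon>::int. \<epsilon> \<in> {1, -1} \<and> (\<exists>us. set us \<subseteq> ?\<Lambda> \<and> map (qproj \<kappa>) us = \<nu> (\<kappa>, \<sigma>) \<and>
             wedge (?e # us) = (\<lambda>xs. - of_int \<epsilon> * ?w xs))) = \<epsilon>"
  proof (rule the_equality)
    have "wedge [?e, n] = (\<lambda>xs. - of_int \<epsilon> * ?w xs)" using \<epsilon>(2) wedge_2_swap[of ?e n] by simp
    then show "\<epsilon> \<in> {1, -1} \<and> (\<exists>us. set us \<subseteq> ?\<Lambda> \<and> map (qproj \<kappa>) us = \<nu> (\<kappa>, \<sigma>) \<and>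
             wedge (?e # us) = (\<lambda>xs. - of_int \<epsilon> * ?w xs))"
      unfolding nu_1[OF c(2)] using n \<epsilon>(1) by (intro conjI exI[of _ "[n]"]) auto
    fix \<epsilon>' :: int
    assume A: "\<epsilon>' \<in> {1, -1} \<and> (\<exists>us. set us \<subseteq> ?\<Lambda> \<and> map (qproj \<kappa>) us = \<nu> (\<kappa>, \<sigma>) \<and>
             wedge (?e # us) = (\<lambda>xs. - of_int \<epsilon>' * ?w xs))"
    from conjunct2[OF A] obtain us where us0: "set us \<subseteq> ?\<Lambda> \<and> map (qproj \<kappa>) us = \<nu> (\<kappa>, \<sigma>) \<and>
             wedge (?e # us) = (\<lambda>xs. - of_int \<epsilon>' * ?w xs)" by (rule exE)
    note us = conjunct1[OF us0] conjunct1[OF conjunct2[OF us0], unfolded nu_1[OF c(2)]] conjunct2[OF conjunct2[OF us0]]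
    obtain m where m: "us = [m]" using us(2) by auto
    have "wedge [m, ?e] = (\<lambda>xs. of_int \<epsilon>' * ?w xs)"
      using us(3) wedge_2_swap[of m ?e] unfolding m by simp
    moreover have "wedge [m, ?e] = wedge [n, ?e]" using us(1,2) by (intro any) (simp_all add: m)
    ultimately show "\<epsilon>' = \<epsilon>" by (intro uniq) simp
  qed
  then have s2: "cube_sign N \<nu> (\<kappa>, \<sigma>) (\<tau>, \<sigma>) = \<epsilon>" using ne by simp
  show ?thesis using s1 s2 n \<epsilon> by blast
qed

text \<open>Expresses the orientation, up to a positive factor, by the rays added in passing from
  \<open>\<tau>\<close> to \<open>\<kappa>\<close> and from \<open>\<kappa>\<close> to
  \<open>\<sigma>\<close>. The other route adds the same rays in the opposite order, which makes the
  two routes comparable.\<close>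

lemma facet_lift_form:
  assumes c: "(\<tau>, \<kappa>) \<in> cubes_dim \<Sigma> 1" "(\<kappa>, \<sigma>) \<in> cubes_dim \<Sigma> 1"
    and v: "gens \<kappa> = insert v (gens \<tau>)" "v \<notin> gens \<tau>" "gens \<sigma> = insert w (gens \<kappa>)" "w \<notin> gens \<kappa>"
    and n: "n \<in> qproj \<tau> ` sublattice N \<sigma>" "qproj \<kappa> n = edge_gen N \<kappa> \<sigma>"
  shows "\<exists>C>0. wedge [n, edge_gen N \<tau> \<kappa>] = (\<lambda>xs. C * wedge [qproj \<tau> w, qproj \<tau> v] xs)"
proof -
  obtain a where a: "a > 0" "edge_gen N \<tau> \<kappa> = a *\<^sub>R qproj \<tau> v" using edge_gen_vert(1)[OF c(1) v(1,2)] by blast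
  obtain b where b: "b > 0" "edge_gen N \<kappa> \<sigma> = b *\<^sub>R qproj \<kappa> w" using edge_gen_vert(1)[OF c(2) v(3,4)] by blast
  have sub: "\<tau> \<subseteq> \<kappa>" "\<tau> \<in> \<Sigma>" "\<kappa> \<in> \<Sigma>" using c(1) cubes_dim_iff by auto
  obtain u where u: "n = qproj \<tau> u" using n(1) by blast
  have "qproj \<kappa> u = qproj \<kappa> (b *\<^sub>R w)"
    using n(2) u b qproj_qproj[OF sub(1)] by (simp add: linear_cmul[OF linear_qproj])
  then have "u - b *\<^sub>R w \<in> span (insert v (gens \<tau>))" using qproj_eq_iff span_gens[OF sub(3)] v(1) by metis
  then obtain t where "u - b *\<^sub>R w - t *\<^sub>R v \<in> span (gens \<tau>)" using span_insert by blast
  then have "qproj \<tau> (u - b *\<^sub>R w - t *\<^sub>R v) = 0" using qproj_eq_0_iff span_gens[OF sub(2)] by metis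
  then have "n = b *\<^sub>R qproj \<tau> w + t *\<^sub>R qproj \<tau> v"
    using u by (simp add: linear_diff[OF linear_qproj] linear_cmul[OF linear_qproj])
      (simp add: algebra_simps)
  then have "wedge [n, edge_gen N \<tau> \<kappa>] = (\<lambda>xs. (b * a - t * 0) * wedge [qproj \<tau> w, qproj \<tau> v] xs)"
    using wedge_2_lincomb[of b "qproj \<tau> w" t "qproj \<tau> v" 0 a] a(2) by simp
  then show ?thesis using a b by (intro exI[of _ "b * a"]) simp
qed

lemma gens_between:
  assumes "(\<tau>, \<kappa>) \<in> cubes_dim \<Sigma> 1" "(\<kappa>, \<sigma>) \<in> cubes_dim \<Sigma> 1" "(\<tau>, \<kappa>') \<in> cubes_dim \<Sigma> 1" "(\<kappa>', \<sigma>) \<in> cubes_dim \<Sigma> 1"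
    "\<kappa> \<noteq> \<kappa>'"
  shows "\<exists>v v'. v \<notin> gens \<tau> \<and> v' \<notin> gens \<tau> \<and> v \<noteq> v' \<and> gens \<kappa> = insert v (gens \<tau>) \<and>
    gens \<kappa>' = insert v' (gens \<tau>) \<and> gens \<sigma> = insert v' (gens \<kappa>) \<and> gens \<sigma> = insert v (gens \<kappa>')"
proof -
  obtain v where v: "v \<notin> gens \<tau>" "gens \<kappa> = insert v (gens \<tau>)" using edge_cubeD[OF assms(1)] by blast
  obtain v' where v': "v' \<notin> gens \<tau>" "gens \<kappa>' = insert v' (gens \<tau>)" using edge_cubeD[OF assms(3)] by blast
  have ne: "v \<noteq> v'"
  proof
    assume "v = v'"
    then have "gens \<kappa> = gens \<kappa>'" using v v' by simp
    then show False using gens_eqD assms cubes_dim_iff by blast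
  qed
  obtain w where w: "w \<notin> gens \<kappa>" "gens \<sigma> = insert w (gens \<kappa>)" using edge_cubeD[OF assms(2)] by blast
  have "gens \<kappa>' \<subseteq> gens \<sigma>" using assms(4) gens_mono cubes_dim_iff by blast
  then have "v' = w" using w v v' ne by auto
  then have "gens \<sigma> = insert v' (gens \<kappa>)" using w by simp
  moreover then have "gens \<sigma> = insert v (gens \<kappa>')" using v v' by auto
  ultimately show ?thesis using v v' ne by (intro exI[of _ v] exI[of _ v'] conjI)
qed

text \<open>The two routes through the square orient it by the same two rays in opposite orders. The
  common value \<epsilon> depends on the orientation and cancels from the cocycle condition.\<close>

lemma facet_signs_opposite:
  assumes d: "(\<tau>, \<sigma>) \<in> cubes_dim \<Sigma> 2"
    and c: "(\<tau>, \<kappa>) \<in> cubes_dim \<Sigma> 1" "(\<kappa>, \<sigma>) \<in> cubes_dim \<Sigma> 1"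
    and c': "(\<tau>, \<kappa>') \<in> cubes_dim \<Sigma> 1" "(\<kappa>', \<sigma>) \<in> cubes_dim \<Sigma> 1" and ne: "\<kappa> \<noteq> \<kappa>'"
  shows "\<exists>\<epsilon>\<in>{1, -1}. cube_sign N \<nu> (\<tau>, \<kappa>) (\<tau>, \<sigma>) = \<epsilon> \<and> cube_sign N \<nu> (\<kappa>, \<sigma>) (\<tau>, \<sigma>) = \<epsilon> \<and>
    cube_sign N \<nu> (\<tau>, \<kappa>') (\<tau>, \<sigma>) = - \<epsilon> \<and> cube_sign N \<nu> (\<kappa>', \<sigma>) (\<tau>, \<sigma>) = - \<epsilon>"
proof -
  let ?w = "wedge (\<nu> (\<tau>, \<sigma>))"
  obtain v v' where v: "v \<notin> gens \<tau>" "v' \<notin> gens \<tau>" "v \<noteq> v'" "gens \<kappa> = insert v (gens \<tau>)"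
    "gens \<kappa>' = insert v' (gens \<tau>)" "gens \<sigma> = insert v' (gens \<kappa>)" "gens \<sigma> = insert v (gens \<kappa>')"
    using gens_between[OF c c' ne] by (elim exE conjE) (rule that)
  obtain \<epsilon> n where e0: "\<epsilon> \<in> {1, -1} \<and> cube_sign N \<nu> (\<tau>, \<kappa>) (\<tau>, \<sigma>) = \<epsilon> \<and> cube_sign N \<nu> (\<kappa>, \<sigma>) (\<tau>, \<sigma>) = \<epsilon> \<and>
    n \<in> qproj \<tau> ` sublattice N \<sigma> \<and> qproj \<kappa> n = edge_gen N \<kappa> \<sigma> \<and>
    wedge [n, edge_gen N \<tau> \<kappa>] = (\<lambda>xs. of_int \<epsilon> * ?w xs)"
    using facet_sign[OF d c] by (elim exE)
  note e = e0[THEN conjunct1] e0[THEN conjunct2, THEN conjunct1]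
    e0[THEN conjunct2, THEN conjunct2, THEN conjunct1]
    e0[THEN conjunct2, THEN conjunct2, THEN conjunct2, THEN conjunct1]
    e0[THEN conjunct2, THEN conjunct2, THEN conjunct2, THEN conjunct2, THEN conjunct1]
    e0[THEN conjunct2, THEN conjunct2, THEN conjunct2, THEN conjunct2, THEN conjunct2]
  obtain \<epsilon>' n' where e'0: "\<epsilon>' \<in> {1, -1} \<and> cube_sign N \<nu> (\<tau>, \<kappa>') (\<tau>, \<sigma>) = \<epsilon>' \<and> cube_sign N \<nu> (\<kappa>', \<sigma>) (\<tau>, \<sigma>) = \<epsilon>' \<and>
    n' \<in> qproj \<tau> ` sublattice N \<sigma> \<and> qproj \<kappa>' n' = edge_gen N \<kappa>' \<sigma> \<and>
    wedge [n', edge_gen N \<tau> \<kappa>'] = (\<lambda>xs. of_int \<epsilon>' * ?w xs)"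
    using facet_sign[OF d c'] by (elim exE)
  note e' = e'0[THEN conjunct1] e'0[THEN conjunct2, THEN conjunct1]
    e'0[THEN conjunct2, THEN conjunct2, THEN conjunct1]
    e'0[THEN conjunct2, THEN conjunct2, THEN conjunct2, THEN conjunct1]
    e'0[THEN conjunct2, THEN conjunct2, THEN conjunct2, THEN conjunct2, THEN conjunct1]
    e'0[THEN conjunct2, THEN conjunct2, THEN conjunct2, THEN conjunct2, THEN conjunct2]
  have vk: "v' \<notin> gens \<kappa>" "v \<notin> gens \<kappa>'" using v by auto
  obtain C where C: "C > 0" "wedge [n, edge_gen N \<tau> \<kappa>] = (\<lambda>xs. C * wedge [qproj \<tau> v', qproj \<tau> v] xs)"
    using facet_lift_form[OF c v(4,1,6) vk(1) e(4,5)] by blast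
  obtain C' where C': "C' > 0" "wedge [n', edge_gen N \<tau> \<kappa>'] = (\<lambda>xs. C' * wedge [qproj \<tau> v, qproj \<tau> v'] xs)"
    using facet_lift_form[OF c' v(5,2,7) vk(2) e'(4,5)] by blast
  obtain xs where xs: "wedge [n, edge_gen N \<tau> \<kappa>] xs \<noteq> 0" using facet_lift_wedge(2)[OF d c e(4,5)] by blast
  define Z where "Z = wedge [qproj \<tau> v', qproj \<tau> v] xs"
  have 1: "of_int \<epsilon> * ?w xs = C * Z" unfolding Z_def fun_cong[OF e(6), symmetric] fun_cong[OF C(2), symmetric] ..
  have 2: "of_int \<epsilon>' * ?w xs = C' * (- Z)"
    using fun_cong[OF e'(6), of xs] fun_cong[OF C'(2), of xs] fun_cong[OF wedge_2_swap[of "qproj \<tau> v" "qproj \<tau> v'"], of xs]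
    unfolding Z_def by (metis)
  have "Z \<noteq> 0" using xs C Z_def by auto
  have "\<epsilon>' \<noteq> \<epsilon>"
  proof
    assume "\<epsilon>' = \<epsilon>"
    then have "C * Z = C' * (- Z)" using 1 2 by simp
    then have "(C + C') * Z = 0" by (simp add: algebra_simps)
    then show False using C C' \<open>Z \<noteq> 0\<close> by simp
  qed
  then have "\<epsilon>' = - \<epsilon>" using e(1) e'(1) by auto
  then show ?thesis using e(1-3) e'(2,3) by blast
qed

section \<open>Facets and coboundaries in dimensions one and two\<close>

lemma finite_cubes_dim: "finite (cubes_dim \<Sigma> q)"
proof (rule finite_subset)
  show "cubes_dim \<Sigma> q \<subseteq> \<Sigma> \<times> \<Sigma>" by (auto simp: cubes_dim_iff)
qed (simp add: finite_fan)

lemma subcube_iff: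
  assumes "(\<tau>', \<sigma>') \<in> cubes \<Sigma>" "(\<tau>, \<sigma>) \<in> cubes \<Sigma>"
  shows "subcube (\<tau>', \<sigma>') (\<tau>, \<sigma>) \<longleftrightarrow> \<tau> \<subseteq> \<tau>' \<and> \<sigma>' \<subseteq> \<sigma>"
  using assms cface_iff by (auto simp: cubes_iff)

lemma cubes_dim_cubes: "\<delta> \<in> cubes_dim \<Sigma> q \<Longrightarrow> \<delta> \<in> cubes \<Sigma>"
  by (auto simp: cubes_dim_def)

lemma cone_dim_eqI: "\<tau> \<in> \<Sigma> \<Longrightarrow> \<sigma> \<in> \<Sigma> \<Longrightarrow> \<tau> \<subseteq> \<sigma> \<Longrightarrow> dim \<sigma> \<le> dim \<tau> \<Longrightarrow> \<tau> = \<sigma>"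
  using gens_mono[of \<tau> \<sigma>] card_seteq[OF finite_gens, of "gens \<tau>" \<sigma>] gens_eqD by (simp add: dim_gens)

lemma cubes_0: "\<gamma> \<in> cubes_dim \<Sigma> 0 \<longleftrightarrow> (\<exists>\<kappa>\<in>\<Sigma>. \<gamma> = (\<kappa>, \<kappa>))"
  using cone_dim_eqI[of "fst \<gamma>" "snd \<gamma>"] by (cases \<gamma>) (auto simp: cubes_dim_iff)

lemma dim_mono_cone: "\<tau> \<in> \<Sigma> \<Longrightarrow> \<sigma> \<in> \<Sigma> \<Longrightarrow> \<tau> \<subseteq> \<sigma> \<Longrightarrow> dim \<tau> \<le> dim \<sigma>"
  by (rule dim_subset)

lemma facets_1:
  assumes d: "(\<tau>, \<sigma>) \<in> cubes_dim \<Sigma> 1"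
  shows "{\<gamma> \<in> cubes_dim \<Sigma> 0. subcube \<gamma> (\<tau>, \<sigma>)} = {(\<tau>, \<tau>), (\<sigma>, \<sigma>)}"
proof -
  have *: "\<tau> \<in> \<Sigma>" "\<sigma> \<in> \<Sigma>" "\<tau> \<subseteq> \<sigma>" "dim \<sigma> = dim \<tau> + 1" using d cubes_dim_iff by auto
  show ?thesis
  proof (intro equalityI subsetI)
    fix \<gamma> assume "\<gamma> \<in> {\<gamma> \<in> cubes_dim \<Sigma> 0. subcube \<gamma> (\<tau>, \<sigma>)}"
    then have g: "\<gamma> \<in> cubes_dim \<Sigma> 0" "subcube \<gamma> (\<tau>, \<sigma>)" by simp_all
    from g(1)[unfolded cubes_0] obtain \<kappa> where k: "\<kappa> \<in> \<Sigma>" "\<gamma> = (\<kappa>, \<kappa>)" by (rule bexE)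
    then have \<kappa>: "\<gamma> = (\<kappa>, \<kappa>)" "\<kappa> \<in> \<Sigma>" "cface \<tau> \<kappa>" "cface \<kappa> \<sigma>" using g(2) by simp_all
    then have sub: "\<tau> \<subseteq> \<kappa>" "\<kappa> \<subseteq> \<sigma>" using cface_iff[OF *(1) \<kappa>(2)] cface_iff[OF \<kappa>(2) *(2)] by simp_all
    show "\<gamma> \<in> {(\<tau>, \<tau>), (\<sigma>, \<sigma>)}"
    proof (cases "dim \<kappa> \<le> dim \<tau>")
      case True then show ?thesis using cone_dim_eqI[of \<tau> \<kappa>] \<kappa>(1,2) sub * by simp
    next
      case False then show ?thesis using cone_dim_eqI[of \<kappa> \<sigma>] \<kappa>(1,2) sub * by simp
    qed
  next
    fix \<gamma> assume "\<gamma> \<in> {(\<tau>, \<tau>), (\<sigma>, \<sigma>)}"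
    then show "\<gamma> \<in> {\<gamma> \<in> cubes_dim \<Sigma> 0. subcube \<gamma> (\<tau>, \<sigma>)}"
      using * cface_iff[of \<tau> \<tau>] cface_iff[of \<tau> \<sigma>] cface_iff[of \<sigma> \<sigma>] by (auto simp: cubes_0)
  qed
qed

lemma facets_2_ex:
  assumes d: "(\<tau>, \<sigma>) \<in> cubes_dim \<Sigma> 2"
  shows "\<exists>\<kappa> \<kappa>'. (\<tau>, \<kappa>) \<in> cubes_dim \<Sigma> 1 \<and> (\<kappa>, \<sigma>) \<in> cubes_dim \<Sigma> 1 \<and>
    (\<tau>, \<kappa>') \<in> cubes_dim \<Sigma> 1 \<and> (\<kappa>', \<sigma>) \<in> cubes_dim \<Sigma> 1 \<and> \<kappa> \<noteq> \<kappa>'"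
proof -
  have *: "\<tau> \<in> \<Sigma>" "\<sigma> \<in> \<Sigma>" "\<tau> \<subseteq> \<sigma>" "dim \<sigma> = dim \<tau> + 2" using d cubes_dim_iff by auto
  have sub: "gens \<tau> \<subseteq> gens \<sigma>" using gens_mono *(3) .
  have "card (gens \<sigma>) = card (gens \<tau>) + 2" using *(4) dim_gens[OF *(1)] dim_gens[OF *(2)] by simp
  then have "card (gens \<sigma> - gens \<tau>) = 2" using sub by (simp add: card_Diff_subset finite_gens)
  then obtain v v' where v: "gens \<sigma> - gens \<tau> = {v, v'}" "v \<noteq> v'" by (auto simp: card_2_iff)
  have k: "(\<tau>, convex_cone hull (insert w (gens \<tau>))) \<in> cubes_dim \<Sigma> 1 \<and>
      (convex_cone hull (insert w (gens \<tau>)), \<sigma>) \<in> cubes_dim \<Sigma> 1 \<and>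
      gens (convex_cone hull (insert w (gens \<tau>))) = insert w (gens \<tau>)" if "w \<in> {v, v'}" for w
  proof -
    have w: "insert w (gens \<tau>) \<subseteq> gens \<sigma>" "w \<notin> gens \<tau>" using that v(1) sub by auto
    note s = subcone[OF *(2) w(1)]
    have "\<tau> \<subseteq> convex_cone hull (insert w (gens \<tau>))" using subset_iff_gens[OF *(1) s(1)] s(2) by auto
    moreover have "dim (convex_cone hull (insert w (gens \<tau>))) = dim \<tau> + 1"
      using s w(2) *(1) finite_gens by (simp add: dim_gens)
    ultimately show ?thesis using s * by (simp add: cubes_dim_iff)
  qed
  have "gens (convex_cone hull (insert v (gens \<tau>))) \<noteq> gens (convex_cone hull (insert v' (gens \<tau>)))"
    using k v by auto
  then have "convex_cone hull (insert v (gens \<tau>)) \<noteq> convex_cone hull (insert v' (gens \<tau>))" by auto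
  then show ?thesis using k[of v] k[of v'] by blast
qed

lemma facets_2:
  assumes d: "(\<tau>, \<sigma>) \<in> cubes_dim \<Sigma> 2"
    and c: "(\<tau>, \<kappa>) \<in> cubes_dim \<Sigma> 1" "(\<kappa>, \<sigma>) \<in> cubes_dim \<Sigma> 1"
    and c': "(\<tau>, \<kappa>') \<in> cubes_dim \<Sigma> 1" "(\<kappa>', \<sigma>) \<in> cubes_dim \<Sigma> 1" and ne: "\<kappa> \<noteq> \<kappa>'"
  shows "{\<gamma> \<in> cubes_dim \<Sigma> 1. subcube \<gamma> (\<tau>, \<sigma>)} = {(\<tau>, \<kappa>), (\<kappa>, \<sigma>), (\<tau>, \<kappa>'), (\<kappa>', \<sigma>)}" (is "?L = ?R")
proof -
  have *: "\<tau> \<in> \<Sigma>" "\<sigma> \<in> \<Sigma>" "\<tau> \<subseteq> \<sigma>" "dim \<sigma> = dim \<tau> + 2" using d cubes_dim_iff by auto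
  obtain v v' where v: "v \<notin> gens \<tau>" "v' \<notin> gens \<tau>" "v \<noteq> v'" "gens \<kappa> = insert v (gens \<tau>)"
    "gens \<kappa>' = insert v' (gens \<tau>)" "gens \<sigma> = insert v' (gens \<kappa>)" "gens \<sigma> = insert v (gens \<kappa>')"
    using gens_between[OF c c' ne] by (elim exE conjE) (rule that)
  have two: "\<mu> = \<kappa> \<or> \<mu> = \<kappa>'" if m: "(\<tau>, \<mu>) \<in> cubes_dim \<Sigma> 1" "\<mu> \<subseteq> \<sigma>" for \<mu>
  proof -
    obtain w where w: "w \<notin> gens \<tau>" "gens \<mu> = insert w (gens \<tau>)" using edge_cubeD[OF m(1)] by blast
    have "gens \<mu> \<subseteq> gens \<sigma>" using gens_mono m(2) .
    then have "w = v \<or> w = v'" using v w by auto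
    then have "gens \<mu> = gens \<kappa> \<or> gens \<mu> = gens \<kappa>'" using v w by auto
    then show ?thesis using gens_eqD[of \<mu> \<kappa>] gens_eqD[of \<mu> \<kappa>'] m(1) c c' by (auto simp: cubes_dim_iff)
  qed
  have "?R \<subseteq> ?L" using c c' * by (auto simp: subcube_iff[OF cubes_dim_cubes cubes_dim_cubes[OF d]] cubes_dim_iff cface_iff)
  moreover have "?L \<subseteq> ?R"
  proof
    fix \<gamma> assume "\<gamma> \<in> ?L"
    then obtain a b where ab: "\<gamma> = (a, b)" "a \<in> \<Sigma>" "b \<in> \<Sigma>" "a \<subseteq> b" "dim b = dim a + 1" "\<tau> \<subseteq> a" "b \<subseteq> \<sigma>"
      using d by (cases \<gamma>) (auto simp: cubes_dim_iff cface_iff)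
    show "\<gamma> \<in> ?R"
    proof (cases "a = \<tau>")
      case True then show ?thesis using two[of b] ab by (auto simp: cubes_dim_iff)
    next
      case False
      then have a1: "dim a \<ge> dim \<tau> + 1" using cone_dim_eqI[of \<tau> a] ab * by (cases "dim a \<le> dim \<tau>") auto
      moreover have "dim b \<le> dim \<sigma>" using dim_mono_cone ab * by blast
      ultimately have "dim a = dim \<tau> + 1" "dim b = dim \<sigma>" using ab * by linarith+
      then have "b = \<sigma>" "(\<tau>, a) \<in> cubes_dim \<Sigma> 1" using cone_dim_eqI[of b \<sigma>] ab * by (auto simp: cubes_dim_iff)
      then show ?thesis using two[of a] ab by auto
    qed
  qed
  ultimately show ?thesis by blast
qed

text \<open>Up to one global sign the coboundary on a square is the difference of the sums along its
  two routes from \<open>\<tau>\<close> to \<open>\<sigma>\<close>, so a cocycle has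
  path-independent sums.\<close>

lemma trop_coboundary_1:
  assumes d: "(\<tau>, \<sigma>) \<in> cubes_dim \<Sigma> 2"
    and c: "(\<tau>, \<kappa>) \<in> cubes_dim \<Sigma> 1" "(\<kappa>, \<sigma>) \<in> cubes_dim \<Sigma> 1"
    and c': "(\<tau>, \<kappa>') \<in> cubes_dim \<Sigma> 1" "(\<kappa>', \<sigma>) \<in> cubes_dim \<Sigma> 1" and ne: "\<kappa> \<noteq> \<kappa>'"
  shows "\<exists>\<epsilon>\<in>{1, -1}. \<forall>a. \<forall>v\<in>F1 N \<Sigma> (\<tau>, \<sigma>). trop_coboundary N \<Sigma> \<nu> 1 a (\<tau>, \<sigma>) v =
    \<epsilon> * ((a (\<tau>, \<kappa>) (qproj \<tau> v) + a (\<kappa>, \<sigma>) (qproj \<kappa> v)) - (a (\<tau>, \<kappa>') (qproj \<tau> v) + a (\<kappa>', \<sigma>) (qproj \<kappa>' v)))"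
proof -
  obtain \<epsilon> where \<epsilon>: "\<epsilon> \<in> {1, -1}" "cube_sign N \<nu> (\<tau>, \<kappa>) (\<tau>, \<sigma>) = \<epsilon>" "cube_sign N \<nu> (\<kappa>, \<sigma>) (\<tau>, \<sigma>) = \<epsilon>"
    "cube_sign N \<nu> (\<tau>, \<kappa>') (\<tau>, \<sigma>) = - \<epsilon>" "cube_sign N \<nu> (\<kappa>', \<sigma>) (\<tau>, \<sigma>) = - \<epsilon>"
    using facet_signs_opposite[OF d c c' ne] by blast
  have ne': "\<tau> \<noteq> \<kappa>" "\<tau> \<noteq> \<kappa>'" "\<sigma> \<noteq> \<kappa>" "\<sigma> \<noteq> \<kappa>'" using c c' cubes_dim_iff by auto
  have 2: "Suc 1 = 2" by simp
  have "trop_coboundary N \<Sigma> \<nu> 1 a (\<tau>, \<sigma>) v =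
    of_int \<epsilon> * ((a (\<tau>, \<kappa>) (qproj \<tau> v) + a (\<kappa>, \<sigma>) (qproj \<kappa> v)) - (a (\<tau>, \<kappa>') (qproj \<tau> v) + a (\<kappa>', \<sigma>) (qproj \<kappa>' v)))"
    if "v \<in> F1 N \<Sigma> (\<tau>, \<sigma>)" for a v
    unfolding trop_coboundary_def facets_2[OF d c c' ne] 2
    using d that ne ne' \<epsilon>(2-) by (simp del: cube_sign.simps F1.simps add: algebra_simps)
  then show ?thesis using \<epsilon>(1) by (intro bexI[of _ "of_int \<epsilon>"]) auto
qed

lemma trop_coboundary_0:
  assumes d: "(\<tau>, \<sigma>) \<in> cubes_dim \<Sigma> 1" and v: "v \<in> F1 N \<Sigma> (\<tau>, \<sigma>)"
  shows "trop_coboundary N \<Sigma> \<nu> 0 a (\<tau>, \<sigma>) v = a (\<tau>, \<tau>) (qproj \<tau> v) - a (\<sigma>, \<sigma>) (qproj \<sigma> v)"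
proof -
  have "\<tau> \<noteq> \<sigma>" using d cubes_dim_iff by auto
  moreover have 1: "Suc 0 = 1" by simp
  ultimately show ?thesis unfolding trop_coboundary_def facets_1[OF d] 1
    using d v cube_sign_lower[OF d] cube_sign_upper[OF d] by (simp del: cube_sign.simps F1.simps One_nat_def)
qed

end

section \<open>Tropical coefficient groups\<close>

text \<open>Cochains have values in \<open>rat\<close>, linear forms in \<open>real\<close>; this
  goes back from a rational real and is unspecified elsewhere.\<close>

definition ratv :: "real \<Rightarrow> rat" where "ratv x = (THE r. real_of_rat r = x)"

lemma of_rat_ratv: "x \<in> \<rat> \<Longrightarrow> real_of_rat (ratv x) = x"
proof -
  assume "x \<in> \<rat>"
  then obtain r where r: "x = real_of_rat r" by (rule Rats_cases)
  show ?thesis unfolding ratv_def r by (rule theI[of _ r]) (simp_all)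
qed

lemma ratv_of_rat[simp]: "ratv (real_of_rat r) = r"
  unfolding ratv_def by (rule the_equality) simp_all

lemma Q_span_image:
  assumes "linear (f :: 'v::real_vector \<Rightarrow> 'v)"
  shows "Q.span (f ` S) = f ` Q.span S"
proof -
  have "module_hom (\<lambda>(q::rat) (x::'v). real_of_rat q *\<^sub>R x) (\<lambda>(q::rat) (x::'v). real_of_rat q *\<^sub>R x) f"
    using assms by (auto simp: module_hom_iff Q.module_axioms linear_add linear_cmul)
  then show ?thesis by (rule module_hom.span_image)
qed

text \<open>Otherwise \<open>S\<close> together with \<open>u\<close> would be rationally
  independent, hence independent over the reals, although \<open>u\<close> is in the real span of
  \<open>S\<close>.\<close>

lemma Q_span_of_real_span:
  assumes N: "zlattice N" and S: "S \<subseteq> Q.span N" "independent S" and u: "u \<in> Q.span N" "u \<in> span S"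
  shows "u \<in> Q.span S"
proof (rule ccontr)
  assume u': "u \<notin> Q.span S"
  obtain bs where bs: "independent (set bs)" "Q.span N = Q.span (set bs)"
    using zlattice_basis[OF N] by metis
  have "Q.independent S"
    using S(2) Q_span_subset_span unfolding Q.dependent_def dependent_def by blast
  then have "Q.independent (insert u S)" using u' by (simp add: Q.independent_insert)
  then have "independent (insert u S)"
    using Q_independent_imp_independent[OF bs(1), of "insert u S"] S(1) u(1) bs(2) by simp
  moreover have "u \<notin> S" using u' Q.span_base by blast
  ultimately have "u \<notin> span S" by (simp add: independent_insert)
  then show False using u(2) by simp
qed

context oriented_fan
begin

definition lat :: "'v set \<Rightarrow> 'v set" where
  "lat \<sigma> = (\<Union>\<eta>\<in>{\<eta>\<in>\<Sigma>. cface \<sigma> \<eta>}. sublattice N \<eta>)"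

text \<open>The projection is applied after the rational span. Thus an element of \<open>F1\<close>
  has a lift in \<open>Q.span N\<close>, even if it does not lie there itself.\<close>

lemma F1_eq: "F1 N \<Sigma> (\<tau>, \<sigma>) = qproj \<tau> ` Q.span (lat \<sigma>)"
proof -
  have "(\<Union>\<eta>\<in>{\<eta>\<in>\<Sigma>. cface \<sigma> \<eta>}. qproj \<tau> ` sublattice N \<eta>) = qproj \<tau> ` lat \<sigma>"
    by (auto simp: lat_def)
  then show ?thesis by (simp add: rat_span_eq Q_span_image[OF linear_qproj])
qed

declare F1.simps[simp del]

lemma F1_0: "F1 N \<Sigma> ({0}, \<sigma>) = Q.span (lat \<sigma>)"
  by (simp add: F1_eq)

lemma lat_mono: "\<tau> \<in> \<Sigma> \<Longrightarrow> \<sigma> \<in> \<Sigma> \<Longrightarrow> \<tau> \<subseteq> \<sigma> \<Longrightarrow> lat \<sigma> \<subseteq> lat \<tau>"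
  using cface_iff by (auto simp: lat_def)

lemma span_lat_mono: "\<tau> \<in> \<Sigma> \<Longrightarrow> \<sigma> \<in> \<Sigma> \<Longrightarrow> \<tau> \<subseteq> \<sigma> \<Longrightarrow> u \<in> Q.span (lat \<sigma>) \<Longrightarrow> u \<in> Q.span (lat \<tau>)"
  using Q.span_mono[OF lat_mono] by blast

lemma lat_subset: "lat \<sigma> \<subseteq> N" by (auto simp: lat_def sublattice_def)

lemma span_lat_subset: "u \<in> Q.span (lat \<sigma>) \<Longrightarrow> u \<in> Q.span N"
  using Q.span_mono[OF lat_subset] by blast

lemma F1_lift: "v \<in> F1 N \<Sigma> (\<tau>, \<sigma>) \<Longrightarrow> \<exists>u\<in>Q.span (lat \<sigma>). v = qproj \<tau> u"
  by (auto simp: F1_eq)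

lemma F1_I: "u \<in> Q.span (lat \<sigma>) \<Longrightarrow> qproj \<tau> u \<in> F1 N \<Sigma> (\<tau>, \<sigma>)"
  by (simp add: F1_eq)

lemma F1_qproj: "v \<in> F1 N \<Sigma> (\<tau>, \<sigma>) \<Longrightarrow> qproj \<tau> v = v"
  by (auto simp: F1_eq)

lemma F1_subspace: "Q.subspace (F1 N \<Sigma> \<delta>)"
proof (cases \<delta>)
  case (Pair \<tau> \<sigma>)
  then show ?thesis by (simp add: F1.simps rat_span_eq)
qed

lemma F1_subcube:
  assumes "(\<tau>, \<sigma>) \<in> cubes \<Sigma>" "(\<tau>', \<sigma>') \<in> cubes \<Sigma>" "subcube (\<tau>', \<sigma>') (\<tau>, \<sigma>)" "v \<in> F1 N \<Sigma> (\<tau>, \<sigma>)"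
  shows "qproj \<tau>' v \<in> F1 N \<Sigma> (\<tau>', \<sigma>')"
proof -
  have *: "\<tau> \<subseteq> \<tau>'" "\<sigma>' \<subseteq> \<sigma>" "\<sigma> \<in> \<Sigma>" "\<sigma>' \<in> \<Sigma>" using assms subcube_iff by (auto simp: cubes_iff)
  obtain u where u: "u \<in> Q.span (lat \<sigma>)" "v = qproj \<tau> u" using F1_lift[OF assms(4)] by blast
  have "qproj \<tau>' v = qproj \<tau>' u" using u(2) qproj_qproj[OF *(1)] by simp
  moreover have "u \<in> Q.span (lat \<sigma>')" using span_lat_mono[OF *(4,3,2) u(1)] .
  ultimately show ?thesis using F1_I by simp
qed

lemma F1_subcube':
  assumes "\<delta> \<in> cubes_dim \<Sigma> p" "\<gamma> \<in> cubes_dim \<Sigma> q" "subcube \<gamma> \<delta>" "v \<in> F1 N \<Sigma> \<delta>"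
  shows "qproj (fst \<gamma>) v \<in> F1 N \<Sigma> \<gamma>"
  using assms F1_subcube[OF cubes_dim_cubes cubes_dim_cubes, of "fst \<delta>" "snd \<delta>" p "fst \<gamma>" "snd \<gamma>" q v] by simp

lemma gens_lat:
  assumes "\<tau> \<in> \<Sigma>" "\<sigma> \<in> \<Sigma>" "\<tau> \<subseteq> \<sigma>"
  shows "gens \<sigma> \<subseteq> lat \<tau>"
proof
  fix x assume "x \<in> gens \<sigma>"
  then have "x \<in> sublattice N \<sigma>"
    using gens_lattice[of \<sigma>] gens_subset[of \<sigma>] span_superset[of \<sigma>] by (auto simp: sublattice_def)
  then show "x \<in> lat \<tau>" unfolding lat_def using assms cface_iff by blast
qed

lemma edge_gen_F1:
  assumes "(\<tau>, \<sigma>) \<in> cubes_dim \<Sigma> 1"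
  shows "edge_gen N \<tau> \<sigma> \<in> F1 N \<Sigma> (\<tau>, \<sigma>)"
proof -
  have s: "\<sigma> \<in> \<Sigma>" using assms by (simp add: cubes_dim_iff)
  obtain x where x: "edge_gen N \<tau> \<sigma> = qproj \<tau> x" "x \<in> sublattice N \<sigma>" using edge_gen_lattice[OF assms] by blast
  have "x \<in> lat \<sigma>" using x(2) s cface_iff[OF s s] by (auto simp: lat_def)
  then show ?thesis using x(1) F1_I[OF Q.span_base] by simp
qed

section \<open>Chains and cochains\<close>

lemma cochain_add:
  "a \<in> trop_cochains N \<Sigma> q \<Longrightarrow> \<delta> \<in> cubes_dim \<Sigma> q \<Longrightarrow> v \<in> F1 N \<Sigma> \<delta> \<Longrightarrow> w \<in> F1 N \<Sigma> \<delta> \<Longrightarrow> a \<delta> (v + w) = a \<delta> v + a \<delta> w"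
  unfolding trop_cochains_def by simp

lemma cochain_scale:
  "a \<in> trop_cochains N \<Sigma> q \<Longrightarrow> \<delta> \<in> cubes_dim \<Sigma> q \<Longrightarrow> v \<in> F1 N \<Sigma> \<delta> \<Longrightarrow> a \<delta> (real_of_rat r *\<^sub>R v) = r * a \<delta> v"
  unfolding trop_cochains_def by simp

lemma cochain_outside:
  "a \<in> trop_cochains N \<Sigma> q \<Longrightarrow> \<delta> \<notin> cubes_dim \<Sigma> q \<or> v \<notin> F1 N \<Sigma> \<delta> \<Longrightarrow> a \<delta> v = 0"
  unfolding trop_cochains_def by (cases \<delta>) simp

lemma cochain_0: "a \<in> trop_cochains N \<Sigma> q \<Longrightarrow> a \<delta> 0 = 0"
proof (cases "\<delta> \<in> cubes_dim \<Sigma> q")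
  assume a: "a \<in> trop_cochains N \<Sigma> q"
  case True
  then show ?thesis using cochain_scale[OF a True Q.subspace_0[OF F1_subspace], of 0] by simp
qed (simp add: cochain_outside)

lemma cochain_sum:
  assumes a: "a \<in> trop_cochains N \<Sigma> q" "\<delta> \<in> cubes_dim \<Sigma> q" and "finite I" "\<And>i. i \<in> I \<Longrightarrow> f i \<in> F1 N \<Sigma> \<delta>"
  shows "a \<delta> (\<Sum>i\<in>I. f i) = (\<Sum>i\<in>I. a \<delta> (f i))"
  using assms(3,4)
proof (induction I rule: finite_induct)
  case empty then show ?case by (simp add: cochain_0[OF a(1)])
next
  case (insert i I)
  then have "(\<Sum>i\<in>I. f i) \<in> F1 N \<Sigma> \<delta>" by (intro Q.subspace_sum[OF F1_subspace]) auto
  then show ?case using insert cochain_add[OF a] by simp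
qed

lemma cochains_diff:
  assumes a: "a \<in> trop_cochains N \<Sigma> q" and b: "b \<in> trop_cochains N \<Sigma> q"
  shows "(\<lambda>\<delta> v. a \<delta> v - b \<delta> v) \<in> trop_cochains N \<Sigma> q"
  unfolding trop_cochains_def
  using cochain_add[OF a] cochain_add[OF b] cochain_scale[OF a] cochain_scale[OF b] cochain_outside[OF a] cochain_outside[OF b]
  by (simp add: algebra_simps)

lemma coboundary_diff:
  "trop_coboundary N \<Sigma> \<nu> q (\<lambda>\<delta> v. a \<delta> v - b \<delta> v) =
    (\<lambda>\<delta> v. trop_coboundary N \<Sigma> \<nu> q a \<delta> v - trop_coboundary N \<Sigma> \<nu> q b \<delta> v)"
  by (intro ext) (simp add: trop_coboundary_def algebra_simps sum_subtractf)

lemma chain_F1: "z \<in> trop_chains N \<Sigma> q \<Longrightarrow> \<delta> \<in> cubes_dim \<Sigma> q \<Longrightarrow> z \<delta> \<in> F1 N \<Sigma> \<delta>"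
  unfolding trop_chains_def by simp

lemma F1_int_scale: "v \<in> F1 N \<Sigma> \<delta> \<Longrightarrow> of_int k *\<^sub>R v \<in> F1 N \<Sigma> \<delta>"
  using Q.subspace_scale[OF F1_subspace, of v \<delta> "of_int k"] by simp

lemma cochain_int_scale:
  "a \<in> trop_cochains N \<Sigma> q \<Longrightarrow> \<delta> \<in> cubes_dim \<Sigma> q \<Longrightarrow> v \<in> F1 N \<Sigma> \<delta> \<Longrightarrow> a \<delta> (of_int k *\<^sub>R v) = of_int k * a \<delta> v"
  using cochain_scale[of a q \<delta> v "of_int k"] by simp

text \<open>Exchange of the order of summation over incident pairs; \<open>b\<close> may be applied
  termwise because projections to facets stay in \<open>F1\<close>.\<close>

lemma coboundary_adjoint:
  assumes b: "b \<in> trop_cochains N \<Sigma> q" and z: "z \<in> trop_chains N \<Sigma> (Suc q)"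
  shows "(\<Sum>\<delta>\<in>cubes_dim \<Sigma> (Suc q). trop_coboundary N \<Sigma> \<nu> q b \<delta> (z \<delta>)) =
    (\<Sum>\<gamma>\<in>cubes_dim \<Sigma> q. b \<gamma> (trop_boundary N \<Sigma> \<nu> q z \<gamma>))"
proof -
  let ?t = "\<lambda>\<gamma> \<delta>. of_int (cube_sign N \<nu> \<gamma> \<delta>) * b \<gamma> (qproj (fst \<gamma>) (z \<delta>))"
  have "(\<Sum>\<delta>\<in>cubes_dim \<Sigma> (Suc q). trop_coboundary N \<Sigma> \<nu> q b \<delta> (z \<delta>)) =
      (\<Sum>\<delta>\<in>cubes_dim \<Sigma> (Suc q). \<Sum>\<gamma> | \<gamma> \<in> cubes_dim \<Sigma> q \<and> subcube \<gamma> \<delta>. ?t \<gamma> \<delta>)"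
    by (rule sum.cong[OF refl]) (simp add: trop_coboundary_def chain_F1[OF z])
  also have "\<dots> = (\<Sum>\<gamma>\<in>cubes_dim \<Sigma> q. \<Sum>\<delta> | \<delta> \<in> cubes_dim \<Sigma> (Suc q) \<and> subcube \<gamma> \<delta>. ?t \<gamma> \<delta>)"
    by (rule sum.swap_restrict[OF finite_cubes_dim finite_cubes_dim])
  also have "\<dots> = (\<Sum>\<gamma>\<in>cubes_dim \<Sigma> q. b \<gamma> (trop_boundary N \<Sigma> \<nu> q z \<gamma>))"
  proof (rule sum.cong[OF refl])
    fix \<gamma> assume g: "\<gamma> \<in> cubes_dim \<Sigma> q"
    have F: "qproj (fst \<gamma>) (z \<delta>) \<in> F1 N \<Sigma> \<gamma>" if "\<delta> \<in> cubes_dim \<Sigma> (Suc q)" "subcube \<gamma> \<delta>" for \<delta>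
      using F1_subcube'[OF that(1) g that(2) chain_F1[OF z that(1)]] .
    have "b \<gamma> (trop_boundary N \<Sigma> \<nu> q z \<gamma>) =
        b \<gamma> (\<Sum>\<delta> | \<delta> \<in> cubes_dim \<Sigma> (Suc q) \<and> subcube \<gamma> \<delta>. of_int (cube_sign N \<nu> \<gamma> \<delta>) *\<^sub>R qproj (fst \<gamma>) (z \<delta>))"
      using g by (simp add: trop_boundary_def)
    also have "\<dots> = (\<Sum>\<delta> | \<delta> \<in> cubes_dim \<Sigma> (Suc q) \<and> subcube \<gamma> \<delta>.
        b \<gamma> (of_int (cube_sign N \<nu> \<gamma> \<delta>) *\<^sub>R qproj (fst \<gamma>) (z \<delta>)))"
      using F by (intro cochain_sum[OF b g]) (auto simp: finite_cubes_dim intro!: F1_int_scale)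
    also have "\<dots> = (\<Sum>\<delta> | \<delta> \<in> cubes_dim \<Sigma> (Suc q) \<and> subcube \<gamma> \<delta>. ?t \<gamma> \<delta>)"
      using F by (intro sum.cong[OF refl]) (simp add: cochain_int_scale[OF b g])
    finally show "(\<Sum>\<delta> | \<delta> \<in> cubes_dim \<Sigma> (Suc q) \<and> subcube \<gamma> \<delta>. ?t \<gamma> \<delta>) = b \<gamma> (trop_boundary N \<Sigma> \<nu> q z \<gamma>)" by simp
  qed
  finally show ?thesis .
qed

lemma boundary_F1:
  assumes z: "z \<in> trop_chains N \<Sigma> (Suc q)" and g: "\<gamma> \<in> cubes_dim \<Sigma> q"
  shows "trop_boundary N \<Sigma> \<nu> q z \<gamma> \<in> F1 N \<Sigma> \<gamma>"
proof -
  have "qproj (fst \<gamma>) (z \<delta>) \<in> F1 N \<Sigma> \<gamma>" if "\<delta> \<in> cubes_dim \<Sigma> (Suc q)" "subcube \<gamma> \<delta>" for \<delta>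
    using F1_subcube'[OF that(1) g that(2) chain_F1[OF z that(1)]] .
  then show ?thesis unfolding trop_boundary_def using g
    by (auto intro!: Q.subspace_sum[OF F1_subspace] F1_int_scale)
qed

section \<open>The pairing of cohomology and homology classes\<close>

definition pair_sum :: "('v cube \<Rightarrow> 'v \<Rightarrow> rat) \<Rightarrow> ('v cube \<Rightarrow> 'v) \<Rightarrow> rat" where
  "pair_sum a z = (\<Sum>\<delta>\<in>cubes_dim \<Sigma> 1. a \<delta> (z \<delta>))"

definition cocycles :: "('v cube \<Rightarrow> 'v \<Rightarrow> rat) set" where
  "cocycles = {a \<in> trop_cochains N \<Sigma> 1. trop_coboundary N \<Sigma> \<nu> 1 a = (\<lambda>_ _. 0)}"

definition coboundaries :: "('v cube \<Rightarrow> 'v \<Rightarrow> rat) set" where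
  "coboundaries = trop_coboundary N \<Sigma> \<nu> 0 ` trop_cochains N \<Sigma> 0"

definition cycles :: "('v cube \<Rightarrow> 'v) set" where
  "cycles = {z \<in> trop_chains N \<Sigma> 1. trop_boundary N \<Sigma> \<nu> 0 z = (\<lambda>_. 0)}"

definition boundaries :: "('v cube \<Rightarrow> 'v) set" where
  "boundaries = trop_boundary N \<Sigma> \<nu> 1 ` trop_chains N \<Sigma> 2"

lemma pair_coboundary:
  assumes "z \<in> cycles" "d \<in> coboundaries"
  shows "pair_sum d z = 0"
proof -
  obtain b where b: "b \<in> trop_cochains N \<Sigma> 0" "d = trop_coboundary N \<Sigma> \<nu> 0 b" using assms(2) coboundaries_def by blast
  have z: "z \<in> trop_chains N \<Sigma> (Suc 0)" "trop_boundary N \<Sigma> \<nu> 0 z = (\<lambda>_. 0)" using assms(1) by (simp_all add: cycles_def)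
  show ?thesis using coboundary_adjoint[OF b(1) z(1)] z(2) by (simp add: pair_sum_def b(2) cochain_0[OF b(1)])
qed

lemma pair_boundary:
  assumes "a \<in> cocycles" "y \<in> boundaries"
  shows "pair_sum a y = 0"
proof -
  obtain w where w: "w \<in> trop_chains N \<Sigma> 2" "y = trop_boundary N \<Sigma> \<nu> 1 w" using assms(2) boundaries_def by blast
  have a: "a \<in> trop_cochains N \<Sigma> 1" "trop_coboundary N \<Sigma> \<nu> 1 a = (\<lambda>_ _. 0)" using assms(1) by (simp_all add: cocycles_def)
  have "w \<in> trop_chains N \<Sigma> (Suc 1)" using w(1) by (simp add: numeral_2_eq_2)
  then show ?thesis using coboundary_adjoint[OF a(1)] a(2) by (simp add: pair_sum_def w(2))
qed

text \<open>The description in \<open>trop_pairing\<close> requires one value for all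
  representatives: coboundaries pair to 0 with cycles, and boundaries with cocycles.\<close>

lemma pairing_value:
  assumes a0: "a0 \<in> cocycles" and c: "c \<in> trop_homology11 N \<Sigma> \<nu>" and z: "z \<in> c"
  shows "trop_pairing \<Sigma> (quot_class cocycles coboundaries a0) c = pair_sum a0 z"
proof -
  obtain z0 where z0: "z0 \<in> cycles" "c = quot_class cycles boundaries z0"
    using c unfolding trop_homology11_def quot_space_def cycles_def boundaries_def by blast
  have 1: "pair_sum a y = pair_sum a0 z0" if ay: "a \<in> quot_class cocycles coboundaries a0" "y \<in> c" for a y
  proof -
    have a: "a \<in> cocycles" "a0 - a \<in> coboundaries" using ay(1) by (simp_all add: quot_class_def)
    have y: "y \<in> cycles" "z0 - y \<in> boundaries" using ay(2) z0(2) by (simp_all add: quot_class_def)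
    have "pair_sum (a0 - a) y = pair_sum a0 y - pair_sum a y" by (simp add: pair_sum_def sum_subtractf)
    then have "pair_sum a y = pair_sum a0 y" using pair_coboundary[OF y(1) a(2)] by simp
    also have "\<dots> = pair_sum a0 z0"
    proof -
      obtain w where w: "w \<in> trop_chains N \<Sigma> 2" "z0 - y = trop_boundary N \<Sigma> \<nu> 1 w" using y(2) boundaries_def by blast
      have w': "w \<in> trop_chains N \<Sigma> (Suc 1)" using w(1) by (simp add: numeral_2_eq_2)
      have ac: "a0 \<in> trop_cochains N \<Sigma> 1" using a0 cocycles_def by simp
      have "a0 \<delta> (z0 \<delta>) = a0 \<delta> ((z0 - y) \<delta>) + a0 \<delta> (y \<delta>)" if d: "\<delta> \<in> cubes_dim \<Sigma> 1" for \<delta>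
      proof -
        have "(z0 - y) \<delta> \<in> F1 N \<Sigma> \<delta>" unfolding w(2) by (rule boundary_F1[OF w' d])
        moreover have "y \<delta> \<in> F1 N \<Sigma> \<delta>" using y(1) d by (intro chain_F1[of y 1]) (simp_all add: cycles_def)
        ultimately have "a0 \<delta> ((z0 - y) \<delta> + y \<delta>) = a0 \<delta> ((z0 - y) \<delta>) + a0 \<delta> (y \<delta>)" by (rule cochain_add[OF ac d])
        then show ?thesis by simp
      qed
      then have "pair_sum a0 z0 = pair_sum a0 (z0 - y) + pair_sum a0 y"
        unfolding pair_sum_def sum.distrib[symmetric] by (rule sum.cong[OF refl])
      then show ?thesis using pair_boundary[OF a0 y(2)] by simp
    qed
    finally show ?thesis .
  qed
  have a00: "a0 \<in> quot_class cocycles coboundaries a0"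
  proof -
    have "(\<lambda>_ _. 0) \<in> trop_cochains N \<Sigma> 0" by (simp add: trop_cochains_def)
    moreover have "trop_coboundary N \<Sigma> \<nu> 0 (\<lambda>_ _. 0) = a0 - a0" by (intro ext) (simp add: trop_coboundary_def)
    ultimately have "a0 - a0 \<in> coboundaries" unfolding coboundaries_def by (metis image_eqI)
    then show ?thesis using a0 by (simp add: quot_class_def)
  qed
  show ?thesis unfolding trop_pairing_def pair_sum_def[symmetric]
  proof (rule the_equality)
    show "\<forall>a\<in>quot_class cocycles coboundaries a0. \<forall>y\<in>c. pair_sum a0 z = pair_sum a y"
      using 1 a00 z by metis
    fix r assume "\<forall>a\<in>quot_class cocycles coboundaries a0. \<forall>y\<in>c. r = pair_sum a y"
    then show "r = pair_sum a0 z" using a00 z by blast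
  qed
qed

section \<open>The degree one Chow group\<close>

text \<open>An element of \<open>dual_lattice\<close> is only required to be additive on
  \<open>N\<close>. The real-linear form with the same values on a basis agrees with it on a
  subgroup containing that basis, hence on \<open>N\<close>.\<close>

lemma dual_lattice_functional:
  assumes m: "m \<in> dual_lattice N"
  shows "\<exists>l\<in>rat_functionals N. \<forall>x\<in>N. l x = of_int (m x)"
proof -
  obtain bs where bs: "distinct bs" "independent (set bs)" "N = int_span bs" "N \<subseteq> Q.span (set bs)"
    "Q.span N = Q.span (set bs)" using zlattice_basis[OF lattice] by metis
  obtain l :: "'v \<Rightarrow> real" where l: "linear l" "\<And>b. b \<in> set bs \<Longrightarrow> l b = of_int (m b)"
    using linear_extension[OF bs(2), of "\<lambda>b. of_int (m b)"] by blast
  have madd: "m (x + y) = m x + m y" if "x \<in> N" "y \<in> N" for x y using m that by (simp add: dual_lattice_def)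
  define S where "S = {x \<in> N. l x = of_int (m x)}"
  have zN: "0 \<in> N" unfolding bs(3) by (rule int_spanI[of _ "\<lambda>_. 0"]) simp
  have Sz: "0 \<in> S" using madd[OF zN zN] zN l(1) by (simp add: S_def linear_0)
  have Sadd: "x + y \<in> S" if "x \<in> S" "y \<in> S" for x y
    using that madd zlattice_add[OF lattice] l(1) by (simp add: S_def linear_add)
  have Sminus: "- x \<in> S" if x: "x \<in> S" for x
  proof -
    have xN: "x \<in> N" and mx: "- x \<in> N" using x zlattice_mult[OF lattice, of x "-1"] by (simp_all add: S_def)
    have "m x + m (- x) = 0" using madd[OF xN mx] Sz l(1) by (simp add: S_def linear_0)
    then have "m (- x) = - m x" by simp
    then show ?thesis using x mx l(1) by (simp add: S_def linear_neg)
  qed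
  have Snat: "of_nat n *\<^sub>R x \<in> S" if "x \<in> S" for n x
    by (induction n) (use Sz Sadd that in \<open>simp_all add: scaleR_left_distrib\<close>)
  have Sint: "of_int k *\<^sub>R x \<in> S" if "x \<in> S" for k x
  proof (cases "k \<ge> 0")
    case True then show ?thesis using Snat[OF that, of "nat k"] by simp
  next
    case False
    then have "of_int k *\<^sub>R x = - (of_nat (nat (- k)) *\<^sub>R x)" by simp
    then show ?thesis using Sminus[OF Snat[OF that, of "nat (- k)"]] by simp
  qed
  have bN: "b \<in> N" if "b \<in> set bs" for b
  proof -
    obtain i where i: "i < length bs" "b = bs ! i" using \<open>b \<in> set bs\<close> by (metis in_set_conv_nth)
    have "b = (\<Sum>j<length bs. of_int (if j = i then 1 else 0) *\<^sub>R bs ! j)"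
      using i by (simp add: if_distrib[of "\<lambda>c. of_int c *\<^sub>R _"] sum.delta cong: if_cong)
    then show ?thesis unfolding bs(3) by (rule int_spanI)
  qed
  have Ssum: "(\<Sum>i\<in>I. f i) \<in> S" if "finite I" "\<And>i. i \<in> I \<Longrightarrow> f i \<in> S" for I :: "nat set" and f
    using that by (induction I rule: finite_induct) (use Sz Sadd in auto)
  have "x \<in> S" if x: "x \<in> N" for x
  proof -
    obtain k :: "nat \<Rightarrow> int" where k: "x = (\<Sum>i<length bs. of_int (k i) *\<^sub>R bs ! i)"
      using x bs(3) int_spanE by metis
    have "bs ! i \<in> S" if "i < length bs" for i using bN l(2) that by (simp add: S_def)
    then show ?thesis unfolding k by (intro Ssum Sint) auto
  qed
  then have eq: "\<forall>x\<in>N. l x = of_int (m x)" by (simp add: S_def)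
  then have "l \<in> rat_functionals N" using l(1) by (auto simp: rat_functionals_def)
  then show ?thesis using eq by blast
qed

text \<open>\<open>l\<close> is expanded in the dual basis of a lattice basis; the coefficients are
  its rational values on that basis.\<close>

lemma functional_dual_lattice:
  assumes l: "l \<in> rat_functionals N"
  shows "\<exists>T q. finite T \<and> T \<subseteq> dual_lattice N \<and> (\<forall>x\<in>N. l x = real_of_rat (\<Sum>m\<in>T. q m * of_int (m x)))"
proof -
  obtain bs where bs: "distinct bs" "independent (set bs)" "N = int_span bs" "N \<subseteq> Q.span (set bs)"
    "Q.span N = Q.span (set bs)" using zlattice_basis[OF lattice] by metis
  have "\<exists>c :: 'v \<Rightarrow> real. linear c \<and> (\<forall>b'\<in>set bs. c b' = (if b' = b then 1 else 0))" for b
    by (rule linear_extension[OF bs(2)])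
  then obtain c :: "'v \<Rightarrow> 'v \<Rightarrow> real"
    where c: "\<And>b. linear (c b)" "\<And>b b'. b' \<in> set bs \<Longrightarrow> c b b' = (if b' = b then 1 else 0)" by metis
  have cint: "c b x \<in> \<int>" if x: "x \<in> N" for b x
  proof -
    obtain k :: "nat \<Rightarrow> int" where k: "x = (\<Sum>i<length bs. of_int (k i) *\<^sub>R bs ! i)"
      using x bs(3) int_spanE by metis
    have "c b (bs ! i) \<in> \<int>" if "i < length bs" for i using c(2)[of "bs ! i" b] that by simp
    then show ?thesis unfolding k using c(1) by (auto simp: linear_sum linear_cmul intro!: Ints_sum Ints_mult)
  qed
  \<comment> \<open>The coordinate forms are real-valued but integral on \<open>N\<close>; integer
    parts give integer-valued functions agreeing with them there.\<close>
  define m where "m = (\<lambda>b x. \<lfloor>c b x\<rfloor>)"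
  have m: "of_int (m b x) = c b x" if "x \<in> N" for b x
    using cint[OF that] by (simp add: m_def)
  have mdual: "m b \<in> dual_lattice N" for b
    unfolding dual_lattice_def
  proof (intro CollectI ballI)
    fix x y assume xy: "x \<in> N" "y \<in> N"
    have "of_int (m b (x + y)) = (of_int (m b x + m b y) :: real)"
      using m[OF zlattice_add[OF lattice xy]] m[OF xy(1)] m[OF xy(2)] c(1) by (simp add: linear_add)
    then show "m b (x + y) = m b x + m b y" by linarith
  qed
  have lb: "l b \<in> \<rat>" if "b \<in> set bs" for b
    using rat_functionals_span[OF l] bs(5) Q.span_base that by blast
  \<comment> \<open>The combination is indexed by functions, so distinct basis vectors must have
    distinct dual vectors.\<close>
  have inj: "inj_on m (set bs)"
  proof (rule inj_onI)
    fix b b' assume b: "b \<in> set bs" "b' \<in> set bs" "m b = m b'"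
    have "m b b = 1" using c(2)[OF b(1), of b] by (simp add: m_def)
    then have "m b' b = 1" using b(3) by simp
    then show "b = b'" using c(2)[OF b(1), of b'] by (simp add: m_def split: if_splits)
  qed
  define q where "q = (\<lambda>f. ratv (l (the_inv_into (set bs) m f)))"
  have lx: "l x = (\<Sum>b\<in>set bs. l b * c b x)" if "x \<in> span (set bs)" for x
  proof (rule linear_eq_on_span[OF _ _ _ that])
    show "linear l" using l by (simp add: rat_functionals_def)
    show "linear (\<lambda>x. \<Sum>b\<in>set bs. l b * c b x)"
      by (intro linear_compose_sum ballI) (use linear_compose_scale_right[OF c(1)] in simp)
    fix x assume x: "x \<in> set bs"
    have "(\<Sum>b\<in>set bs. l b * c b x) = (\<Sum>b\<in>set bs. if b = x then l x else 0)"
      by (rule sum.cong[OF refl]) (use c(2)[OF x] in auto)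
    then show "l x = (\<Sum>b\<in>set bs. l b * c b x)" using x by simp
  qed
  have "l x = real_of_rat (\<Sum>m\<in>m ` set bs. q m * of_int (m x))" if x: "x \<in> N" for x
  proof -
    have "real_of_rat (\<Sum>f\<in>m ` set bs. q f * of_int (f x)) = (\<Sum>b\<in>set bs. real_of_rat (q (m b)) * of_int (m b x))"
      by (simp add: sum.reindex[OF inj] of_rat_sum of_rat_mult)
    also have "\<dots> = (\<Sum>b\<in>set bs. l b * c b x)"
      by (rule sum.cong[OF refl]) (simp add: q_def the_inv_into_f_f[OF inj] of_rat_ratv[OF lb] m[OF x])
    also have "\<dots> = l x" using lx bs(4) Q_span_subset_span x by (metis subsetD)
    finally show ?thesis by simp
  qed
  moreover have "m ` set bs \<subseteq> dual_lattice N" using mdual by blast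
  ultimately show ?thesis by (intro exI[of _ "m ` set bs"] exI[of _ q]) simp
qed

text \<open>A finite rational combination of elements of M is a single form in
  \<open>rat_functionals N\<close>, and conversely; relations are thus restrictions of such forms to
  the ray generators.\<close>

lemma chow_rel_iff:
  "y \<in> chow_rel N \<Sigma> \<longleftrightarrow> (\<exists>l\<in>rat_functionals N. \<forall>\<rho>\<in>rays \<Sigma>. real_of_rat (y \<rho>) = l (ray_gen N \<rho>)) \<and> y \<in> chow_free \<Sigma>"
proof
  assume "y \<in> chow_rel N \<Sigma>"
  then obtain T q where T: "y = (\<lambda>\<rho>. if \<rho> \<in> rays \<Sigma> then \<Sum>m\<in>T. q m * of_int (m (ray_gen N \<rho>)) else 0)"
    "finite T" "T \<subseteq> dual_lattice N" unfolding chow_rel_def by blast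
  have "\<forall>m\<in>T. \<exists>l\<in>rat_functionals N. \<forall>x\<in>N. l x = of_int (m x)" using dual_lattice_functional T(3) by blast
  then obtain L where L: "\<And>m. m \<in> T \<Longrightarrow> L m \<in> rat_functionals N" "\<And>m x. m \<in> T \<Longrightarrow> x \<in> N \<Longrightarrow> L m x = of_int (m x)"
    by metis
  define l where "l = (\<lambda>x. \<Sum>m\<in>T. real_of_rat (q m) * L m x)"
  have "linear l" unfolding l_def
  proof (intro linear_compose_sum ballI)
    fix m assume "m \<in> T"
    then have "linear (L m)" using L(1) by (simp add: rat_functionals_def)
    then show "linear (\<lambda>x. real_of_rat (q m) * L m x)" using linear_compose_scale_right[of "L m" "real_of_rat (q m)"] by simp
  qed
  moreover have lx: "l x = real_of_rat (\<Sum>m\<in>T. q m * of_int (m x))" if "x \<in> N" for x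
    unfolding l_def using L(2) that by (simp add: of_rat_sum of_rat_mult)
  ultimately have "l \<in> rat_functionals N" by (auto simp: rat_functionals_def)
  moreover have "\<forall>\<rho>\<in>rays \<Sigma>. real_of_rat (y \<rho>) = l (ray_gen N \<rho>)"
    using lx ray_gen_props(3) T(1) by simp
  ultimately show "(\<exists>l\<in>rat_functionals N. \<forall>\<rho>\<in>rays \<Sigma>. real_of_rat (y \<rho>) = l (ray_gen N \<rho>)) \<and> y \<in> chow_free \<Sigma>"
    using T(1) by (auto simp: chow_free_def)
next
  assume "(\<exists>l\<in>rat_functionals N. \<forall>\<rho>\<in>rays \<Sigma>. real_of_rat (y \<rho>) = l (ray_gen N \<rho>)) \<and> y \<in> chow_free \<Sigma>"
  then obtain l where l: "l \<in> rat_functionals N" "\<And>\<rho>. \<rho> \<in> rays \<Sigma> \<Longrightarrow> real_of_rat (y \<rho>) = l (ray_gen N \<rho>)"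
    and y: "\<And>\<rho>. \<rho> \<notin> rays \<Sigma> \<Longrightarrow> y \<rho> = 0" by (auto simp: chow_free_def)
  obtain T q where T: "finite T" "T \<subseteq> dual_lattice N" "\<And>x. x \<in> N \<Longrightarrow> l x = real_of_rat (\<Sum>m\<in>T. q m * of_int (m x))"
    using functional_dual_lattice[OF l(1)] by metis
  have "y = (\<lambda>\<rho>. if \<rho> \<in> rays \<Sigma> then \<Sum>m\<in>T. q m * of_int (m (ray_gen N \<rho>)) else 0)"
  proof
    fix \<rho>
    show "y \<rho> = (if \<rho> \<in> rays \<Sigma> then \<Sum>m\<in>T. q m * of_int (m (ray_gen N \<rho>)) else 0)"
    proof (cases "\<rho> \<in> rays \<Sigma>")
      case True
      then have "real_of_rat (y \<rho>) = real_of_rat (\<Sum>m\<in>T. q m * of_int (m (ray_gen N \<rho>)))"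
        using l(2) T(3) ray_gen_props(3) by simp
      then have "y \<rho> = (\<Sum>m\<in>T. q m * of_int (m (ray_gen N \<rho>)))" by (simp only: of_rat_eq_iff)
      then show ?thesis using True by simp
    qed (simp add: y)
  qed
  then show "y \<in> chow_rel N \<Sigma>" unfolding chow_rel_def using T(1,2) by blast
qed

lemma chow_rel_diff:
  assumes "x \<in> chow_rel N \<Sigma>" "y \<in> chow_rel N \<Sigma>"
  shows "x - y \<in> chow_rel N \<Sigma>"
proof -
  obtain l where l: "l \<in> rat_functionals N" "\<forall>\<rho>\<in>rays \<Sigma>. real_of_rat (x \<rho>) = l (ray_gen N \<rho>)" "x \<in> chow_free \<Sigma>"
    using assms(1) chow_rel_iff by auto
  obtain k where k: "k \<in> rat_functionals N" "\<forall>\<rho>\<in>rays \<Sigma>. real_of_rat (y \<rho>) = k (ray_gen N \<rho>)" "y \<in> chow_free \<Sigma>"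
    using assms(2) chow_rel_iff by auto
  have "\<forall>\<rho>\<in>rays \<Sigma>. real_of_rat ((x - y) \<rho>) = (\<lambda>v. l v - k v) (ray_gen N \<rho>)" using l k by (simp add: of_rat_diff)
  moreover have "x - y \<in> chow_free \<Sigma>" using l k by (simp add: chow_free_def)
  ultimately show ?thesis unfolding chow_rel_iff
    by (intro conjI bexI[OF _ rat_functionals_diff[OF l(1) k(1)]])
qed

lemma chow_rel_0: "(\<lambda>_. 0) \<in> chow_rel N \<Sigma>"
proof -
  have "(\<lambda>_. 0) \<in> rat_functionals N" by (auto simp: rat_functionals_def linear_zero)
  then show ?thesis unfolding chow_rel_iff by (intro conjI bexI[of _ "\<lambda>_. 0"]) (simp_all add: chow_free_def)
qed

lemma chow_class_eqI:
  assumes "x \<in> chow_free \<Sigma>" "y \<in> chow_free \<Sigma>" "x - y \<in> chow_rel N \<Sigma>"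
  shows "chow_class N \<Sigma> x = chow_class N \<Sigma> y"
proof -
  have "x - w \<in> chow_rel N \<Sigma> \<longleftrightarrow> y - w \<in> chow_rel N \<Sigma>" for w
  proof
    assume "x - w \<in> chow_rel N \<Sigma>"
    then have "(x - w) - (x - y) \<in> chow_rel N \<Sigma>" using assms(3) by (rule chow_rel_diff)
    moreover have "(x - w) - (x - y) = y - w" by (intro ext) simp
    ultimately show "y - w \<in> chow_rel N \<Sigma>" by simp
  next
    assume "y - w \<in> chow_rel N \<Sigma>"
    moreover have "(\<lambda>_. 0) - (x - y) \<in> chow_rel N \<Sigma>" using chow_rel_0 assms(3) by (rule chow_rel_diff)
    ultimately have "(y - w) - ((\<lambda>_. 0) - (x - y)) \<in> chow_rel N \<Sigma>" by (rule chow_rel_diff)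
    moreover have "(y - w) - ((\<lambda>_. 0) - (x - y)) = x - w" by (intro ext) simp
    ultimately show "x - w \<in> chow_rel N \<Sigma>" by simp
  qed
  then show ?thesis by (simp add: chow_class_def quot_class_def)
qed

lemma chow_class_eqD:
  assumes "y \<in> chow_free \<Sigma>" "chow_class N \<Sigma> x = chow_class N \<Sigma> y"
  shows "x - y \<in> chow_rel N \<Sigma>"
proof -
  have "y - y = (\<lambda>_. 0)" by (intro ext) simp
  then have "y \<in> chow_class N \<Sigma> y" using assms(1) chow_rel_0 by (simp add: chow_class_def quot_class_def)
  then have "y \<in> chow_class N \<Sigma> x" using assms(2) by simp
  then show ?thesis by (simp add: chow_class_def quot_class_def)
qed

section \<open>Tropical cohomology in degree (1,1)\<close>

definition ray_values :: "('v cube \<Rightarrow> 'v \<Rightarrow> rat) \<Rightarrow> 'v set \<Rightarrow> rat" where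
  "ray_values a = (\<lambda>\<rho>. if \<rho> \<in> rays \<Sigma> then a ({0}, \<rho>) (ray_gen N \<rho>) else 0)"

lemma ray_values_free: "ray_values a \<in> chow_free \<Sigma>"
  by (simp add: ray_values_def chow_free_def)

lemma ray_gen_lat: "\<rho> \<in> rays \<Sigma> \<Longrightarrow> \<sigma> \<in> \<Sigma> \<Longrightarrow> \<sigma> \<subseteq> \<rho> \<Longrightarrow> ray_gen N \<rho> \<in> Q.span (lat \<sigma>)"
proof -
  assume r: "\<rho> \<in> rays \<Sigma>" and s: "\<sigma> \<in> \<Sigma>" "\<sigma> \<subseteq> \<rho>"
  have "ray_gen N \<rho> \<in> gens \<rho>" using r ray_gen_in_ray by (simp add: gens_def verts_def)
  moreover have "\<rho> \<in> \<Sigma>" using r by (simp add: rays_def)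
  ultimately show ?thesis using gens_lat[OF s(1) _ s(2)] Q.span_base by blast
qed

lemma zero_subset: "\<sigma> \<in> \<Sigma> \<Longrightarrow> {0} \<subseteq> \<sigma>" using zero_in_cone by simp

text \<open>On a ray the term at infinity is 0, since the projection along \<open>\<rho>\<close>
  kills its own generator. What is left is the component of the 0-cochain at
  \<open>({0}, {0})\<close>, which extends to a form in \<open>rat_functionals N\<close>.\<close>

lemma ray_values_coboundary:
  assumes d: "d \<in> coboundaries"
  shows "ray_values d \<in> chow_rel N \<Sigma>"
proof -
  obtain b where b: "b \<in> trop_cochains N \<Sigma> 0" "d = trop_coboundary N \<Sigma> \<nu> 0 b"
    using d unfolding coboundaries_def by (rule imageE)
  have c0: "({0}, {0}) \<in> cubes_dim \<Sigma> 0" using zero_cone by (simp add: cubes_0)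
  have F0: "Q.span (lat {0}) = F1 N \<Sigma> ({0}, {0})" by (simp add: F1_0)
  have "\<exists>l\<in>rat_functionals N. \<forall>w\<in>F1 N \<Sigma> ({0}, {0}). l w = real_of_rat (b ({0}, {0}) w)"
  proof (rule rat_functional_extension[OF lattice F1_subspace])
    show "F1 N \<Sigma> ({0}, {0}) \<subseteq> Q.span N" using span_lat_subset F0 by blast
  qed (simp_all add: cochain_add[OF b(1) c0] cochain_scale[OF b(1) c0])
  then obtain l where l: "l \<in> rat_functionals N" "\<forall>w\<in>F1 N \<Sigma> ({0}, {0}). l w = real_of_rat (b ({0}, {0}) w)" by blast
  have "real_of_rat (ray_values d \<rho>) = l (ray_gen N \<rho>)" if r: "\<rho> \<in> rays \<Sigma>" for \<rho>
  proof -
    have rS: "\<rho> \<in> \<Sigma>" using r by (simp add: rays_def)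
    have F: "ray_gen N \<rho> \<in> F1 N \<Sigma> ({0}, \<rho>)" using ray_gen_lat[OF r rS] by (simp add: F1_0)
    have F': "ray_gen N \<rho> \<in> F1 N \<Sigma> ({0}, {0})" using ray_gen_lat[OF r zero_cone zero_subset[OF rS]] by (simp add: F1_0)
    have "qproj \<rho> (ray_gen N \<rho>) = 0" using ray_gen_in_ray[OF r] span_base by (simp add: qproj_eq_0_iff)
    then have "d ({0}, \<rho>) (ray_gen N \<rho>) = b ({0}, {0}) (ray_gen N \<rho>)"
      unfolding b(2) trop_coboundary_0[OF ray_cube[OF r] F] by (simp add: cochain_0[OF b(1)])
    then show ?thesis using r l(2) F' by (simp add: ray_values_def)
  qed
  then show ?thesis unfolding chow_rel_iff using l(1) ray_values_free by (intro conjI bexI[of _ l]) simp_all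
qed

lemma coboundaries_diff:
  assumes "d \<in> coboundaries" "e \<in> coboundaries"
  shows "d - e \<in> coboundaries"
proof -
  obtain b where b: "b \<in> trop_cochains N \<Sigma> 0" "d = trop_coboundary N \<Sigma> \<nu> 0 b"
    using assms(1) unfolding coboundaries_def by (rule imageE)
  obtain c where c: "c \<in> trop_cochains N \<Sigma> 0" "e = trop_coboundary N \<Sigma> \<nu> 0 c"
    using assms(2) unfolding coboundaries_def by (rule imageE)
  have "d - e = trop_coboundary N \<Sigma> \<nu> 0 (\<lambda>\<delta> v. b \<delta> v - c \<delta> v)"
    unfolding coboundary_diff b(2) c(2) by (intro ext) simp
  then show ?thesis unfolding coboundaries_def using cochains_diff[OF b(1) c(1)] by (rule image_eqI)
qed

lemma coboundaries_0: "(\<lambda>_ _. 0) \<in> coboundaries"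
proof -
  have 1: "(\<lambda>_ _. 0) \<in> trop_cochains N \<Sigma> 0" by (simp add: trop_cochains_def)
  have "(\<lambda>_ _. 0) = trop_coboundary N \<Sigma> \<nu> 0 (\<lambda>_ _. 0)" by (intro ext) (simp add: trop_coboundary_def)
  then show ?thesis unfolding coboundaries_def using 1 by (rule image_eqI)
qed

lemma cocycles_diff:
  assumes a: "a \<in> cocycles" and b: "b \<in> cocycles"
  shows "a - b \<in> cocycles"
proof -
  have "a - b = (\<lambda>\<delta> v. a \<delta> v - b \<delta> v)" by (intro ext) simp
  then show ?thesis using a b cochains_diff coboundary_diff[of 1 a b] by (simp add: cocycles_def)
qed

definition coh_class :: "('v cube \<Rightarrow> 'v \<Rightarrow> rat) \<Rightarrow> ('v cube \<Rightarrow> 'v \<Rightarrow> rat) set" where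
  "coh_class a = quot_class cocycles coboundaries a"

lemma coh_class_eqI:
  assumes "a - b \<in> coboundaries"
  shows "coh_class a = coh_class b"
proof -
  have "a - w \<in> coboundaries \<longleftrightarrow> b - w \<in> coboundaries" for w
  proof
    assume "a - w \<in> coboundaries"
    then have "(a - w) - (a - b) \<in> coboundaries" using assms by (rule coboundaries_diff)
    moreover have "(a - w) - (a - b) = b - w" by (intro ext) simp
    ultimately show "b - w \<in> coboundaries" by simp
  next
    assume "b - w \<in> coboundaries"
    moreover have "(\<lambda>_ _. 0) - (a - b) \<in> coboundaries" using coboundaries_0 assms by (rule coboundaries_diff)
    ultimately have "(b - w) - ((\<lambda>_ _. 0) - (a - b)) \<in> coboundaries" by (rule coboundaries_diff)
    moreover have "(b - w) - ((\<lambda>_ _. 0) - (a - b)) = a - w" by (intro ext) simp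
    ultimately show "a - w \<in> coboundaries" by simp
  qed
  then show ?thesis by (simp add: coh_class_def quot_class_def)
qed

lemma cohomology_iff: "\<beta> \<in> trop_cohomology11 N \<Sigma> \<nu> \<longleftrightarrow> (\<exists>a\<in>cocycles. \<beta> = coh_class a)"
  unfolding trop_cohomology11_def quot_space_def cocycles_def[symmetric] coboundaries_def[symmetric] coh_class_def
  by blast

lemma ray_values_diff: "ray_values (a - b) = ray_values a - ray_values b"
  by (intro ext) (simp add: ray_values_def)

lemma chow_of_coh_class:
  assumes a: "a \<in> cocycles"
  shows "chow_of_cohomology N \<Sigma> (coh_class a) = chow_class N \<Sigma> (ray_values a)"
proof -
  have "chow_class N \<Sigma> (ray_values b) = chow_class N \<Sigma> (ray_values a)" if "b \<in> coh_class a" for b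
  proof (rule chow_class_eqI[OF ray_values_free ray_values_free, symmetric])
    have "a - b \<in> coboundaries" using that by (simp add: coh_class_def quot_class_def)
    then show "ray_values a - ray_values b \<in> chow_rel N \<Sigma>" using ray_values_coboundary ray_values_diff by metis
  qed
  moreover have "a \<in> coh_class a"
  proof -
    have "a - a = (\<lambda>_ _. 0)" by (intro ext) simp
    then show ?thesis using a coboundaries_0 by (simp add: coh_class_def quot_class_def)
  qed
  ultimately have "(\<Union>b\<in>coh_class a. chow_class N \<Sigma> (ray_values b)) = chow_class N \<Sigma> (ray_values a)" by blast
  then show ?thesis by (simp add: chow_of_cohomology_def ray_values_def)
qed

section \<open>Integration of a cocycle\<close>

lemma cocycle_square:
  assumes d: "d \<in> cocycles"
    and c: "(\<mu>, \<kappa>) \<in> cubes_dim \<Sigma> 1" "(\<kappa>, \<sigma>) \<in> cubes_dim \<Sigma> 1" "(\<mu>, \<kappa>') \<in> cubes_dim \<Sigma> 1" "(\<kappa>', \<sigma>) \<in> cubes_dim \<Sigma> 1"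
    and u: "u \<in> Q.span (lat \<sigma>)"
  shows "d (\<mu>, \<kappa>) (qproj \<mu> u) + d (\<kappa>, \<sigma>) (qproj \<kappa> u) = d (\<mu>, \<kappa>') (qproj \<mu> u) + d (\<kappa>', \<sigma>) (qproj \<kappa>' u)"
proof (cases "\<kappa> = \<kappa>'")
  case False
  have ms: "(\<mu>, \<sigma>) \<in> cubes_dim \<Sigma> 2" using c by (auto simp: cubes_dim_iff)
  have F: "qproj \<mu> u \<in> F1 N \<Sigma> (\<mu>, \<sigma>)" by (rule F1_I[OF u])
  obtain \<epsilon> :: rat where e: "\<epsilon> \<in> {1, -1}" "\<forall>a. \<forall>v\<in>F1 N \<Sigma> (\<mu>, \<sigma>). trop_coboundary N \<Sigma> \<nu> 1 a (\<mu>, \<sigma>) v =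
    \<epsilon> * ((a (\<mu>, \<kappa>) (qproj \<mu> v) + a (\<kappa>, \<sigma>) (qproj \<kappa> v)) - (a (\<mu>, \<kappa>') (qproj \<mu> v) + a (\<kappa>', \<sigma>) (qproj \<kappa>' v)))"
    using trop_coboundary_1[OF ms c False] by (rule bexE)
  have "trop_coboundary N \<Sigma> \<nu> 1 d (\<mu>, \<sigma>) (qproj \<mu> u) = 0" using d by (simp add: cocycles_def)
  then have "(d (\<mu>, \<kappa>) (qproj \<mu> (qproj \<mu> u)) + d (\<kappa>, \<sigma>) (qproj \<kappa> (qproj \<mu> u))) -
      (d (\<mu>, \<kappa>') (qproj \<mu> (qproj \<mu> u)) + d (\<kappa>', \<sigma>) (qproj \<kappa>' (qproj \<mu> u))) = 0"
    using e(1) e(2)[rule_format, OF F, of d] by auto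
  then show ?thesis by (simp add: qproj_cube[OF c(1)] qproj_cube[OF c(3)])
qed simp

definition some_facet :: "'v set \<Rightarrow> 'v set" where
  "some_facet \<sigma> = (SOME \<tau>. (\<tau>, \<sigma>) \<in> cubes_dim \<Sigma> 1)"

text \<open>A cocycle is integrated along a maximal chain of faces from \<open>{0}\<close> to \<open>\<sigma>\<close>; independence of the chain is
the cocycle condition on the squares.\<close>

primrec primitive_rec :: "('v cube \<Rightarrow> 'v \<Rightarrow> rat) \<Rightarrow> nat \<Rightarrow> 'v set \<Rightarrow> 'v \<Rightarrow> rat" where
  "primitive_rec d 0 \<sigma> u = 0"
| "primitive_rec d (Suc k) \<sigma> u = primitive_rec d k (some_facet \<sigma>) u + d (some_facet \<sigma>, \<sigma>) (qproj (some_facet \<sigma>) u)"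

text \<open>Induction on the dimension. A facet \<open>\<tau>\<close> other than the chosen one
  \<open>\<kappa>\<close> meets it in a face of codimension two in \<open>\<sigma>\<close>; the
  induction hypothesis on both facets and the square between them exchange the two routes.\<close>

lemma primitive_rec_facet:
  assumes d: "d \<in> cocycles"
  shows "(\<tau>, \<sigma>) \<in> cubes_dim \<Sigma> 1 \<Longrightarrow> dim \<sigma> = Suc k \<Longrightarrow> u \<in> Q.span (lat \<sigma>) \<Longrightarrow>
    primitive_rec d (Suc k) \<sigma> u = primitive_rec d k \<tau> u + d (\<tau>, \<sigma>) (qproj \<tau> u)"
proof (induction k arbitrary: \<tau> \<sigma> u)
  case 0
  have f: "(some_facet \<sigma>, \<sigma>) \<in> cubes_dim \<Sigma> 1" unfolding some_facet_def using 0(1) by (rule someI)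
  have S: "\<tau> \<in> \<Sigma>" "some_facet \<sigma> \<in> \<Sigma>" "dim \<sigma> = dim \<tau> + 1" "dim \<sigma> = dim (some_facet \<sigma>) + 1"
    using 0(1) f by (simp_all only: cubes_dim_iff)
  have "card (gens \<tau>) = 0" "card (gens (some_facet \<sigma>)) = 0"
    using S(3,4) 0(2) dim_gens[OF S(1)] dim_gens[OF S(2)] by linarith+
  then have "gens \<tau> = gens (some_facet \<sigma>)" using finite_gens by simp
  then have "\<tau> = some_facet \<sigma>" using gens_eqD 0(1) f cubes_dim_iff by metis
  then show ?case by simp
next
  case (Suc k)
  define \<kappa> where "\<kappa> = some_facet \<sigma>"
  have f: "(\<kappa>, \<sigma>) \<in> cubes_dim \<Sigma> 1" unfolding \<kappa>_def some_facet_def using Suc(2) by (rule someI)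
  show ?case
  proof (cases "\<tau> = \<kappa>")
    case False
    have S: "\<tau> \<in> \<Sigma>" "\<kappa> \<in> \<Sigma>" "\<sigma> \<in> \<Sigma>" "\<tau> \<subseteq> \<sigma>" "\<kappa> \<subseteq> \<sigma>" "dim \<tau> = Suc k" "dim \<kappa> = Suc k"
      using Suc(2,3) f by (auto simp: cubes_dim_iff)
    define \<mu> where "\<mu> = \<tau> \<inter> \<kappa>"
    have \<mu>: "\<mu> \<in> \<Sigma>" "\<mu> \<subseteq> \<tau>" "\<mu> \<subseteq> \<kappa>" using Int_in_fan[OF S(1,2)] by (auto simp: \<mu>_def)
    have dm: "dim \<mu> = k"
    proof -
      obtain v where v: "v \<notin> gens \<tau>" "gens \<sigma> = insert v (gens \<tau>)" using edge_cubeD[OF Suc(2)] by (elim exE conjE) (rule that)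
      obtain w where w: "w \<notin> gens \<kappa>" "gens \<sigma> = insert w (gens \<kappa>)" using edge_cubeD[OF f] by (elim exE conjE) (rule that)
      have ne: "gens \<tau> \<noteq> gens \<kappa>" using gens_eqD[OF S(1,2)] False by blast
      have "v \<noteq> w" using v w ne by (metis Diff_insert_absorb)
      then have "gens \<tau> = insert w (gens \<mu>)" "w \<notin> gens \<mu>"
        using v w by (auto simp: \<mu>_def gens_Int)
      then have "card (gens \<tau>) = Suc (card (gens \<mu>))" using finite_gens by simp
      then show ?thesis using dim_gens[OF S(1)] dim_gens[OF \<mu>(1)] S(6) by simp
    qed
    have c: "(\<mu>, \<kappa>) \<in> cubes_dim \<Sigma> 1" "(\<mu>, \<tau>) \<in> cubes_dim \<Sigma> 1" using S \<mu> dm by (simp_all add: cubes_dim_iff)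
    have "primitive_rec d (Suc (Suc k)) \<sigma> u = primitive_rec d (Suc k) \<kappa> u + d (\<kappa>, \<sigma>) (qproj \<kappa> u)" by (simp add: \<kappa>_def)
    also have "primitive_rec d (Suc k) \<kappa> u = primitive_rec d k \<mu> u + d (\<mu>, \<kappa>) (qproj \<mu> u)"
      by (rule Suc.IH[OF c(1) S(7) span_lat_mono[OF S(2,3,5) Suc.prems(3)]])
    also have "primitive_rec d k \<mu> u + d (\<mu>, \<kappa>) (qproj \<mu> u) + d (\<kappa>, \<sigma>) (qproj \<kappa> u) =
        primitive_rec d k \<mu> u + (d (\<mu>, \<kappa>) (qproj \<mu> u) + d (\<kappa>, \<sigma>) (qproj \<kappa> u))" by simp
    also have "d (\<mu>, \<kappa>) (qproj \<mu> u) + d (\<kappa>, \<sigma>) (qproj \<kappa> u) = d (\<mu>, \<tau>) (qproj \<mu> u) + d (\<tau>, \<sigma>) (qproj \<tau> u)"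
      by (rule cocycle_square[OF d c(1) f c(2) Suc.prems(1,3)])
    also have "primitive_rec d k \<mu> u + (d (\<mu>, \<tau>) (qproj \<mu> u) + d (\<tau>, \<sigma>) (qproj \<tau> u)) =
        (primitive_rec d k \<mu> u + d (\<mu>, \<tau>) (qproj \<mu> u)) + d (\<tau>, \<sigma>) (qproj \<tau> u)" by simp
    also have "primitive_rec d k \<mu> u + d (\<mu>, \<tau>) (qproj \<mu> u) = primitive_rec d (Suc k) \<tau> u"
      by (rule Suc.IH[OF c(2) S(6) span_lat_mono[OF S(1,3,4) Suc.prems(3)], symmetric])
    finally show ?thesis .
  qed (simp add: \<kappa>_def)
qed

definition primitive_on :: "('v cube \<Rightarrow> 'v \<Rightarrow> rat) \<Rightarrow> 'v set \<Rightarrow> 'v \<Rightarrow> rat" where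
  "primitive_on d \<sigma> = primitive_rec d (dim \<sigma>) \<sigma>"

lemma primitive_on_facet:
  assumes "d \<in> cocycles" "(\<tau>, \<sigma>) \<in> cubes_dim \<Sigma> 1" "u \<in> Q.span (lat \<sigma>)"
  shows "primitive_on d \<sigma> u = primitive_on d \<tau> u + d (\<tau>, \<sigma>) (qproj \<tau> u)"
proof -
  have k: "dim \<sigma> = Suc (dim \<tau>)" using assms(2) by (simp add: cubes_dim_iff)
  show ?thesis unfolding primitive_on_def k by (rule primitive_rec_facet[OF assms(1,2) k assms(3)])
qed

lemma facet_through:
  assumes s: "\<sigma> \<in> \<Sigma>" and w: "w \<in> gens \<sigma>"
  shows "(convex_cone hull (gens \<sigma> - {w}), \<sigma>) \<in> cubes_dim \<Sigma> 1" "gens (convex_cone hull (gens \<sigma> - {w})) = gens \<sigma> - {w}"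
proof -
  have sub: "gens \<sigma> - {w} \<subseteq> gens \<sigma>" by blast
  note S = subcone[OF s sub]
  show "gens (convex_cone hull (gens \<sigma> - {w})) = gens \<sigma> - {w}" by (rule S(2))
  have "card (gens \<sigma>) > 0" using w finite_gens card_gt_0_iff by blast
  then show "(convex_cone hull (gens \<sigma> - {w}), \<sigma>) \<in> cubes_dim \<Sigma> 1"
    using S s w finite_gens by (simp add: cubes_dim_iff dim_gens)
qed

lemma primitive_on_zero: "\<sigma> \<in> \<Sigma> \<Longrightarrow> gens \<sigma> = {} \<Longrightarrow> primitive_on d \<sigma> u = 0"
  using dim_gens by (simp add: primitive_on_def)

lemma primitive_on_linear:
  assumes d: "d \<in> cocycles"
  shows "\<sigma> \<in> \<Sigma> \<Longrightarrow> u \<in> Q.span (lat \<sigma>) \<Longrightarrow> u' \<in> Q.span (lat \<sigma>) \<Longrightarrow>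
      primitive_on d \<sigma> (u + u') = primitive_on d \<sigma> u + primitive_on d \<sigma> u'"
    "\<sigma> \<in> \<Sigma> \<Longrightarrow> u \<in> Q.span (lat \<sigma>) \<Longrightarrow> primitive_on d \<sigma> (real_of_rat r *\<^sub>R u) = r * primitive_on d \<sigma> u"
proof (induction "dim \<sigma>" arbitrary: \<sigma> u u')
  case 0
  { case 1 then have "gens \<sigma> = {}" using 0 dim_gens finite_gens by auto
    then show ?case using primitive_on_zero 1 by simp }
  { case 2 then have "gens \<sigma> = {}" using 0 dim_gens finite_gens by auto
    then show ?case using primitive_on_zero 2 by simp }
next
  case (Suc k)
  have dc: "d \<in> trop_cochains N \<Sigma> 1" using d by (simp add: cocycles_def)
  have F: "\<exists>\<tau>. (\<tau>, \<sigma>) \<in> cubes_dim \<Sigma> 1" if "\<sigma> \<in> \<Sigma>"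
  proof -
    have "gens \<sigma> \<noteq> {}" using Suc(3) dim_gens[OF that] by auto
    then show ?thesis using facet_through(1)[OF that] by blast
  qed
  { case 1
    obtain \<tau> where t: "(\<tau>, \<sigma>) \<in> cubes_dim \<Sigma> 1" using F[OF 1(1)] by blast
    have tS: "\<tau> \<in> \<Sigma>" "\<tau> \<subseteq> \<sigma>" "k = dim \<tau>" using t Suc(3) by (auto simp: cubes_dim_iff)
    note u = span_lat_mono[OF tS(1) 1(1) tS(2)]
    show ?case
      using Suc(1)[OF tS(3,1) u[OF 1(2)] u[OF 1(3)]] cochain_add[OF dc t F1_I[OF 1(2)] F1_I[OF 1(3)]]
      by (simp add: primitive_on_facet[OF d t] 1 Q.span_add linear_add[OF linear_qproj]) }
  { case 2
    obtain \<tau> where t: "(\<tau>, \<sigma>) \<in> cubes_dim \<Sigma> 1" using F[OF 2(1)] by blast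
    have tS: "\<tau> \<in> \<Sigma>" "\<tau> \<subseteq> \<sigma>" "k = dim \<tau>" using t Suc(3) by (auto simp: cubes_dim_iff)
    note u = span_lat_mono[OF tS(1) 2(1) tS(2)]
    show ?case
      using Suc(2)[OF tS(3,1) u[OF 2(2)]] cochain_scale[OF dc t F1_I[OF 2(2)], of r]
      by (simp add: primitive_on_facet[OF d t] 2 Q.span_scale linear_cmul[OF linear_qproj] algebra_simps) }
qed

lemma primitive_on_gen:
  assumes d: "d \<in> cocycles"
  shows "\<sigma> \<in> \<Sigma> \<Longrightarrow> \<rho> \<in> rays \<Sigma> \<Longrightarrow> ray_gen N \<rho> \<in> gens \<sigma> \<Longrightarrow> primitive_on d \<sigma> (ray_gen N \<rho>) = ray_values d \<rho>"
proof (induction "dim \<sigma>" arbitrary: \<sigma>)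
  case 0
  then have "gens \<sigma> = {}" using dim_gens[of \<sigma>] finite_gens by simp
  then show ?case using 0 by simp
next
  case (Suc k)
  let ?e = "ray_gen N \<rho>"
  have dc: "d \<in> trop_cochains N \<Sigma> 1" using d by (simp add: cocycles_def)
  have e: "?e \<in> Q.span (lat \<sigma>)" using gens_lat[OF Suc(3,3)] Suc(5) Q.span_base by blast
  show ?case
  proof (cases "gens \<sigma> = {?e}")
    case True
    have "\<rho> \<subseteq> \<sigma>" using ray_subset_iff[OF Suc(4,3)] gens_subset Suc(5) by blast
    moreover have rS: "\<rho> \<in> \<Sigma>" "dim \<rho> = 1" using Suc(4) by (simp_all add: rays_def)
    ultimately have s: "\<sigma> = \<rho>" using cone_dim_eqI[of \<rho> \<sigma>] Suc(3) dim_gens[OF Suc(3)] True by simp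
    have "primitive_on d \<sigma> ?e = primitive_on d {0} ?e + d ({0}, \<rho>) ?e"
      using primitive_on_facet[OF d ray_cube[OF Suc(4)], of ?e] e unfolding s by simp
    also have "primitive_on d {0} ?e = 0" by (rule primitive_on_zero[OF zero_cone gens_zero])
    finally show ?thesis using Suc(4) by (simp add: ray_values_def)
  next
    case False
    then obtain w where w: "w \<in> gens \<sigma>" "w \<noteq> ?e" using Suc(5) by blast
    define \<tau> where "\<tau> = convex_cone hull (gens \<sigma> - {w})"
    note t = facet_through[OF Suc(3) w(1), folded \<tau>_def]
    have tS: "\<tau> \<in> \<Sigma>" "k = dim \<tau>" using t(1) Suc(2) by (auto simp: cubes_dim_iff)
    have et: "?e \<in> gens \<tau>" using t(2) w(2) Suc(5) by simp
    have "?e \<in> span \<tau>" using et gens_subset span_base by blast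
    then have "qproj \<tau> ?e = 0" by (simp add: qproj_eq_0_iff)
    then have "primitive_on d \<sigma> ?e = primitive_on d \<tau> ?e"
      using primitive_on_facet[OF d t(1) e] by (simp add: cochain_0[OF dc])
    then show ?thesis using Suc(1)[OF tS(2,1) Suc(4) et] by simp
  qed
qed

text \<open>Injectivity of the map to the Chow group. The difference \<open>h\<close> of the form
  \<open>l\<close> and the integral of \<open>d\<close> vanishes on the generators of
  \<open>\<sigma>\<close>, hence on the rational part of \<open>span \<sigma>\<close>; so it
  descends to \<open>N\<^sup>\<sigma>\<close> and gives a 0-cochain with coboundary
  \<open>d\<close>.\<close>

lemma cocycle_is_coboundary:
  assumes d: "d \<in> cocycles" and r: "ray_values d \<in> chow_rel N \<Sigma>"
  shows "d \<in> coboundaries"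
proof -
  obtain l where l: "l \<in> rat_functionals N" "\<And>\<rho>. \<rho> \<in> rays \<Sigma> \<Longrightarrow> real_of_rat (ray_values d \<rho>) = l (ray_gen N \<rho>)"
    using r chow_rel_iff by auto
  have lin: "linear l" using l(1) by (simp add: rat_functionals_def)
  have dc: "d \<in> trop_cochains N \<Sigma> 1" using d by (simp add: cocycles_def)
  have lr: "real_of_rat (ratv (l u)) = l u" if "u \<in> Q.span (lat \<sigma>)" for u \<sigma>
    using rat_functionals_span[OF l(1) span_lat_subset[OF that]] by (rule of_rat_ratv)
  \<comment> \<open>In this order, because the coboundary is the value at \<open>\<tau>\<close>
    minus that at \<open>\<sigma>\<close>, whereas the integral increases by \<open>d\<close> from
    \<open>\<tau>\<close> to \<open>\<sigma>\<close>.\<close>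
  define h where "h = (\<lambda>\<sigma> u. ratv (l u) - primitive_on d \<sigma> u)"
  have hadd: "h \<sigma> (u + u') = h \<sigma> u + h \<sigma> u'" if s: "\<sigma> \<in> \<Sigma>" "u \<in> Q.span (lat \<sigma>)" "u' \<in> Q.span (lat \<sigma>)" for \<sigma> u u'
  proof -
    have "real_of_rat (ratv (l (u + u'))) = real_of_rat (ratv (l u) + ratv (l u'))"
      using lr[OF s(2)] lr[OF s(3)] lr[OF Q.span_add[OF s(2,3)]] by (simp add: of_rat_add linear_add[OF lin])
    then have "ratv (l (u + u')) = ratv (l u) + ratv (l u')" by (simp only: of_rat_eq_iff)
    then show ?thesis using primitive_on_linear(1)[OF d s] by (simp add: h_def)
  qed
  have hscale: "h \<sigma> (real_of_rat q *\<^sub>R u) = q * h \<sigma> u" if s: "\<sigma> \<in> \<Sigma>" "u \<in> Q.span (lat \<sigma>)" for \<sigma> u q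
  proof -
    have "real_of_rat (ratv (l (real_of_rat q *\<^sub>R u))) = real_of_rat (q * ratv (l u))"
      using lr[OF s(2)] lr[OF Q.span_scale[OF s(2)]] by (simp add: of_rat_mult linear_cmul[OF lin])
    then have "ratv (l (real_of_rat q *\<^sub>R u)) = q * ratv (l u)" by (simp only: of_rat_eq_iff)
    then show ?thesis using primitive_on_linear(2)[OF d s] by (simp add: h_def algebra_simps)
  qed
  have hker: "h \<sigma> u = 0" if s: "\<sigma> \<in> \<Sigma>" "u \<in> Q.span (lat \<sigma>)" "u \<in> span \<sigma>" for \<sigma> u
  proof -
    have gl: "gens \<sigma> \<subseteq> Q.span (lat \<sigma>)" using gens_lat[OF s(1,1)] Q.span_superset by blast
    have "gens \<sigma> \<subseteq> Q.span N" using gl span_lat_subset by blast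
    \<comment> \<open>A rational vector in the real span of the generators is a rational combination
      of them, so it suffices to know \<open>h\<close> on the generators.\<close>
    then have u: "u \<in> Q.span (gens \<sigma>)"
      using Q_span_of_real_span[OF lattice _ gens_cone(1)[OF s(1)] span_lat_subset[OF s(2)]] s(3) span_gens[OF s(1)] by simp
    define W where "W = {u \<in> Q.span (lat \<sigma>). h \<sigma> u = 0}"
    have "Q.subspace W" unfolding Q.subspace_def W_def
      using hadd[OF s(1)] hscale[OF s(1)] hscale[OF s(1) Q.span_zero, of 0]
      by (auto simp: Q.span_zero Q.span_add Q.span_scale)
    moreover have "gens \<sigma> \<subseteq> W"
    proof
      fix v assume v: "v \<in> gens \<sigma>"
      then obtain \<rho> where \<rho>: "\<rho> \<in> rays \<Sigma>" "v = ray_gen N \<rho>" by (auto simp: gens_def verts_def)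
      have "primitive_on d \<sigma> v = ray_values d \<rho>" using primitive_on_gen[OF d s(1) \<rho>(1)] v \<rho>(2) by simp
      moreover have "ratv (l v) = ray_values d \<rho>" using l(2)[OF \<rho>(1)] \<rho>(2) by (metis ratv_of_rat)
      ultimately show "v \<in> W" using gl v by (auto simp: W_def h_def)
    qed
    ultimately have "Q.span (gens \<sigma>) \<subseteq> W" by (rule Q.span_minimal[rotated])
    then show ?thesis using u W_def by blast
  qed
  have hdep: "h \<sigma> u = h \<sigma> u'" if s: "\<sigma> \<in> \<Sigma>" "u \<in> Q.span (lat \<sigma>)" "u' \<in> Q.span (lat \<sigma>)" "qproj \<sigma> u = qproj \<sigma> u'" for \<sigma> u u'
  proof -
    have m: "u - u' \<in> Q.span (lat \<sigma>)" using s(2,3) by (rule Q.span_diff)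
    have "u - u' \<in> span \<sigma>" using s(4) qproj_eq_iff by blast
    then have "h \<sigma> (u - u') = 0" using hker s(1) m by blast
    moreover have "h \<sigma> ((u - u') + u') = h \<sigma> (u - u') + h \<sigma> u'" by (rule hadd[OF s(1) m s(3)])
    ultimately show ?thesis by simp
  qed
  \<comment> \<open>A rational lift is chosen; by \<open>hdep\<close> the value does not depend on
    it. Elsewhere \<open>trop_cochains\<close> prescribes 0.\<close>
  define b where "b = (\<lambda>(\<tau>, \<sigma>) w. if (\<tau>, \<sigma>) \<in> cubes_dim \<Sigma> 0 \<and> w \<in> F1 N \<Sigma> (\<tau>, \<sigma>)
      then h \<sigma> (SOME u. u \<in> Q.span (lat \<sigma>) \<and> qproj \<sigma> u = w) else 0)"
  have bval: "b (\<sigma>, \<sigma>) (qproj \<sigma> u) = h \<sigma> u" if s: "\<sigma> \<in> \<Sigma>" "u \<in> Q.span (lat \<sigma>)" for \<sigma> u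
  proof -
    have "\<exists>u'. u' \<in> Q.span (lat \<sigma>) \<and> qproj \<sigma> u' = qproj \<sigma> u" using s(2) by blast
    from someI_ex[OF this] have "h \<sigma> (SOME u'. u' \<in> Q.span (lat \<sigma>) \<and> qproj \<sigma> u' = qproj \<sigma> u) = h \<sigma> u"
      using hdep[OF s(1) _ s(2)] by blast
    then show ?thesis using s F1_I[OF s(2), of \<sigma>] by (simp add: b_def cubes_0)
  qed
  have bc: "b \<in> trop_cochains N \<Sigma> 0"
    unfolding trop_cochains_def
  proof (intro CollectI conjI ballI allI impI)
    fix \<delta> assume "\<delta> \<in> cubes_dim \<Sigma> 0"
    then obtain \<sigma> where s: "\<sigma> \<in> \<Sigma>" "\<delta> = (\<sigma>, \<sigma>)" unfolding cubes_0 by (rule bexE)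
    fix v assume "v \<in> F1 N \<Sigma> \<delta>"
    then obtain u where u: "u \<in> Q.span (lat \<sigma>)" "v = qproj \<sigma> u" using F1_lift s(2) by blast
    show "b \<delta> (real_of_rat r *\<^sub>R v) = r * b \<delta> v" for r
      using bval[OF s(1) Q.span_scale[OF u(1)], of r] bval[OF s(1) u(1)] hscale[OF s(1) u(1)]
      by (simp add: s(2) u(2) linear_cmul[OF linear_qproj])
    fix w assume "w \<in> F1 N \<Sigma> \<delta>"
    then obtain u' where u': "u' \<in> Q.span (lat \<sigma>)" "w = qproj \<sigma> u'" using F1_lift s(2) by blast
    show "b \<delta> (v + w) = b \<delta> v + b \<delta> w"
      using bval[OF s(1) Q.span_add[OF u(1) u'(1)]] bval[OF s(1) u(1)] bval[OF s(1) u'(1)] hadd[OF s(1) u(1) u'(1)]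
      by (simp add: s(2) u(2) u'(2) linear_add[OF linear_qproj])
  next
    fix \<delta> v assume "\<delta> \<notin> cubes_dim \<Sigma> 0 \<or> v \<notin> F1 N \<Sigma> \<delta>"
    then show "b \<delta> v = 0" by (cases \<delta>) (auto simp: b_def)
  qed
  have "trop_coboundary N \<Sigma> \<nu> 0 b (\<tau>, \<sigma>) v = d (\<tau>, \<sigma>) v" for \<tau> \<sigma> v
  proof (cases "(\<tau>, \<sigma>) \<in> cubes_dim \<Sigma> 1 \<and> v \<in> F1 N \<Sigma> (\<tau>, \<sigma>)")
    case True
    then have c: "(\<tau>, \<sigma>) \<in> cubes_dim \<Sigma> 1" and v: "v \<in> F1 N \<Sigma> (\<tau>, \<sigma>)" by auto
    obtain u where u: "u \<in> Q.span (lat \<sigma>)" "v = qproj \<tau> u" using F1_lift[OF v] by blast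
    have S: "\<tau> \<in> \<Sigma>" "\<sigma> \<in> \<Sigma>" "\<tau> \<subseteq> \<sigma>" using c by (auto simp: cubes_dim_iff)
    have ut: "u \<in> Q.span (lat \<tau>)" using span_lat_mono[OF S u(1)] .
    have "trop_coboundary N \<Sigma> \<nu> 0 b (\<tau>, \<sigma>) v = h \<tau> u - h \<sigma> u"
      unfolding trop_coboundary_0[OF c v] using bval[OF S(1) ut] bval[OF S(2) u(1)] by (simp add: u(2) qproj_cube[OF c])
    also have "\<dots> = d (\<tau>, \<sigma>) v" using primitive_on_facet[OF d c u(1)] by (simp add: h_def u(2))
    finally show ?thesis .
  next
    case False
    then have "\<not> ((\<tau>, \<sigma>) \<in> cubes_dim \<Sigma> (Suc 0) \<and> v \<in> F1 N \<Sigma> (\<tau>, \<sigma>))" by simp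
    then have "trop_coboundary N \<Sigma> \<nu> 0 b (\<tau>, \<sigma>) v = 0" unfolding trop_coboundary_def by (rule if_not_P)
    moreover have "d (\<tau>, \<sigma>) v = 0" using False by (intro cochain_outside[OF dc]) auto
    ultimately show ?thesis by simp
  qed
  then have "d = trop_coboundary N \<Sigma> \<nu> 0 b" by (intro ext) (metis surj_pair)
  then show ?thesis unfolding coboundaries_def using bc by (rule image_eqI)
qed

lemma cohomology_of_chow_eq:
  assumes a: "a \<in> cocycles"
  shows "cohomology_of_chow N \<Sigma> \<nu> (chow_class N \<Sigma> (ray_values a)) = coh_class a"
  unfolding cohomology_of_chow_def the_inv_into_def
proof (rule the_equality)
  show "coh_class a \<in> trop_cohomology11 N \<Sigma> \<nu> \<and> chow_of_cohomology N \<Sigma> (coh_class a) = chow_class N \<Sigma> (ray_values a)"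
    using a cohomology_iff chow_of_coh_class[OF a] by blast
  fix \<beta> assume b: "\<beta> \<in> trop_cohomology11 N \<Sigma> \<nu> \<and> chow_of_cohomology N \<Sigma> \<beta> = chow_class N \<Sigma> (ray_values a)"
  then obtain a' where a': "a' \<in> cocycles" "\<beta> = coh_class a'" using cohomology_iff by blast
  then have "chow_class N \<Sigma> (ray_values a') = chow_class N \<Sigma> (ray_values a)" using b chow_of_coh_class by simp
  then have "ray_values (a' - a) \<in> chow_rel N \<Sigma>" unfolding ray_values_diff by (rule chow_class_eqD[OF ray_values_free])
  then have "a' - a \<in> coboundaries" by (rule cocycle_is_coboundary[OF cocycles_diff[OF a'(1) a]])
  then show "\<beta> = coh_class a" using a'(2) coh_class_eqI by simp
qed

section \<open>The cocycle of a conewise linear function\<close>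

text \<open>The forms are real-linear, so that their differences factor through \<open>qproj\<close>, which need not
preserve the rational vectors.\<close>

definition local_functionals :: "('v set \<Rightarrow> rat) \<Rightarrow> ('v set \<Rightarrow> 'v \<Rightarrow> real) \<Rightarrow> bool" where
  "local_functionals x L \<longleftrightarrow> L {0} = (\<lambda>_. 0) \<and> (\<forall>\<sigma>\<in>\<Sigma>. L \<sigma> \<in> rat_functionals N \<and>
     (\<forall>\<rho>\<in>rays \<Sigma>. ray_gen N \<rho> \<in> \<sigma> \<longrightarrow> L \<sigma> (ray_gen N \<rho>) = real_of_rat (x \<rho>)))"

lemma local_functionals_exist: "\<exists>L. local_functionals x L"
proof -
  define y where "y = (\<lambda>v. x (the_inv_into (rays \<Sigma>) (ray_gen N) v))"
  have y: "y (ray_gen N \<rho>) = x \<rho>" if "\<rho> \<in> rays \<Sigma>" for \<rho>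
    using the_inv_into_f_f[OF inj_ray_gen that] by (simp add: y_def)
  have "\<exists>l\<in>rat_functionals N. \<forall>w\<in>gens \<sigma>. l w = real_of_rat (y w)" if s: "\<sigma> \<in> \<Sigma>" for \<sigma>
  proof (rule rat_functional_prescribed[OF lattice _ gens_cone(1)[OF s]])
    show "gens \<sigma> \<subseteq> Q.span N" using gens_lattice Q.span_superset by blast
  qed
  then obtain L where L: "\<And>\<sigma>. \<sigma> \<in> \<Sigma> \<Longrightarrow> L \<sigma> \<in> rat_functionals N" "\<And>\<sigma> w. \<sigma> \<in> \<Sigma> \<Longrightarrow> w \<in> gens \<sigma> \<Longrightarrow> L \<sigma> w = real_of_rat (y w)"
    by metis
  \<comment> \<open>\<open>{0}\<close> contains no ray generator, so its form may be reset to 0; the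
    cocycle is then given by \<open>L \<rho>\<close> on the edge of a ray
    \<open>\<rho>\<close>.\<close>
  define L' where "L' = L({0} := (\<lambda>_. 0))"
  have z: "(\<lambda>_. 0) \<in> rat_functionals N" by (auto simp: rat_functionals_def linear_zero)
  have "L' \<sigma> \<in> rat_functionals N" if "\<sigma> \<in> \<Sigma>" for \<sigma> using L(1)[OF that] z by (simp add: L'_def)
  moreover have "L' \<sigma> (ray_gen N \<rho>) = real_of_rat (x \<rho>)" if "\<sigma> \<in> \<Sigma>" "\<rho> \<in> rays \<Sigma>" "ray_gen N \<rho> \<in> \<sigma>" for \<sigma> \<rho>
  proof -
    have "\<sigma> \<noteq> {0}" using that ray_gen_props(1) by auto
    moreover have "ray_gen N \<rho> \<in> gens \<sigma>" using that by (simp add: gens_def verts_def)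
    ultimately show ?thesis using L(2)[OF that(1)] y[OF that(2)] by (simp add: L'_def)
  qed
  ultimately have "local_functionals x L'" by (simp add: local_functionals_def) (simp add: L'_def)
  then show ?thesis by blast
qed

lemma local_linear: "local_functionals x L \<Longrightarrow> \<sigma> \<in> \<Sigma> \<Longrightarrow> linear (L \<sigma>)"
  by (simp add: local_functionals_def rat_functionals_def)

lemma local_gens: "local_functionals x L \<Longrightarrow> \<sigma> \<in> \<Sigma> \<Longrightarrow> \<rho> \<in> rays \<Sigma> \<Longrightarrow> ray_gen N \<rho> \<in> \<sigma> \<Longrightarrow> L \<sigma> (ray_gen N \<rho>) = real_of_rat (x \<rho>)"
  by (simp add: local_functionals_def)

lemma local_agree:
  assumes L: "local_functionals x L" and t: "\<tau> \<in> \<Sigma>" "\<sigma> \<in> \<Sigma>" "\<tau> \<subseteq> \<sigma>" "v \<in> span \<tau>"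
  shows "L \<sigma> v = L \<tau> v"
proof (rule linear_eq_on_span[OF local_linear[OF L t(2)] local_linear[OF L t(1)]])
  show "v \<in> span (gens \<tau>)" using t(4) span_gens[OF t(1)] by simp
  fix w assume "w \<in> gens \<tau>"
  then obtain \<rho> where \<rho>: "\<rho> \<in> rays \<Sigma>" "w = ray_gen N \<rho>" "w \<in> \<tau>" by (auto simp: gens_def verts_def)
  then show "L \<sigma> w = L \<tau> w" using local_gens[OF L t(1) \<rho>(1)] local_gens[OF L t(2) \<rho>(1)] t(3) by auto
qed

text \<open>Both forms restrict to \<open>L \<kappa>\<close> on the common face
  \<open>\<kappa>\<close>, so their difference descends to the quotient by it.\<close>

lemma local_qproj:
  assumes L: "local_functionals x L" and t: "\<kappa> \<in> \<Sigma>" "\<tau> \<in> \<Sigma>" "\<sigma> \<in> \<Sigma>" "\<kappa> \<subseteq> \<tau>" "\<kappa> \<subseteq> \<sigma>"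
  shows "L \<sigma> (qproj \<kappa> v) - L \<tau> (qproj \<kappa> v) = L \<sigma> v - L \<tau> v"
proof -
  have "linear (\<lambda>v. L \<sigma> v - L \<tau> v)" by (intro linear_compose_sub local_linear[OF L] t)
  moreover have "L \<sigma> v - L \<tau> v = 0" if "v \<in> \<kappa>" for v
    using local_agree[OF L t(1,2,4) span_base[OF that]] local_agree[OF L t(1,3,5) span_base[OF that]] by simp
  ultimately show ?thesis using linear_qproj_invariant[of "\<lambda>v. L \<sigma> v - L \<tau> v" \<kappa> v] by simp
qed

definition fan_cocycle :: "('v set \<Rightarrow> 'v \<Rightarrow> real) \<Rightarrow> 'v cube \<Rightarrow> 'v \<Rightarrow> rat" where
  "fan_cocycle L \<delta> v = (if \<delta> \<in> cubes_dim \<Sigma> 1 \<and> v \<in> F1 N \<Sigma> \<delta> then ratv (L (snd \<delta>) v - L (fst \<delta>) v) else 0)"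

text \<open>The right-hand side is rational because the difference may be evaluated on a rational
  lift of \<open>v\<close>; this justifies \<open>ratv\<close> in the definition.\<close>

lemma fan_cocycle_value:
  assumes L: "local_functionals x L" and c: "(\<tau>, \<sigma>) \<in> cubes_dim \<Sigma> 1" "v \<in> F1 N \<Sigma> (\<tau>, \<sigma>)"
  shows "real_of_rat (fan_cocycle L (\<tau>, \<sigma>) v) = L \<sigma> v - L \<tau> v"
proof -
  have S: "\<tau> \<in> \<Sigma>" "\<sigma> \<in> \<Sigma>" "\<tau> \<subseteq> \<sigma>" using c by (auto simp: cubes_dim_iff)
  obtain u where u: "u \<in> Q.span (lat \<sigma>)" "v = qproj \<tau> u" using F1_lift[OF c(2)] by blast
  have "L \<sigma> v - L \<tau> v = L \<sigma> u - L \<tau> u" unfolding u(2) by (rule local_qproj[OF L S(1,1,2) subset_refl S(3)])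
  moreover have "L \<sigma> u \<in> \<rat>" "L \<tau> u \<in> \<rat>"
    using L S rat_functionals_span[OF _ span_lat_subset[OF u(1)]] by (auto simp: local_functionals_def)
  ultimately have "L \<sigma> v - L \<tau> v \<in> \<rat>" by simp
  then show ?thesis using c by (simp add: fan_cocycle_def of_rat_ratv)
qed

lemma fan_cocycle_cochain:
  assumes L: "local_functionals x L"
  shows "fan_cocycle L \<in> trop_cochains N \<Sigma> 1"
  unfolding trop_cochains_def
proof (intro CollectI conjI ballI allI impI)
  fix \<delta> assume d: "\<delta> \<in> cubes_dim \<Sigma> 1"
  obtain \<tau> \<sigma> where ts: "\<delta> = (\<tau>, \<sigma>)" by (cases \<delta>)
  note val = fan_cocycle_value[OF L d[unfolded ts]]
  have S: "\<tau> \<in> \<Sigma>" "\<sigma> \<in> \<Sigma>" using d ts by (auto simp: cubes_dim_iff)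
  note lin = local_linear[OF L S(1)] local_linear[OF L S(2)]
  fix v assume v: "v \<in> F1 N \<Sigma> \<delta>"
  show "fan_cocycle L \<delta> (real_of_rat r *\<^sub>R v) = r * fan_cocycle L \<delta> v" for r
  proof -
    have rv: "real_of_rat r *\<^sub>R v \<in> F1 N \<Sigma> (\<tau>, \<sigma>)" using Q.subspace_scale[OF F1_subspace v] ts by simp
    have "real_of_rat (fan_cocycle L \<delta> (real_of_rat r *\<^sub>R v)) = real_of_rat r * (L \<sigma> v - L \<tau> v)"
      unfolding ts val[OF rv] by (simp add: linear_cmul[OF lin(1)] linear_cmul[OF lin(2)] algebra_simps)
    also have "L \<sigma> v - L \<tau> v = real_of_rat (fan_cocycle L \<delta> v)" using val[of v] v ts by simp
    finally have "real_of_rat (fan_cocycle L \<delta> (real_of_rat r *\<^sub>R v)) = real_of_rat (r * fan_cocycle L \<delta> v)"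
      by (simp add: of_rat_mult)
    then show ?thesis by (simp only: of_rat_eq_iff)
  qed
  fix w assume w: "w \<in> F1 N \<Sigma> \<delta>"
  have "v + w \<in> F1 N \<Sigma> \<delta>" using Q.subspace_add[OF F1_subspace v w] .
  then have "real_of_rat (fan_cocycle L \<delta> (v + w)) = real_of_rat (fan_cocycle L \<delta> v + fan_cocycle L \<delta> w)"
    using val v w by (simp add: ts of_rat_add linear_add[OF lin(1)] linear_add[OF lin(2)])
  then show "fan_cocycle L \<delta> (v + w) = fan_cocycle L \<delta> v + fan_cocycle L \<delta> w" by (simp only: of_rat_eq_iff)
next
  fix \<delta> v assume "\<delta> \<notin> cubes_dim \<Sigma> 1 \<or> v \<notin> F1 N \<Sigma> \<delta>"
  then show "fan_cocycle L \<delta> v = 0" by (simp only: fan_cocycle_def) auto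
qed

text \<open>Along either route through a square the differences telescope to
  \<open>L \<sigma> - L \<tau>\<close>.\<close>

lemma fan_cocycle_cocycle:
  assumes L: "local_functionals x L"
  shows "fan_cocycle L \<in> cocycles"
proof -
  have "trop_coboundary N \<Sigma> \<nu> 1 (fan_cocycle L) (\<tau>, \<sigma>) v = 0" for \<tau> \<sigma> v
  proof (cases "(\<tau>, \<sigma>) \<in> cubes_dim \<Sigma> 2 \<and> v \<in> F1 N \<Sigma> (\<tau>, \<sigma>)")
    case True
    then have d: "(\<tau>, \<sigma>) \<in> cubes_dim \<Sigma> 2" and v: "v \<in> F1 N \<Sigma> (\<tau>, \<sigma>)" by auto
    have S: "\<tau> \<in> \<Sigma>" "\<sigma> \<in> \<Sigma>" "\<tau> \<subseteq> \<sigma>" using d by (auto simp: cubes_dim_iff)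
    obtain \<kappa> \<kappa>' where k: "(\<tau>, \<kappa>) \<in> cubes_dim \<Sigma> 1" "(\<kappa>, \<sigma>) \<in> cubes_dim \<Sigma> 1"
      "(\<tau>, \<kappa>') \<in> cubes_dim \<Sigma> 1" "(\<kappa>', \<sigma>) \<in> cubes_dim \<Sigma> 1" "\<kappa> \<noteq> \<kappa>'"
      using facets_2_ex[OF d] by (elim exE conjE) (rule that)
    obtain u where u: "u \<in> Q.span (lat \<sigma>)" "v = qproj \<tau> u" using F1_lift[OF v] by blast
    have path: "real_of_rat (fan_cocycle L (\<tau>, \<mu>) (qproj \<tau> v) + fan_cocycle L (\<mu>, \<sigma>) (qproj \<mu> v)) = L \<sigma> v - L \<tau> v"
      if m: "(\<tau>, \<mu>) \<in> cubes_dim \<Sigma> 1" "(\<mu>, \<sigma>) \<in> cubes_dim \<Sigma> 1" for \<mu>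
    proof -
      have M: "\<mu> \<in> \<Sigma>" "\<tau> \<subseteq> \<mu>" "\<mu> \<subseteq> \<sigma>" using m by (auto simp: cubes_dim_iff)
      have F: "qproj \<tau> v \<in> F1 N \<Sigma> (\<tau>, \<mu>)" using F1_I[OF span_lat_mono[OF M(1) S(2) M(3) u(1)], of \<tau>] by (simp add: u(2))
      have F': "qproj \<mu> v \<in> F1 N \<Sigma> (\<mu>, \<sigma>)" using F1_I[OF u(1), of \<mu>] by (simp add: u(2) qproj_cube[OF m(1)])
      have "L \<sigma> (qproj \<mu> v) - L \<mu> (qproj \<mu> v) = L \<sigma> v - L \<mu> v"
        by (rule local_qproj[OF L M(1,1) S(2) subset_refl M(3)])
      then show ?thesis
        using fan_cocycle_value[OF L m(1) F] fan_cocycle_value[OF L m(2) F'] F1_qproj[OF v] by (simp add: of_rat_add)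
    qed
    have "real_of_rat (fan_cocycle L (\<tau>, \<kappa>) (qproj \<tau> v) + fan_cocycle L (\<kappa>, \<sigma>) (qproj \<kappa> v)) =
        real_of_rat (fan_cocycle L (\<tau>, \<kappa>') (qproj \<tau> v) + fan_cocycle L (\<kappa>', \<sigma>) (qproj \<kappa>' v))"
      unfolding path[OF k(1,2)] path[OF k(3,4)] by (rule refl)
    then have eq: "fan_cocycle L (\<tau>, \<kappa>) (qproj \<tau> v) + fan_cocycle L (\<kappa>, \<sigma>) (qproj \<kappa> v) =
        fan_cocycle L (\<tau>, \<kappa>') (qproj \<tau> v) + fan_cocycle L (\<kappa>', \<sigma>) (qproj \<kappa>' v)" by (simp only: of_rat_eq_iff)
    obtain \<epsilon> :: rat where "\<forall>a. \<forall>v\<in>F1 N \<Sigma> (\<tau>, \<sigma>). trop_coboundary N \<Sigma> \<nu> 1 a (\<tau>, \<sigma>) v =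
      \<epsilon> * ((a (\<tau>, \<kappa>) (qproj \<tau> v) + a (\<kappa>, \<sigma>) (qproj \<kappa> v)) - (a (\<tau>, \<kappa>') (qproj \<tau> v) + a (\<kappa>', \<sigma>) (qproj \<kappa>' v)))"
      using trop_coboundary_1[OF d k] by (rule bexE)
    from this[rule_format, OF v, of "fan_cocycle L"] show ?thesis unfolding eq by simp
  next
    case False
    then have "\<not> ((\<tau>, \<sigma>) \<in> cubes_dim \<Sigma> (Suc 1) \<and> v \<in> F1 N \<Sigma> (\<tau>, \<sigma>))" by (simp add: numeral_2_eq_2)
    then show ?thesis unfolding trop_coboundary_def by (rule if_not_P)
  qed
  then have "trop_coboundary N \<Sigma> \<nu> 1 (fan_cocycle L) = (\<lambda>_ _. 0)" by (intro ext) (metis surj_pair)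
  then show ?thesis using fan_cocycle_cochain[OF L] by (simp add: cocycles_def)
qed

lemma fan_cocycle_ray_values:
  assumes L: "local_functionals x L" and x: "x \<in> chow_free \<Sigma>"
  shows "ray_values (fan_cocycle L) = x"
proof
  fix \<rho>
  show "ray_values (fan_cocycle L) \<rho> = x \<rho>"
  proof (cases "\<rho> \<in> rays \<Sigma>")
    case True
    have rS: "\<rho> \<in> \<Sigma>" using True by (simp add: rays_def)
    have F: "ray_gen N \<rho> \<in> F1 N \<Sigma> ({0}, \<rho>)" using ray_gen_lat[OF True rS] by (simp add: F1_0)
    have "real_of_rat (fan_cocycle L ({0}, \<rho>) (ray_gen N \<rho>)) = L \<rho> (ray_gen N \<rho>) - L {0} (ray_gen N \<rho>)"
      by (rule fan_cocycle_value[OF L ray_cube[OF True] F])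
    also have "\<dots> = real_of_rat (x \<rho>)"
      using local_gens[OF L rS True ray_gen_in_ray[OF True]] L by (simp add: local_functionals_def)
    finally show ?thesis using True by (simp add: ray_values_def)
  next
    case False
    then show ?thesis using x by (simp add: ray_values_def chow_free_def)
  qed
qed

text \<open>The right-hand side has the shape of \<open>chain_form\<close> on singular chains,
  through which the cubical and the singular side are matched.\<close>

theorem pairing_formula:
  assumes L: "local_functionals x L" and x: "x \<in> chow_free \<Sigma>" and c: "c \<in> trop_homology11 N \<Sigma> \<nu>" and z: "z \<in> c"
  shows "real_of_rat (trop_pairing \<Sigma> (cohomology_of_chow N \<Sigma> \<nu> (chow_class N \<Sigma> x)) c) =
    (\<Sum>(\<tau>, \<sigma>)\<in>cubes_dim \<Sigma> 1. L \<sigma> (z (\<tau>, \<sigma>)) - L \<tau> (z (\<tau>, \<sigma>)))"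
proof -
  have a: "fan_cocycle L \<in> cocycles" by (rule fan_cocycle_cocycle[OF L])
  have "cohomology_of_chow N \<Sigma> \<nu> (chow_class N \<Sigma> x) = coh_class (fan_cocycle L)"
    using cohomology_of_chow_eq[OF a] fan_cocycle_ray_values[OF L x] by simp
  then have "trop_pairing \<Sigma> (cohomology_of_chow N \<Sigma> \<nu> (chow_class N \<Sigma> x)) c = pair_sum (fan_cocycle L) z"
    using pairing_value[OF a c z] by (simp add: coh_class_def)
  moreover have "real_of_rat (pair_sum (fan_cocycle L) z) = (\<Sum>(\<tau>, \<sigma>)\<in>cubes_dim \<Sigma> 1. L \<sigma> (z (\<tau>, \<sigma>)) - L \<tau> (z (\<tau>, \<sigma>)))"
    unfolding pair_sum_def of_rat_sum
  proof (rule sum.cong[OF refl])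
    fix \<delta> assume d: "\<delta> \<in> cubes_dim \<Sigma> 1"
    obtain \<tau> \<sigma> where ts: "\<delta> = (\<tau>, \<sigma>)" by (cases \<delta>)
    obtain z0 where "z0 \<in> cycles" "c = quot_class cycles boundaries z0"
      using c unfolding trop_homology11_def quot_space_def cycles_def boundaries_def by blast
    then have "z \<in> trop_chains N \<Sigma> 1" using z by (simp add: quot_class_def cycles_def)
    then have "z \<delta> \<in> F1 N \<Sigma> \<delta>" using d by (rule chain_F1)
    then show "real_of_rat (fan_cocycle L \<delta> (z \<delta>)) = (case \<delta> of (\<tau>, \<sigma>) \<Rightarrow> L \<sigma> (z (\<tau>, \<sigma>)) - L \<tau> (z (\<tau>, \<sigma>)))"
      using fan_cocycle_value[OF L] d by (simp add: ts)
  qed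
  ultimately show ?thesis by simp
qed

end

section \<open>Strata of singular simplices\<close>

definition vtx :: "nat \<Rightarrow> nat \<Rightarrow> real" where "vtx i = (\<lambda>j. if j = i then 1 else 0)"

definition seg :: "real \<Rightarrow> nat \<Rightarrow> real" where "seg t = (\<lambda>j. if j = 0 then 1 - t else if j = 1 then t else 0)"

lemma vtx_in_simplex: "i \<le> q \<Longrightarrow> vtx i \<in> standard_simplex q"
  by (auto simp: standard_simplex_def vtx_def)

lemma vtx_open_face: "i \<le> q \<Longrightarrow> vtx i \<in> open_face q {i}"
  using vtx_in_simplex by (auto simp: open_face_def vtx_def)

lemma seg_in_simplex: "0 \<le> t \<Longrightarrow> t \<le> 1 \<Longrightarrow> seg t \<in> standard_simplex 1"
  by (auto simp: standard_simplex_def seg_def)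

lemma seg_01: "seg 0 = vtx 0" "seg 1 = vtx 1"
  by (auto simp: seg_def vtx_def)

lemma seg_open_face: "0 < t \<Longrightarrow> t < 1 \<Longrightarrow> seg t \<in> open_face 1 {..1}"
  using seg_in_simplex[of t] by (auto simp: open_face_def seg_def split: if_splits)

lemma continuous_seg:
  "continuous_map (top_of_set {0..1}) (subtopology (powertop_real UNIV) (standard_simplex 1)) seg"
proof (rule continuous_map_into_subtopology)
  have "continuous_on {0..1} (\<lambda>t. seg t k)" for k
    unfolding seg_def by (cases "k = 0"; cases "k = 1") (auto intro!: continuous_intros)
  then show "continuous_map (top_of_set {0..1}) (powertop_real UNIV) seg"
    unfolding continuous_map_componentwise_UNIV by simp
  show "seg \<in> topspace (top_of_set {0..1}) \<rightarrow> standard_simplex 1" using seg_in_simplex by auto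
qed

context oriented_fan
begin

lemma topspace_cone_closure: "topspace (cone_closure_topology \<sigma>) = cone_closure \<sigma>"
  by (auto simp: cone_closure_topology_def topspace_pullback_topology)

lemma openin_point_eval_finite:
  assumes m: "m \<in> dual_cone \<sigma>"
  shows "openin (cone_closure_topology \<sigma>) {p \<in> cone_closure \<sigma>. point_eval p m \<noteq> \<infinity>}"
proof -
  let ?P = "product_topology (\<lambda>_. euclidean :: ennreal topology) (dual_cone \<sigma>)"
  have "openin ?P {g \<in> topspace ?P. g m \<in> {..<\<infinity>}}"
    by (rule openin_continuous_map_preimage[OF continuous_map_product_projection[OF m]]) simp
  moreover have "{p \<in> cone_closure \<sigma>. point_eval p m \<noteq> \<infinity>} =
      (\<lambda>p. \<lambda>m\<in>dual_cone \<sigma>. point_eval p m) -` {g \<in> topspace ?P. g m \<in> {..<\<infinity>}} \<inter> cone_closure \<sigma>"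
    using m by (auto simp: less_top)
  ultimately show ?thesis unfolding cone_closure_topology_def openin_pullback_topology by blast
qed

text \<open>The coordinate form of a generator of \<open>\<tau>\<close> outside
  \<open>\<tau>'\<close> serves: coordinates with respect to the generators are nonnegative on a
  simplicial cone.\<close>

lemma separating_functional:
  assumes S: "\<tau> \<in> \<Sigma>" "\<sigma> \<in> \<Sigma>" "\<tau> \<subseteq> \<sigma>" "\<tau>' \<in> \<Sigma>" "\<tau>' \<subseteq> \<sigma>" "\<not> \<tau> \<subseteq> \<tau>'"
  shows "\<exists>m\<in>dual_cone \<sigma>. (\<forall>t\<in>\<tau>'. m \<bullet> t = 0) \<and> (\<exists>t\<in>\<tau>. m \<bullet> t \<noteq> 0)"
proof -
  obtain v where v: "v \<in> gens \<tau>" "v \<notin> gens \<tau>'" using subset_iff_gens[OF S(1,4)] S(6) by blast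
  obtain l :: "'v \<Rightarrow> real" where l: "linear l" "\<forall>b\<in>gens \<sigma>. l b = (if b = v then 1 else 0)"
    using linear_extension[OF gens_cone(1)[OF S(2)], of "\<lambda>b. if b = v then 1 else 0"] by blast
  obtain m where m: "\<And>x. l x = m \<bullet> x"
    using l(1) by (metis adjoint_works inner_commute inner_real_def mult.right_neutral)
  have "m \<in> dual_cone \<sigma>" unfolding dual_cone_def
  proof (intro CollectI ballI)
    fix x assume "x \<in> \<sigma>"
    then obtain c where c: "x = (\<Sum>v\<in>gens \<sigma>. c v *\<^sub>R v)" "\<forall>v\<in>gens \<sigma>. 0 \<le> c v" using cone_coneD[OF S(2)] by blast
    have "l x = (\<Sum>v\<in>gens \<sigma>. c v * l v)" unfolding c(1) using l(1) by (simp add: linear_sum linear_cmul)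
    also have "\<dots> \<ge> 0" using c(2) l(2) by (intro sum_nonneg) auto
    finally show "0 \<le> m \<bullet> x" using m by simp
  qed
  moreover have "m \<bullet> t = 0" if "t \<in> \<tau>'" for t
  proof -
    have "t \<in> span (gens \<tau>')" using that span_base span_gens[OF S(4)] by blast
    moreover have "l w = 0" if "w \<in> gens \<tau>'" for w using that v(2) l(2) gens_mono[OF S(5)] by auto
    ultimately have "l t = 0" using linear_eq_0_on_span'[OF l(1)] by blast
    then show ?thesis using m by simp
  qed
  moreover have "m \<bullet> v \<noteq> 0" using l(2) v(1) gens_mono[OF S(3)] m by auto
  moreover have "v \<in> \<tau>" using v(1) gens_subset by blast
  ultimately show ?thesis by blast
qed

text \<open>A form in the dual cone that vanishes on the stratum cone of \<open>p\<close> but not on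
  \<open>\<tau>\<close> is finite at \<open>p\<close> and infinite on all strata of cones containing
  \<open>\<tau>\<close>; finiteness of a coordinate is an open condition.\<close>

lemma openin_strata:
  assumes t: "\<tau> \<in> \<Sigma>"
  shows "openin (compactification \<Sigma>) {p \<in> (\<Union>\<sigma>\<in>\<Sigma>. cone_closure \<sigma>). \<not> \<tau> \<subseteq> fst p}"
  unfolding openin_compactification
proof (intro conjI ballI)
  show "{p \<in> (\<Union>\<sigma>\<in>\<Sigma>. cone_closure \<sigma>). \<not> \<tau> \<subseteq> fst p} \<subseteq> (\<Union>\<sigma>\<in>\<Sigma>. cone_closure \<sigma>)" by blast
  fix \<sigma> assume s: "\<sigma> \<in> \<Sigma>"
  let ?U = "{p \<in> (\<Union>\<sigma>\<in>\<Sigma>. cone_closure \<sigma>). \<not> \<tau> \<subseteq> fst p} \<inter> cone_closure \<sigma>"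
  have face: "fst p \<in> \<Sigma> \<and> fst p \<subseteq> \<sigma>" if "p \<in> cone_closure \<sigma>" for p
    using that cface_in_fan[OF s] cface_iff[OF _ s] by (cases p) (auto simp: cone_closure_def)
  show "openin (cone_closure_topology \<sigma>) ?U"
  proof (cases "\<tau> \<subseteq> \<sigma>")
    case False
    have "?U = cone_closure \<sigma>" using face False s by blast
    then show ?thesis using topspace_cone_closure openin_topspace by metis
  next
    case True
    show ?thesis
    proof (subst openin_subopen, intro ballI)
      fix p assume p: "p \<in> ?U"
      obtain \<tau>' y where ty: "p = (\<tau>', y)" by (cases p)
      have f: "\<tau>' \<in> \<Sigma>" "\<tau>' \<subseteq> \<sigma>" "\<not> \<tau> \<subseteq> \<tau>'" using p face[of p] ty by simp_all
      obtain m where m: "m \<in> dual_cone \<sigma>" "\<forall>t\<in>\<tau>'. m \<bullet> t = 0" "\<exists>t\<in>\<tau>. m \<bullet> t \<noteq> 0"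
        using separating_functional[OF t s True f] by blast
      let ?T = "{p \<in> cone_closure \<sigma>. point_eval p m \<noteq> \<infinity>}"
      have "p \<in> ?T" using p m(2) ty by simp
      moreover have "?T \<subseteq> ?U"
      proof
        fix q assume q: "q \<in> ?T"
        obtain \<kappa> z where kz: "q = (\<kappa>, z)" by (cases q)
        have "\<forall>t\<in>\<kappa>. m \<bullet> t = 0" using q kz by (auto split: if_splits)
        then have "\<not> \<tau> \<subseteq> \<kappa>" using m(3) by blast
        then show "q \<in> ?U" using q kz s by auto
      qed
      ultimately show "\<exists>T. openin (cone_closure_topology \<sigma>) T \<and> p \<in> T \<and> T \<subseteq> ?U"
        using openin_point_eval_finite[OF m(1)] by blast
    qed
  qed
qed

lemma open_cube_disjoint:
  assumes "\<delta> \<in> cubes \<Sigma>" "\<delta>' \<in> cubes \<Sigma>" "p \<in> open_cube \<delta>" "p \<in> open_cube \<delta>'"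
  shows "\<delta> = \<delta>'"
proof -
  obtain \<tau> \<sigma> \<tau>' \<sigma>' where d: "\<delta> = (\<tau>, \<sigma>)" "\<delta>' = (\<tau>', \<sigma>')" by (cases \<delta>; cases \<delta>')
  obtain x where x: "p = (\<tau>, x)" "x \<in> rel_interior (qproj \<tau> ` \<sigma>)" using assms(3) d(1) by auto
  have x': "\<tau>' = \<tau>" "x \<in> rel_interior (qproj \<tau> ` \<sigma>')" using assms(4) d(2) x(1) by auto
  have "\<sigma> = \<sigma>'" using star_relint_unique[of \<tau> \<sigma> x \<sigma>'] assms(1,2) d x x' by (simp add: cubes_iff)
  then show ?thesis using d x' by simp
qed

lemma simplex_cube_eqI:
  assumes "\<delta> \<in> cubes \<Sigma>" "s ` open_face 1 {..1} \<subseteq> open_cube \<delta>"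
  shows "simplex_cube \<Sigma> 1 s = \<delta>"
  unfolding simplex_cube_def
proof (rule the_equality)
  show "\<delta> \<in> cubes \<Sigma> \<and> s ` open_face 1 {..1} \<subseteq> open_cube \<delta>" using assms by blast
  have h: "seg (1/2) \<in> open_face 1 {..1}" by (rule seg_open_face) simp_all
  fix \<delta>' assume "\<delta>' \<in> cubes \<Sigma> \<and> s ` open_face 1 {..1} \<subseteq> open_cube \<delta>'"
  then show "\<delta>' = \<delta>" using open_cube_disjoint[of \<delta>' \<delta> "s (seg (1/2))"] assms h by blast
qed

lemma strat_simplex_cube:
  assumes "strat_simplex \<Sigma> q s" "J \<noteq> {}" "J \<subseteq> {..q}"
  shows "\<exists>\<delta>\<in>cubes \<Sigma>. s ` open_face q J \<subseteq> open_cube \<delta>"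
  using assms unfolding strat_simplex_def by blast

lemma fst_open_cube: "\<delta> \<in> cubes \<Sigma> \<Longrightarrow> p \<in> open_cube \<delta> \<Longrightarrow> fst p = fst \<delta>"
  by (cases \<delta>) auto

lemma strat_simplex_vertex:
  assumes s: "strat_simplex \<Sigma> q s" and i: "i \<le> q"
  shows "fst (s (vtx i)) \<in> \<Sigma>"
proof -
  obtain \<delta> where d: "\<delta> \<in> cubes \<Sigma>" "s ` open_face q {i} \<subseteq> open_cube \<delta>" using strat_simplex_cube[OF s, of "{i}"] i by auto
  then have "s (vtx i) \<in> open_cube \<delta>" using vtx_open_face[OF i] by blast
  then have "fst (s (vtx i)) = fst \<delta>" by (rule fst_open_cube[OF d(1)])
  then show ?thesis using d(1) by (cases \<delta>) (simp add: cubes_iff)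
qed

lemma simplex_cube_props:
  assumes s: "strat_simplex \<Sigma> 1 s"
  shows "simplex_cube \<Sigma> 1 s \<in> cubes \<Sigma>" "s ` open_face 1 {..1} \<subseteq> open_cube (simplex_cube \<Sigma> 1 s)"
proof -
  obtain \<delta> where d: "\<delta> \<in> cubes \<Sigma>" "s ` open_face 1 {..1} \<subseteq> open_cube \<delta>" using strat_simplex_cube[OF s, of "{..1}"] by auto
  show "simplex_cube \<Sigma> 1 s \<in> cubes \<Sigma>" "s ` open_face 1 {..1} \<subseteq> open_cube (simplex_cube \<Sigma> 1 s)"
    using d simplex_cube_eqI[OF d] by simp_all
qed

text \<open>The strata of the cones containing a given cone form a closed set.\<close>

lemma strat_edge_closure:
  assumes s: "strat_simplex \<Sigma> 1 s" and i: "i \<le> 1"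
  shows "fst (simplex_cube \<Sigma> 1 s) \<subseteq> fst (s (vtx i))"
proof (rule ccontr)
  assume n: "\<not> ?thesis"
  define \<tau> where "\<tau> = fst (simplex_cube \<Sigma> 1 s)"
  have t: "\<tau> \<in> \<Sigma>" using simplex_cube_props(1)[OF s] unfolding \<tau>_def by (cases "simplex_cube \<Sigma> 1 s") (simp add: cubes_iff)
  let ?U = "{p \<in> (\<Union>\<sigma>\<in>\<Sigma>. cone_closure \<sigma>). \<not> \<tau> \<subseteq> fst p}"
  have "continuous_map (subtopology (powertop_real UNIV) (standard_simplex 1)) (compactification \<Sigma>) s"
    using s by (simp add: strat_simplex_def singular_simplex_def)
  then have cont: "continuous_map (top_of_set {0..1}) (compactification \<Sigma>) (s \<circ> seg)"
    by (rule continuous_map_compose[OF continuous_seg])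
  have tops: "topspace (compactification \<Sigma>) \<subseteq> (\<Union>\<sigma>\<in>\<Sigma>. cone_closure \<sigma>)"
    using openin_compactification openin_topspace by metis
  define W where "W = {u \<in> topspace (top_of_set {0..1}). (s \<circ> seg) u \<in> ?U}"
  have W: "openin (top_of_set {0..1}) W" unfolding W_def
    by (rule openin_continuous_map_preimage[OF cont openin_strata[OF t]])
  have W': "W = {u \<in> {0..1}. \<not> \<tau> \<subseteq> fst (s (seg u))}"
  proof -
    have "s (seg u) \<in> (\<Union>\<sigma>\<in>\<Sigma>. cone_closure \<sigma>)" if "u \<in> {0..1}" for u
    proof (rule subsetD[OF tops])
      show "s (seg u) \<in> topspace (compactification \<Sigma>)"
        using continuous_map_image_subset_topspace[OF cont] that by (simp add: image_subset_iff)
    qed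
    then show ?thesis unfolding W_def by (intro Collect_cong) (simp, blast)
  qed
  define a where "a = real i"
  have a: "a \<in> {0..1}" "seg a = vtx i" using i seg_01 by (auto simp: a_def le_Suc_eq)
  then have "a \<in> W" using n by (simp add: W' \<tau>_def)
  then obtain e where e: "e > 0" "\<And>u. u \<in> {0..1} \<Longrightarrow> dist u a < e \<Longrightarrow> u \<in> W"
    using W unfolding openin_euclidean_subtopology_iff by (metis dist_commute)
  \<comment> \<open>The point \<open>b\<close> at distance \<open>h\<close> from the end
    \<open>a\<close> is interior to the edge and still in the open set \<open>W\<close>.\<close>
  define h where "h = min (1/2) (e/2)"
  define b where "b = (if i = 0 then h else 1 - h)"
  have "0 < h" "h \<le> 1/2" "h < e" using e(1) by (auto simp: h_def min_def)
  then have b: "0 < b" "b < 1" "dist b a < e" using i by (auto simp: b_def a_def dist_real_def le_Suc_eq)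
  then have "b \<in> W" using e(2)[of b] by simp
  then have "\<not> \<tau> \<subseteq> fst (s (seg b))" by (simp add: W')
  moreover have "s (seg b) \<in> open_cube (simplex_cube \<Sigma> 1 s)"
    using simplex_cube_props(2)[OF s] seg_open_face[OF b(1,2)] by blast
  then have "fst (s (seg b)) = \<tau>" unfolding \<tau>_def by (rule fst_open_cube[OF simplex_cube_props(1)[OF s]])
  ultimately show False by simp
qed

section \<open>The singular cocycle of a conewise linear function\<close>

definition edge_form :: "('v set \<Rightarrow> 'v \<Rightarrow> real) \<Rightarrow> 'v sing \<Rightarrow> 'v \<Rightarrow> real" where
  "edge_form L s v = L (fst (s (vtx 1))) v - L (fst (s (vtx 0))) v"

definition chain_form :: "('v set \<Rightarrow> 'v \<Rightarrow> real) \<Rightarrow> ('v sing \<Rightarrow> 'v) \<Rightarrow> real" where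
  "chain_form L c = (\<Sum>s | c s \<noteq> 0. edge_form L s (c s))"

lemma linear_edge_form: "(\<And>\<sigma>. linear (L \<sigma>)) \<Longrightarrow> linear (edge_form L s)"
  unfolding edge_form_def[abs_def] by (intro linear_compose_sub)

lemma chain_form_superset:
  assumes L: "\<And>\<sigma>. linear (L \<sigma>)" and "finite S" "{s. c s \<noteq> 0} \<subseteq> S"
  shows "chain_form L c = (\<Sum>s\<in>S. edge_form L s (c s))"
  unfolding chain_form_def using assms(2,3) linear_0[OF linear_edge_form[OF L]]
  by (intro sum.mono_neutral_left) auto

lemma chain_form_add:
  assumes L: "\<And>\<sigma>. linear (L \<sigma>)" and f: "finite {s. c s \<noteq> 0}" "finite {s. d s \<noteq> 0}"
  shows "chain_form L (\<lambda>s. c s + d s) = chain_form L c + chain_form L d"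
proof -
  let ?S = "{s. c s \<noteq> 0} \<union> {s. d s \<noteq> 0}"
  have "finite ?S" using f by simp
  note sup = chain_form_superset[of L, OF L this]
  have 1: "chain_form L (\<lambda>s. c s + d s) = (\<Sum>s\<in>?S. edge_form L s (c s + d s))" by (rule sup) auto
  have 2: "chain_form L c = (\<Sum>s\<in>?S. edge_form L s (c s))" by (rule sup) auto
  have 3: "chain_form L d = (\<Sum>s\<in>?S. edge_form L s (d s))" by (rule sup) auto
  show ?thesis unfolding 1 2 3 by (simp add: linear_add[OF linear_edge_form[OF L]] sum.distrib)
qed

lemma chain_form_diff:
  assumes L: "\<And>\<sigma>. linear (L \<sigma>)" and f: "finite {s. c s \<noteq> 0}" "finite {s. d s \<noteq> 0}"
  shows "chain_form L (\<lambda>s. c s - d s) = chain_form L c - chain_form L d"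
proof -
  let ?S = "{s. c s \<noteq> 0} \<union> {s. d s \<noteq> 0}"
  have "finite ?S" using f by simp
  note sup = chain_form_superset[of L, OF L this]
  have 1: "chain_form L (\<lambda>s. c s - d s) = (\<Sum>s\<in>?S. edge_form L s (c s - d s))" by (rule sup) auto
  have 2: "chain_form L c = (\<Sum>s\<in>?S. edge_form L s (c s))" by (rule sup) auto
  have 3: "chain_form L d = (\<Sum>s\<in>?S. edge_form L s (d s))" by (rule sup) auto
  show ?thesis unfolding 1 2 3 by (simp add: linear_diff[OF linear_edge_form[OF L]] sum_subtractf)
qed

text \<open>Several indices may share a simplex \<open>p i\<close>; their coefficients are added
  before the form is applied. Cubical cycles, stratum curves and boundaries all give chains of this
  kind.\<close>

lemma chain_form_mass:
  assumes L: "\<And>\<sigma>. linear (L \<sigma>)" and I: "finite I"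
  shows "chain_form L (\<lambda>s. \<Sum>i | i \<in> I \<and> p i = s. v i) = (\<Sum>i\<in>I. edge_form L (p i) (v i))"
    "finite {s. (\<Sum>i | i \<in> I \<and> p i = s. v i) \<noteq> 0}"
proof -
  have sub: "{s. (\<Sum>i | i \<in> I \<and> p i = s. v i) \<noteq> 0} \<subseteq> p ` I"
  proof
    fix s assume "s \<in> {s. (\<Sum>i | i \<in> I \<and> p i = s. v i) \<noteq> 0}"
    then have "{i. i \<in> I \<and> p i = s} \<noteq> {}" by (metis (mono_tags, lifting) mem_Collect_eq sum.empty)
    then show "s \<in> p ` I" by blast
  qed
  then show "finite {s. (\<Sum>i | i \<in> I \<and> p i = s. v i) \<noteq> 0}" using I finite_subset by blast
  have "chain_form L (\<lambda>s. \<Sum>i | i \<in> I \<and> p i = s. v i) = (\<Sum>s\<in>p ` I. edge_form L s (\<Sum>i | i \<in> I \<and> p i = s. v i))"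
    using I sub by (intro chain_form_superset[OF L]) auto
  also have "\<dots> = (\<Sum>s\<in>p ` I. \<Sum>i | i \<in> I \<and> p i = s. edge_form L (p i) (v i))"
    by (intro sum.cong[OF refl]) (simp add: linear_sum[OF linear_edge_form[OF L]])
  also have "\<dots> = (\<Sum>i\<in>I. edge_form L (p i) (v i))"
    using sum.image_gen[OF I, of "\<lambda>i. edge_form L (p i) (v i)" p] by simp
  finally show "chain_form L (\<lambda>s. \<Sum>i | i \<in> I \<and> p i = s. v i) = (\<Sum>i\<in>I. edge_form L (p i) (v i))" .
qed

lemma strat_simplex_face:
  assumes s: "strat_simplex \<Sigma> 2 s" and k: "k \<le> 2"
  shows "strat_simplex \<Sigma> 1 (singular_face 2 k s)"
  unfolding strat_simplex_def
proof (intro conjI allI impI)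
  have ss: "singular_simplex 2 (compactification \<Sigma>) s" using s by (simp add: strat_simplex_def)
  show "singular_simplex 1 (compactification \<Sigma>) (singular_face 2 k s)"
    using singular_simplex_singular_face[OF ss _ k] by simp
  fix J :: "nat set" assume J: "J \<noteq> {} \<and> J \<subseteq> {..1}"
  \<comment> \<open>The image of \<open>J\<close> under the increasing map that skips
    \<open>k\<close>: the support of a point of the face, seen in the triangle.\<close>
  define J' where "J' = {i. i < k \<and> i \<in> J} \<union> {i. k < i \<and> i - 1 \<in> J}"
  have map: "simplical_face k x \<in> open_face 2 J'" if x: "x \<in> open_face 1 J" for x
  proof -
    have "x \<in> standard_simplex (2 - Suc 0)" using x by (simp add: open_face_def)
    then have "simplical_face k x \<in> standard_simplex 2" using simplical_face_in_standard_simplex[of 2 k x] k by simp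
    moreover have "{i. simplical_face k x i \<noteq> 0} = J'"
    proof (rule Set.set_eqI)
      fix i
      have xJ: "x j \<noteq> 0 \<longleftrightarrow> j \<in> J" for j using x by (auto simp: open_face_def)
      show "i \<in> {i. simplical_face k x i \<noteq> 0} \<longleftrightarrow> i \<in> J'"
        using xJ[of i] xJ[of "i - 1"] by (auto simp: simplical_face_def J'_def)
    qed
    ultimately show ?thesis by (simp add: open_face_def)
  qed
  obtain j where j: "j \<in> J" "j \<le> 1" using J by auto
  have "(if j < k then j else j + 1) \<in> J'" using j by (auto simp: J'_def)
  moreover have "J' \<subseteq> {..2}"
  proof
    fix i assume "i \<in> J'"
    then have "i \<in> J \<or> i - 1 \<in> J" by (auto simp: J'_def)
    then have "i \<le> 1 \<or> i - 1 \<le> 1" using J by auto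
    then show "i \<in> {..2}" by auto
  qed
  ultimately obtain \<delta> where d: "\<delta> \<in> cubes \<Sigma>" "s ` open_face 2 J' \<subseteq> open_cube \<delta>"
    using strat_simplex_cube[OF s, of J'] by blast
  have "singular_face 2 k s ` open_face 1 J \<subseteq> open_cube \<delta>"
  proof
    fix p assume "p \<in> singular_face 2 k s ` open_face 1 J"
    then obtain x where x: "x \<in> open_face 1 J" "p = singular_face 2 k s x" by blast
    then have "p = s (simplical_face k x)" by (simp add: singular_face_def open_face_def)
    then show "p \<in> open_cube \<delta>" using map[OF x(1)] d(2) by blast
  qed
  then show "\<exists>\<delta>\<in>cubes \<Sigma>. singular_face 2 k s ` open_face 1 J \<subseteq> open_cube \<delta>" using d(1) by blast
qed

lemma face_vtx:
  "singular_face 2 0 s (vtx 0) = s (vtx 1)" "singular_face 2 0 s (vtx 1) = s (vtx 2)"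
  "singular_face 2 1 s (vtx 0) = s (vtx 0)" "singular_face 2 1 s (vtx 1) = s (vtx 2)"
  "singular_face 2 2 s (vtx 0) = s (vtx 0)" "singular_face 2 2 s (vtx 1) = s (vtx 1)"
proof -
  have e: "singular_face 2 k s (vtx i) = s (simplical_face k (vtx i))" if "i \<le> 1" for k i
    using vtx_in_simplex[OF that] by (simp add: singular_face_def)
  have f: "simplical_face 0 (vtx 0) = vtx 1" "simplical_face 0 (vtx 1) = vtx 2"
    "simplical_face 1 (vtx 0) = vtx 0" "simplical_face 1 (vtx 1) = vtx 2"
    "simplical_face 2 (vtx 0) = vtx 0" "simplical_face 2 (vtx 1) = vtx 1"
    by (auto simp: simplical_face_def vtx_def fun_eq_iff)
  show "singular_face 2 0 s (vtx 0) = s (vtx 1)" "singular_face 2 0 s (vtx 1) = s (vtx 2)"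
    "singular_face 2 1 s (vtx 0) = s (vtx 0)" "singular_face 2 1 s (vtx 1) = s (vtx 2)"
    "singular_face 2 2 s (vtx 0) = s (vtx 0)" "singular_face 2 2 s (vtx 1) = s (vtx 1)"
    using e[of 0] e[of 1] f by simp_all
qed

text \<open>The coefficient of a face is projected along the cone \<open>\<kappa>\<close> of its
  stratum. As \<open>\<kappa>\<close> is contained in the stratum cones of both ends of the face,
  the difference of forms does not see this projection.\<close>

lemma chain_form_boundary:
  assumes L: "\<And>\<sigma>. linear (L \<sigma>)" and loc: "local_functionals x L" and b: "b \<in> sing_chains N \<Sigma> 2"
  shows "chain_form L (sing_boundary \<Sigma> 2 b) = 0"
proof -
  define S where "S = {s. b s \<noteq> 0}"
  have finS: "finite S" and strat: "\<And>s. s \<in> S \<Longrightarrow> strat_simplex \<Sigma> 2 s"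
    using b by (auto simp: sing_chains_def S_def)
  define I where "I = S \<times> {..2::nat}"
  have finI: "finite I" using finS by (simp add: I_def)
  let ?face = "\<lambda>(s, k). singular_face 2 k s"
  define v where "v = (\<lambda>(s, k). (-1) ^ k *\<^sub>R qproj (fst (simplex_cube \<Sigma> 1 (singular_face 2 k s))) (b s))"
  have "sing_boundary \<Sigma> 2 b = (\<lambda>t. \<Sum>i | i \<in> I \<and> ?face i = t. v i)"
  proof
    fix t
    have "sing_boundary \<Sigma> 2 b t = (\<Sum>s\<in>S. \<Sum>k | k \<le> 2 \<and> singular_face 2 k s = t. v (s, k))"
      unfolding sing_boundary_def S_def v_def by (intro sum.cong[OF refl]) auto
    also have "\<dots> = (\<Sum>(s, k)\<in>Sigma S (\<lambda>s. {k. k \<le> 2 \<and> singular_face 2 k s = t}). v (s, k))"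
      using finS by (intro sum.Sigma) auto
    also have "\<dots> = (\<Sum>i | i \<in> I \<and> ?face i = t. v i)"
      by (rule sum.cong) (auto simp: I_def)
    finally show "sing_boundary \<Sigma> 2 b t = (\<Sum>i | i \<in> I \<and> ?face i = t. v i)" .
  qed
  then have "chain_form L (sing_boundary \<Sigma> 2 b) = (\<Sum>i\<in>I. edge_form L (?face i) (v i))"
    using chain_form_mass(1)[where p = ?face and v = v, OF L finI] by simp
  also have "\<dots> = (\<Sum>s\<in>S. \<Sum>k\<le>2. edge_form L (singular_face 2 k s) (v (s, k)))"
    unfolding I_def by (subst sum.cartesian_product) (auto intro: sum.cong)
  also have "\<dots> = (\<Sum>s\<in>S. 0)"
  proof (rule sum.cong[OF refl])
    fix s assume s: "s \<in> S"
    have e: "edge_form L (singular_face 2 k s) (v (s, k)) = (-1) ^ k * edge_form L (singular_face 2 k s) (b s)"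
      if k: "k \<le> 2" for k
    proof -
      let ?t = "singular_face 2 k s"
      have st: "strat_simplex \<Sigma> 1 ?t" by (rule strat_simplex_face[OF strat[OF s] k])
      define \<kappa> where "\<kappa> = fst (simplex_cube \<Sigma> 1 ?t)"
      have k: "\<kappa> \<in> \<Sigma>" using simplex_cube_props(1)[OF st] unfolding \<kappa>_def by (cases "simplex_cube \<Sigma> 1 ?t") (simp add: cubes_iff)
      have "edge_form L ?t (qproj \<kappa> (b s)) = edge_form L ?t (b s)"
        unfolding edge_form_def \<kappa>_def[symmetric]
        by (rule local_qproj[OF loc k strat_simplex_vertex[OF st] strat_simplex_vertex[OF st]
              strat_edge_closure[OF st, folded \<kappa>_def] strat_edge_closure[OF st, folded \<kappa>_def]]) simp_all
      then show ?thesis by (simp add: v_def \<kappa>_def linear_cmul[OF linear_edge_form[OF L]])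
    qed
    have 2: "{..2::nat} = {0, 1, 2}" by auto
    \<comment> \<open>With \<open>Li\<close> the form at vertex i, the faces give
      \<open>(L2 - L1) - (L2 - L0) + (L1 - L0) = 0\<close>, all evaluated at the same vector
      \<open>b s\<close>.\<close>
    show "(\<Sum>k\<le>2. edge_form L (singular_face 2 k s) (v (s, k))) = 0"
      unfolding 2 using e[of 0] e[of 1] e[of 2] by (simp add: edge_form_def face_vtx[unfolded One_nat_def])
  qed
  finally show ?thesis by simp
qed

section \<open>Rays\<close>

lemma edge_path_vtx0: "fst (edge_path \<Sigma> \<tau> e (vtx 0)) = \<tau>"
  using vtx_in_simplex[of 0 1] by (simp add: edge_path_def vtx_def)

lemma edge_path_bounded: "len e \<noteq> \<infinity> \<Longrightarrow> fst (edge_path \<Sigma> \<tau> e (vtx 1)) = \<tau>"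
  using vtx_in_simplex[of 1 1] by (simp add: edge_path_def)

lemma end_cone_eq:
  assumes "\<tau> \<in> \<Sigma>" "\<eta> \<in> \<Sigma>" "\<tau> \<subseteq> \<eta>" "v \<in> rel_interior (qproj \<tau> ` \<eta>)"
  shows "(THE \<eta>. \<eta> \<in> \<Sigma> \<and> cface \<tau> \<eta> \<and> v \<in> rel_interior (qproj \<tau> ` \<eta>)) = \<eta>"
proof (rule the_equality)
  show "\<eta> \<in> \<Sigma> \<and> cface \<tau> \<eta> \<and> v \<in> rel_interior (qproj \<tau> ` \<eta>)" using assms cface_iff by simp
  fix \<eta>' assume "\<eta>' \<in> \<Sigma> \<and> cface \<tau> \<eta>' \<and> v \<in> rel_interior (qproj \<tau> ` \<eta>')"
  then have e: "\<eta>' \<in> \<Sigma>" "\<tau> \<subseteq> \<eta>'" "v \<in> rel_interior (qproj \<tau> ` \<eta>')"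
    using cface_iff[OF assms(1), of \<eta>'] by auto
  show "\<eta>' = \<eta>" by (rule star_relint_unique[OF assms(1) e assms(2-4)])
qed

lemma edge_path_ray:
  assumes "\<tau> \<in> \<Sigma>" "\<eta> \<in> \<Sigma>" "\<tau> \<subseteq> \<eta>" "dir e \<in> rel_interior (qproj \<tau> ` \<eta>)" "len e = \<infinity>" "x \<in> standard_simplex 1"
  shows "edge_path \<Sigma> \<tau> e x = (if x 0 \<noteq> 0 then (\<tau>, base e + (x 1 / x 0) *\<^sub>R dir e) else (\<eta>, qproj \<eta> (base e)))"
  using assms(5,6) by (simp add: edge_path_def end_cone_eq[OF assms(1-4)])

lemma edge_gen_relint:
  assumes c: "(\<tau>, \<sigma>) \<in> cubes_dim \<Sigma> 1" and t: "t > 0"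
  shows "t *\<^sub>R edge_gen N \<tau> \<sigma> \<in> rel_interior (qproj \<tau> ` \<sigma>)"
proof -
  have S: "\<tau> \<in> \<Sigma>" "\<sigma> \<in> \<Sigma>" "\<tau> \<subseteq> \<sigma>" using c by (auto simp: cubes_dim_iff)
  obtain v where v: "v \<notin> gens \<tau>" "gens \<sigma> = insert v (gens \<tau>)" using edge_cubeD[OF c] by (elim exE conjE) (rule that)
  obtain a where a: "a > 0" "edge_gen N \<tau> \<sigma> = a *\<^sub>R qproj \<tau> v" using edge_gen_vert(1)[OF c v(2,1)] by (elim exE conjE) (rule that)
  have d: "gens \<sigma> - gens \<tau> = {v}" using v by blast
  have "qproj \<tau> (\<Sum>w\<in>gens \<sigma> - gens \<tau>. (t * a) *\<^sub>R w) \<in> rel_interior (qproj \<tau> ` \<sigma>)"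
    using t a(1) by (intro star_relintI[OF S]) simp
  then show ?thesis by (simp add: d a(2) linear_cmul[OF linear_qproj])
qed

lemma zero_relint: "\<sigma> \<in> \<Sigma> \<Longrightarrow> 0 \<in> rel_interior (qproj \<sigma> ` \<sigma>)"
  using star_relintI[of \<sigma> \<sigma> "\<lambda>_. 1"] by simp

lemma edge_form_cube_path:
  assumes c: "(\<tau>, \<sigma>) \<in> cubes_dim \<Sigma> 1"
  shows "edge_form L (cube_path N \<Sigma> (\<tau>, \<sigma>)) v = L \<sigma> v - L \<tau> v"
proof -
  have S: "\<tau> \<in> \<Sigma>" "\<sigma> \<in> \<Sigma>" "\<tau> \<subseteq> \<sigma>" using c by (auto simp: cubes_dim_iff)
  let ?e = "Edge 0 (edge_gen N \<tau> \<sigma>) \<infinity>"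
  have "dir ?e \<in> rel_interior (qproj \<tau> ` \<sigma>)" using edge_gen_relint[OF c, of 1] by simp
  then have "edge_path \<Sigma> \<tau> ?e (vtx 1) = (\<sigma>, 0)"
    using edge_path_ray[OF S, of ?e "vtx 1"] vtx_in_simplex[of 1 1] by (simp add: vtx_def)
  then show ?thesis using edge_path_vtx0[of \<tau> ?e] by (simp add: edge_form_def cube_path_def)
qed

lemma chain_form_sing_of_trop:
  assumes L: "\<And>\<sigma>. linear (L \<sigma>)"
  shows "chain_form L (sing_of_trop N \<Sigma> z) = (\<Sum>(\<tau>, \<sigma>)\<in>cubes_dim \<Sigma> 1. L \<sigma> (z (\<tau>, \<sigma>)) - L \<tau> (z (\<tau>, \<sigma>)))"
    "finite {s. sing_of_trop N \<Sigma> z s \<noteq> 0}"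
proof -
  have "chain_form L (sing_of_trop N \<Sigma> z) = (\<Sum>\<delta>\<in>cubes_dim \<Sigma> 1. edge_form L (cube_path N \<Sigma> \<delta>) (z \<delta>))"
    unfolding sing_of_trop_def[abs_def] by (rule chain_form_mass(1)[OF L finite_cubes_dim])
  also have "\<dots> = (\<Sum>(\<tau>, \<sigma>)\<in>cubes_dim \<Sigma> 1. L \<sigma> (z (\<tau>, \<sigma>)) - L \<tau> (z (\<tau>, \<sigma>)))"
    by (rule sum.cong[OF refl]) (auto simp: edge_form_cube_path)
  finally show "chain_form L (sing_of_trop N \<Sigma> z) = (\<Sum>(\<tau>, \<sigma>)\<in>cubes_dim \<Sigma> 1. L \<sigma> (z (\<tau>, \<sigma>)) - L \<tau> (z (\<tau>, \<sigma>)))" .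
  show "finite {s. sing_of_trop N \<Sigma> z s \<noteq> 0}"
    unfolding sing_of_trop_def by (rule chain_form_mass(2)[OF L finite_cubes_dim])
qed

lemma chain_form_curve:
  assumes L: "\<And>\<sigma>. linear (L \<sigma>)" and fin: "\<forall>D\<in>set C. finite (edges D)"
  shows "chain_form L (curve_chain \<Sigma> C) = (\<Sum>D\<leftarrow>C. \<Sum>e\<in>edges D. of_int (weight D e) * edge_form L (edge_path \<Sigma> (stratum D) e) (dir e)) \<and>
    finite {s. curve_chain \<Sigma> C s \<noteq> 0}"
  using fin
proof (induction C)
  case Nil
  then show ?case by (simp add: curve_chain_def chain_form_def)
next
  case (Cons D C)
  have fD: "finite (edges D)" using Cons by simp
  define c where "c = (\<lambda>s. \<Sum>e | e \<in> edges D \<and> edge_path \<Sigma> (stratum D) e = s. of_int (weight D e) *\<^sub>R dir e)"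
  have split: "curve_chain \<Sigma> (D # C) = (\<lambda>s. c s + curve_chain \<Sigma> C s)"
    by (intro ext) (simp add: curve_chain_def c_def)
  have fc: "finite {s. c s \<noteq> 0}" unfolding c_def by (rule chain_form_mass(2)[of L, OF L fD])
  have cf: "chain_form L c = (\<Sum>e\<in>edges D. of_int (weight D e) * edge_form L (edge_path \<Sigma> (stratum D) e) (dir e))"
    unfolding c_def chain_form_mass(1)[of L, OF L fD] by (simp add: linear_cmul[OF linear_edge_form[OF L]])
  have IH: "chain_form L (curve_chain \<Sigma> C) = (\<Sum>D\<leftarrow>C. \<Sum>e\<in>edges D. of_int (weight D e) * edge_form L (edge_path \<Sigma> (stratum D) e) (dir e))"
    "finite {s. curve_chain \<Sigma> C s \<noteq> 0}" using Cons by auto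
  have "finite {s. c s + curve_chain \<Sigma> C s \<noteq> 0}"
    by (rule finite_subset[of _ "{s. c s \<noteq> 0} \<union> {s. curve_chain \<Sigma> C s \<noteq> 0}"]) (use fc IH(2) in auto)
  then show ?case unfolding split using chain_form_add[of L, OF L fc IH(2)] cf IH(1) by simp
qed

text \<open>Here \<open>u\<close> is the barycentric coordinate that vanishes at the point at
  infinity and \<open>c\<close> the slope of a form along the ray. Near \<open>u = 0\<close> the
  function is continuous as the inverse of one tending to 0, elsewhere as a quotient.\<close>

lemma continuous_ray_coordinate:
  assumes c: "c > 0"
  shows "continuous_on {0..1} (\<lambda>u::real. if u \<noteq> 0 then ennreal ((1 - u) / u * c) else \<infinity>)"
proof -
  let ?k = "\<lambda>u::real. if u \<noteq> 0 then ennreal ((1 - u) / u * c) else \<infinity>"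
  have "continuous_on {0..1/2} (\<lambda>u. inverse (ennreal (u / ((1 - u) * c))))"
    using c by (intro continuous_on_inverse_ennreal continuous_on_ennreal continuous_intros) auto
  moreover have "inverse (ennreal (u / ((1 - u) * c))) = ?k u" if "u \<in> {0..1/2}" for u
  proof (cases "u = 0")
    case False
    then have "0 < u / ((1 - u) * c)" using that c by simp
    then have "inverse (ennreal (u / ((1 - u) * c))) = ennreal (inverse (u / ((1 - u) * c)))" by (rule inverse_ennreal)
    then show ?thesis using False by simp
  qed simp
  ultimately have 1: "continuous_on {0..1/2} ?k" by (rule continuous_on_eq)
  have "continuous_on {1/2..1} (\<lambda>u. ennreal ((1 - u) / u * c))"
    by (intro continuous_on_ennreal continuous_intros) auto
  moreover have "ennreal ((1 - u) / u * c) = ?k u" if "u \<in> {1/2..1}" for u using that by auto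
  ultimately have 2: "continuous_on {1/2..1} ?k" by (rule continuous_on_eq)
  have "continuous_on ({0..1/2} \<union> {1/2..1}) ?k"
    by (rule continuous_on_closed_Un[OF _ _ 1 2]) simp_all
  moreover have "{0..1/2} \<union> {1/2..1} = {0..1::real}" by auto
  ultimately show ?thesis by simp
qed

text \<open>Continuity is tested on each \<open>m\<close> in the dual cone of
  \<open>\<sigma>\<close>. If \<open>m\<close> is not zero on \<open>\<tau>\<close>, the value is
  constantly \<infinity>; if it vanishes on \<open>\<sigma>\<close>, constantly 0; otherwise it
  grows linearly along the ray and reaches \<infinity> at its end.\<close>

lemma strat_simplex_ray:
  assumes c: "(\<tau>, \<sigma>) \<in> cubes_dim \<Sigma> 1"
  shows "strat_simplex \<Sigma> 1 (edge_path \<Sigma> \<tau> (Edge 0 (edge_gen N \<tau> \<sigma>) \<infinity>))" (is "strat_simplex \<Sigma> 1 ?s")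
proof -
  have S: "\<tau> \<in> \<Sigma>" "\<sigma> \<in> \<Sigma>" "\<tau> \<subseteq> \<sigma>" using c by (auto simp: cubes_dim_iff)
  let ?u = "edge_gen N \<tau> \<sigma>"
  let ?X = "subtopology (powertop_real UNIV) (standard_simplex 1)"
  have u1: "?u \<in> rel_interior (qproj \<tau> ` \<sigma>)" using edge_gen_relint[OF c, of 1] by simp
  have sx: "?s x = (if x 0 \<noteq> 0 then (\<tau>, (x 1 / x 0) *\<^sub>R ?u) else (\<sigma>, 0))" if "x \<in> standard_simplex 1" for x
    using edge_path_ray[OF S _ _ that, of "Edge 0 ?u \<infinity>"] u1 by simp
  obtain y where y: "y \<in> \<sigma>" "?u = qproj \<tau> y" using u1 rel_interior_subset by blast
  have cl: "?s x \<in> cone_closure \<sigma>" if x: "x \<in> standard_simplex 1" for x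
  proof (cases "x 0 \<noteq> 0")
    case True
    have "0 \<le> x 1 / x 0" using x by (simp add: standard_simplex_def)
    then have "(x 1 / x 0) *\<^sub>R y \<in> \<sigma>" using convex_cone_scaleR[OF convex_cone_cone[OF S(2)]] y(1) by blast
    moreover have "(x 1 / x 0) *\<^sub>R ?u = qproj \<tau> ((x 1 / x 0) *\<^sub>R y)" using y(2) by (simp add: linear_cmul[OF linear_qproj])
    ultimately show ?thesis using True sx[OF x] cface_iff[OF S(1,2)] S(3) by (auto simp: cone_closure_def)
  next
    case False
    have "0 \<in> qproj \<sigma> ` \<sigma>" using zero_in_cone[OF S(2)] by (auto intro!: image_eqI[of _ _ 0])
    then show ?thesis using False sx[OF x] cface_iff[OF S(2,2)] by (simp add: cone_closure_def)
  qed
  have coord: "continuous_map ?X euclidean (\<lambda>x. point_eval (?s x) m)" if m: "m \<in> dual_cone \<sigma>" for m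
  proof -
    have muy: "m \<bullet> ?u = m \<bullet> y" if "\<forall>t\<in>\<tau>. m \<bullet> t = 0"
    proof -
      have lin: "linear (\<lambda>x. m \<bullet> x)" by (rule bounded_linear.linear[OF bounded_linear_inner_right])
      show ?thesis unfolding y(2) by (rule linear_qproj_invariant[OF lin]) (use that in blast)
    qed
    have my: "0 \<le> m \<bullet> y" using m y(1) by (simp add: dual_cone_def)
    \<comment> \<open>The image of \<open>\<sigma>\<close> in the quotient is the half-line through
      \<open>?u\<close>. So a form vanishing on \<open>\<tau>\<close> and at \<open>?u\<close>
      vanishes on \<open>\<sigma>\<close> and has value 0, not \<infinity>, at the end of the
      ray.\<close>
    have ms: "\<forall>t\<in>\<sigma>. m \<bullet> t = 0" if mt: "\<forall>t\<in>\<tau>. m \<bullet> t = 0" and mu: "m \<bullet> ?u = 0"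
    proof
      fix t assume t: "t \<in> \<sigma>"
      have lin: "linear (\<lambda>x. m \<bullet> x)" by (rule bounded_linear.linear[OF bounded_linear_inner_right])
      obtain v where v: "v \<notin> gens \<tau>" "gens \<sigma> = insert v (gens \<tau>)" using edge_cubeD[OF c] by (elim exE conjE) (rule that)
      obtain r where "qproj \<tau> t = r *\<^sub>R qproj \<tau> v"
        using edge_gen_vert(3)[OF c v(2,1)] t by blast
      moreover obtain a where a: "a > 0" "?u = a *\<^sub>R qproj \<tau> v"
        using edge_gen_vert(1)[OF c v(2,1)] by (elim exE conjE) (rule that)
      ultimately have "m \<bullet> qproj \<tau> t = 0" using mu by simp
      then show "m \<bullet> t = 0" using linear_qproj_invariant[OF lin, of \<tau> t] mt by simp
    qed
    have const: "continuous_map ?X euclidean (\<lambda>_. k)" for k :: ennreal by simp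
    show ?thesis
    proof (cases "\<forall>t\<in>\<tau>. m \<bullet> t = 0")
      case False
      then have "\<not> (\<forall>t\<in>\<sigma>. m \<bullet> t = 0)" using S(3) by blast
      then have "point_eval (?s x) m = \<infinity>" if "x \<in> topspace ?X" for x
        using False sx[of x] that by auto
      then show ?thesis using continuous_map_eq[OF const, of \<infinity> "\<lambda>x. point_eval (?s x) m"]
        by auto
    next
      case True
      note mt = True
      show ?thesis
      proof (cases "m \<bullet> ?u = 0")
        case True
        then have "point_eval (?s x) m = 0" if "x \<in> topspace ?X" for x
          using mt ms[OF mt True] sx[of x] that by auto
        then show ?thesis using continuous_map_eq[OF const, of 0 "\<lambda>x. point_eval (?s x) m"]
          by auto
      next
        case False
        define d where "d = m \<bullet> ?u"
        have d: "d > 0" using my muy[OF mt] False by (simp add: d_def)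
        let ?k = "\<lambda>u::real. if u \<noteq> 0 then ennreal ((1 - u) / u * d) else \<infinity>"
        have "continuous_map ?X (top_of_set {0..1}) (\<lambda>x. x 0)"
        proof (rule continuous_map_into_subtopology)
          show "continuous_map ?X euclideanreal (\<lambda>x. x 0)"
            by (rule continuous_map_from_subtopology[OF continuous_map_product_projection]) simp
          show "(\<lambda>x. x 0) \<in> topspace ?X \<rightarrow> {0..1}" by (auto simp: standard_simplex_def)
        qed
        moreover have "continuous_map (top_of_set {0..1}) euclidean ?k" using continuous_ray_coordinate[OF d] by simp
        ultimately have "continuous_map ?X euclidean (?k \<circ> (\<lambda>x. x 0))" by (rule continuous_map_compose)
        moreover have "(?k \<circ> (\<lambda>x. x 0)) x = point_eval (?s x) m" if "x \<in> topspace ?X" for x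
        proof -
          have x: "x \<in> standard_simplex 1" using that by simp
          then have x1: "x 1 = 1 - x 0" by (simp add: standard_simplex_def)
          have "\<not> (\<forall>t\<in>\<sigma>. m \<bullet> t = 0)" using y(1) d muy[OF mt] by (intro notI) (simp add: d_def)
          then have "(\<forall>t\<in>\<sigma>. m \<bullet> t = 0) = False" by blast
          then show ?thesis using mt x1 by (simp only: sx[OF x] point_eval.simps o_apply d_def split: if_split) simp
        qed
        ultimately show ?thesis by (rule continuous_map_eq)
      qed
    qed
  qed
  have cc: "continuous_map ?X (cone_closure_topology \<sigma>) ?s"
    unfolding cone_closure_topology_def
  proof (rule continuous_map_pullback')
    show "continuous_map ?X (product_topology (\<lambda>_. euclidean) (dual_cone \<sigma>))
        ((\<lambda>p. \<lambda>m\<in>dual_cone \<sigma>. point_eval p m) \<circ> ?s)"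
      unfolding continuous_map_componentwise
      using coord by auto
    show "topspace ?X \<subseteq> ?s -` cone_closure \<sigma>" using cl by auto
  qed
  have cont: "continuous_map ?X (compactification \<Sigma>) ?s"
    unfolding continuous_map_def
  proof (intro conjI allI impI)
    have "openin (compactification \<Sigma>) (\<Union>\<sigma>\<in>\<Sigma>. cone_closure \<sigma>)"
      unfolding openin_compactification
    proof (intro conjI ballI)
      fix \<kappa> assume "\<kappa> \<in> \<Sigma>"
      then have "(\<Union>\<sigma>\<in>\<Sigma>. cone_closure \<sigma>) \<inter> cone_closure \<kappa> = topspace (cone_closure_topology \<kappa>)"
        by (auto simp: topspace_cone_closure)
      then show "openin (cone_closure_topology \<kappa>) ((\<Union>\<sigma>\<in>\<Sigma>. cone_closure \<sigma>) \<inter> cone_closure \<kappa>)"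
        by (metis openin_topspace)
    qed simp
    then have "(\<Union>\<sigma>\<in>\<Sigma>. cone_closure \<sigma>) \<subseteq> topspace (compactification \<Sigma>)" by (rule openin_subset)
    then show "?s \<in> topspace ?X \<rightarrow> topspace (compactification \<Sigma>)" using cl S(2) by auto
    fix U assume "openin (compactification \<Sigma>) U"
    then have "openin (cone_closure_topology \<sigma>) (U \<inter> cone_closure \<sigma>)" using S(2) openin_compactification by blast
    then have "openin ?X {x \<in> topspace ?X. ?s x \<in> U \<inter> cone_closure \<sigma>}"
      by (rule openin_continuous_map_preimage[OF cc])
    moreover have "{x \<in> topspace ?X. ?s x \<in> U \<inter> cone_closure \<sigma>} = {x \<in> topspace ?X. ?s x \<in> U}" using cl by auto
    ultimately show "openin ?X {x \<in> topspace ?X. ?s x \<in> U}" by simp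
  qed
  show ?thesis unfolding strat_simplex_def singular_simplex_def
  proof (intro conjI allI impI)
    show "continuous_map ?X (compactification \<Sigma>) ?s" by (rule cont)
    show "?s \<in> extensional (standard_simplex 1)" by (simp add: edge_path_def)
    fix J :: "nat set" assume J: "J \<noteq> {} \<and> J \<subseteq> {..1}"
    have sub: "J \<subseteq> {0, 1}" "J \<noteq> {}"
      using J by (auto simp: subset_iff le_Suc_eq)
    have "J = {0} \<or> J = {1} \<or> J = {0, 1}"
      using sub by (cases "0 \<in> J"; cases "1 \<in> J") auto
    then consider "J = {0}" | "J = {1}" | "J = {0, 1}" by (elim disjE)
    then show "\<exists>\<delta>\<in>cubes \<Sigma>. ?s ` open_face 1 J \<subseteq> open_cube \<delta>"
    proof cases
      case 1
      have "?s x \<in> open_cube (\<tau>, \<tau>)" if x: "x \<in> open_face 1 J" for x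
      proof -
        have "x \<in> standard_simplex 1" "x 0 \<noteq> 0" "x 1 = 0" using x 1 by (auto simp: open_face_def)
        then show ?thesis using sx[of x] zero_relint[OF S(1)] by simp
      qed
      then show ?thesis using S(1) by (intro bexI[of _ "(\<tau>, \<tau>)"]) (auto simp: cubes_iff simp del: open_cube.simps)
    next
      case 2
      have "?s x \<in> open_cube (\<sigma>, \<sigma>)" if x: "x \<in> open_face 1 J" for x
      proof -
        have "x \<in> standard_simplex 1" "x 0 = 0" using x 2 by (auto simp: open_face_def)
        then show ?thesis using sx[of x] zero_relint[OF S(2)] by simp
      qed
      then show ?thesis using S(2) by (intro bexI[of _ "(\<sigma>, \<sigma>)"]) (auto simp: cubes_iff simp del: open_cube.simps)
    next
      case 3
      have "?s x \<in> open_cube (\<tau>, \<sigma>)" if x: "x \<in> open_face 1 J" for x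
      proof -
        have xs: "x \<in> standard_simplex 1" "x 0 \<noteq> 0" "x 1 \<noteq> 0" using x 3 by (auto simp: open_face_def)
        then have "0 < x 0" "0 < x 1" by (auto simp: standard_simplex_def less_le)
        then have "0 < x 1 / x 0" by simp
        then show ?thesis using sx[OF xs(1)] xs(2) edge_gen_relint[OF c] by simp
      qed
      then show ?thesis using S by (intro bexI[of _ "(\<tau>, \<sigma>)"]) (auto simp: cubes_iff simp del: open_cube.simps)
    qed
  qed
qed

end

section \<open>Gordan's theorem over the rationals\<close>

text \<open>Induction on \<open>I\<close>. A function in \<open>F\<close> positive on the smaller
  index set is perturbed if its value at the new index \<open>j\<close> is 0. If that value is
  negative, the functions vanishing at \<open>j\<close> are considered, and a relation among them is
  completed by a weight at \<open>j\<close>.\<close>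

theorem gordan:
  fixes F :: "('i \<Rightarrow> rat) set"
  assumes "finite I"
    and "\<And>\<phi> \<psi>. \<phi> \<in> F \<Longrightarrow> \<psi> \<in> F \<Longrightarrow> (\<lambda>i. \<phi> i + \<psi> i) \<in> F"
    and "\<And>\<phi> c. \<phi> \<in> F \<Longrightarrow> (\<lambda>i. c * \<phi> i) \<in> F"
    and "F \<noteq> {}"
  shows "(\<exists>\<phi>\<in>F. \<forall>i\<in>I. 0 < \<phi> i) \<or>
    (\<exists>w. (\<forall>i\<in>I. 0 \<le> w i) \<and> (\<exists>i\<in>I. 0 < w i) \<and> (\<forall>\<phi>\<in>F. (\<Sum>i\<in>I. w i * \<phi> i) = 0))"
  using assms
proof (induction I arbitrary: F rule: finite_induct)
  case empty
  then show ?case by auto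
next
  case (insert j I)
  note add = insert.prems(1) and scale = insert.prems(2)
  have perturb: "\<exists>\<epsilon>>0. \<forall>i\<in>I. 0 < \<phi> i + \<epsilon> * \<psi> i" if pos: "\<forall>i\<in>I. 0 < \<phi> i" for \<phi> \<psi> :: "'i \<Rightarrow> rat"
  proof -
    \<comment> \<open>Small enough that \<open>\<epsilon> * \<bar>\<psi> i\<bar> < \<phi> i\<close>
      on \<open>I\<close>; the summand 1 makes this strict and the denominators positive, the
      inserted 1 covers empty \<open>I\<close>.\<close>
    define \<epsilon> where "\<epsilon> = Min (insert 1 ((\<lambda>i. \<phi> i / (1 + \<bar>\<psi> i\<bar>)) ` I))"
    have "\<epsilon> > 0" unfolding \<epsilon>_def using insert.hyps(1) pos by (auto simp: add_pos_nonneg)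
    moreover have "0 < \<phi> i + \<epsilon> * \<psi> i" if i: "i \<in> I" for i
    proof -
      have "\<epsilon> \<le> \<phi> i / (1 + \<bar>\<psi> i\<bar>)" unfolding \<epsilon>_def using insert.hyps(1) i by simp
      then have "\<epsilon> * (1 + \<bar>\<psi> i\<bar>) \<le> \<phi> i" by (simp add: pos_le_divide_eq add_pos_nonneg)
      moreover have "\<epsilon> * \<psi> i \<ge> - (\<epsilon> * \<bar>\<psi> i\<bar>)"
        using \<open>\<epsilon> > 0\<close> by (metis abs_ge_minus_self minus_le_iff mult_left_mono mult_minus_right less_imp_le)
      ultimately show ?thesis using \<open>\<epsilon> > 0\<close> by (simp add: algebra_simps)
    qed
    ultimately show ?thesis by blast
  qed
  show ?case
  proof (cases "\<exists>\<phi>\<in>F. \<forall>i\<in>I. 0 < \<phi> i")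
    case False
    then obtain w where w: "\<forall>i\<in>I. 0 \<le> w i" "\<exists>i\<in>I. 0 < w i" "\<forall>\<phi>\<in>F. (\<Sum>i\<in>I. w i * \<phi> i) = 0"
      using insert.IH[OF add scale insert.prems(3)] by blast
    define w' where "w' = w(j := 0)"
    have "(\<Sum>i\<in>insert j I. w' i * \<phi> i) = (\<Sum>i\<in>I. w i * \<phi> i)" for \<phi>
      using insert.hyps by (simp add: w'_def) (intro sum.cong, auto)
    then have "\<forall>\<phi>\<in>F. (\<Sum>i\<in>insert j I. w' i * \<phi> i) = 0" using w(3) by simp
    moreover have "\<forall>i\<in>insert j I. 0 \<le> w' i" "\<exists>i\<in>insert j I. 0 < w' i" using w(1,2) insert.hyps by (auto simp: w'_def)
    ultimately show ?thesis by blast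
  next
    case True
    then obtain \<phi> where \<phi>: "\<phi> \<in> F" "\<forall>i\<in>I. 0 < \<phi> i" by blast
    consider "\<phi> j > 0" | "\<phi> j = 0" | "\<phi> j < 0" by linarith
    then show ?thesis
    proof cases
      case 1
      then show ?thesis using \<phi> by (intro disjI1 bexI[of _ \<phi>]) auto
    next
      case 2
      show ?thesis
      proof (cases "\<exists>\<psi>\<in>F. \<psi> j \<noteq> 0")
        case True
        then obtain \<psi>' where \<psi>': "\<psi>' \<in> F" "\<psi>' j \<noteq> 0" by blast
        \<comment> \<open>Multiplying by the value at \<open>j\<close> makes the value there a
          square, hence positive.\<close>
        define \<psi> where "\<psi> = (\<lambda>i. \<psi>' j * \<psi>' i)"
        have \<psi>: "\<psi> \<in> F" "\<psi> j > 0" using scale[OF \<psi>'(1)] \<psi>'(2) by (auto simp: \<psi>_def zero_less_mult_iff)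
        obtain \<epsilon> where e: "\<epsilon> > 0" "\<forall>i\<in>I. 0 < \<phi> i + \<epsilon> * \<psi> i" using perturb[OF \<phi>(2)] by blast
        have "(\<lambda>i. \<phi> i + \<epsilon> * \<psi> i) \<in> F" using add[OF \<phi>(1) scale[OF \<psi>(1)]] .
        moreover have "\<forall>i\<in>insert j I. 0 < \<phi> i + \<epsilon> * \<psi> i" using e \<psi>(2) 2 by simp
        ultimately show ?thesis by (intro disjI1 bexI[of _ "\<lambda>i. \<phi> i + \<epsilon> * \<psi> i"])
      next
        case False
        define w where "w = (\<lambda>i. if i = j then 1 else (0::rat))"
        have "(\<Sum>i\<in>insert j I. w i * \<psi> i) = \<psi> j" for \<psi>
          using insert.hyps by (simp add: w_def) (intro sum.neutral, auto)
        then have "\<forall>\<psi>\<in>F. (\<Sum>i\<in>insert j I. w i * \<psi> i) = 0" using False by simp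
        moreover have "\<forall>i\<in>insert j I. 0 \<le> w i" "\<exists>i\<in>insert j I. 0 < w i" by (auto simp: w_def)
        ultimately show ?thesis by blast
      qed
    next
      case 3
      define F' where "F' = {\<psi> \<in> F. \<psi> j = 0}"
      have "(\<lambda>i. 0 * \<phi> i) \<in> F" by (rule scale[OF \<phi>(1)])
      then have "(\<lambda>i. 0 * \<phi> i) \<in> F'" by (simp add: F'_def)
      then have F': "F' \<noteq> {}" by blast
      have "(\<exists>\<psi>\<in>F'. \<forall>i\<in>I. 0 < \<psi> i) \<or>
        (\<exists>w. (\<forall>i\<in>I. 0 \<le> w i) \<and> (\<exists>i\<in>I. 0 < w i) \<and> (\<forall>\<psi>\<in>F'. (\<Sum>i\<in>I. w i * \<psi> i) = 0))"
        by (rule insert.IH[OF _ _ F']) (use add scale in \<open>auto simp: F'_def\<close>)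
      then show ?thesis
      proof
        assume "\<exists>\<psi>\<in>F'. \<forall>i\<in>I. 0 < \<psi> i"
        then obtain \<psi> where \<psi>: "\<psi> \<in> F" "\<psi> j = 0" "\<forall>i\<in>I. 0 < \<psi> i" by (auto simp: F'_def)
        obtain \<epsilon> where e: "\<epsilon> > 0" "\<forall>i\<in>I. 0 < \<psi> i + \<epsilon> * ((-1) * \<phi> i)" using perturb[OF \<psi>(3), of "\<lambda>i. (-1) * \<phi> i"] by blast
        have "(\<lambda>i. \<psi> i + \<epsilon> * ((-1) * \<phi> i)) \<in> F" using add[OF \<psi>(1) scale[OF scale[OF \<phi>(1)]]] .
        moreover have "\<forall>i\<in>insert j I. 0 < \<psi> i + \<epsilon> * ((-1) * \<phi> i)"
          using e \<psi>(2) 3 by (simp add: mult_pos_neg)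
        ultimately show ?thesis by (intro disjI1 bexI[of _ "\<lambda>i. \<psi> i + \<epsilon> * ((-1) * \<phi> i)"])
      next
        assume "\<exists>w. (\<forall>i\<in>I. 0 \<le> w i) \<and> (\<exists>i\<in>I. 0 < w i) \<and> (\<forall>\<psi>\<in>F'. (\<Sum>i\<in>I. w i * \<psi> i) = 0)"
        then obtain w where w: "\<forall>i\<in>I. 0 \<le> w i" "\<exists>i\<in>I. 0 < w i" "\<And>\<psi>. \<psi> \<in> F' \<Longrightarrow> (\<Sum>i\<in>I. w i * \<psi> i) = 0" by blast
        define s where "s = (\<Sum>i\<in>I. w i * \<phi> i)"
        have s: "s \<ge> 0" unfolding s_def using w(1) \<phi>(2) by (intro sum_nonneg) (simp add: less_imp_le)
        \<comment> \<open>The weight at \<open>j\<close> is forced by the relation for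
          \<open>\<phi>\<close> itself; it is nonnegative since \<open>s \<ge> 0\<close> and
          \<open>\<phi> j < 0\<close>.\<close>
        define w' where "w' = w(j := - s / \<phi> j)"
        have wj: "0 \<le> w' j" using s 3 by (simp add: w'_def divide_nonneg_neg)
        have "(\<Sum>i\<in>insert j I. w' i * \<psi> i) = 0" if \<psi>: "\<psi> \<in> F" for \<psi>
        proof -
          \<comment> \<open>Subtracting this multiple of \<open>\<phi>\<close> makes the value at
            \<open>j\<close> zero, so the relation on \<open>F'\<close> applies.\<close>
          define c where "c = \<psi> j / \<phi> j"
          have "(\<lambda>i. \<psi> i + (- c) * \<phi> i) \<in> F" using add[OF \<psi> scale[OF \<phi>(1)]] .
          then have "(\<lambda>i. \<psi> i + (- c) * \<phi> i) \<in> F'" using 3 by (simp add: F'_def c_def)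
          then have "(\<Sum>i\<in>I. w i * (\<psi> i + (- c) * \<phi> i)) = 0" by (rule w(3))
          moreover have "(\<Sum>i\<in>I. w i * (\<psi> i + (- c) * \<phi> i)) = (\<Sum>i\<in>I. w i * \<psi> i) - c * s"
            unfolding s_def by (simp add: sum_distrib_left sum_subtractf[symmetric] algebra_simps)
          ultimately have "(\<Sum>i\<in>I. w i * \<psi> i) = c * s" by simp
          moreover have "(\<Sum>i\<in>insert j I. w' i * \<psi> i) = w' j * \<psi> j + (\<Sum>i\<in>I. w i * \<psi> i)"
            using insert.hyps by (simp add: w'_def) (intro sum.cong, auto)
          ultimately show ?thesis using 3 by (simp add: w'_def c_def)
        qed
        moreover have "\<forall>i\<in>insert j I. 0 \<le> w' i" using w(1) wj by (auto simp: w'_def)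
        moreover have "\<exists>i\<in>insert j I. 0 < w' i" using w(2) insert.hyps by (auto simp: w'_def)
        ultimately show ?thesis by blast
      qed
    qed
  qed
qed

lemma clear_denominators:
  fixes w :: "'i \<Rightarrow> rat"
  assumes "finite I" "\<And>i. i \<in> I \<Longrightarrow> 0 \<le> w i"
  shows "\<exists>(d::int) W. d > 0 \<and> (\<forall>i\<in>I. of_int (W i) = of_int d * w i \<and> (0::int) \<le> W i)"
  using assms
proof (induction I rule: finite_induct)
  case empty
  then show ?case by (intro exI[of _ 1]) simp
next
  case (insert j I)
  then obtain d W where d: "d > 0" "\<forall>i\<in>I. of_int (W i) = of_int d * w i \<and> (0::int) \<le> W i" by auto
  obtain a b where q: "quotient_of (w j) = (a, b)" by (cases "quotient_of (w j)")
  have ab: "b > 0" "w j = of_int a / of_int b" using quotient_of_denom_pos[OF q] quotient_of_div[OF q] by auto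
  have a0: "0 \<le> a"
  proof (rule ccontr)
    assume "\<not> 0 \<le> a"
    then have "w j < 0" using ab by (simp add: divide_neg_pos)
    then show False using insert.prems[of j] by simp
  qed
  define W' where "W' = (\<lambda>i. if i = j then d * a else b * W i)"
  have "of_int (W' i) = of_int (d * b) * w i \<and> 0 \<le> W' i" if "i \<in> insert j I" for i
    using that d ab a0 by (auto simp: W'_def)
  moreover have "d * b > 0" using d ab by simp
  ultimately show ?case by blast
qed

context oriented_fan
begin

section \<open>Ample classes are positive on effective curves\<close>

lemma conewise_value:
  assumes x: "local_functionals x L" and f: "conewise_linear \<Sigma> f"
    and fx: "\<forall>\<rho>\<in>rays \<Sigma>. f (ray_gen N \<rho>) = real_of_rat (x \<rho>)" and s: "\<sigma> \<in> \<Sigma>" "y \<in> \<sigma>"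
  shows "f y = L \<sigma> y"
proof -
  obtain l where l: "linear l" "\<forall>y\<in>\<sigma>. f y = l y" using f s(1) unfolding conewise_linear_def by blast
  have "y \<in> span (gens \<sigma>)" using span_gens[OF s(1)] span_base[OF s(2)] by simp
  then have "l y = L \<sigma> y"
  proof (rule linear_eq_on_span[OF l(1) local_linear[OF x s(1)], rotated])
    fix w assume "w \<in> gens \<sigma>"
    then obtain \<rho> where \<rho>: "\<rho> \<in> rays \<Sigma>" "w = ray_gen N \<rho>" "w \<in> \<sigma>" by (auto simp: gens_def verts_def)
    then have "L \<sigma> w = real_of_rat (x \<rho>)" using local_gens[OF x s(1) \<rho>(1)] by simp
    moreover have "l w = f w" using l(2) \<rho>(3) by simp
    ultimately show "l w = L \<sigma> w" using fx \<rho>(1,2) by simp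
  qed
  then show ?thesis using l(2) s(2) by simp
qed

lemma closed_star_cone: "\<tau> \<in> \<Sigma> \<Longrightarrow> \<sigma> \<in> \<Sigma> \<Longrightarrow> \<tau> \<subseteq> \<sigma> \<Longrightarrow> closed (qproj \<tau> ` \<sigma>)"
  using star_gens(3) closed_convex_cone_hull finite_gens by (metis finite_Diff finite_imageI)

text \<open>The interior of the edge lies in one open cube, so its points lie in one closed cone;
  those at parameter \<open>t\<close>, divided by \<open>t\<close>, tend to \<open>dir e\<close>.
  Thus \<open>dir e\<close> is in this cone and in the relative interior of one of its
  faces.\<close>

lemma ray_end_cone:
  assumes st: "strat_simplex \<Sigma> 1 (edge_path \<Sigma> \<tau> e)" and len: "len e = \<infinity>"
  shows "\<exists>\<eta>\<in>\<Sigma>. \<tau> \<subseteq> \<eta> \<and> dir e \<in> rel_interior (qproj \<tau> ` \<eta>)"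
proof -
  obtain \<delta> where d: "\<delta> \<in> cubes \<Sigma>" "edge_path \<Sigma> \<tau> e ` open_face 1 {..1} \<subseteq> open_cube \<delta>"
    using strat_simplex_cube[OF st, of "{..1}"] by auto
  obtain \<tau>' \<sigma> where ts: "\<delta> = (\<tau>', \<sigma>)" by (cases \<delta>)
  have val: "(\<tau>, base e + t *\<^sub>R dir e) \<in> open_cube \<delta>" if t: "t > 0" for t
  proof -
    \<comment> \<open>With second coordinate \<open>t / (1 + t)\<close> the quotient of the two
      barycentric coordinates is \<open>t\<close>.\<close>
    have u: "0 < t / (1 + t)" "t / (1 + t) < 1" using t by auto
    have "seg (t / (1 + t)) \<in> standard_simplex 1" using u by (intro seg_in_simplex) auto
    moreover have "1 - t / (1 + t) = 1 / (1 + t)" using t by (simp add: field_simps)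
    ultimately have "edge_path \<Sigma> \<tau> e (seg (t / (1 + t))) = (\<tau>, base e + t *\<^sub>R dir e)"
      using t len by (simp add: edge_path_def seg_def)
    then show ?thesis using d(2) seg_open_face[OF u] by (metis image_subset_iff)
  qed
  have \<tau>': "\<tau>' = \<tau>" using val[of 1] ts by simp
  have S: "\<tau> \<in> \<Sigma>" "\<sigma> \<in> \<Sigma>" "\<tau> \<subseteq> \<sigma>" using d(1) ts \<tau>' by (auto simp: cubes_iff)
  let ?K = "qproj \<tau> ` \<sigma>"
  have inK: "base e + t *\<^sub>R dir e \<in> ?K" if "t > 0" for t
    using val[OF that] ts \<tau>' rel_interior_subset by auto
  have cone: "convex_cone ?K" by (rule convex_cone_linear_image[OF conjI[OF convex_cone_cone[OF S(2)] linear_qproj]])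
  have seq: "(1 / real (Suc n)) *\<^sub>R base e + dir e \<in> ?K" for n
  proof -
    have "(1 / real (Suc n)) *\<^sub>R (base e + real (Suc n) *\<^sub>R dir e) \<in> ?K"
      using convex_cone_scaleR[OF cone] inK[of "real (Suc n)"] by simp
    then show ?thesis by (simp add: scaleR_right_distrib)
  qed
  have "(\<lambda>n. (1 / real (Suc n)) *\<^sub>R base e + dir e) \<longlonglongrightarrow> 0 *\<^sub>R base e + dir e"
    by (intro tendsto_intros LIMSEQ_Suc[OF lim_1_over_n])
  then have "dir e \<in> ?K" using closed_sequentially[OF closed_star_cone[OF S] seq] by simp
  then show ?thesis using star_relint_exists[OF S] by metis
qed

text \<open>Summed over all vertices, the balancing conditions count a bounded edge twice with
  opposite signs and an unbounded edge once.\<close>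

lemma balanced_sum_rays:
  assumes bal: "balanced D" and fin: "finite (edges D)"
  shows "(\<Sum>e | e \<in> edges D \<and> len e = \<infinity>. of_int (weight D e) *\<^sub>R dir e) = 0"
proof -
  let ?E = "edges D" and ?B = "{e \<in> edges D. len e \<noteq> \<infinity>}"
  let ?w = "\<lambda>e. of_int (weight D e) *\<^sub>R dir e"
  define P where "P = base ` ?E \<union> edge_end ` ?E"
  have finP: "finite P" using fin by (simp add: P_def)
  have b: "(\<Sum>e | e \<in> ?E \<and> base e = p. ?w e) - (\<Sum>e | e \<in> ?B \<and> edge_end e = p. ?w e) = 0" for p
    using bal[unfolded balanced_def, rule_format, of p] by (simp add: sum_negf conj_assoc)
  have "(\<Sum>p\<in>P. (\<Sum>e | e \<in> ?E \<and> base e = p. ?w e)) = (\<Sum>e\<in>?E. ?w e)"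
    by (rule sum.group[OF fin finP]) (auto simp: P_def)
  moreover have "(\<Sum>p\<in>P. (\<Sum>e | e \<in> ?B \<and> edge_end e = p. ?w e)) = (\<Sum>e\<in>?B. ?w e)"
    by (rule sum.group[OF _ finP]) (use fin in \<open>auto simp: P_def\<close>)
  moreover have "(\<Sum>p\<in>P. (\<Sum>e | e \<in> ?E \<and> base e = p. ?w e) - (\<Sum>e | e \<in> ?B \<and> edge_end e = p. ?w e)) = 0"
    by (simp only: b sum.neutral_const)
  ultimately have "(\<Sum>e\<in>?E. ?w e) - (\<Sum>e\<in>?B. ?w e) = 0" by (simp only: sum_subtractf)
  moreover have "(\<Sum>e\<in>?E. ?w e) = (\<Sum>e\<in>?E - ?B. ?w e) + (\<Sum>e\<in>?B. ?w e)"
    by (rule sum.subset_diff) (use fin in auto)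
  moreover have "?E - ?B = {e \<in> ?E. len e = \<infinity>}" by auto
  ultimately show ?thesis by simp
qed

text \<open>If all edges were bounded, pairing the balancing condition at each vertex
  \<open>p\<close> with \<open>p\<close> itself and summing would show that the total of weight
  times length times squared norm of the direction is 0, although each term is positive.\<close>

lemma effective_has_ray:
  assumes bal: "balanced D" and fin: "finite (edges D)" "edges D \<noteq> {}"
    and pos: "\<And>e. e \<in> edges D \<Longrightarrow> 0 < weight D e \<and> 0 < len e \<and> dir e \<noteq> 0"
  shows "\<exists>e\<in>edges D. len e = \<infinity>"
proof (rule ccontr)
  assume n: "\<not> ?thesis"
  let ?E = "edges D"
  let ?w = "\<lambda>e. of_int (weight D e) *\<^sub>R dir e"
  define P where "P = base ` ?E \<union> edge_end ` ?E"
  have finP: "finite P" using fin by (simp add: P_def)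
  have b: "(\<Sum>e | e \<in> ?E \<and> base e = p. ?w e) - (\<Sum>e | e \<in> ?E \<and> edge_end e = p. ?w e) = 0" for p
  proof -
    have "{e. e \<in> ?E \<and> len e \<noteq> \<infinity> \<and> edge_end e = p} = {e. e \<in> ?E \<and> edge_end e = p}" using n by auto
    then show ?thesis using bal[unfolded balanced_def, rule_format, of p] by (simp add: sum_negf)
  qed
  have g1: "(\<Sum>p\<in>P. (\<Sum>e | e \<in> ?E \<and> base e = p. base e \<bullet> ?w e)) = (\<Sum>e\<in>?E. base e \<bullet> ?w e)"
    by (rule sum.group[OF fin(1) finP]) (auto simp: P_def)
  have g2: "(\<Sum>p\<in>P. (\<Sum>e | e \<in> ?E \<and> edge_end e = p. edge_end e \<bullet> ?w e)) = (\<Sum>e\<in>?E. edge_end e \<bullet> ?w e)"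
    by (rule sum.group[OF fin(1) finP]) (auto simp: P_def)
  have "(\<Sum>e | e \<in> ?E \<and> base e = p. base e \<bullet> ?w e) - (\<Sum>e | e \<in> ?E \<and> edge_end e = p. edge_end e \<bullet> ?w e) = 0" for p
  proof -
    have 1: "(\<Sum>e | e \<in> ?E \<and> base e = p. base e \<bullet> ?w e) = p \<bullet> (\<Sum>e | e \<in> ?E \<and> base e = p. ?w e)"
      unfolding inner_sum_right by (rule sum.cong) auto
    have 2: "(\<Sum>e | e \<in> ?E \<and> edge_end e = p. edge_end e \<bullet> ?w e) = p \<bullet> (\<Sum>e | e \<in> ?E \<and> edge_end e = p. ?w e)"
      unfolding inner_sum_right by (rule sum.cong) auto
    show ?thesis unfolding 1 2 inner_diff_right[symmetric] b by simp
  qed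
  then have "(\<Sum>e\<in>?E. base e \<bullet> ?w e) - (\<Sum>e\<in>?E. edge_end e \<bullet> ?w e) = 0"
    unfolding g1[symmetric] g2[symmetric] sum_subtractf[symmetric] by simp
  then have "(\<Sum>e\<in>?E. edge_end e \<bullet> ?w e - base e \<bullet> ?w e) = 0" by (simp add: sum_subtractf)
  moreover have "(\<Sum>e\<in>?E. edge_end e \<bullet> ?w e - base e \<bullet> ?w e) > 0"
  proof (rule sum_pos[OF fin])
    fix e assume e: "e \<in> ?E"
    have "0 < real_of_ereal (len e)" using pos[OF e] n e by (cases "len e") auto
    moreover have "edge_end e \<bullet> ?w e - base e \<bullet> ?w e = real_of_ereal (len e) * (of_int (weight D e) * (dir e \<bullet> dir e))"
      by (simp add: edge_end_def inner_add_left algebra_simps)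
    ultimately show "0 < edge_end e \<bullet> ?w e - base e \<bullet> ?w e" using pos[OF e] by simp
  qed
  ultimately show False by simp
qed

lemma stratum_curve_positive:
  assumes lin: "\<And>\<sigma>. linear (L \<sigma>)" and L: "local_functionals x L"
    and f: "conewise_linear \<Sigma> f" "strictly_convex \<Sigma> f" and fx: "\<forall>\<rho>\<in>rays \<Sigma>. f (ray_gen N \<rho>) = real_of_rat (x \<rho>)"
    and D: "is_stratum_curve N \<Sigma> D" "\<forall>e\<in>edges D. 0 < weight D e"
    and st: "\<forall>e\<in>edges D. strat_simplex \<Sigma> 1 (edge_path \<Sigma> (stratum D) e)"
  shows "0 < (\<Sum>e\<in>edges D. of_int (weight D e) * edge_form L (edge_path \<Sigma> (stratum D) e) (dir e))"
proof -
  define \<tau> where "\<tau> = stratum D"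
  let ?E = "edges D" and ?R = "{e \<in> edges D. len e = \<infinity>}"
  have t: "\<tau> \<in> \<Sigma>" and finE: "finite ?E" and neE: "?E \<noteq> {}" and bal: "balanced D"
    and ed: "\<And>e. e \<in> ?E \<Longrightarrow> primitive (qproj \<tau> ` N) (dir e) \<and> 0 < len e"
    using D(1) by (simp_all add: is_stratum_curve_def \<tau>_def)
  have dir0: "dir e \<noteq> 0" if "e \<in> ?E" for e using ed[OF that] by (simp add: primitive_def)
  obtain l where l: "linear l" "\<And>y. y \<in> \<tau> \<Longrightarrow> f y - l y = 0"
    "\<And>\<eta> y. \<eta> \<in> \<Sigma> \<Longrightarrow> \<tau> \<subseteq> \<eta> \<Longrightarrow> y \<in> \<eta> - \<tau> \<Longrightarrow> f y - l y > 0"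
    using f(2) t unfolding strictly_convex_def by metis
  have fL: "f y = L \<sigma> y" if "\<sigma> \<in> \<Sigma>" "y \<in> \<sigma>" for \<sigma> y by (rule conewise_value[OF L f(1) fx that])
  have ray: "edge_form L (edge_path \<Sigma> \<tau> e) (dir e) > (l (dir e) - L \<tau> (dir e))" if e: "e \<in> ?R" for e
  proof -
    obtain \<eta> where \<eta>: "\<eta> \<in> \<Sigma>" "\<tau> \<subseteq> \<eta>" "dir e \<in> rel_interior (qproj \<tau> ` \<eta>)"
      using ray_end_cone[of \<tau> e] st e by (auto simp: \<tau>_def)
    have len: "len e = \<infinity>" using e by simp
    have "edge_path \<Sigma> \<tau> e (vtx 1) = (\<eta>, qproj \<eta> (base e))"
      using edge_path_ray[OF t \<eta> len vtx_in_simplex[of 1 1]] by (simp add: vtx_def)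
    then have form: "edge_form L (edge_path \<Sigma> \<tau> e) (dir e) = L \<eta> (dir e) - L \<tau> (dir e)"
      by (simp add: edge_form_def edge_path_vtx0)
    \<comment> \<open>As \<open>dir e\<close> is nonzero, its lift \<open>y\<close> lies outside
      \<open>\<tau>\<close>, where strict convexity is strict. Since \<open>L \<eta> - l\<close>
      vanishes on \<open>\<tau>\<close>, the inequality at \<open>y\<close> passes to
      \<open>dir e\<close>.\<close>
    obtain y where y: "y \<in> \<eta>" "dir e = qproj \<tau> y" using \<eta>(3) rel_interior_subset by blast
    have "y \<notin> \<tau>"
    proof
      assume "y \<in> \<tau>"
      then have "qproj \<tau> y = 0" using span_base by (simp add: qproj_eq_0_iff)
      then show False using dir0[of e] e y(2) by simp
    qed
    then have "f y - l y > 0" using l(3)[OF \<eta>(1,2)] y(1) by blast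
    moreover have "L \<eta> (qproj \<tau> y) - l (qproj \<tau> y) = L \<eta> y - l y"
    proof (rule linear_qproj_invariant[where l = "\<lambda>v. L \<eta> v - l v"])
      show "linear (\<lambda>v. L \<eta> v - l v)" by (intro linear_compose_sub lin l(1))
      fix v assume "v \<in> \<tau>"
      then show "L \<eta> v - l v = 0" using fL[OF \<eta>(1), of v] l(2)[of v] \<eta>(2) by auto
    qed
    ultimately show ?thesis using form fL[OF \<eta>(1) y(1)] y(2) by simp
  qed
  have bnd: "edge_form L (edge_path \<Sigma> \<tau> e) (dir e) = 0" if "e \<in> ?E" "len e \<noteq> \<infinity>" for e
    using edge_path_bounded[OF that(2), of \<tau>] by (simp add: edge_form_def edge_path_vtx0)
  obtain e0 where e0: "e0 \<in> ?R" using effective_has_ray[OF bal finE neE] D(2) ed dir0 by blast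
  have "(\<Sum>e\<in>?E. of_int (weight D e) * edge_form L (edge_path \<Sigma> \<tau> e) (dir e)) =
      (\<Sum>e\<in>?R. of_int (weight D e) * edge_form L (edge_path \<Sigma> \<tau> e) (dir e))"
    using bnd finE by (intro sum.mono_neutral_right) auto
  also have "\<dots> > (\<Sum>e\<in>?R. of_int (weight D e) * (l (dir e) - L \<tau> (dir e)))"
  proof (rule sum_strict_mono)
    show "finite ?R" using finE by simp
    show "?R \<noteq> {}" using e0 by blast
    fix e assume e: "e \<in> ?R"
    then have "0 < weight D e" using D(2) by simp
    then show "of_int (weight D e) * (l (dir e) - L \<tau> (dir e)) < of_int (weight D e) * edge_form L (edge_path \<Sigma> \<tau> e) (dir e)"
      using ray[OF e] by simp
  qed
  finally have gt: "(\<Sum>e\<in>?R. of_int (weight D e) * (l (dir e) - L \<tau> (dir e))) <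
      (\<Sum>e\<in>?E. of_int (weight D e) * edge_form L (edge_path \<Sigma> \<tau> e) (dir e))" .
  have ll: "linear (\<lambda>v. l v - L \<tau> v)" by (intro linear_compose_sub lin l(1))
  have "(\<Sum>e\<in>?R. of_int (weight D e) * (l (dir e) - L \<tau> (dir e))) =
      (\<lambda>v. l v - L \<tau> v) (\<Sum>e\<in>?R. of_int (weight D e) *\<^sub>R dir e)"
    unfolding linear_sum[OF ll] by (rule sum.cong[OF refl]) (simp add: linear_cmul[OF ll])
  also have "\<dots> = 0" using balanced_sum_rays[OF bal finE] linear_0[OF ll] by simp
  finally show ?thesis using gt by (simp add: \<tau>_def)
qed

text \<open>Linearity is arranged outside \<open>\<Sigma>\<close> as well, because
  \<open>chain_form\<close> has to be additive on finite chains regardless of where the vertices of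
  the simplices lie.\<close>

lemma local_functionals_linear_exist: "\<exists>L. local_functionals x L \<and> (\<forall>\<sigma>. linear (L \<sigma>))"
proof -
  obtain L where L: "local_functionals x L" using local_functionals_exist by blast
  define L' where "L' = (\<lambda>\<sigma>. if \<sigma> \<in> \<Sigma> then L \<sigma> else (\<lambda>_. 0))"
  have "local_functionals x L'" using L zero_cone by (simp add: local_functionals_def L'_def)
  moreover have "linear (L' \<sigma>)" for \<sigma>
    by (simp add: L'_def local_linear[OF L] linear_zero)
  ultimately show ?thesis by blast
qed

text \<open>The form takes equal values on homologous chains, so the pairing may be computed on the
  edges of the curve.\<close>

lemma pairing_curve:
  assumes lin: "\<And>\<sigma>. linear (L \<sigma>)" and L: "local_functionals x L" and x: "x \<in> chow_free \<Sigma>"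
    and c: "c \<in> trop_homology11 N \<Sigma> \<nu>" "z \<in> c" and C: "tropical_curve N \<Sigma> C"
    and b: "(\<lambda>s. sing_of_trop N \<Sigma> z s - curve_chain \<Sigma> C s) \<in> sing_boundary \<Sigma> 2 ` sing_chains N \<Sigma> 2"
  shows "real_of_rat (trop_pairing \<Sigma> (cohomology_of_chow N \<Sigma> \<nu> (chow_class N \<Sigma> x)) c) =
    (\<Sum>D\<leftarrow>C. \<Sum>e\<in>edges D. of_int (weight D e) * edge_form L (edge_path \<Sigma> (stratum D) e) (dir e))"
proof -
  obtain y where y: "y \<in> sing_chains N \<Sigma> 2"
    "(\<lambda>s. sing_of_trop N \<Sigma> z s - curve_chain \<Sigma> C s) = sing_boundary \<Sigma> 2 y" using b by (rule imageE)
  have fin: "\<forall>D\<in>set C. finite (edges D)" using C by (simp add: tropical_curve_def is_stratum_curve_def)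
  note cc = chain_form_curve[of L, OF lin fin]
  note st = chain_form_sing_of_trop[of L, OF lin, of z]
  have "chain_form L (\<lambda>s. sing_of_trop N \<Sigma> z s - curve_chain \<Sigma> C s) = 0"
    unfolding y(2) by (rule chain_form_boundary[of L, OF lin L y(1)])
  then have "chain_form L (sing_of_trop N \<Sigma> z) = chain_form L (curve_chain \<Sigma> C)"
    using chain_form_diff[of L, OF lin st(2) conjunct2[OF cc]] by simp
  then show ?thesis using pairing_formula[OF L x c] st(1) cc by simp
qed

lemma ample_imp_positive:
  assumes f: "conewise_linear \<Sigma> f" "strictly_convex \<Sigma> f" and x: "x \<in> chow_free \<Sigma>"
    and fx: "\<forall>\<rho>\<in>rays \<Sigma>. f (ray_gen N \<rho>) = real_of_rat (x \<rho>)"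
    and C: "effective_curve N \<Sigma> C" and c: "is_class_of_curve N \<Sigma> \<nu> C c"
  shows "0 < trop_pairing \<Sigma> (cohomology_of_chow N \<Sigma> \<nu> (chow_class N \<Sigma> x)) c"
proof -
  obtain L where L: "local_functionals x L" and lin: "\<And>\<sigma>. linear (L \<sigma>)" using local_functionals_linear_exist by blast
  obtain C' z where c': "c \<in> trop_homology11 N \<Sigma> \<nu>" "list_all2 subdivides C' C" "tropical_curve N \<Sigma> C'"
    "\<forall>D\<in>set C'. \<forall>e\<in>edges D. strat_simplex \<Sigma> 1 (edge_path \<Sigma> (stratum D) e)" "z \<in> c"
    "(\<lambda>s. sing_of_trop N \<Sigma> z s - curve_chain \<Sigma> C' s) \<in> sing_boundary \<Sigma> 2 ` sing_chains N \<Sigma> 2"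
    using c unfolding is_class_of_curve_def by (elim exE conjE bexE) (rule that)
  \<comment> \<open>A subdividing edge carries the weight of an edge containing it, so effectiveness
    passes to the subdivision.\<close>
  have w: "\<forall>e\<in>edges D. 0 < weight D e" if D: "D \<in> set C'" for D
  proof
    fix e assume e: "e \<in> edges D"
    obtain i where i: "i < length C'" "D = C' ! i" using D by (metis in_set_conv_nth)
    have s: "subdivides D (C ! i)" using list_all2_nthD[OF c'(2) i(1)] i(2) by simp
    have Ci: "C ! i \<in> set C" using i(1) list_all2_lengthD[OF c'(2)] by simp
    have "\<forall>e\<in>edges D. \<exists>e'\<in>edges (C ! i). edge_points e \<subseteq> edge_points e' \<and> weight D e = weight (C ! i) e'"
      using s by (simp add: subdivides_def)
    from bspec[OF this e] obtain e' where "e' \<in> edges (C ! i)" "weight D e = weight (C ! i) e'" by (elim bexE conjE) (rule that)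
    then show "0 < weight D e" using C Ci by (simp add: effective_curve_def)
  qed
  let ?v = "\<lambda>D. \<Sum>e\<in>edges D. of_int (weight D e) * edge_form L (edge_path \<Sigma> (stratum D) e) (dir e)"
  have pos: "0 < ?v D" if D: "D \<in> set C'" for D
  proof (rule stratum_curve_positive[OF lin L f fx _ w[OF D]])
    show "is_stratum_curve N \<Sigma> D" using c'(3) D by (simp add: tropical_curve_def)
    show "\<forall>e\<in>edges D. strat_simplex \<Sigma> 1 (edge_path \<Sigma> (stratum D) e)" using c'(4) D by blast
  qed
  have "C' \<noteq> []" using c'(3) by (simp add: tropical_curve_def)
  moreover have "0 < (\<Sum>D\<leftarrow>Ds. ?v D)" if "Ds \<noteq> []" "set Ds \<subseteq> set C'" for Ds
    using that
  proof (induction Ds)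
    case (Cons D Ds)
    then show ?case using pos[of D] by (cases "Ds = []") (auto intro: add_pos_pos)
  qed simp
  ultimately have "0 < (\<Sum>D\<leftarrow>C'. ?v D)" by blast
  then have "0 < real_of_rat (trop_pairing \<Sigma> (cohomology_of_chow N \<Sigma> \<nu> (chow_class N \<Sigma> x)) c)"
    using pairing_curve[OF lin L x c'(1,5,3,6)] by simp
  then show ?thesis by simp
qed

section \<open>Classes positive on effective curves are ample\<close>

text \<open>The edges are the rays from 0 along the one-dimensional cones of the star fan, whose
  closures are cubes. So the curve serves as its own subdivision, and its singular chain is
  literally that of the cubical cycle \<open>z\<close>.\<close>

lemma star_curve:
  assumes s: "\<sigma> \<in> \<Sigma>" and I: "I \<subseteq> {\<eta>. (\<sigma>, \<eta>) \<in> cubes_dim \<Sigma> 1}" "I \<noteq> {}"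
    and W: "\<And>\<eta>. \<eta> \<in> I \<Longrightarrow> (0::int) < W \<eta>" and bal: "(\<Sum>\<eta>\<in>I. of_int (W \<eta>) *\<^sub>R edge_gen N \<sigma> \<eta>) = 0"
  shows "\<exists>C c z. effective_curve N \<Sigma> C \<and> is_class_of_curve N \<Sigma> \<nu> C c \<and> z \<in> c \<and>
    z = (\<lambda>\<delta>. if fst \<delta> = \<sigma> \<and> snd \<delta> \<in> I then of_int (W (snd \<delta>)) *\<^sub>R edge_gen N \<sigma> (snd \<delta>) else 0)"
proof -
  let ?u = "edge_gen N \<sigma>"
  have cI: "(\<sigma>, \<eta>) \<in> cubes_dim \<Sigma> 1" if "\<eta> \<in> I" for \<eta> using I(1) that by blast
  have SI: "\<eta> \<in> \<Sigma>" "\<sigma> \<subseteq> \<eta>" "\<sigma> \<noteq> \<eta>" if "\<eta> \<in> I" for \<eta> using cI[OF that] by (auto simp: cubes_dim_iff)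
  have finI: "finite I" by (rule finite_subset[OF subsetI[OF SI(1)] finite_fan])
  define E where "E = (\<lambda>\<eta>. Edge 0 (?u \<eta>) \<infinity>)"
  \<comment> \<open>Positive multiples of the generators lie in the disjoint relative interiors of
    different star cones, so different rays meet only at 0.\<close>
  have same: "\<eta> = \<eta>'" if h: "\<eta> \<in> I" "\<eta>' \<in> I" "t > 0" "t' > 0" "t *\<^sub>R ?u \<eta> = t' *\<^sub>R ?u \<eta>'" for \<eta> \<eta>' t t'
    using star_relint_unique[OF s SI(1,2)[OF h(1)] edge_gen_relint[OF cI[OF h(1)] h(3)] SI(1,2)[OF h(2)]]
      edge_gen_relint[OF cI[OF h(2)] h(4)] h(5) by simp
  have injE: "inj_on E I" by (rule inj_onI) (use same[of _ _ 1 1] in \<open>auto simp: E_def\<close>)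
  define D where "D = \<lparr>stratum = \<sigma>, edges = E ` I, weight = (\<lambda>e. W (the_inv_into I E e))\<rparr>"
  have wE: "weight D (E \<eta>) = W \<eta>" if "\<eta> \<in> I" for \<eta>
    using the_inv_into_f_f[OF injE that] by (simp add: D_def)
  have pts: "edge_points (E \<eta>) = {t *\<^sub>R ?u \<eta> | t. 0 \<le> t}" for \<eta> by (auto simp: edge_points_def E_def)
  \<comment> \<open>If \<open>?u \<eta>\<close> is a multiple of a vector of
    \<open>N\<^sup>\<sigma>\<close>, a lift of that vector lies in \<open>span \<eta>\<close>; hence
    the vector is in \<open>N\<^sub>\<eta> / N\<^sub>\<sigma>\<close> and is itself an integer
    multiple of \<open>?u \<eta>\<close>.\<close>
  have prim: "primitive (qproj \<sigma> ` N) (?u \<eta>)" if h: "\<eta> \<in> I" for \<eta>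
    unfolding primitive_def
  proof (intro conjI ballI allI impI)
    have "?u \<eta> \<in> qproj \<sigma> ` sublattice N \<eta>" by (rule edge_gen_lattice[OF cI[OF h]])
    then show "?u \<eta> \<in> qproj \<sigma> ` N" by (auto simp: sublattice_def)
    show u0: "?u \<eta> \<noteq> 0" by (rule edge_gen_nonzero[OF cI[OF h]])
    fix v k assume v: "v \<in> qproj \<sigma> ` N" "?u \<eta> = of_int k *\<^sub>R v"
    obtain n where n: "v = qproj \<sigma> n" "n \<in> N" using v(1) by blast
    have k: "k \<noteq> 0" using v(2) u0 by auto
    obtain y where y: "?u \<eta> = qproj \<sigma> y" "y \<in> sublattice N \<eta>" using edge_gen_lattice[OF cI[OF h]] by blast
    have "qproj \<sigma> y = qproj \<sigma> (of_int k *\<^sub>R n)" using y v n by (simp add: linear_cmul[OF linear_qproj])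
    then have yk: "y - of_int k *\<^sub>R n \<in> span \<eta>" using qproj_eq_iff span_mono[OF SI(2)[OF h]] by blast
    have "y \<in> span \<eta>" using y(2) by (simp add: sublattice_def)
    then have "y - (y - of_int k *\<^sub>R n) \<in> span \<eta>" using yk by (rule span_diff)
    then have "of_int k *\<^sub>R n \<in> span \<eta>" by simp
    then have "(1 / of_int k) *\<^sub>R (of_int k *\<^sub>R n) \<in> span \<eta>" by (rule span_scale)
    moreover have "(1 / of_int k) *\<^sub>R (of_int k *\<^sub>R n) = n" using k by simp
    ultimately have "n \<in> sublattice N \<eta>" using n(2) by (simp only: sublattice_def Int_iff)
    then have "v \<in> qproj \<sigma> ` sublattice N \<eta>" using n(1) by blast
    then obtain j :: int where j: "v = of_int j *\<^sub>R ?u \<eta>" unfolding edge_lattice[OF cI[OF h]] by blast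
    have "?u \<eta> = of_int k *\<^sub>R (of_int j *\<^sub>R ?u \<eta>)" using v(2) j by metis
    then have "(of_int (k * j) - 1 :: real) *\<^sub>R ?u \<eta> = 0" by (simp add: scaleR_left_diff_distrib)
    then have "of_int (k * j) = (1::real)" using u0 by simp
    then have "k * j = 1" by linarith
    then show "k = 1 \<or> k = -1" using zmult_eq_1_iff by auto
  qed
  have isD: "is_stratum_curve N \<Sigma> D"
    unfolding is_stratum_curve_def
  proof (intro conjI ballI impI)
    show "stratum D \<in> \<Sigma>" "finite (edges D)" "edges D \<noteq> {}" using s finI I(2) by (simp_all add: D_def)
    fix e assume "e \<in> edges D"
    then obtain \<eta> where \<eta>: "\<eta> \<in> I" "e = E \<eta>" by (auto simp: D_def)
    show "primitive (qproj (stratum D) ` N) (dir e)" "0 < len e" using prim[OF \<eta>(1)] \<eta>(2) by (simp_all add: D_def E_def)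
    show "weight D e \<noteq> 0" using W[OF \<eta>(1)] wE[OF \<eta>(1)] \<eta>(2) by simp
    have "cface \<sigma> \<eta>" using cface_iff[OF s SI(1)[OF \<eta>(1)]] SI(2)[OF \<eta>(1)] by simp
    then have "qproj \<sigma> ` \<eta> \<in> star_fan \<Sigma> \<sigma>" using SI(1)[OF \<eta>(1)] by (auto simp: star_fan_def)
    moreover have "edge_points e \<subseteq> qproj \<sigma> ` \<eta>"
    proof
      fix p assume "p \<in> edge_points e"
      then obtain t where t: "p = t *\<^sub>R ?u \<eta>" "0 \<le> t" using \<eta>(2) pts by blast
      have "?u \<eta> \<in> qproj \<sigma> ` \<eta>" using edge_gen_relint[OF cI[OF \<eta>(1)], of 1] rel_interior_subset by auto
      then show "p \<in> qproj \<sigma> ` \<eta>"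
        using t convex_cone_scaleR[OF convex_cone_linear_image[OF conjI[OF convex_cone_cone[OF SI(1)[OF \<eta>(1)]] linear_qproj]]] by blast
    qed
    ultimately show "edge_points e \<subseteq> \<Union>(star_fan \<Sigma> (stratum D))" by (auto simp: D_def)
    fix e' assume "e' \<in> edges D" "e \<noteq> e'"
    then obtain \<eta>' where \<eta>': "\<eta>' \<in> I" "e' = E \<eta>'" "\<eta> \<noteq> \<eta>'" using \<eta>(2) by (auto simp: D_def)
    show "edge_points e \<inter> edge_points e' \<subseteq> edge_vertices e \<inter> edge_vertices e'"
    proof
      fix p assume "p \<in> edge_points e \<inter> edge_points e'"
      then obtain t t' where t: "p = t *\<^sub>R ?u \<eta>" "0 \<le> t" "p = t' *\<^sub>R ?u \<eta>'" "0 \<le> t'"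
        using \<eta>(2) \<eta>'(2) pts by blast
      have "p = 0"
      proof (rule ccontr)
        assume "p \<noteq> 0"
        then have "t > 0" "t' > 0" using t by (auto simp: less_le)
        then show False using same[OF \<eta>(1) \<eta>'(1)] t(1,3) \<eta>'(3) by metis
      qed
      then show "p \<in> edge_vertices e \<inter> edge_vertices e'" using \<eta>(2) \<eta>'(2) by (simp add: edge_vertices_def E_def)
    qed
  next
    show "balanced D" unfolding balanced_def
    proof
      fix p
      have 1: "{e. e \<in> edges D \<and> len e \<noteq> \<infinity> \<and> edge_end e = p} = {}" by (auto simp: D_def E_def)
      have "(\<Sum>e | e \<in> edges D \<and> base e = p. of_int (weight D e) *\<^sub>R dir e) = 0"
      proof (cases "p = 0")
        case True
        then have "{e. e \<in> edges D \<and> base e = p} = E ` I" by (auto simp: D_def E_def)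
        then have "(\<Sum>e | e \<in> edges D \<and> base e = p. of_int (weight D e) *\<^sub>R dir e) = (\<Sum>\<eta>\<in>I. of_int (weight D (E \<eta>)) *\<^sub>R dir (E \<eta>))"
          by (simp add: sum.reindex[OF injE])
        also have "\<dots> = (\<Sum>\<eta>\<in>I. of_int (W \<eta>) *\<^sub>R ?u \<eta>)" by (rule sum.cong[OF refl]) (simp add: wE, simp add: E_def)
        finally show ?thesis using bal by simp
      next
        case False
        then have "{e. e \<in> edges D \<and> base e = p} = {}" by (auto simp: D_def E_def)
        then show ?thesis by (simp only: sum.empty)
      qed
      then show "(\<Sum>e | e \<in> edges D \<and> base e = p. of_int (weight D e) *\<^sub>R dir e) +
         (\<Sum>e | e \<in> edges D \<and> len e \<noteq> \<infinity> \<and> edge_end e = p. of_int (weight D e) *\<^sub>R (- dir e)) = 0"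
        unfolding 1 by simp
    qed
  qed
  have trop: "tropical_curve N \<Sigma> [D]" using isD by (simp add: tropical_curve_def)
  have eff: "effective_curve N \<Sigma> [D]"
    unfolding effective_curve_def using trop W wE by (auto simp: D_def)
  define z where "z = (\<lambda>\<delta>. if fst \<delta> = \<sigma> \<and> snd \<delta> \<in> I then of_int (W (snd \<delta>)) *\<^sub>R ?u (snd \<delta>) else 0)"
  have zval: "z (\<sigma>, \<eta>) = of_int (W \<eta>) *\<^sub>R ?u \<eta>" if "\<eta> \<in> I" for \<eta> using that by (simp add: z_def)
  have zc: "z \<in> trop_chains N \<Sigma> 1"
    unfolding trop_chains_def
  proof (intro CollectI conjI ballI allI impI)
    fix \<delta> assume "\<delta> \<in> cubes_dim \<Sigma> 1"
    show "z \<delta> \<in> F1 N \<Sigma> \<delta>"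
    proof (cases "fst \<delta> = \<sigma> \<and> snd \<delta> \<in> I")
      case True
      then have d: "\<delta> = (\<sigma>, snd \<delta>)" "snd \<delta> \<in> I" by (auto simp: prod_eq_iff)
      show ?thesis by (subst (1 2) d(1)) (simp add: zval[OF d(2)] F1_int_scale edge_gen_F1[OF cI[OF d(2)]])
    next
      case False
      then show ?thesis using Q.subspace_0[OF F1_subspace, of \<delta>] by (simp only: z_def if_False)
    qed
  next
    fix \<delta> assume "\<delta> \<notin> cubes_dim \<Sigma> 1"
    then show "z \<delta> = 0" using cI[of "snd \<delta>"] by (auto simp: z_def)
  qed
  have zsup: "{\<delta>. z \<delta> \<noteq> 0} \<subseteq> Pair \<sigma> ` I"
  proof
    fix \<delta> assume "\<delta> \<in> {\<delta>. z \<delta> \<noteq> 0}"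
    then have "fst \<delta> = \<sigma>" "snd \<delta> \<in> I" by (auto simp: z_def split: if_splits)
    then show "\<delta> \<in> Pair \<sigma> ` I" by (metis image_eqI prod.collapse)
  qed
  \<comment> \<open>At \<open>(\<sigma>, \<sigma>)\<close> the boundary is the balancing sum; at the
    far ends \<open>(\<eta>, \<eta>)\<close> the projection along \<open>\<eta>\<close> kills the
    generator.\<close>
  have zb: "trop_boundary N \<Sigma> \<nu> 0 z \<gamma> = 0" for \<gamma>
  proof (cases "\<gamma> \<in> cubes_dim \<Sigma> 0")
    case True
    then obtain \<kappa> where k: "\<kappa> \<in> \<Sigma>" "\<gamma> = (\<kappa>, \<kappa>)" unfolding cubes_0 by (rule bexE)
    let ?t = "\<lambda>\<delta>. of_int (cube_sign N \<nu> \<gamma> \<delta>) *\<^sub>R qproj \<kappa> (z \<delta>)"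
    define A where "A = {\<delta>. \<delta> \<in> cubes_dim \<Sigma> (Suc 0) \<and> subcube \<gamma> \<delta>}"
    have finA: "finite A" unfolding A_def by (rule finite_subset[OF _ finite_cubes_dim[of "Suc 0"]]) blast
    have "trop_boundary N \<Sigma> \<nu> 0 z \<gamma> = (\<Sum>\<delta>\<in>A. ?t \<delta>)" using True k(2) by (simp add: trop_boundary_def A_def)
    also have "\<dots> = 0"
    proof (cases "\<kappa> = \<sigma>")
      case ks: True
      have PA: "Pair \<sigma> ` I \<subseteq> A"
      proof
        fix \<delta> assume "\<delta> \<in> Pair \<sigma> ` I"
        then obtain \<eta> where \<eta>: "\<eta> \<in> I" "\<delta> = (\<sigma>, \<eta>)" by blast
        show "\<delta> \<in> A" using cI[OF \<eta>(1)] cface_iff[OF s s] cface_iff[OF s SI(1)[OF \<eta>(1)]] SI(2)[OF \<eta>(1)]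
          by (simp add: A_def \<eta>(2) k(2) ks)
      qed
      have "(\<Sum>\<delta>\<in>A. ?t \<delta>) = (\<Sum>\<delta>\<in>Pair \<sigma> ` I. ?t \<delta>)"
      proof (rule sum.mono_neutral_right[OF finA PA], rule ballI)
        fix \<delta> assume "\<delta> \<in> A - Pair \<sigma> ` I"
        then have "z \<delta> = 0" using zsup by blast
        then show "?t \<delta> = 0" by simp
      qed
      also have "\<dots> = (\<Sum>\<eta>\<in>I. ?t (\<sigma>, \<eta>))" by (simp add: sum.reindex inj_on_def)
      also have "\<dots> = (\<Sum>\<eta>\<in>I. of_int (W \<eta>) *\<^sub>R ?u \<eta>)"
      proof (rule sum.cong[OF refl])
        fix \<eta> assume h: "\<eta> \<in> I"
        show "?t (\<sigma>, \<eta>) = of_int (W \<eta>) *\<^sub>R ?u \<eta>"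
          using cube_sign_lower[OF cI[OF h]] edge_gen_qproj(1)[OF cI[OF h]]
          by (simp add: k(2) ks zval[OF h] linear_cmul[OF linear_qproj] del: cube_sign.simps)
      qed
      finally show ?thesis using bal by simp
    next
      case ks: False
      show ?thesis
      proof (rule sum.neutral, rule ballI)
        fix \<delta> assume d: "\<delta> \<in> A"
        show "?t \<delta> = 0"
        proof (cases "z \<delta> = 0")
          case False
          then obtain \<eta> where \<eta>: "\<eta> \<in> I" "\<delta> = (\<sigma>, \<eta>)" using zsup by blast
          have "\<gamma> \<in> {\<gamma> \<in> cubes_dim \<Sigma> 0. subcube \<gamma> (\<sigma>, \<eta>)}" using d True by (simp add: A_def \<eta>(2))
          then have "\<kappa> = \<eta>" unfolding facets_1[OF cI[OF \<eta>(1)]] using k(2) ks by simp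
          then show ?thesis using edge_gen_qproj(2)[OF cI[OF \<eta>(1)]]
            by (simp add: \<eta>(2) zval[OF \<eta>(1)] linear_cmul[OF linear_qproj])
        qed simp
      qed
    qed
    finally show ?thesis .
  next
    case False
    then show ?thesis by (simp add: trop_boundary_def)
  qed
  have zcyc: "z \<in> cycles" using zc zb by (auto simp: cycles_def)
  define c where "c = quot_class cycles boundaries z"
  have ch: "c \<in> trop_homology11 N \<Sigma> \<nu>"
    unfolding trop_homology11_def quot_space_def cycles_def[symmetric] boundaries_def[symmetric] c_def
    using zcyc by blast
  have zinc: "z \<in> c"
  proof -
    have 1: "(\<lambda>_. 0) \<in> trop_chains N \<Sigma> 2" using Q.subspace_0[OF F1_subspace] by (simp add: trop_chains_def)
    have "z - z = trop_boundary N \<Sigma> \<nu> 1 (\<lambda>_. 0)" by (intro ext) (simp add: trop_boundary_def)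
    then have "z - z \<in> boundaries" unfolding boundaries_def using 1 by (rule image_eqI)
    then show ?thesis using zcyc by (simp add: c_def quot_class_def)
  qed
  have chain: "sing_of_trop N \<Sigma> z s = curve_chain \<Sigma> [D] s" for s
  proof -
    have "sing_of_trop N \<Sigma> z s = (\<Sum>\<delta> | \<delta> \<in> Pair \<sigma> ` I \<and> cube_path N \<Sigma> \<delta> = s. z \<delta>)"
      unfolding sing_of_trop_def using zsup cI finite_cubes_dim
      by (intro sum.mono_neutral_right) (auto intro: finite_subset[OF _ finite_cubes_dim[of 1]])
    also have "{\<delta>. \<delta> \<in> Pair \<sigma> ` I \<and> cube_path N \<Sigma> \<delta> = s} = Pair \<sigma> ` {\<eta> \<in> I. edge_path \<Sigma> \<sigma> (E \<eta>) = s}"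
      by (auto simp: cube_path_def E_def)
    also have "(\<Sum>\<delta>\<in>Pair \<sigma> ` {\<eta> \<in> I. edge_path \<Sigma> \<sigma> (E \<eta>) = s}. z \<delta>) = (\<Sum>\<eta>\<in>{\<eta> \<in> I. edge_path \<Sigma> \<sigma> (E \<eta>) = s}. z (\<sigma>, \<eta>))"
      by (simp add: sum.reindex inj_on_def)
    also have "\<dots> = (\<Sum>\<eta>\<in>{\<eta> \<in> I. edge_path \<Sigma> \<sigma> (E \<eta>) = s}. of_int (weight D (E \<eta>)) *\<^sub>R dir (E \<eta>))"
      by (rule sum.cong[OF refl]) (simp add: zval wE, simp add: E_def)
    also have "\<dots> = (\<Sum>e\<in>E ` {\<eta> \<in> I. edge_path \<Sigma> \<sigma> (E \<eta>) = s}. of_int (weight D e) *\<^sub>R dir e)"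
      using inj_on_subset[OF injE, of "{\<eta> \<in> I. edge_path \<Sigma> \<sigma> (E \<eta>) = s}"] by (simp add: sum.reindex)
    also have "E ` {\<eta> \<in> I. edge_path \<Sigma> \<sigma> (E \<eta>) = s} = {e. e \<in> edges D \<and> edge_path \<Sigma> (stratum D) e = s}"
      by (auto simp: D_def)
    finally show ?thesis by (simp add: curve_chain_def)
  qed
  have zero: "(\<lambda>s. sing_of_trop N \<Sigma> z s - curve_chain \<Sigma> [D] s) \<in> sing_boundary \<Sigma> 2 ` sing_chains N \<Sigma> 2"
  proof (rule image_eqI)
    show "(\<lambda>_. 0) \<in> sing_chains N \<Sigma> 2" by (simp add: sing_chains_def)
    show "(\<lambda>s. sing_of_trop N \<Sigma> z s - curve_chain \<Sigma> [D] s) = sing_boundary \<Sigma> 2 (\<lambda>_. 0)"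
      using chain by (intro ext) (simp add: sing_boundary_def)
  qed
  have "list_all2 subdivides [D] [D]" by (auto simp: subdivides_def)
  moreover have "\<forall>D'\<in>set [D]. \<forall>e\<in>edges D'. strat_simplex \<Sigma> 1 (edge_path \<Sigma> (stratum D') e)"
    using strat_simplex_ray[OF cI] by (auto simp: D_def E_def)
  ultimately have "is_class_of_curve N \<Sigma> \<nu> [D] c"
    unfolding is_class_of_curve_def using ch trop zinc zero by blast
  then show ?thesis using eff zinc z_def by blast
qed

text \<open>A rational \<open>Y\<close> outside \<open>span \<sigma>\<close> would be independent of
  the generators of \<open>\<sigma>\<close>, and a rational form could be prescribed as 1 on it and
  0 on them.\<close>

lemma rational_kernel:
  assumes s: "\<sigma> \<in> \<Sigma>" and Y: "Y \<in> Q.span N"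
    and l: "\<And>l. l \<in> rat_functionals N \<Longrightarrow> (\<forall>v\<in>\<sigma>. l v = 0) \<Longrightarrow> l Y = 0"
  shows "Y \<in> span \<sigma>"
proof (rule ccontr)
  assume n: "Y \<notin> span \<sigma>"
  then have n': "Y \<notin> span (gens \<sigma>)" using span_gens[OF s] by simp
  then have ind: "independent (insert Y (gens \<sigma>))" using gens_cone(1)[OF s] by (simp add: independent_insertI)
  have sub: "insert Y (gens \<sigma>) \<subseteq> Q.span N" using Y gens_lattice Q.span_superset by blast
  obtain k where k: "k \<in> rat_functionals N" "\<forall>w\<in>insert Y (gens \<sigma>). k w = real_of_rat (if w = Y then 1 else 0)"
    using rat_functional_prescribed[OF lattice sub ind, of "\<lambda>w. if w = Y then 1 else 0"] by blast
  have lin: "linear k" using k(1) by (simp add: rat_functionals_def)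
  have "Y \<notin> gens \<sigma>" using n' span_base by blast
  then have kg: "k w = 0" if "w \<in> gens \<sigma>" for w using k(2) that by auto
  have "k v = 0" if "v \<in> \<sigma>" for v
    using linear_eq_0_on_span'[OF lin kg, of "gens \<sigma>" v] span_gens[OF s] span_base[OF that] by simp
  then have "k Y = 0" using l[OF k(1)] by blast
  then show False using k(2) by simp
qed

text \<open>Sought is \<open>l\<close> with \<open>l < g\<close> at the ray generators of the star
  fan, \<open>g\<close> being the value of \<open>L \<eta> - L \<sigma>\<close>. Made homogeneous,
  the system is \<open>t * g - l > 0\<close>, \<open>t > 0\<close>. Gordan's theorem yields a
  solution, which is divided by \<open>t\<close>, or weights: their relations for
  \<open>t = 0\<close> express balancing, and the one for \<open>l = 0\<close> bounds the pairing by
  0 from above.\<close>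

lemma positive_imp_local_convex:
  assumes lin: "\<And>\<sigma>. linear (L \<sigma>)" and L: "local_functionals x L" and x: "x \<in> chow_free \<Sigma>"
    and pos: "\<forall>C c. effective_curve N \<Sigma> C \<longrightarrow> is_class_of_curve N \<Sigma> \<nu> C c \<longrightarrow>
       0 < trop_pairing \<Sigma> (cohomology_of_chow N \<Sigma> \<nu> (chow_class N \<Sigma> x)) c"
    and s: "\<sigma> \<in> \<Sigma>"
  shows "\<exists>l. linear l \<and> (\<forall>v\<in>\<sigma>. l v = 0) \<and>
    (\<forall>\<eta>. (\<sigma>, \<eta>) \<in> cubes_dim \<Sigma> 1 \<longrightarrow> l (edge_gen N \<sigma> \<eta>) < L \<eta> (edge_gen N \<sigma> \<eta>) - L \<sigma> (edge_gen N \<sigma> \<eta>))"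
proof -
  define I where "I = {\<eta>. (\<sigma>, \<eta>) \<in> cubes_dim \<Sigma> 1}"
  have finI: "finite I" by (rule finite_subset[OF _ finite_fan]) (auto simp: I_def cubes_dim_iff)
  have sI: "\<sigma> \<notin> I" by (auto simp: I_def cubes_dim_iff)
  let ?u = "edge_gen N \<sigma>"
  have cI: "(\<sigma>, \<eta>) \<in> cubes_dim \<Sigma> 1" if "\<eta> \<in> I" for \<eta> using that by (simp add: I_def)
  define g where "g = (\<lambda>\<eta>. ratv (L \<eta> (?u \<eta>) - L \<sigma> (?u \<eta>)))"
  have g: "real_of_rat (g \<eta>) = L \<eta> (?u \<eta>) - L \<sigma> (?u \<eta>)" if h: "\<eta> \<in> I" for \<eta>
  proof -
    note F = edge_gen_F1[OF cI[OF h]]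
    have "real_of_rat (fan_cocycle L (\<sigma>, \<eta>) (?u \<eta>)) = L \<eta> (?u \<eta>) - L \<sigma> (?u \<eta>)"
      by (rule fan_cocycle_value[OF L cI[OF h] F])
    moreover have "fan_cocycle L (\<sigma>, \<eta>) (?u \<eta>) = g \<eta>" using cI[OF h] F by (simp add: fan_cocycle_def g_def)
    ultimately show ?thesis by simp
  qed
  define K where "K = {l \<in> rat_functionals N. \<forall>v\<in>\<sigma>. l v = 0}"
  have linK: "linear l" if "l \<in> K" for l using that by (simp add: K_def rat_functionals_def)
  \<comment> \<open>\<open>?u \<eta>\<close> may lie outside the rational span of \<open>N\<close>,
    so it is replaced by a lattice lift; forms in \<open>K\<close> take the same value on
    both.\<close>
  have lift: "\<exists>y\<in>N. ?u \<eta> = qproj \<sigma> y" if "\<eta> \<in> I" for \<eta>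
    using edge_gen_lattice[OF cI[OF that]] by (auto simp: sublattice_def)
  then obtain Y where Y: "\<And>\<eta>. \<eta> \<in> I \<Longrightarrow> Y \<eta> \<in> N" "\<And>\<eta>. \<eta> \<in> I \<Longrightarrow> ?u \<eta> = qproj \<sigma> (Y \<eta>)" by metis
  have lY: "l (?u \<eta>) = l (Y \<eta>)" if "l \<in> K" "\<eta> \<in> I" for l \<eta>
    unfolding Y(2)[OF that(2)] by (rule linear_qproj_invariant[OF linK[OF that(1)]]) (use that(1) in \<open>simp add: K_def\<close>)
  have lrat: "real_of_rat (ratv (l (?u \<eta>))) = l (?u \<eta>)" if "l \<in> K" "\<eta> \<in> I" for l \<eta>
  proof (rule of_rat_ratv)
    show "l (?u \<eta>) \<in> \<rat>" unfolding lY[OF that] using that(1) Y(1)[OF that(2)] by (auto simp: K_def rat_functionals_def)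
  qed
  \<comment> \<open>The index \<open>\<sigma>\<close>, which is not in \<open>I\<close>, labels the
    homogenizing coordinate \<open>t\<close>.\<close>
  define \<phi> where "\<phi> = (\<lambda>l t i. if i = \<sigma> then t else if i \<in> I then t * g i - ratv (l (?u i)) else (0::rat))"
  define F where "F = {\<phi> l t | l t. l \<in> K}"
  have "(\<exists>\<psi>\<in>F. \<forall>i\<in>insert \<sigma> I. 0 < \<psi> i) \<or>
    (\<exists>w. (\<forall>i\<in>insert \<sigma> I. 0 \<le> w i) \<and> (\<exists>i\<in>insert \<sigma> I. 0 < w i) \<and> (\<forall>\<psi>\<in>F. (\<Sum>i\<in>insert \<sigma> I. w i * \<psi> i) = 0))"
  proof (rule gordan)
    show "finite (insert \<sigma> I)" using finI by simp
    have "(\<lambda>_. 0) \<in> K" by (auto simp: K_def rat_functionals_def linear_zero)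
    then show "F \<noteq> {}" by (auto simp: F_def)
    fix \<psi> assume "\<psi> \<in> F"
    then obtain l t where lt: "\<psi> = \<phi> l t" "l \<in> K" by (auto simp: F_def)
    show "(\<lambda>i. c * \<psi> i) \<in> F" for c
    proof -
      have "(\<lambda>v. real_of_rat c * l v) \<in> K" using lt(2) rat_functionals_cmul[of l N "real_of_rat c"] by (simp add: K_def)
      moreover have "ratv (real_of_rat c * l (?u i)) = c * ratv (l (?u i))" if "i \<in> I" for i
        using lrat[OF lt(2) that] by (metis of_rat_mult ratv_of_rat)
      then have "(\<lambda>i. c * \<psi> i) = \<phi> (\<lambda>v. real_of_rat c * l v) (c * t)"
        using sI by (intro ext) (auto simp: \<phi>_def lt(1) algebra_simps)
      ultimately show ?thesis unfolding F_def by blast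
    qed
    fix \<psi>' assume "\<psi>' \<in> F"
    then obtain l' t' where lt': "\<psi>' = \<phi> l' t'" "l' \<in> K" by (auto simp: F_def)
    show "(\<lambda>i. \<psi> i + \<psi>' i) \<in> F"
    proof -
      have "(\<lambda>v. l v + l' v) \<in> K" using lt(2) lt'(2) rat_functionals_add by (auto simp: K_def)
      moreover have "ratv (l (?u i) + l' (?u i)) = ratv (l (?u i)) + ratv (l' (?u i))" if "i \<in> I" for i
        using lrat[OF lt(2) that] lrat[OF lt'(2) that] by (metis of_rat_add ratv_of_rat)
      then have "(\<lambda>i. \<psi> i + \<psi>' i) = \<phi> (\<lambda>v. l v + l' v) (t + t')"
        using sI by (intro ext) (auto simp: \<phi>_def lt(1) lt'(1) algebra_simps)
      ultimately show ?thesis unfolding F_def by blast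
    qed
  qed
  then show ?thesis
  proof
    assume "\<exists>\<psi>\<in>F. \<forall>i\<in>insert \<sigma> I. 0 < \<psi> i"
    then obtain l t where lt: "l \<in> K" "\<forall>i\<in>insert \<sigma> I. 0 < \<phi> l t i" by (auto simp: F_def)
    have t: "t > 0" using lt(2) by (simp add: \<phi>_def)
    define l' where "l' = (\<lambda>v. (1 / real_of_rat t) * l v)"
    have "linear l'" unfolding l'_def by (rule linear_compose_scale_right[OF linK[OF lt(1)], unfolded real_scaleR_def])
    moreover have "\<forall>v\<in>\<sigma>. l' v = 0" using lt(1) by (simp add: l'_def K_def)
    moreover have "l' (?u \<eta>) < L \<eta> (?u \<eta>) - L \<sigma> (?u \<eta>)" if "(\<sigma>, \<eta>) \<in> cubes_dim \<Sigma> 1" for \<eta>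
    proof -
      have h: "\<eta> \<in> I" using that by (simp add: I_def)
      have ne: "\<eta> \<noteq> \<sigma>" using h sI by blast
      have "0 < \<phi> l t \<eta>" using lt(2) h by blast
      then have "0 < t * g \<eta> - ratv (l (?u \<eta>))" using h ne by (simp add: \<phi>_def)
      then have "0 < real_of_rat (t * g \<eta> - ratv (l (?u \<eta>)))" by simp
      then have "l (?u \<eta>) < real_of_rat t * (L \<eta> (?u \<eta>) - L \<sigma> (?u \<eta>))"
        using g[OF h] lrat[OF lt(1) h] by (simp add: of_rat_diff of_rat_mult)
      then show ?thesis using t by (simp add: l'_def pos_divide_less_eq mult.commute)
    qed
    ultimately show ?thesis by blast
  next
    assume "\<exists>w. (\<forall>i\<in>insert \<sigma> I. 0 \<le> w i) \<and> (\<exists>i\<in>insert \<sigma> I. 0 < w i) \<and> (\<forall>\<psi>\<in>F. (\<Sum>i\<in>insert \<sigma> I. w i * \<psi> i) = 0)"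
    then obtain w where w: "\<And>i. i \<in> insert \<sigma> I \<Longrightarrow> 0 \<le> w i" "\<exists>i\<in>insert \<sigma> I. 0 < w i"
      "\<And>\<psi>. \<psi> \<in> F \<Longrightarrow> (\<Sum>i\<in>insert \<sigma> I. w i * \<psi> i) = 0" by blast
    have rel: "w \<sigma> * t + (\<Sum>\<eta>\<in>I. w \<eta> * (t * g \<eta> - ratv (l (?u \<eta>)))) = 0" if "l \<in> K" for l t
    proof -
      have "\<phi> l t \<in> F" using that by (auto simp: F_def)
      then have "(\<Sum>i\<in>insert \<sigma> I. w i * \<phi> l t i) = 0" by (rule w(3))
      moreover have "(\<Sum>\<eta>\<in>I. w \<eta> * \<phi> l t \<eta>) = (\<Sum>\<eta>\<in>I. w \<eta> * (t * g \<eta> - ratv (l (?u \<eta>))))"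
        using sI by (intro sum.cong[OF refl]) (auto simp: \<phi>_def)
      ultimately show ?thesis using finI sI by (simp add: \<phi>_def)
    qed
    have "\<exists>(d::int) W. d > 0 \<and> (\<forall>i\<in>I. of_int (W i) = of_int d * w i \<and> (0::int) \<le> W i)"
      by (rule clear_denominators[OF finI]) (simp add: w(1))
    then obtain d W where dW0: "(d::int) > 0" "\<forall>i\<in>I. of_int (W i) = of_int d * w i \<and> (0::int) \<le> W i" by (elim exE conjE) (rule that)
    note dW = dW0(1) dW0(2)[rule_format, THEN conjunct1] dW0(2)[rule_format, THEN conjunct2]
    have K0: "(\<lambda>_. 0) \<in> K" by (auto simp: K_def rat_functionals_def linear_zero)
    have r0: "ratv 0 = 0" using ratv_of_rat[of 0] by simp
    \<comment> \<open>The relation for \<open>l = 0\<close>, \<open>t = 1\<close>. As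
      \<open>w \<sigma> \<ge> 0\<close>, the weighted sum of \<open>g\<close> is \<le> 0.\<close>
    have wg: "w \<sigma> + (\<Sum>\<eta>\<in>I. w \<eta> * g \<eta>) = 0" using rel[OF K0, of 1] r0 by simp
    have sumW: "(\<Sum>\<eta>\<in>I. rat_of_int (W \<eta>) * g \<eta>) \<le> 0"
    proof -
      have "(\<Sum>\<eta>\<in>I. rat_of_int (W \<eta>) * g \<eta>) = of_int d * (\<Sum>\<eta>\<in>I. w \<eta> * g \<eta>)"
        using dW(2) by (simp add: sum_distrib_left mult.assoc)
      also have "(\<Sum>\<eta>\<in>I. w \<eta> * g \<eta>) = - w \<sigma>" using wg by linarith
      finally show ?thesis using dW(1) w(1)[of \<sigma>] by simp
    qed
    \<comment> \<open>Edges of a curve have nonzero weights, so only the positive ones are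
      kept.\<close>
    define J where "J = {\<eta> \<in> I. 0 < W \<eta>}"
    have Wpos: "0 < W i \<longleftrightarrow> 0 < w i" if "i \<in> I" for i
    proof -
      have "0 < W i \<longleftrightarrow> 0 < rat_of_int (W i)" by simp
      also have "\<dots> \<longleftrightarrow> 0 < w i" unfolding dW(2)[OF that] using dW(1) by (simp add: zero_less_mult_iff)
      finally show ?thesis .
    qed
    \<comment> \<open>If all weights on \<open>I\<close> vanished, so would
      \<open>w \<sigma>\<close> by \<open>wg\<close>, against the choice of
      \<open>w\<close>.\<close>
    have J0: "J \<noteq> {}"
    proof
      assume "J = {}"
      then have "w i = 0" if "i \<in> I" for i using that w(1)[of i] Wpos[OF that] by (auto simp: J_def)
      then have "w \<sigma> = 0" "\<forall>i\<in>I. w i = 0" using wg by simp_all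
      then show False using w(2) by auto
    qed
    have J: "J \<subseteq> {\<eta>. (\<sigma>, \<eta>) \<in> cubes_dim \<Sigma> 1}" by (auto simp: J_def I_def)
    have finJ: "finite J" using finI by (simp add: J_def)
    have WJ: "(\<Sum>\<eta>\<in>J. h \<eta> (W \<eta>)) = (\<Sum>\<eta>\<in>I. h \<eta> (W \<eta>))" if "\<And>\<eta>. h \<eta> 0 = 0" for h :: "'v set \<Rightarrow> int \<Rightarrow> 'b::comm_monoid_add"
    proof (rule sum.mono_neutral_left[OF finI])
      show "J \<subseteq> I" by (auto simp: J_def)
      show "\<forall>i\<in>I - J. h i (W i) = 0"
      proof
        fix i assume "i \<in> I - J"
        then have "W i = 0" using dW(3)[of i] by (auto simp: J_def)
        then show "h i (W i) = 0" using that by simp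
      qed
    qed
    \<comment> \<open>The relations for \<open>t = 0\<close>: every form in \<open>K\<close>
      vanishes on the weighted sum of the lifts. Its membership in \<open>span \<sigma>\<close> is
      balancing in the quotient.\<close>
    have "(\<Sum>\<eta>\<in>I. of_int (W \<eta>) *\<^sub>R Y \<eta>) \<in> span \<sigma>"
    proof (rule rational_kernel[OF s])
      have "of_int (W \<eta>) *\<^sub>R Y \<eta> \<in> Q.span N" if "\<eta> \<in> I" for \<eta>
        using Q.span_base[OF zlattice_mult[OF lattice Y(1)[OF that]]] .
      then show "(\<Sum>\<eta>\<in>I. of_int (W \<eta>) *\<^sub>R Y \<eta>) \<in> Q.span N" by (rule Q.span_sum)
      fix l assume "l \<in> rat_functionals N" "\<forall>v\<in>\<sigma>. l v = 0"
      then have lK: "l \<in> K" by (simp add: K_def)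
      have "l (\<Sum>\<eta>\<in>I. of_int (W \<eta>) *\<^sub>R Y \<eta>) = (\<Sum>\<eta>\<in>I. of_int (W \<eta>) * l (Y \<eta>))"
        using linK[OF lK] by (simp add: linear_sum linear_cmul)
      also have "\<dots> = (\<Sum>\<eta>\<in>I. real_of_rat (of_int d * (w \<eta> * ratv (l (?u \<eta>)))))"
      proof (rule sum.cong[OF refl])
        fix \<eta> assume h: "\<eta> \<in> I"
        have "real_of_rat (rat_of_int (W \<eta>)) = real_of_rat (of_int d * w \<eta>)" using dW(2)[OF h] by simp
        then show "of_int (W \<eta>) * l (Y \<eta>) = real_of_rat (of_int d * (w \<eta> * ratv (l (?u \<eta>))))"
          using lY[OF lK h] lrat[OF lK h] by (simp add: of_rat_mult)
      qed
      also have "\<dots> = real_of_rat (of_int d * (\<Sum>\<eta>\<in>I. w \<eta> * ratv (l (?u \<eta>))))"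
        by (simp add: of_rat_sum sum_distrib_left)
      also have "(\<Sum>\<eta>\<in>I. w \<eta> * ratv (l (?u \<eta>))) = 0" using rel[OF lK, of 0] by (simp add: sum_negf)
      finally show "l (\<Sum>\<eta>\<in>I. of_int (W \<eta>) *\<^sub>R Y \<eta>) = 0" by simp
    qed
    then have "qproj \<sigma> (\<Sum>\<eta>\<in>I. of_int (W \<eta>) *\<^sub>R Y \<eta>) = 0" by (simp add: qproj_eq_0_iff)
    then have "(\<Sum>\<eta>\<in>I. of_int (W \<eta>) *\<^sub>R ?u \<eta>) = 0"
      using Y(2) by (simp add: linear_sum[OF linear_qproj] linear_cmul[OF linear_qproj])
    then have bal: "(\<Sum>\<eta>\<in>J. of_int (W \<eta>) *\<^sub>R ?u \<eta>) = 0"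
      using WJ[of "\<lambda>\<eta> k. of_int k *\<^sub>R ?u \<eta>"] by simp
    obtain C c z where C: "effective_curve N \<Sigma> C" "is_class_of_curve N \<Sigma> \<nu> C c" "z \<in> c"
      and z: "z = (\<lambda>\<delta>. if fst \<delta> = \<sigma> \<and> snd \<delta> \<in> J then of_int (W (snd \<delta>)) *\<^sub>R ?u (snd \<delta>) else 0)"
      using star_curve[OF s J J0 _ bal] by (auto simp: J_def)
    have ch: "c \<in> trop_homology11 N \<Sigma> \<nu>" using C(2) by (simp add: is_class_of_curve_def)
    have "real_of_rat (trop_pairing \<Sigma> (cohomology_of_chow N \<Sigma> \<nu> (chow_class N \<Sigma> x)) c) =
        (\<Sum>(\<tau>, \<eta>)\<in>cubes_dim \<Sigma> 1. L \<eta> (z (\<tau>, \<eta>)) - L \<tau> (z (\<tau>, \<eta>)))"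
      by (rule pairing_formula[OF L x ch C(3)])
    also have "\<dots> = (\<Sum>(\<tau>, \<eta>)\<in>Pair \<sigma> ` J. L \<eta> (z (\<tau>, \<eta>)) - L \<tau> (z (\<tau>, \<eta>)))"
    proof (rule sum.mono_neutral_right[OF finite_cubes_dim])
      show "Pair \<sigma> ` J \<subseteq> cubes_dim \<Sigma> 1" using J by blast
      show "\<forall>\<delta>\<in>cubes_dim \<Sigma> 1 - Pair \<sigma> ` J. (case \<delta> of (\<tau>, \<eta>) \<Rightarrow> L \<eta> (z (\<tau>, \<eta>)) - L \<tau> (z (\<tau>, \<eta>))) = 0"
        using linear_0[OF lin] by (auto simp: z)
    qed
    also have "\<dots> = (\<Sum>\<eta>\<in>J. of_int (W \<eta>) * (L \<eta> (?u \<eta>) - L \<sigma> (?u \<eta>)))"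
      by (simp add: sum.reindex inj_on_def z linear_cmul[OF lin] algebra_simps)
    also have "\<dots> = (\<Sum>\<eta>\<in>I. of_int (W \<eta>) * (L \<eta> (?u \<eta>) - L \<sigma> (?u \<eta>)))"
      by (rule WJ[of "\<lambda>\<eta> k. of_int k * (L \<eta> (?u \<eta>) - L \<sigma> (?u \<eta>))"]) simp
    also have "\<dots> = real_of_rat (\<Sum>\<eta>\<in>I. rat_of_int (W \<eta>) * g \<eta>)"
      using g by (simp add: of_rat_sum of_rat_mult)
    also have "\<dots> \<le> 0" using sumW by (simp only: of_rat_le_0_iff)
    finally have "trop_pairing \<Sigma> (cohomology_of_chow N \<Sigma> \<nu> (chow_class N \<Sigma> x)) c \<le> 0" by simp
    then show ?thesis using pos[rule_format, OF C(1,2)] by simp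
  qed
qed

text \<open>On a cone \<open>\<eta>\<close> containing \<open>\<sigma>\<close>,
  \<open>f - l'\<close> is linear, zero on the generators of \<open>\<sigma>\<close> and positive on
  the others, so the inequalities at the rays of the star fan already give strict convexity.\<close>

lemma positive_imp_ample:
  assumes x: "x \<in> chow_free \<Sigma>"
    and pos: "\<forall>C c. effective_curve N \<Sigma> C \<longrightarrow> is_class_of_curve N \<Sigma> \<nu> C c \<longrightarrow>
       0 < trop_pairing \<Sigma> (cohomology_of_chow N \<Sigma> \<nu> (chow_class N \<Sigma> x)) c"
  shows "ample N \<Sigma> (chow_class N \<Sigma> x)"
proof -
  obtain L where L: "local_functionals x L" and lin: "\<And>\<sigma>. linear (L \<sigma>)" using local_functionals_linear_exist by blast
  define f where "f = (\<lambda>v. L (SOME \<sigma>. \<sigma> \<in> \<Sigma> \<and> v \<in> \<sigma>) v)"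
  have fL: "f v = L \<sigma> v" if v: "\<sigma> \<in> \<Sigma>" "v \<in> \<sigma>" for \<sigma> v
  proof -
    define \<eta> where "\<eta> = (SOME \<sigma>. \<sigma> \<in> \<Sigma> \<and> v \<in> \<sigma>)"
    have \<eta>: "\<eta> \<in> \<Sigma> \<and> v \<in> \<eta>" unfolding \<eta>_def by (rule someI[where P = "\<lambda>\<sigma>. \<sigma> \<in> \<Sigma> \<and> v \<in> \<sigma>"]) (rule conjI[OF v])
    have i: "\<sigma> \<inter> \<eta> \<in> \<Sigma>" using Int_in_fan v(1) \<eta> by simp
    have "v \<in> span (\<sigma> \<inter> \<eta>)" using v(2) \<eta> by (intro span_base) simp
    then have "L \<eta> v = L \<sigma> v"
      using local_agree[OF L i, of \<eta> v] local_agree[OF L i, of \<sigma> v] v(1) \<eta> by simp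
    then show ?thesis by (simp add: f_def \<eta>_def)
  qed
  have cont: "continuous_on (\<Union>\<Sigma>) f"
  proof -
    have "continuous_on (\<Union>\<sigma>\<in>\<Sigma>. \<sigma>) f"
    proof (rule continuous_on_closed_Union[OF finite_fan])
      fix \<sigma> assume s: "\<sigma> \<in> \<Sigma>"
      show "closed \<sigma>" using gens_cone(2)[OF s] closed_convex_cone_hull[OF finite_gens] by metis
      have "continuous_on \<sigma> (L \<sigma>)" by (rule linear_continuous_on[OF linear_conv_bounded_linear[THEN iffD1, OF lin]])
      then show "continuous_on \<sigma> f" by (rule continuous_on_eq) (simp add: fL[OF s])
    qed
    then show ?thesis by simp
  qed
  have f1: "conewise_linear \<Sigma> f"
    unfolding conewise_linear_def
  proof (intro conjI ballI)
    fix \<sigma> assume s: "\<sigma> \<in> \<Sigma>"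
    show "\<exists>l. linear l \<and> (\<forall>x\<in>\<sigma>. f x = l x)" using lin fL[OF s] by (intro exI[of _ "L \<sigma>"]) simp
  qed (rule cont)
  have f2: "strictly_convex \<Sigma> f"
    unfolding strictly_convex_def
  proof
    fix \<sigma> assume s: "\<sigma> \<in> \<Sigma>"
    obtain l where l0: "linear l \<and> (\<forall>v\<in>\<sigma>. l v = 0) \<and>
      (\<forall>\<eta>. (\<sigma>, \<eta>) \<in> cubes_dim \<Sigma> 1 \<longrightarrow> l (edge_gen N \<sigma> \<eta>) < L \<eta> (edge_gen N \<sigma> \<eta>) - L \<sigma> (edge_gen N \<sigma> \<eta>))"
      using positive_imp_local_convex[OF lin L x pos s] by (elim exE)
    note l = l0[THEN conjunct1] l0[THEN conjunct2, THEN conjunct1, rule_format]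
      l0[THEN conjunct2, THEN conjunct2, rule_format]
    define l' where "l' = (\<lambda>v. L \<sigma> v + l v)"
    have lin': "linear l'" unfolding l'_def by (intro linear_compose_add lin l(1))
    \<comment> \<open>The inequality for the edge from \<open>\<sigma>\<close> to the cone
      \<open>\<kappa>\<close> spanned by \<open>\<sigma>\<close> and \<open>v\<close> passes to
      \<open>v\<close>, since the generator of that edge is a positive multiple of the image of
      \<open>v\<close>.\<close>
    have gen: "L \<eta> v - l' v > 0" if h: "\<eta> \<in> \<Sigma>" "\<sigma> \<subseteq> \<eta>" "v \<in> gens \<eta>" "v \<notin> gens \<sigma>" for \<eta> v
    proof -
      have sub: "insert v (gens \<sigma>) \<subseteq> gens \<eta>" using h(3) gens_mono[OF h(2)] by simp
      define \<kappa> where "\<kappa> = convex_cone hull (insert v (gens \<sigma>))"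
      note k = subcone[OF h(1) sub, folded \<kappa>_def]
      have sk: "\<sigma> \<subseteq> \<kappa>" using subset_iff_gens[OF s k(1)] k(2) by auto
      have c: "(\<sigma>, \<kappa>) \<in> cubes_dim \<Sigma> 1"
        using s k sk h(4) finite_gens by (simp add: cubes_dim_iff dim_gens)
      obtain a where a: "a > 0" "edge_gen N \<sigma> \<kappa> = a *\<^sub>R qproj \<sigma> v"
        using edge_gen_vert(1)[OF c k(2) h(4)] by (elim exE conjE) (rule that)
      have "v \<in> \<kappa>" using k(2) gens_subset by blast
      then have Lv: "L \<eta> v = L \<kappa> v" using local_agree[OF L k(1) h(1) k(3) span_base] by simp
      have 1: "L \<kappa> (qproj \<sigma> v) - L \<sigma> (qproj \<sigma> v) = L \<kappa> v - L \<sigma> v" by (rule local_qproj[OF L s s k(1) subset_refl sk])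
      have 2: "l (qproj \<sigma> v) = l v" by (rule linear_qproj_invariant[OF l(1,2)])
      have "a * l (qproj \<sigma> v) < a * (L \<kappa> (qproj \<sigma> v) - L \<sigma> (qproj \<sigma> v))"
        using l(3)[OF c] unfolding a(2) by (simp add: linear_cmul[OF lin] linear_cmul[OF l(1)] algebra_simps)
      then have "l v < L \<kappa> v - L \<sigma> v" unfolding 1 2 using a(1) by simp
      then show ?thesis using Lv by (simp add: l'_def)
    qed
    have "f v - l' v > 0" if h: "\<eta> \<in> \<Sigma>" "\<sigma> \<subseteq> \<eta>" "v \<in> \<eta> - \<sigma>" for \<eta> v
    proof -
      obtain c where c: "v = (\<Sum>w\<in>gens \<eta>. c w *\<^sub>R w)" "\<forall>w\<in>gens \<eta>. 0 \<le> c w" using cone_coneD[OF h(1)] h(3) by blast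
      have linH: "linear (\<lambda>v. L \<eta> v - l' v)" by (intro linear_compose_sub lin lin')
      have H0: "L \<eta> w - l' w = 0" if "w \<in> gens \<sigma>" for w
      proof -
        have "w \<in> \<sigma>" using that gens_subset by blast
        then show ?thesis using local_agree[OF L s h(1,2) span_base] l(2) by (simp add: l'_def)
      qed
      have "\<exists>w\<in>gens \<eta> - gens \<sigma>. c w \<noteq> 0"
      proof (rule ccontr)
        assume "\<not> ?thesis"
        then have "v = (\<Sum>w\<in>gens \<sigma>. c w *\<^sub>R w)" unfolding c(1)
          using gens_mono[OF h(2)] by (intro sum.mono_neutral_right finite_gens) auto
        then have "v \<in> \<sigma>" using cone_coneI[OF s, of c] c(2) gens_mono[OF h(2)] by auto
        then show False using h(3) by blast
      qed
      then obtain w0 where w0: "w0 \<in> gens \<eta>" "w0 \<notin> gens \<sigma>" "c w0 \<noteq> 0" by blast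
      have "L \<eta> v - l' v = (\<Sum>w\<in>gens \<eta>. c w * (L \<eta> w - l' w))"
        unfolding c(1) using linear_sum[OF linH, of "\<lambda>w. c w *\<^sub>R w" "gens \<eta>"] by (simp add: linear_cmul[OF linH])
      also have "\<dots> > 0"
      proof (rule sum_pos2[OF finite_gens w0(1)])
        show "0 < c w0 * (L \<eta> w0 - l' w0)" using gen[OF h(1,2) w0(1,2)] c(2) w0(1,3) by (simp add: less_le)
        fix w assume w: "w \<in> gens \<eta>"
        show "0 \<le> c w * (L \<eta> w - l' w)"
        proof (cases "w \<in> gens \<sigma>")
          case True then show ?thesis using H0 by simp
        next
          case False
          then have "0 < L \<eta> w - l' w" by (rule gen[OF h(1,2) w])
          then show ?thesis using c(2) w by simp
        qed
      qed
      finally show ?thesis using fL[OF h(1)] h(3) by simp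
    qed
    moreover have "f v - l' v = 0" if "v \<in> \<sigma>" for v using fL[OF s that] l(2)[OF that] by (simp add: l'_def)
    ultimately show "\<exists>l. linear l \<and> (\<forall>x\<in>\<sigma>. f x - l x = 0) \<and> (\<forall>\<eta>\<in>\<Sigma>. \<sigma> \<subseteq> \<eta> \<longrightarrow> (\<forall>x\<in>\<eta> - \<sigma>. f x - l x > 0))"
      using lin' by blast
  qed
  have "f (ray_gen N \<rho>) = real_of_rat (x \<rho>)" if r: "\<rho> \<in> rays \<Sigma>" for \<rho>
  proof -
    have "\<rho> \<in> \<Sigma>" using r by (simp add: rays_def)
    then show ?thesis using fL[OF _ ray_gen_in_ray[OF r]] local_gens[OF L _ r ray_gen_in_ray[OF r]] by simp
  qed
  then show ?thesis unfolding ample_def using f1 f2 x by blast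
qed

end

theorem theorem1p6:
  fixes N :: "'v::euclidean_space set"
    and \<Sigma> :: "'v set set"
    and \<nu> :: "'v cube \<Rightarrow> 'v list"
    and \<alpha> :: "('v set \<Rightarrow> rat) set"
  assumes "zlattice N"
    and "fan N \<Sigma>"
    and "simplicial \<Sigma>"
    and "orientation N \<Sigma> \<nu>"
    and "\<alpha> \<in> chow1 N \<Sigma>"
  shows "ample N \<Sigma> \<alpha> \<longleftrightarrow>
    (\<forall>C c. effective_curve N \<Sigma> C \<longrightarrow> is_class_of_curve N \<Sigma> \<nu> C c \<longrightarrow>
       0 < trop_pairing \<Sigma> (cohomology_of_chow N \<Sigma> \<nu> \<alpha>) c)"
proof -
  interpret oriented_fan N \<Sigma> \<nu> using assms(1-4) by unfold_locales
  obtain x where x: "x \<in> chow_free \<Sigma>" "\<alpha> = chow_class N \<Sigma> x"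
    using assms(5) by (auto simp: chow1_def quot_space_def chow_class_def)
  show ?thesis
  proof
    assume "ample N \<Sigma> \<alpha>"
    then obtain f y where f: "conewise_linear \<Sigma> f" "strictly_convex \<Sigma> f" "y \<in> chow_free \<Sigma>"
      "\<forall>\<rho>\<in>rays \<Sigma>. f (ray_gen N \<rho>) = real_of_rat (y \<rho>)" "\<alpha> = chow_class N \<Sigma> y"
      unfolding ample_def by (elim exE conjE) (rule that)
    \<comment> \<open>The values \<open>y\<close> of \<open>f\<close> also represent \<alpha>; the
      argument is run with them rather than with \<open>x\<close>.\<close>
    then show "\<forall>C c. effective_curve N \<Sigma> C \<longrightarrow> is_class_of_curve N \<Sigma> \<nu> C c \<longrightarrow>
       0 < trop_pairing \<Sigma> (cohomology_of_chow N \<Sigma> \<nu> \<alpha>) c"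
      using ample_imp_positive[OF f(1-4)] by blast
  next
    assume "\<forall>C c. effective_curve N \<Sigma> C \<longrightarrow> is_class_of_curve N \<Sigma> \<nu> C c \<longrightarrow>
       0 < trop_pairing \<Sigma> (cohomology_of_chow N \<Sigma> \<nu> \<alpha>) c"
    then show "ample N \<Sigma> \<alpha>" unfolding x(2) by (rule positive_imp_ample[OF x(1)])
  qed
qed

end
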